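(* Let $U$, $\phi$, $a_0,\dots,a_N$, $a$, $K$, $W_1$, $p$, $\Psi$, $\bar p=p-\Psi$, $r$, $r_0$, $r_1$, $c_1$, $c_2$, $G$, $\mathcal M$, $\mathcal A$, $\mathcal B$, $N_1$ be as described in the context, and set $$\kappa_1=\frac{r_0}{r_0-2},\quad \kappa_2=\frac{r_0(r_1-1)}{2r_0+(r_0-2)r_1(2-a)},\quad \nu_1=\frac{r_0-2r_1}{r_0+(r_0-2)r_1},\quad \nu_2=\frac{2(r_0-2+a)}{(2-a)(r_0-2)},$$ $$\kappa_3=\frac{\kappa_1}{2-a}-\frac{\nu_1}{2}=\frac{r_0}{(2-a)(r_0-2)}-\frac{r_0-2r_1}{2(r_0+(r_0-2)r_1)}>0 .$$ Then there is a constant $C>0$ depending only on $a$, $r$, $r_1$, $c_1$, $c_2$ (not on the individual functions $\phi$, $a_i$, nor on the initial and boundary data) such that the following hold. (i) If $t\in(0,1)$, then $$\|\bar p\|_{L^\infty(U\times(t/2,t))}\le C t^{-\kappa_3}N_1(0,t)^{\kappa_2}\Big(\|\bar p(0)\|_{L^2_\phi(U)}+\mathcal M(t)^{\frac1{2-a}}\Big)^{\nu_2}.$$ If $t\ge 1$, then $$\|\bar p\|_{L^\infty(U\times(t-\frac12,t))}\le C N_1(t-1,t)^{\kappa_2}\Big(\|\bar p(0)\|_{L^2_\phi(U)}+\mathcal M(t)^{\frac1{2-a}}\Big)^{\nu_2}.$$ (ii) If $\mathcal A<\infty$, then $$\limsup_{t\to\infty}\|\bar p\|_{L^\infty(U\times(t-\frac12,t))}\le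 C\Big(\limsup_{t\to\infty}N_1(t-1,t)\Big)^{\kappa_2}\mathcal A^{\frac{\nu_2}{2-a}}.$$ (iii) If $\mathcal B<\infty$, then there is $T>0$ such that for all $t>T$, $$\|\bar p\|_{L^\infty(U\times(t-\frac12,t))}\le C N_1(t-1,t)^{\kappa_2}\Big(\mathcal B^{\frac1{2(1-a)}}+G(t)^{\frac1{2-a}}\Big)^{\nu_2}.$$
   Context: Domain and coefficients. $U\subset\mathbb R^n$ ($n\ge2$) is a bounded domain with $C^1$ boundary $\Gamma=\partial U$; $\phi:U\to(0,\infty)$ is a given function. Let $N\ge1$, $0=\alpha_0<\alpha_1<\dots<\alpha_N$ be fixed real numbers, and let $a_0,\dots,a_N$ be functions on $\bar U$ with $a_0,a_N>0$ and $a_1,\dots,a_{N-1}\ge0$. Put $g(x,s)=\sum_{j=0}^N a_j(x)s^{\alpha_j}$ for $s\ge0$, and $a=\frac{\alpha_N}{\alpha_N+1}\in(0,1)$. For $\xi\ge0$ let $s(x,\xi)$ be the unique nonnegative solution $s$ of $s\,g(x,s)=\xi$, and $K(x,\xi)=1/g(x,s(x,\xi))$. Let $M(x)=\max_{0\le j\le N}a_j(x)$ and $W_1(x)=\frac{a_N(x)^a}{2NM(x)}$. Problem. $p(x,t)$ is a solution (regular enough for the equation to be tested against functions of the solution) of $\phi(x)p_t=\nabla\cdot(K(x,|\nabla p|)\nabla p)$ on $U\times(0,\infty)$, $p=\psi$ on $\Gamma\times(0,\infty)$, $p(x,0)=p_0(x)$ on $U$. $\Psi(x,t)$ is an extension of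 $\psi$ from $\Gamma\times(0,\infty)$ to $\bar U\times[0,\infty)$, and $\bar p=p-\Psi$ (so $\bar p=0$ on $\Gamma$). Write $f(t)=f(\cdot,t)$. Weighted norms. For a weight $f\ge0$, $\|u\|_{L^q_f(U)}$ is the $L^q$ norm on $U$ with respect to the measure $f\,dx$ (abbreviated $\|u\|_{L^q_f}$). Assumptions. (1) $\phi\in L^1(U)$, and there are $r>2$, $c_2>0$ with $\|u\|_{L^r_\phi(U)}\le c_2\|\nabla u\|_{L^{2-a}_{W_1}(U)}$ for functions $u$ vanishing on $\Gamma$. (2) There is $c_1>0$ with $\|u\|_{L^2_\phi(U)}\le c_1\|\nabla u\|_{L^{2-a}_{W_1}(U)}$ for functions $u$ vanishing on $\Gamma$. (By Hölder, (1) implies (2) with $c_1=c_2(\int_U\phi\,dx)^{1/2-1/r}$.) Parameters. $r_0=2+(2-a)(1-\frac2r)>2$; $r_1$ is a fixed number in $(1,r_0/2)$; $r_1'=r_1/(r_1-1)$. Data quantities. $B_1=\int_U a_N\,dx$, $B_*=\max\{B_1,1\}$, $G(t)=B_*+\|\nabla\Psi(t)\|_{L^2_{1/a_0}}^2+\|\nabla\Psi(t)\|_{L^{2-a}_{W_1}}^{2-a}+\|\Psi_t(t)\|_{L^2_\phi}^{\frac{2-a}{1-a}}$ for $t\ge 0$. $\mathcal M$ is a continuous increasing function on $[0,\infty)$ with $\mathcal M(t)\ge G(t)$ for all $t\ge0$. $\mathcal A=\limsup_{t\to\infty}G(t)$ and $\mathcal B=\limsup_{t\to\infty}[G'(t)]^-$,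 where $[z]^-=\max\{-z,0\}$ (when $\mathcal B$ is used, $G$ is understood to be $C^1$ on $(0,\infty)$). For $t>s\ge0$, $$N_1(s,t)=\max\Big\{1,\int_U a_N^{r_1'}\phi^{1-r_1'}dx\Big\}+\int_s^t\!\int_U\Big[\big(W_1|\nabla\Psi|^{2-a}+a_0^{-1}|\nabla\Psi|^2\big)^{r_1'}\phi^{1-r_1'}+|\Psi_t|^{2r_1'}\phi\Big]dx\,d\tau.$$ *)

theory Defs
  imports "HOL-Analysis.Analysis" "HOL-Probability.Essential_Supremum"
begin

section \<open>Euclidean space of variable dimension\<close>

text \<open>The constant of the theorem does not depend on the dimension \<open>n\<close>, so it has to be chosen
  before \<open>n\<close> and \<open>n\<close> cannot be carried by a type. Points are functions in \<open>extensional {..<n}\<close>,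
  which is both the carrier of the product topology and the space of the product measure below.
  Vector fields are only ever evaluated at indices \<open>i < n\<close>.\<close>

type_synonym point = "nat \<Rightarrow> real"

definition Rn :: "nat \<Rightarrow> point topology"
  where "Rn n = product_topology (\<lambda>_. euclideanreal) {..<n}"

definition leb :: "nat \<Rightarrow> point measure"
  where "leb n = Pi\<^sub>M {..<n} (\<lambda>_. lborel)"

definition vnorm :: "nat \<Rightarrow> point \<Rightarrow> real"
  where "vnorm n v = L2_set v {..<n}"

definition vinner :: "nat \<Rightarrow> point \<Rightarrow> point \<Rightarrow> real"
  where "vinner n v w = (\<Sum>i<n. v i * w i)"

text \<open>\<open>f\<close> is continuously differentiable on the open set \<open>V\<close> with gradient \<open>Df\<close>.\<close>

definition C1_on :: "nat \<Rightarrow> point set \<Rightarrow> (point \<Rightarrow> real) \<Rightarrow> (point \<Rightarrow> point) \<Rightarrow> bool"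
  where "C1_on n V f Df \<longleftrightarrow>
    (\<forall>i<n. continuous_map (subtopology (Rn n) V) euclideanreal (\<lambda>x. Df x i) \<and>
      (\<forall>x\<in>V. ((\<lambda>s. f (x(i := s))) has_real_derivative Df x i) (at (x i))))"

definition bounded_domain :: "nat \<Rightarrow> point set \<Rightarrow> bool"
  where "bounded_domain n U \<longleftrightarrow>
    U \<noteq> {} \<and> openin (Rn n) U \<and> connectedin (Rn n) U \<and> (\<exists>R. \<forall>x\<in>U. vnorm n x \<le> R)"

text \<open>Near each boundary point, and up to relabelling and reorienting the axes, \<open>U\<close> is the region
  on one side of the graph of a \<open>C\<^sup>1\<close> function \<open>\<gamma>\<close> of the coordinates other than the \<open>i\<close>-th.\<close>

definition C1_boundary :: "nat \<Rightarrow> point set \<Rightarrow> bool"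
  where "C1_boundary n U \<longleftrightarrow>
    (\<forall>z \<in> Rn n frontier_of U. \<exists>V i \<sigma> \<gamma> D\<gamma>.
       openin (Rn n) V \<and> z \<in> V \<and> i < n \<and> \<sigma> \<in> {-1, 1::real} \<and>
       C1_on n (topspace (Rn n)) \<gamma> D\<gamma> \<and> (\<forall>x s. \<gamma> (x(i := s)) = \<gamma> x) \<and>
       U \<inter> V = {x \<in> V. \<sigma> * x i > \<sigma> * \<gamma> x})"

section \<open>Function spaces\<close>

text \<open>\<open>C\<^sup>1\<close> functions with compact support in \<open>U\<close>, together with their gradient.\<close>

definition C1c :: "nat \<Rightarrow> point set \<Rightarrow> (point \<Rightarrow> real) \<Rightarrow> (point \<Rightarrow> point) \<Rightarrow> bool"
  where "C1c n U f Df \<longleftrightarrow> C1_on n (topspace (Rn n)) f Df \<and>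
    (\<exists>K. compactin (Rn n) K \<and> K \<subseteq> U \<and> (\<forall>x \<in> topspace (Rn n) - K. f x = 0))"

definition loc_integrable :: "nat \<Rightarrow> point set \<Rightarrow> (point \<Rightarrow> real) \<Rightarrow> bool"
  where "loc_integrable n U u \<longleftrightarrow>
    (\<forall>K. compactin (Rn n) K \<and> K \<subseteq> U \<longrightarrow> set_integrable (leb n) K u)"

definition weak_gradient :: "nat \<Rightarrow> point set \<Rightarrow> (point \<Rightarrow> real) \<Rightarrow> (point \<Rightarrow> point) \<Rightarrow> bool"
  where "weak_gradient n U u Du \<longleftrightarrow>
    loc_integrable n U u \<and>
    (\<forall>i<n. loc_integrable n U (\<lambda>x. Du x i) \<and>
      (\<forall>\<eta> D\<eta>. C1c n U \<eta> D\<eta> \<longrightarrow>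
        (LINT x:U|leb n. u x * D\<eta> x i) = - (LINT x:U|leb n. Du x i * \<eta> x)))"

text \<open>\<open>W0 n U u Du\<close>: \<open>u\<close> belongs to \<open>W\<^sub>0\<^sup>1\<^sup>,\<^sup>1(U)\<close>, the closure of the compactly supported \<open>C\<^sup>1\<close> functions
  in \<open>W\<^sup>1\<^sup>,\<^sup>1(U)\<close>, and \<open>Du\<close> is its weak gradient. As \<open>U\<close> is bounded with \<open>C\<^sup>1\<close> boundary, these are
  the functions of \<open>W\<^sup>1\<^sup>,\<^sup>1(U)\<close> that vanish on \<open>\<Gamma>\<close> in the sense of traces.\<close>

definition W0 :: "nat \<Rightarrow> point set \<Rightarrow> (point \<Rightarrow> real) \<Rightarrow> (point \<Rightarrow> point) \<Rightarrow> bool"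
  where "W0 n U u Du \<longleftrightarrow>
    set_integrable (leb n) U u \<and> (\<forall>i<n. set_integrable (leb n) U (\<lambda>x. Du x i)) \<and>
    (\<exists>\<eta> D\<eta>. (\<forall>k::nat. C1c n U (\<eta> k) (D\<eta> k)) \<and>
      (\<lambda>k. \<integral>\<^sup>+x\<in>U. ennreal \<bar>\<eta> k x - u x\<bar> \<partial>leb n) \<longlonglongrightarrow> 0 \<and>
      (\<forall>i<n. (\<lambda>k. \<integral>\<^sup>+x\<in>U. ennreal \<bar>D\<eta> k x i - Du x i\<bar> \<partial>leb n) \<longlonglongrightarrow> 0))"

text \<open>Powers of extended nonnegative numbers, to be used with exponents \<open>y > 0\<close> only.\<close>

definition epowr :: "ennreal \<Rightarrow> real \<Rightarrow> ennreal"  (infixr "epowr" 80)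
  where "x epowr y = (if x = \<infinity> then \<infinity> else ennreal (enn2real x powr y))"

text \<open>The norm of \<open>L\<^sup>q\<^sub>f(U)\<close>; infinite if \<open>u\<close> is not in the space.\<close>

definition wnorm :: "nat \<Rightarrow> point set \<Rightarrow> real \<Rightarrow> (point \<Rightarrow> real) \<Rightarrow> (point \<Rightarrow> real) \<Rightarrow> ennreal"
  where "wnorm n U q f u = (\<integral>\<^sup>+x\<in>U. ennreal (\<bar>u x\<bar> powr q * f x) \<partial>leb n) epowr (1 / q)"

text \<open>The norm of \<open>L\<^sup>\<infinity>(U \<times> (t\<^sub>1, t\<^sub>2))\<close>. Here and below, functions of space and time take the
  time first, so that \<open>u t\<close> is the function \<open>u(\<cdot>, t)\<close>.\<close>

definition Linf_norm :: "nat \<Rightarrow> point set \<Rightarrow> real \<Rightarrow> real \<Rightarrow> (real \<Rightarrow> point \<Rightarrow> real) \<Rightarrow> ennreal"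
  where "Linf_norm n U t1 t2 u =
    esssup (restrict_space (leb n \<Otimes>\<^sub>M lborel) (U \<times> {t1<..<t2})) (\<lambda>(x, t). ennreal \<bar>u t x\<bar>)"

definition spacetime_measurable :: "nat \<Rightarrow> point set \<Rightarrow> real set \<Rightarrow> (real \<Rightarrow> point \<Rightarrow> real) \<Rightarrow> bool"
  where "spacetime_measurable n U J u \<longleftrightarrow>
    (\<lambda>(x, t). u t x) \<in> borel_measurable (restrict_space (leb n \<Otimes>\<^sub>M lborel) (U \<times> J))"

text \<open>For almost every \<open>x\<close>, the function \<open>t \<mapsto> u t x\<close> is locally absolutely continuous on \<open>J\<close>
  with derivative \<open>ut t x\<close>.\<close>

definition time_derivative ::
    "nat \<Rightarrow> point set \<Rightarrow> real set \<Rightarrow> (real \<Rightarrow> point \<Rightarrow> real) \<Rightarrow> (real \<Rightarrow> point \<Rightarrow> real) \<Rightarrow> bool"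
  where "time_derivative n U J u ut \<longleftrightarrow>
    (AE x in leb n. x \<in> U \<longrightarrow> (\<forall>s\<in>J. \<forall>t\<in>J. s < t \<longrightarrow>
       set_integrable lborel {s..t} (\<lambda>\<tau>. ut \<tau> x) \<and>
       u t x - u s x = (LINT \<tau>:{s..t}|lborel. ut \<tau> x)))"

section \<open>The medium\<close>

text \<open>The fields are \<open>n\<close>, \<open>U\<close>, \<open>\<phi>\<close>, \<open>N\<close>, \<open>\<alpha>\<close> and the coefficients \<open>a\<^sub>j(x)\<close>.\<close>

record medium =
  Dim :: nat
  Dom :: "point set"
  Por :: "point \<Rightarrow> real"
  Deg :: nat
  Expo :: "nat \<Rightarrow> real"
  Coef :: "nat \<Rightarrow> point \<Rightarrow> real"

definition medium :: "('z) medium_scheme \<Rightarrow> bool"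
  where "medium P \<longleftrightarrow>
    2 \<le> Dim P \<and> bounded_domain (Dim P) (Dom P) \<and> C1_boundary (Dim P) (Dom P) \<and>
    Por P \<in> borel_measurable (restrict_space (leb (Dim P)) (Dom P)) \<and> (\<forall>x\<in>Dom P. 0 < Por P x) \<and>
    1 \<le> Deg P \<and> Expo P 0 = 0 \<and> strict_mono_on {..Deg P} (Expo P) \<and>
    (\<forall>j\<le>Deg P. Coef P j \<in> borel_measurable (restrict_space (leb (Dim P)) (Dom P))) \<and>
    (\<forall>x \<in> Rn (Dim P) closure_of Dom P.
       0 < Coef P 0 x \<and> 0 < Coef P (Deg P) x \<and> (\<forall>j\<le>Deg P. 0 \<le> Coef P j x))"

text \<open>The \<open>j = 0\<close> term of \<open>g\<close> is split off because \<open>0 powr 0 = 0\<close> in the library.\<close>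

definition gF :: "('z) medium_scheme \<Rightarrow> point \<Rightarrow> real \<Rightarrow> real"
  where "gF P x s = Coef P 0 x + (\<Sum>j=1..Deg P. Coef P j x * s powr Expo P j)"

definition sF :: "('z) medium_scheme \<Rightarrow> point \<Rightarrow> real \<Rightarrow> real"
  where "sF P x \<xi> = (THE s. 0 \<le> s \<and> s * gF P x s = \<xi>)"

definition KF :: "('z) medium_scheme \<Rightarrow> point \<Rightarrow> real \<Rightarrow> real"
  where "KF P x \<xi> = 1 / gF P x (sF P x \<xi>)"

definition aF :: "('z) medium_scheme \<Rightarrow> real"
  where "aF P = Expo P (Deg P) / (Expo P (Deg P) + 1)"

definition W1 :: "('z) medium_scheme \<Rightarrow> point \<Rightarrow> real"
  where "W1 P x = Coef P (Deg P) x powr aF P /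
    (2 * real (Deg P) * Max ((\<lambda>j. Coef P j x) ` {..Deg P}))"

text \<open>The weighted Poincare-Sobolev inequalities, with exponent \<open>q = r\<close> (and \<open>c = c\<^sub>2\<close>) or
  \<open>q = 2\<close> (and \<open>c = c\<^sub>1\<close>).\<close>

definition weighted_ineq :: "('z) medium_scheme \<Rightarrow> real \<Rightarrow> real \<Rightarrow> bool"
  where "weighted_ineq P q c \<longleftrightarrow>
    (\<forall>u Du. W0 (Dim P) (Dom P) u Du \<longrightarrow>
       wnorm (Dim P) (Dom P) q (Por P) u
         \<le> ennreal c * wnorm (Dim P) (Dom P) (2 - aF P) (W1 P) (\<lambda>x. vnorm (Dim P) (Du x)))"

section \<open>The initial boundary value problem\<close>

text \<open>The additional fields are \<open>p\<close>, \<open>\<nabla>p\<close>, \<open>p\<^sub>t\<close>, \<open>\<Psi>\<close>, \<open>\<nabla>\<Psi>\<close>, \<open>\<Psi>\<^sub>t\<close>, with \<open>\<nabla>p\<close> etc. tied to \<open>p\<close> and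
  \<open>\<Psi>\<close> by \<open>extension\<close> and \<open>solution\<close> below. The initial datum is \<open>p\<^sub>0 = Pres P 0\<close>.\<close>

record flow = medium +
  Pres :: "real \<Rightarrow> point \<Rightarrow> real"
  GradPres :: "real \<Rightarrow> point \<Rightarrow> point"
  DtPres :: "real \<Rightarrow> point \<Rightarrow> real"
  Psi :: "real \<Rightarrow> point \<Rightarrow> real"
  GradPsi :: "real \<Rightarrow> point \<Rightarrow> point"
  DtPsi :: "real \<Rightarrow> point \<Rightarrow> real"

definition pbar :: "('z) flow_scheme \<Rightarrow> real \<Rightarrow> point \<Rightarrow> real"
  where "pbar P t x = Pres P t x - Psi P t x"

text \<open>Regularity of \<open>\<Psi>\<close>. The boundary values \<open>\<psi>\<close> of \<open>p\<close> enter only as the trace of \<open>\<Psi>\<close> on \<open>\<Gamma>\<close>.\<close>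

definition extension :: "('z) flow_scheme \<Rightarrow> bool"
  where "extension P \<longleftrightarrow>
    spacetime_measurable (Dim P) (Dom P) {0..} (Psi P) \<and>
    (\<forall>i<Dim P. spacetime_measurable (Dim P) (Dom P) {0..} (\<lambda>t x. GradPsi P t x i)) \<and>
    spacetime_measurable (Dim P) (Dom P) {0..} (DtPsi P) \<and>
    (\<forall>t\<ge>0. weak_gradient (Dim P) (Dom P) (Psi P t) (GradPsi P t)) \<and>
    time_derivative (Dim P) (Dom P) {0..} (Psi P) (DtPsi P)"

definition flux :: "('z) flow_scheme \<Rightarrow> real \<Rightarrow> point \<Rightarrow> point"
  where "flux P t x = (\<lambda>i. KF P x (vnorm (Dim P) (GradPres P t x)) * GradPres P t x i)"

text \<open>The equation at time \<open>t\<close> in weak form. The test functions are the bounded \<open>v\<close> vanishing on \<open>\<Gamma>\<close>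
  for which the right-hand side is an integrable function. By local integrability of the flux
  they include all compactly supported \<open>C\<^sup>1\<close> functions; by the regularity imposed in \<open>solution\<close>
  they include bounded functions \<open>F(pbar)\<close> with \<open>F(0) = 0\<close> and \<open>F'\<close> bounded, provided the data
  satisfy \<open>a\<^sub>0\<^sup>-\<^sup>1 |\<nabla>\<Psi>|\<^sup>2 \<in> L\<^sup>1(U)\<close>.\<close>

definition equation_at :: "('z) flow_scheme \<Rightarrow> real \<Rightarrow> bool"
  where "equation_at P t \<longleftrightarrow>
    (\<forall>i<Dim P. loc_integrable (Dim P) (Dom P) (\<lambda>x. flux P t x i)) \<and>
    (\<forall>v Dv. W0 (Dim P) (Dom P) v Dv \<and> (\<exists>B. \<forall>x\<in>Dom P. \<bar>v x\<bar> \<le> B) \<and>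
       set_integrable (leb (Dim P)) (Dom P)
         (\<lambda>x. vnorm (Dim P) (flux P t x) * vnorm (Dim P) (Dv x)) \<longrightarrow>
       (LINT x:Dom P|leb (Dim P). Por P x * DtPres P t x * v x)
         = - (LINT x:Dom P|leb (Dim P). vinner (Dim P) (flux P t x) (Dv x)))"

text \<open>Solutions, with regularity that allows for testing with functions of \<open>pbar\<close>. The Dirichlet
  condition \<open>p = \<psi>\<close> on \<open>\<Gamma>\<close> is the condition \<open>W0\<close> on \<open>pbar\<close>. The initial values are attained in
  \<open>L\<^sup>2\<^sub>\<phi>(U)\<close>; no regularity of \<open>p\<^sub>t\<close> is required up to \<open>t = 0\<close>.\<close>

definition solution :: "('z) flow_scheme \<Rightarrow> bool"
  where "solution P \<longleftrightarrow>
    spacetime_measurable (Dim P) (Dom P) {0..} (Pres P) \<and>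
    (\<forall>i<Dim P. spacetime_measurable (Dim P) (Dom P) {0<..} (\<lambda>t x. GradPres P t x i)) \<and>
    spacetime_measurable (Dim P) (Dom P) {0<..} (DtPres P) \<and>
    time_derivative (Dim P) (Dom P) {0<..} (Pres P) (DtPres P) \<and>
    (\<forall>s t. 0 < s \<and> s < t \<longrightarrow>
       set_integrable (leb (Dim P) \<Otimes>\<^sub>M lborel) (Dom P \<times> {s..t}) (\<lambda>(x, \<tau>). Por P x * DtPres P \<tau> x)) \<and>
    wnorm (Dim P) (Dom P) 2 (Por P) (pbar P 0) < \<infinity> \<and>
    ((\<lambda>t. wnorm (Dim P) (Dom P) 2 (Por P) (\<lambda>x. Pres P t x - Pres P 0 x)) \<longlongrightarrow> 0) (at_right 0) \<and>
    (AE t in lborel. 0 < t \<longrightarrow>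
       weak_gradient (Dim P) (Dom P) (Pres P t) (GradPres P t) \<and>
       W0 (Dim P) (Dom P) (pbar P t) (\<lambda>x i. GradPres P t x i - GradPsi P t x i) \<and>
       set_integrable (leb (Dim P)) (Dom P)
         (\<lambda>x. KF P x (vnorm (Dim P) (GradPres P t x)) * (vnorm (Dim P) (GradPres P t x))\<^sup>2) \<and>
       equation_at P t)"

section \<open>Quantities depending on the data\<close>

definition Bstar :: "('z) medium_scheme \<Rightarrow> ennreal"
  where "Bstar P = max (\<integral>\<^sup>+x\<in>Dom P. ennreal (Coef P (Deg P) x) \<partial>leb (Dim P)) 1"

definition G :: "('z) flow_scheme \<Rightarrow> real \<Rightarrow> ennreal"
  where "G P t = Bstar P
    + wnorm (Dim P) (Dom P) 2 (\<lambda>x. 1 / Coef P 0 x) (\<lambda>x. vnorm (Dim P) (GradPsi P t x)) epowr 2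
    + wnorm (Dim P) (Dom P) (2 - aF P) (W1 P) (\<lambda>x. vnorm (Dim P) (GradPsi P t x)) epowr (2 - aF P)
    + wnorm (Dim P) (Dom P) 2 (Por P) (DtPsi P t) epowr ((2 - aF P) / (1 - aF P))"

definition calA :: "('z) flow_scheme \<Rightarrow> ennreal"
  where "calA P = Limsup at_top (G P)"

text \<open>\<open>G\<close> as a real function (it is finite whenever it has a finite majorant), and \<open>\<B>\<close>, which is
  meaningful if this function is \<open>C\<^sup>1\<close> on \<open>(0, \<infinity>)\<close>.\<close>

definition Greal :: "('z) flow_scheme \<Rightarrow> real \<Rightarrow> real"
  where "Greal P t = enn2real (G P t)"

definition G_C1 :: "('z) flow_scheme \<Rightarrow> bool"
  where "G_C1 P \<longleftrightarrow>
    (\<forall>t>0. Greal P differentiable at t) \<and> continuous_on {0<..} (deriv (Greal P))"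

definition calB :: "('z) flow_scheme \<Rightarrow> ennreal"
  where "calB P = Limsup at_top (\<lambda>t. ennreal (max (- deriv (Greal P) t) 0))"

text \<open>The argument \<open>r1'\<close> is the conjugate exponent of \<open>r1\<close>.\<close>

definition N1 :: "('z) flow_scheme \<Rightarrow> real \<Rightarrow> real \<Rightarrow> real \<Rightarrow> ennreal"
  where "N1 P r1 s t = (let r1' = r1 / (r1 - 1) in
    max 1 (\<integral>\<^sup>+x\<in>Dom P. ennreal (Coef P (Deg P) x powr r1' * Por P x powr (1 - r1')) \<partial>leb (Dim P))
    + (\<integral>\<^sup>+\<tau>\<in>{s..t}. (\<integral>\<^sup>+x\<in>Dom P. ennreal (
         (W1 P x * vnorm (Dim P) (GradPsi P \<tau> x) powr (2 - aF P)
           + (vnorm (Dim P) (GradPsi P \<tau> x))\<^sup>2 / Coef P 0 x) powr r1' * Por P x powr (1 - r1')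
         + \<bar>DtPsi P \<tau> x\<bar> powr (2 * r1') * Por P x) \<partial>leb (Dim P)) \<partial>lborel))"

text \<open>A majorant of \<open>G\<close>; in particular \<open>G\<close> is finite.\<close>

definition majorant :: "('z) flow_scheme \<Rightarrow> (real \<Rightarrow> real) \<Rightarrow> bool"
  where "majorant P M \<longleftrightarrow>
    continuous_on {0..} M \<and> mono_on {0..} M \<and> (\<forall>t\<ge>0. G P t \<le> ennreal (M t))"

section \<open>Exponents\<close>

definition r0 :: "real \<Rightarrow> real \<Rightarrow> real"
  where "r0 a r = 2 + (2 - a) * (1 - 2 / r)"

definition kappa1 :: "real \<Rightarrow> real \<Rightarrow> real"
  where "kappa1 a r = r0 a r / (r0 a r - 2)"

definition kappa2 :: "real \<Rightarrow> real \<Rightarrow> real \<Rightarrow> real"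
  where "kappa2 a r r1 = r0 a r * (r1 - 1) / (2 * r0 a r + (r0 a r - 2) * r1 * (2 - a))"

definition nu1 :: "real \<Rightarrow> real \<Rightarrow> real \<Rightarrow> real"
  where "nu1 a r r1 = (r0 a r - 2 * r1) / (r0 a r + (r0 a r - 2) * r1)"

definition nu2 :: "real \<Rightarrow> real \<Rightarrow> real"
  where "nu2 a r = 2 * (r0 a r - 2 + a) / ((2 - a) * (r0 a r - 2))"

definition kappa3 :: "real \<Rightarrow> real \<Rightarrow> real \<Rightarrow> real"
  where "kappa3 a r r1 = kappa1 a r / (2 - a) - nu1 a r r1 / 2"

end

(* Testing the equation with F(p - Psi), for nondecreasing F with F(0) = 0, and using
   K(x,xi) xi^2 >= W_1 xi^(2-a) - a_N / 2, gives an energy inequality whose right-hand side is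
   controlled by G. For F the identity, the weighted inequality with exponent 2 turns it into a
   differential inequality y' + c y^((2-a)/2) <= C G for the squared L^2_phi norm y, and
   comparison with (multiples of) the constant M(t)^(2/(2-a)), or with a power of G(t) plus a
   constant, bounds y. For F vanishing on |u| <= k, the inequality with exponent r gives the
   recursion of De Giorgi's iteration on shrinking time intervals and rising levels k, which
   bounds the supremum by the L^2_phi norm. *)

theory Submission
  imports Defs
begin

section \<open>Absolutely continuous functions\<close>

text \<open>The equation may be tested with bounded functions only. Hence every energy estimate is
  derived for truncated test functions, where the dissipation is finite and can be absorbed, and is
  then extended by monotone convergence. Test functions have to be C^1 functions of u, so a
  piecewise quadratic function replaces the truncation (|u| - k)_+, at the price of an intermediate
  level in each step of the iteration. Averaging the energy inequality over its initial time takes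
  the place of a cutoff in time. The energy inequality relates two times, so it bounds the growth of
  y but not its fall, and no continuity of y is established; the comparison arguments are built to
  tolerate downward jumps. The exponent r_0 = 2 + (2 - a)(1 - 2/r) is the one at which Hoelder's
  inequality interpolates between the supremum in time of the L^2_\<phi> norm and the L^r_\<phi>
  norm while remaining linear in the dissipation. The constant must be known before the medium is.
  The choice of the constants of the iteration is therefore a statement about real numbers alone,
  and the other constants are explicit functions of a and c_1.\<close>

lemma lipschitz_of_deriv:
  fixes F h :: "real \<Rightarrow> real"
  assumes "\<And>u. (F has_real_derivative h u) (at u)" "\<And>u. \<bar>h u\<bar> \<le> 1"
  shows "\<bar>F x - F y\<bar> \<le> \<bar>x - y\<bar>"
  using field_differentiable_bound[of UNIV F h 1 x y] assms by simp

text \<open>The range of \<open>H\<close>, not the time interval, is cut into \<open>N\<close> equal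
  pieces: by the intermediate value theorem there are times at which \<open>H\<close> takes the
  equidistant values, and between consecutive ones \<open>E\<close> changes by at most
  \<open>C\<close> times the square of (H t - H s) / N. The sum of \<open>N\<close> such squares is
  of order 1/N. These times need not increase, which is why increments are bounded for all
  pairs.\<close>

lemma constant_of_quadratic_increments:
  fixes E H :: "real \<Rightarrow> real"
  assumes "s \<le> t" and Hc: "continuous_on {s..t} H"
    and q: "\<And>u v. u \<in> {s..t} \<Longrightarrow> v \<in> {s..t} \<Longrightarrow> \<bar>E v - E u\<bar> \<le> C * (H v - H u)\<^sup>2"
    and H: "H s \<le> H t"
  shows "E t = E s"
proof -
  have C: "C * (H t - H s)\<^sup>2 \<ge> 0" using q[of s t] assms(1) by auto
  have bound: "\<bar>E t - E s\<bar> \<le> (C * (H t - H s)\<^sup>2) / real N" if N: "N > 0" for N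
  proof -
    define y where "y j = H s + real j * (H t - H s) / real N" for j
    have "\<exists>x. x \<in> {s..t} \<and> H x = y j" if "j \<le> N" for j
    proof -
      have "real j * (H t - H s) / real N \<le> real N * (H t - H s) / real N"
        using that H by (intro divide_right_mono mult_right_mono) auto
      hence "y j \<le> H t" using N by (simp add: y_def)
      moreover have "H s \<le> y j" using H by (simp add: y_def)
      ultimately show ?thesis using IVT'[of H s "y j" t] assms(1) Hc by auto
    qed
    then obtain x where x: "\<And>j. j \<le> N \<Longrightarrow> x j \<in> {s..t}" "\<And>j. j \<le> N \<Longrightarrow> H (x j) = y j" by metis
    \<comment> \<open>\<open>x 0\<close> and \<open>x N\<close> need not be the endpoints, but
      \<open>H\<close> has the same values there, so by the quadratic bound \<open>E\<close> has,
      too.\<close>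
    have "\<bar>E (x 0) - E s\<bar> \<le> 0" using q[of s "x 0"] x[of 0] assms(1) by (simp add: y_def)
    moreover have "\<bar>E t - E (x N)\<bar> \<le> 0" using q[of "x N" t] x[of N] assms(1) N by (simp add: y_def)
    moreover have "\<bar>E (x N) - E (x 0)\<bar> \<le> (C * (H t - H s)\<^sup>2) / real N"
    proof -
      have "E (x N) - E (x 0) = (\<Sum>j<N. E (x (Suc j)) - E (x j))" by (subst sum_lessThan_telescope) simp
      also have "\<bar>\<dots>\<bar> \<le> (\<Sum>j<N. C * ((H t - H s) / real N)\<^sup>2)"
      proof (rule order_trans[OF sum_abs], rule sum_mono)
        fix j assume j: "j \<in> {..<N}"
        have "y (Suc j) - y j = (H t - H s) / real N" using N by (simp add: y_def field_simps)
        thus "\<bar>E (x (Suc j)) - E (x j)\<bar> \<le> C * ((H t - H s) / real N)\<^sup>2"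
          using q[of "x j" "x (Suc j)"] x[of j] x[of "Suc j"] j by auto
      qed
      also have "\<dots> = (C * (H t - H s)\<^sup>2) / real N"
        using N by (simp add: power_divide power2_eq_square field_simps)
      finally show ?thesis .
    qed
    ultimately show ?thesis by linarith
  qed
  have "(\<lambda>N. (C * (H t - H s)\<^sup>2) / real N) \<longlonglongrightarrow> 0" by (rule lim_const_over_n)
  hence "\<bar>E t - E s\<bar> \<le> 0"
    by (rule LIMSEQ_le_const) (auto intro!: exI[of _ 1] bound)
  thus ?thesis by simp
qed

text \<open>The chain rule for an absolutely continuous function \<open>w\<close>: both sides have, over short
  intervals, the same increments up to the square of the increment of \<open>\<integral> \<bar>g\<bar>\<close>.\<close>

lemma absolutely_continuous_chain_rule:
  fixes w g F h \<Phi> :: "real \<Rightarrow> real"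
  assumes st: "s \<le> t" and g: "set_integrable lborel {s..t} g"
    and w: "\<And>u v. s \<le> u \<Longrightarrow> u \<le> v \<Longrightarrow> v \<le> t \<Longrightarrow> w v - w u = (LINT \<tau>:{u..v}|lborel. g \<tau>)"
    and F: "\<And>u. (F has_real_derivative h u) (at u)" "\<And>u. \<bar>h u\<bar> \<le> 1"
    and \<Phi>: "\<And>u. (\<Phi> has_real_derivative F u) (at u)"
  shows "set_integrable lborel {s..t} (\<lambda>\<tau>. F (w \<tau>) * g \<tau>)"
    and "\<Phi> (w t) - \<Phi> (w s) = (LINT \<tau>:{s..t}|lborel. F (w \<tau>) * g \<tau>)"
proof -
  note lip = lipschitz_of_deriv[OF F]
  have Fc: "continuous_on UNIV F"
    using F(1) by (intro DERIV_continuous_on) (auto intro: has_field_derivative_at_within)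
  have ga: "set_integrable lborel {s..t} (\<lambda>x. \<bar>g x\<bar>)" by (rule set_integrable_abs[OF g])
  have sub: "set_integrable lborel {u..v} g" "set_integrable lborel {u..v} (\<lambda>x. \<bar>g x\<bar>)"
    if "s \<le> u" "v \<le> t" for u v
    using that by (auto intro!: set_integrable_subset[OF g] set_integrable_subset[OF ga])
  define H where "H v = (LINT \<tau>:{s..v}|lborel. \<bar>g \<tau>\<bar>)" for v
  have Hint: "H v = integral {s..v} (\<lambda>x. \<bar>g x\<bar>)" if "v \<in> {s..t}" for v
    unfolding H_def using sub(2)[of s v] that by (intro set_borel_integral_eq_integral) auto
  have Hc: "continuous_on {s..t} H"
  proof -
    have "continuous_on {s..t} (\<lambda>v. integral {s..v} (\<lambda>x. \<bar>g x\<bar>))"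
      by (intro indefinite_integral_continuous_1 set_borel_integral_eq_integral(1)[OF ga])
    thus ?thesis by (rule continuous_on_eq) (rule Hint[symmetric])
  qed
  have Hd: "(LINT \<tau>:{u..v}|lborel. \<bar>g \<tau>\<bar>) = H v - H u" if "s \<le> u" "u \<le> v" "v \<le> t" for u v
  proof -
    have "integral {s..u} (\<lambda>x. \<bar>g x\<bar>) + integral {u..v} (\<lambda>x. \<bar>g x\<bar>) = integral {s..v} (\<lambda>x. \<bar>g x\<bar>)"
      using that sub(2)[of s v] by (intro Henstock_Kurzweil_Integration.integral_combine set_borel_integral_eq_integral(1)) auto
    thus ?thesis using Hint that sub(2)[of u v] by (simp add: set_borel_integral_eq_integral(2))
  qed
  have wb: "\<bar>w v - w u\<bar> \<le> H v - H u" if "s \<le> u" "u \<le> v" "v \<le> t" for u v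
  proof -
    have "\<bar>LINT \<tau>:{u..v}|lborel. g \<tau>\<bar> \<le> (LINT \<tau>:{u..v}|lborel. \<bar>g \<tau>\<bar>)"
      using set_integral_norm_bound[OF sub(1)[of u v]] that by simp
    thus ?thesis using w Hd that by simp
  qed
  have Hm: "H u \<le> H v" if "s \<le> u" "u \<le> v" "v \<le> t" for u v using wb[OF that] by linarith
  have wc: "continuous_on {s..t} w"
  proof -
    have 1: "w v = w s + integral {s..v} g" if "v \<in> {s..t}" for v
      using w[of s v] that sub(1)[of s v] by (simp add: set_borel_integral_eq_integral(2))
    have 2: "continuous_on {s..t} (\<lambda>v. w s + integral {s..v} g)"
      by (intro continuous_intros indefinite_integral_continuous_1 set_borel_integral_eq_integral(1)[OF g])
    show ?thesis by (rule continuous_on_eq[OF 2]) (rule 1[symmetric])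
  qed
  have Fwc: "continuous_on {s..t} (\<lambda>\<tau>. F (w \<tau>))"
    using continuous_on_compose2[OF Fc wc] by simp
  \<comment> \<open>The shift \<open>c\<close> is there because the claim serves twice: with 0 for
    the integrability to be shown, and with the mean value of \<open>F\<close> in the estimate of
    the increments.\<close>
  have int: "set_integrable lborel {u..v} (\<lambda>\<tau>. (F (w \<tau>) - c) * g \<tau>)" if "s \<le> u" "v \<le> t" for u v c
  proof -
    have cc: "continuous_on {u..v} (\<lambda>\<tau>. F (w \<tau>) - c)"
      using that by (intro continuous_intros continuous_on_subset[OF Fwc]) auto
    have "bounded ((\<lambda>\<tau>. F (w \<tau>) - c) ` {u..v})"
      by (intro compact_imp_bounded compact_continuous_image cc) auto
    then obtain B where B: "\<And>\<tau>. \<tau> \<in> {u..v} \<Longrightarrow> \<bar>F (w \<tau>) - c\<bar> \<le> B"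
      unfolding bounded_iff by (auto simp del: atLeastAtMost_iff)
    have m: "(\<lambda>\<tau>. indicator {u..v} \<tau> *\<^sub>R (F (w \<tau>) - c)) \<in> borel_measurable borel"
      by (rule borel_measurable_continuous_on_indicator[OF _ cc]) simp
    have g1: "integrable lborel (\<lambda>\<tau>. B * (indicator {u..v} \<tau> *\<^sub>R g \<tau>))"
      using sub(1)[of u v] that unfolding set_integrable_def by (intro integrable_mult_right) auto
    have gm: "(\<lambda>\<tau>. indicator {u..v} \<tau> *\<^sub>R g \<tau>) \<in> borel_measurable borel"
      using borel_measurable_integrable[OF sub(1)[of u v, unfolded set_integrable_def]] that by simp
    have eq: "(\<lambda>\<tau>. indicator {u..v} \<tau> *\<^sub>R ((F (w \<tau>) - c) * g \<tau>)) =
        (\<lambda>\<tau>. (indicator {u..v} \<tau> *\<^sub>R (F (w \<tau>) - c)) * (indicator {u..v} \<tau> *\<^sub>R g \<tau>))"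
      by (auto simp: fun_eq_iff indicator_def)
    show ?thesis unfolding set_integrable_def eq
    proof (rule Bochner_Integration.integrable_bound[OF g1])
      show "(\<lambda>\<tau>. (indicator {u..v} \<tau> *\<^sub>R (F (w \<tau>) - c)) * (indicator {u..v} \<tau> *\<^sub>R g \<tau>)) \<in> borel_measurable lborel"
        using m gm by simp
      show "AE \<tau> in lborel. norm ((indicator {u..v} \<tau> *\<^sub>R (F (w \<tau>) - c)) * (indicator {u..v} \<tau> *\<^sub>R g \<tau>))
          \<le> norm (B * (indicator {u..v} \<tau> *\<^sub>R g \<tau>))"
        using B by (intro AE_I2) (auto simp: indicator_def abs_mult intro!: mult_right_mono intro: order_trans[OF _ abs_ge_self])
    qed
  qed
  show I: "set_integrable lborel {s..t} (\<lambda>\<tau>. F (w \<tau>) * g \<tau>)" using int[of s t 0] by simp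
  define E where "E v = \<Phi> (w v) - (LINT \<tau>:{s..v}|lborel. F (w \<tau>) * g \<tau>)" for v
  have inc: "\<bar>E v - E u\<bar> \<le> 2 * (H v - H u)\<^sup>2" if uv: "s \<le> u" "u \<le> v" "v \<le> t" for u v
  proof -
    have i3: "set_integrable lborel {a..b} (\<lambda>\<tau>. F (w \<tau>) * g \<tau>)" if "s \<le> a" "b \<le> t" for a b
      using int[of a b 0] that by simp
    have e1: "(LINT \<tau>:{s..v}|lborel. F (w \<tau>) * g \<tau>) = (LINT \<tau>:{s..u}|lborel. F (w \<tau>) * g \<tau>)
        + (LINT \<tau>:{u..v}|lborel. F (w \<tau>) * g \<tau>)"
    proof -
      have "integral {s..u} (\<lambda>\<tau>. F (w \<tau>) * g \<tau>) + integral {u..v} (\<lambda>\<tau>. F (w \<tau>) * g \<tau>) = integral {s..v} (\<lambda>\<tau>. F (w \<tau>) * g \<tau>)"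
        using uv i3[of s v] by (intro Henstock_Kurzweil_Integration.integral_combine set_borel_integral_eq_integral(1)) auto
      thus ?thesis using uv i3 by (simp add: set_borel_integral_eq_integral(2))
    qed
    \<comment> \<open>The mean value theorem wants distinct endpoints in increasing order, so equal
      and reversed values are treated separately; in each case the point is no further from
      \<open>w u\<close> than \<open>w v\<close> is.\<close>
    obtain c where c: "\<Phi> (w v) - \<Phi> (w u) = F c * (w v - w u)" "\<bar>c - w u\<bar> \<le> \<bar>w v - w u\<bar>"
    proof (cases "w u = w v")
      case True thus ?thesis using that[of "w u"] by simp
    next
      case False
      then consider "w u < w v" | "w v < w u" by linarith
      thus ?thesis
      proof cases
        case 1
        obtain z where "w u < z" "z < w v" "\<Phi> (w v) - \<Phi> (w u) = (w v - w u) * F z"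
          using MVT2[OF 1, of \<Phi> F] \<Phi> by auto
        thus ?thesis using that[of z] by (simp add: mult.commute)
      next
        case 2
        obtain z where "w v < z" "z < w u" "\<Phi> (w u) - \<Phi> (w v) = (w u - w v) * F z"
          using MVT2[OF 2, of \<Phi> F] \<Phi> by auto
        thus ?thesis using that[of z] by (simp add: algebra_simps)
      qed
    qed
    have "E v - E u = F c * (LINT \<tau>:{u..v}|lborel. g \<tau>) - (LINT \<tau>:{u..v}|lborel. F (w \<tau>) * g \<tau>)"
      using e1 c(1) w[OF uv] by (simp add: E_def)
    also have "\<dots> = - (LINT \<tau>:{u..v}|lborel. (F (w \<tau>) - F c) * g \<tau>)"
      using i3[of u v] sub(1)[of u v] uv by (simp add: left_diff_distrib set_integral_diff)
    also have "\<bar>\<dots>\<bar> \<le> (LINT \<tau>:{u..v}|lborel. \<bar>(F (w \<tau>) - F c) * g \<tau>\<bar>)"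
      using set_integral_norm_bound[OF int[of u v "F c"]] uv by simp
    also have "\<dots> \<le> (LINT \<tau>:{u..v}|lborel. (2 * (H v - H u)) * \<bar>g \<tau>\<bar>)"
    proof (rule set_integral_mono)
      show "set_integrable lborel {u..v} (\<lambda>\<tau>. \<bar>(F (w \<tau>) - F c) * g \<tau>\<bar>)"
        using int[of u v "F c"] uv by (intro set_integrable_abs) auto
      show "set_integrable lborel {u..v} (\<lambda>\<tau>. (2 * (H v - H u)) * \<bar>g \<tau>\<bar>)"
        using sub(2)[of u v] uv by (intro set_integrable_mult_right) auto
      fix \<tau> assume \<tau>: "\<tau> \<in> {u..v}"
      have "\<bar>w \<tau> - w u\<bar> \<le> H \<tau> - H u" "H \<tau> \<le> H v" "\<bar>w v - w u\<bar> \<le> H v - H u"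
        using \<tau> uv by (auto intro!: wb Hm)
      \<comment> \<open>The factor 2: from \<open>w \<tau>\<close> to \<open>w u\<close> and from
        \<open>w u\<close> to \<open>c\<close>, each at most H v - H u.\<close>
      hence "\<bar>w \<tau> - c\<bar> \<le> 2 * (H v - H u)" using c(2) by (smt (verit))
      hence "\<bar>F (w \<tau>) - F c\<bar> \<le> 2 * (H v - H u)" using lip[of "w \<tau>" c] by linarith
      thus "\<bar>(F (w \<tau>) - F c) * g \<tau>\<bar> \<le> (2 * (H v - H u)) * \<bar>g \<tau>\<bar>"
        by (auto simp: abs_mult intro!: mult_right_mono)
    qed
    also have "\<dots> = 2 * (H v - H u)\<^sup>2" using Hd[OF uv] by (simp add: power2_eq_square)
    finally show ?thesis .
  qed
  have "E t = E s"
  proof (rule constant_of_quadratic_increments[OF st Hc])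
    fix u v assume "u \<in> {s..t}" "v \<in> {s..t}"
    thus "\<bar>E v - E u\<bar> \<le> 2 * (H v - H u)\<^sup>2"
      using inc[of u v] inc[of v u] by (cases "u \<le> v") (auto simp: abs_minus_commute power2_commute)
  qed (use Hm st in auto)
  moreover have "(LINT \<tau>:{s..s}|lborel. F (w \<tau>) * g \<tau>) = 0"
    using int[of s s 0] st by (simp add: set_borel_integral_eq_integral(2))
  ultimately show "\<Phi> (w t) - \<Phi> (w s) = (LINT \<tau>:{s..t}|lborel. F (w \<tau>) * g \<tau>)" by (simp add: E_def)
qed

section \<open>Composition in \<open>W\<^sub>0\<^sup>1\<^sup>,\<^sup>1\<close>\<close>

lemma topspace_Rn: "topspace (Rn n) = extensional {..<n}"
  unfolding Rn_def topspace_product_topology by (auto simp: PiE_def)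

lemma space_leb: "space (leb n) = extensional {..<n}"
  unfolding leb_def space_PiM by (auto simp: PiE_def)

text \<open>On the space of all functions the Borel sets of the product topology are those of the
  product sigma-algebra, since the index set is countable. An open set of extensional functions is
  the trace of the open set of all functions whose restriction to the first \<open>n\<close>
  coordinates lies in it.\<close>

lemma openin_Rn_sets:
  assumes "openin (Rn n) U" shows "U \<in> sets (leb n)"
proof -
  have 1: "continuous_map euclidean (Rn n) (\<lambda>x::point. restrict x {..<n})"
    unfolding Rn_def continuous_map_componentwise
    by (auto intro!: continuous_intros simp: continuous_on_product_coordinates)
  have "openin euclidean {x \<in> topspace euclidean. restrict x {..<n} \<in> U}"
    using openin_continuous_map_preimage[OF 1 assms] .
  hence 2: "open {x::point. restrict x {..<n} \<in> U}" by simp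
  hence 3: "{x::point. restrict x {..<n} \<in> U} \<in> sets (Pi\<^sub>M UNIV (\<lambda>_. borel))"
    unfolding sets_PiM_equal_borel by simp
  have 4: "(\<lambda>x. x) \<in> measurable (leb n) (Pi\<^sub>M UNIV (\<lambda>_. borel::real measure))"
  proof (rule measurable_PiM_single')
    fix i :: nat
    show "(\<lambda>x. x i) \<in> measurable (leb n) borel"
    proof (cases "i < n")
      case True
      have "(\<lambda>x. x i) \<in> measurable (leb n) lborel"
        unfolding leb_def using True by (intro measurable_component_singleton) auto
      thus ?thesis by simp
    next
      case False
      \<comment> \<open>Beyond the first \<open>n\<close> coordinates an extensional function is
        constantly \<open>undefined\<close>.\<close>
      have "(\<lambda>x. x i) \<in> measurable (leb n) borel \<longleftrightarrow> (\<lambda>x::point. undefined::real) \<in> measurable (leb n) borel"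
        by (rule measurable_cong) (use False in \<open>auto simp: space_leb extensional_def\<close>)
      thus ?thesis by simp
    qed
  qed auto
  have "(\<lambda>x. x) -` {x. restrict x {..<n} \<in> U} \<inter> space (leb n) \<in> sets (leb n)"
    by (rule measurable_sets[OF 4 3])
  also have "(\<lambda>x. x) -` {x. restrict x {..<n} \<in> U} \<inter> space (leb n) = U"
    using openin_subset[OF assms] by (auto simp: space_leb topspace_Rn extensional_restrict)
  finally show ?thesis .
qed

lemma continuous_map_Rn_measurable:
  assumes "continuous_map (Rn n) euclideanreal f" shows "f \<in> borel_measurable (leb n)"
proof (rule borel_measurableI)
  fix S :: "real set" assume "open S"
  hence "openin (Rn n) {x \<in> topspace (Rn n). f x \<in> S}"
    using openin_continuous_map_preimage[OF assms] by simp
  hence "{x \<in> topspace (Rn n). f x \<in> S} \<in> sets (leb n)" by (rule openin_Rn_sets)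
  also have "{x \<in> topspace (Rn n). f x \<in> S} = f -` S \<inter> space (leb n)"
    by (auto simp: topspace_Rn space_leb)
  finally show "f -` S \<inter> space (leb n) \<in> sets (leb n)" .
qed

lemma Rn_box_nhd:
  assumes "openin (Rn n) V" "x \<in> V"
  obtains d where "d > 0" "\<And>y. y \<in> extensional {..<n} \<Longrightarrow> \<forall>i<n. \<bar>y i - x i\<bar> < d \<Longrightarrow> y \<in> V"
proof -
  have "\<exists>W. finite {i \<in> {..<n}. W i \<noteq> topspace euclideanreal} \<and>
      (\<forall>i\<in>{..<n}. openin euclideanreal (W i)) \<and> x \<in> Pi\<^sub>E {..<n} W \<and> Pi\<^sub>E {..<n} W \<subseteq> V"
    by (rule bspec[OF _ assms(2)]) (rule assms(1)[unfolded Rn_def openin_product_topology_alt])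
  then obtain W where W: "\<And>i. i < n \<Longrightarrow> open (W i)" "x \<in> Pi\<^sub>E {..<n} W" "Pi\<^sub>E {..<n} W \<subseteq> V"
    by (metis lessThan_iff open_openin)
  have "\<exists>e>0. \<forall>s. \<bar>s - x i\<bar> < e \<longrightarrow> s \<in> W i" if "i < n" for i
    proof -
    have "x i \<in> W i" using W(2) that by auto
    thus ?thesis using W(1)[OF that] unfolding open_dist dist_real_def by blast
  qed
  then obtain e where e: "\<And>i. i < n \<Longrightarrow> e i > 0" "\<And>i s. i < n \<Longrightarrow> \<bar>s - x i\<bar> < e i \<Longrightarrow> s \<in> W i"
    by metis
  \<comment> \<open>The element 1 keeps the set nonempty when \<open>n\<close> is 0.\<close>
  define d where "d = Min (insert 1 (e ` {..<n}))"
  have "d > 0" unfolding d_def using e(1) by (subst Min_gr_iff) auto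
  have d: "d \<le> e i" if "i < n" for i unfolding d_def using that by (intro Min_le) auto
  show thesis
  proof (rule that[OF \<open>d > 0\<close>])
    fix y :: point assume y: "y \<in> extensional {..<n}" "\<forall>i<n. \<bar>y i - x i\<bar> < d"
    have "y i \<in> W i" if "i < n" for i
      using e(2)[OF that, of "y i"] d[OF that] y(2) that by force
    hence "y \<in> Pi\<^sub>E {..<n} W" using y(1) by (auto simp: PiE_def)
    thus "y \<in> V" using W(3) by auto
  qed
qed

text \<open>The increment is telescoped along the coordinate axes, so that only one-variable mean value
  theorems are needed.\<close>

lemma C1_on_continuous:
  assumes "C1_on n (topspace (Rn n)) f Df"
  shows "continuous_map (Rn n) euclideanreal f"
  unfolding continuous_map_eq_topcontinuous_at topcontinuous_at_def
proof (rule ballI)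
  have cont: "continuous_map (Rn n) euclideanreal (\<lambda>x. Df x i)" if "i < n" for i
    using assms that unfolding C1_on_def by auto
  have der: "((\<lambda>s. f (x(i := s))) has_real_derivative Df x i) (at (x i))"
    if "i < n" "x \<in> extensional {..<n}" for x i
    using assms that unfolding C1_on_def topspace_Rn by auto
  fix x assume x: "x \<in> topspace (Rn n)"
  have "\<exists>W. openin (Rn n) W \<and> x \<in> W \<and> (\<forall>y\<in>W. f y \<in> V)"
    if V: "openin euclideanreal V \<and> f x \<in> V" for V
  proof -
  obtain e where e: "e > 0" "\<And>s. \<bar>s - f x\<bar> < e \<Longrightarrow> s \<in> V"
    using V unfolding open_openin[symmetric] open_dist dist_real_def by auto
  have "\<exists>d>0. \<forall>y. y \<in> extensional {..<n} \<longrightarrow> (\<forall>j<n. \<bar>y j - x j\<bar> < d) \<longrightarrow> \<bar>Df y i\<bar> \<le> \<bar>Df x i\<bar> + 1"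
    if i: "i < n" for i
  proof -
    have "openin (Rn n) {y \<in> topspace (Rn n). Df y i \<in> {Df x i - 1 <..< Df x i + 1}}"
      by (rule openin_continuous_map_preimage[OF cont[OF i]]) simp
    moreover have "x \<in> {y \<in> topspace (Rn n). Df y i \<in> {Df x i - 1 <..< Df x i + 1}}" using x by simp
    ultimately obtain d where d: "d > 0" "\<And>y. y \<in> extensional {..<n} \<Longrightarrow> \<forall>j<n. \<bar>y j - x j\<bar> < d
      \<Longrightarrow> y \<in> {y \<in> topspace (Rn n). Df y i \<in> {Df x i - 1 <..< Df x i + 1}}"
      by (rule Rn_box_nhd) (rule that)
    have "\<bar>Df y i\<bar> \<le> \<bar>Df x i\<bar> + 1" if "y \<in> extensional {..<n}" "\<forall>j<n. \<bar>y j - x j\<bar> < d" for y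
      using d(2)[of y] that by auto
    thus ?thesis using d(1) by blast
  qed
  then obtain d where d: "\<And>i. i < n \<Longrightarrow> d i > 0" "\<And>i y. i < n \<Longrightarrow> y \<in> extensional {..<n} \<Longrightarrow>
      (\<forall>j<n. \<bar>y j - x j\<bar> < d i) \<Longrightarrow> \<bar>Df y i\<bar> \<le> \<bar>Df x i\<bar> + 1" by metis
  \<comment> \<open>A common bound for all partial derivatives on the box; the last summand makes it
    positive also for \<open>n\<close> = 0.\<close>
  define B where "B = (\<Sum>i<n. \<bar>Df x i\<bar> + 1) + 1"
  have B: "\<bar>Df x i\<bar> + 1 \<le> B" if "i < n" for i
  proof -
    have "\<bar>Df x i\<bar> + 1 \<le> (\<Sum>i<n. \<bar>Df x i\<bar> + 1)"
      using that by (intro member_le_sum) auto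
    thus ?thesis by (simp add: B_def)
  qed
  have "B > 0" unfolding B_def by (intro add_nonneg_pos sum_nonneg) auto
  define \<delta> where "\<delta> = Min (insert (e / (B * (real n + 1))) (d ` {..<n}))"
  have \<delta>: "\<delta> > 0" unfolding \<delta>_def using d(1) e(1) \<open>B > 0\<close> by (subst Min_gr_iff) auto
  have \<delta>d: "\<delta> \<le> d i" if "i < n" for i unfolding \<delta>_def using that by (intro Min_le) auto
  have \<delta>e: "\<delta> \<le> e / (B * (real n + 1))" unfolding \<delta>_def by (intro Min_le) auto
  define W where "W = Pi\<^sub>E {..<n} (\<lambda>i. {x i - \<delta> <..< x i + \<delta>})"
  have "openin (Rn n) W" unfolding W_def Rn_def
    by (rule openin_PiE[THEN iffD2]) (simp, intro disjI2 ballI, simp)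
  moreover have "x \<in> W" using x \<delta> by (auto simp: W_def topspace_Rn PiE_def Pi_def)
  moreover have "f y \<in> V" if y: "y \<in> W" for y
  proof -
    have ye: "y \<in> extensional {..<n}" using y unfolding W_def by (simp add: PiE_def)
    have yd: "\<bar>y i - x i\<bar> < \<delta>" if "i < n" for i
    proof -
      have "y i \<in> {x i - \<delta> <..< x i + \<delta>}" using y that unfolding W_def by (auto simp: PiE_def Pi_def)
      thus ?thesis by (simp add: abs_less_iff)
    qed
    define z where "z j = (\<lambda>i. if i < j then y i else x i)" for j
    have ze: "z j \<in> extensional {..<n}" for j
      using ye x by (auto simp: z_def topspace_Rn extensional_def)
    have step: "\<bar>f (z (Suc j)) - f (z j)\<bar> \<le> B * \<delta>" if j: "j < n" for j
    proof -
      have zs: "z (Suc j) = (z j)(j := y j)" by (auto simp: z_def fun_eq_iff less_Suc_eq)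
      have zj: "z j = (z j)(j := x j)" by (auto simp: z_def fun_eq_iff)
      have "norm (f ((z j)(j := y j)) - f ((z j)(j := x j))) \<le> B * norm (y j - x j)"
      proof (rule field_differentiable_bound[where S = "closed_segment (x j) (y j)" and f' = "\<lambda>s. Df ((z j)(j := s)) j"])
        fix s assume s: "s \<in> closed_segment (x j) (y j)"
        have e1: "(z j)(j := s) \<in> extensional {..<n}" using ze[of j] j by (auto simp: extensional_def)
        show "((\<lambda>s. f ((z j)(j := s))) has_field_derivative Df ((z j)(j := s)) j) (at s within closed_segment (x j) (y j))"
          by (rule DERIV_subset[OF _ subset_UNIV]) (use der[OF j e1] in simp)
        have "\<bar>s - x j\<bar> \<le> \<bar>y j - x j\<bar>" using s by (auto simp: closed_segment_eq_real_ivl split: if_splits)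
        hence sx: "\<bar>s - x j\<bar> < d j" using yd[OF j] \<delta>d[OF j] by linarith
        have "\<bar>((z j)(j := s)) i - x i\<bar> < d j" if "i < n" for i
          using sx yd[OF that] \<delta>d[OF j] \<delta> by (auto simp: z_def)
        hence "\<forall>i<n. \<bar>((z j)(j := s)) i - x i\<bar> < d j" by blast
        hence "\<bar>Df ((z j)(j := s)) j\<bar> \<le> \<bar>Df x j\<bar> + 1" using d(2)[OF j e1] by blast
        thus "norm (Df ((z j)(j := s)) j) \<le> B" using B[OF j] by simp
      qed auto
      also have "\<dots> \<le> B * \<delta>" using yd[OF j] \<open>B > 0\<close> by (intro mult_left_mono) auto
      finally show ?thesis by (simp only: zs zj[symmetric] real_norm_def)
    qed
    have "\<bar>f (z n) - f (z 0)\<bar> = \<bar>\<Sum>j<n. f (z (Suc j)) - f (z j)\<bar>"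
      by (subst sum_lessThan_telescope) simp
    also have "\<dots> \<le> (\<Sum>j<n. B * \<delta>)" by (intro order_trans[OF sum_abs] sum_mono step) auto
    also have "\<dots> = real n * (B * \<delta>)" by simp
    also have "\<dots> < (real n + 1) * (B * \<delta>)" using \<open>B > 0\<close> \<delta> by simp
    also have "\<dots> \<le> e" using \<delta>e \<open>B > 0\<close>
      by (subst (asm) pos_le_divide_eq) (auto simp: algebra_simps intro: add_pos_nonneg)
    finally have "\<bar>f (z n) - f (z 0)\<bar> < e" .
    moreover have "z n = y" "z 0 = x" using ye x by (auto simp: z_def fun_eq_iff topspace_Rn extensional_def)
    ultimately show ?thesis using e(2) by simp
  qed
  ultimately show "\<exists>W. openin (Rn n) W \<and> x \<in> W \<and> (\<forall>y\<in>W. f y \<in> V)" by blast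
  qed
  thus "x \<in> topspace (Rn n) \<and> f \<in> topspace (Rn n) \<rightarrow> topspace euclideanreal \<and>
      (\<forall>V. openin euclideanreal V \<and> f x \<in> V \<longrightarrow>
        (\<exists>W. openin (Rn n) W \<and> x \<in> W \<and> (\<forall>y\<in>W. f y \<in> V)))"
    using x by simp
qed

section \<open>The chain rule for functions vanishing on the boundary\<close>

lemma C1c_compose:
  assumes "C1c n U f Df" "\<And>u. (F has_real_derivative h u) (at u)" "continuous_on UNIV h" "F 0 = 0"
  shows "C1c n U (\<lambda>x. F (f x)) (\<lambda>x i. h (f x) * Df x i)"
proof -
  have C1: "C1_on n (topspace (Rn n)) f Df" using assms(1) by (simp add: C1c_def)
  have fc: "continuous_map (Rn n) euclideanreal f" by (rule C1_on_continuous[OF C1])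
  have hc: "continuous_map (Rn n) euclideanreal (\<lambda>x. h (f x))"
    using continuous_map_compose[OF fc, of euclideanreal h] assms(3) by (simp add: o_def)
  have "continuous_map (Rn n) euclideanreal (\<lambda>x. h (f x) * Df x i)" if "i < n" for i
    using C1 that hc unfolding C1_on_def by (intro continuous_map_real_mult) auto
  moreover have "((\<lambda>s. F (f (x(i := s)))) has_real_derivative h (f x) * Df x i) (at (x i))"
    if "i < n" "x \<in> topspace (Rn n)" for x i
  proof -
    have "((\<lambda>s. f (x(i := s))) has_real_derivative Df x i) (at (x i))"
      using C1 that unfolding C1_on_def by auto
    moreover have "(F has_real_derivative h (f x)) (at (f (x(i := x i))))"
      using assms(2) by simp
    ultimately show ?thesis using DERIV_chain2 by metis
  qed
  ultimately show ?thesis using assms(1,4) unfolding C1c_def C1_on_def by auto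
qed

lemma set_integrable_iff_restrict:
  assumes "A \<in> sets M"
  shows "set_integrable M A f \<longleftrightarrow> integrable (restrict_space M A) (f :: _ \<Rightarrow> real)"
proof -
  have "A \<inter> space M \<in> sets M" using assms by simp
  thus ?thesis unfolding set_integrable_def by (simp add: integrable_restrict_space)
qed

text \<open>The approximating sequence is composed with \<open>F\<close>. The gradients differ by
  h(\<eta>) (D\<eta> - Du) + (h(\<eta>) - h(u)) Du. The first part tends to 0 because |h| \<le> 1;
  for the second, \<open>h\<close> being merely continuous, dominated convergence is used, which
  asks for convergence almost everywhere and so for a subsequence.\<close>

lemma W0_compose:
  assumes U: "openin (Rn n) U" and W0: "W0 n U u Du"
    and F: "\<And>u. (F has_real_derivative h u) (at u)" "continuous_on UNIV h" "F 0 = 0" "\<And>u. \<bar>h u\<bar> \<le> 1"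
  shows "W0 n U (\<lambda>x. F (u x)) (\<lambda>x i. h (u x) * Du x i)"
proof -
  define Mx where "Mx = restrict_space (leb n) U"
  have Us: "U \<in> sets (leb n)" by (rule openin_Rn_sets[OF U])
  hence Us': "U \<inter> space (leb n) \<in> sets (leb n)" by simp
  note seti = set_integrable_iff_restrict[OF Us, folded Mx_def]
  have nni: "(\<integral>\<^sup>+x\<in>U. g x \<partial>leb n) = (\<integral>\<^sup>+x. g x \<partial>Mx)" for g
    unfolding Mx_def using Us' by (simp add: nn_integral_restrict_space)
  have hm [measurable]: "h \<in> borel_measurable borel" using F(2) by (rule borel_measurable_continuous_onI)
  have Fm [measurable]: "F \<in> borel_measurable borel"
    using F(1) by (intro borel_measurable_continuous_onI DERIV_continuous_on) (auto intro: has_field_derivative_at_within)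
  note lip = lipschitz_of_deriv[OF F(1) F(4)]
  have ui: "integrable Mx u" and Dui: "\<And>i. i < n \<Longrightarrow> integrable Mx (\<lambda>x. Du x i)"
    using W0 unfolding W0_def seti by auto
  note [measurable] = borel_measurable_integrable[OF ui]
  obtain \<eta> D\<eta> where e: "\<And>k::nat. C1c n U (\<eta> k) (D\<eta> k)"
    and e1: "(\<lambda>k. \<integral>\<^sup>+x. ennreal \<bar>\<eta> k x - u x\<bar> \<partial>Mx) \<longlonglongrightarrow> 0"
    and e2: "\<And>i. i < n \<Longrightarrow> (\<lambda>k. \<integral>\<^sup>+x. ennreal \<bar>D\<eta> k x i - Du x i\<bar> \<partial>Mx) \<longlonglongrightarrow> 0"
    using W0 unfolding W0_def nni by blast
  have em [measurable]: "\<eta> k \<in> borel_measurable Mx" for k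
    using C1_on_continuous[of n "\<eta> k" "D\<eta> k"] e[of k] unfolding C1c_def Mx_def
    by (auto intro: measurable_restrict_space1 continuous_map_Rn_measurable)
  have dm: "(\<lambda>x. D\<eta> k x i) \<in> borel_measurable Mx" if "i < n" for k i
    using e[of k] that unfolding C1c_def Mx_def C1_on_def
    by (auto intro!: measurable_restrict_space1 continuous_map_Rn_measurable)
  have "\<forall>\<^sub>F k in sequentially. (\<integral>\<^sup>+x. ennreal \<bar>\<eta> k x - u x\<bar> \<partial>Mx) < 1"
    using order_tendstoD(2)[OF e1, of 1] by simp
  \<comment> \<open>The extraction of the subsequence asks for integrable differences; they are
    integrable as soon as their norms are below 1.\<close>
  then obtain k0 where k0: "\<And>k. k \<ge> k0 \<Longrightarrow> (\<integral>\<^sup>+x. ennreal \<bar>\<eta> k x - u x\<bar> \<partial>Mx) < 1"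
    unfolding eventually_sequentially by blast
  have i0: "integrable Mx (\<lambda>x. \<eta> (k + k0) x - u x)" for k
    by (rule integrableI_bounded) (use k0[of "k + k0"] in \<open>auto intro: less_trans\<close>)
  have "(\<lambda>k. ennreal (\<integral>x. norm (\<eta> (k + k0) x - u x) \<partial>Mx)) \<longlonglongrightarrow> ennreal 0"
    using LIMSEQ_ignore_initial_segment[OF e1, of k0] i0
    by (subst nn_integral_eq_integral[symmetric]) auto
  hence "(\<lambda>k. \<integral>x. norm (\<eta> (k + k0) x - u x) \<partial>Mx) \<longlonglongrightarrow> 0"
    by (subst (asm) tendsto_ennreal_iff) (auto intro!: integral_nonneg_AE)
  from tendsto_L1_AE_subseq[OF i0 this] obtain r where r: "strict_mono r"
    "AE x in Mx. (\<lambda>k. \<eta> (r k + k0) x - u x) \<longlonglongrightarrow> 0" by blast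
  define q where "q k = r k + k0" for k
  have q: "strict_mono q" using r(1) unfolding q_def strict_mono_def by auto
  have ae: "AE x in Mx. (\<lambda>k. \<eta> (q k) x) \<longlonglongrightarrow> u x"
    using r(2) unfolding q_def by (auto simp: LIM_zero_iff)
  have t1: "(\<lambda>k. \<integral>\<^sup>+x. ennreal \<bar>F (\<eta> (q k) x) - F (u x)\<bar> \<partial>Mx) \<longlonglongrightarrow> 0"
  proof (rule tendsto_sandwich[OF _ _ tendsto_const])
    show "(\<lambda>k. \<integral>\<^sup>+x. ennreal \<bar>\<eta> (q k) x - u x\<bar> \<partial>Mx) \<longlonglongrightarrow> 0"
      using LIMSEQ_subseq_LIMSEQ[OF e1 q] by (simp add: o_def)
    show "\<forall>\<^sub>F k in sequentially. (\<integral>\<^sup>+x. ennreal \<bar>F (\<eta> (q k) x) - F (u x)\<bar> \<partial>Mx)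
        \<le> (\<integral>\<^sup>+x. ennreal \<bar>\<eta> (q k) x - u x\<bar> \<partial>Mx)"
      by (intro always_eventually allI nn_integral_mono ennreal_leI lip)
  qed auto
  have t2: "(\<lambda>k. \<integral>\<^sup>+x. ennreal \<bar>h (\<eta> (q k) x) * D\<eta> (q k) x i - h (u x) * Du x i\<bar> \<partial>Mx) \<longlonglongrightarrow> 0"
    if i: "i < n" for i
  proof -
    note [measurable] = borel_measurable_integrable[OF Dui[OF i]] dm[OF i]
    have d: "(\<lambda>k. \<integral>\<^sup>+x. ennreal (\<bar>h (\<eta> (q k) x) - h (u x)\<bar> * \<bar>Du x i\<bar>) \<partial>Mx) \<longlonglongrightarrow> (\<integral>\<^sup>+x. 0 \<partial>Mx)"
    proof (rule nn_integral_dominated_convergence[where w = "\<lambda>x. ennreal (2 * \<bar>Du x i\<bar>)"])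
      show "AE x in Mx. ennreal (\<bar>h (\<eta> (q k) x) - h (u x)\<bar> * \<bar>Du x i\<bar>) \<le> ennreal (2 * \<bar>Du x i\<bar>)" for k
      proof (intro AE_I2 ennreal_leI mult_right_mono)
        fix x show "\<bar>h (\<eta> (q k) x) - h (u x)\<bar> \<le> 2"
          using F(4)[of "\<eta> (q k) x"] F(4)[of "u x"] by linarith
      qed auto
      have "integrable Mx (\<lambda>x. 2 * \<bar>Du x i\<bar>)" using Dui[OF i] by auto
      thus "(\<integral>\<^sup>+x. ennreal (2 * \<bar>Du x i\<bar>) \<partial>Mx) < \<infinity>"
        by (subst nn_integral_eq_integral) auto
      show "AE x in Mx. (\<lambda>k. ennreal (\<bar>h (\<eta> (q k) x) - h (u x)\<bar> * \<bar>Du x i\<bar>)) \<longlonglongrightarrow> 0"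
        using ae
      proof eventually_elim
        case (elim x)
        have "(\<lambda>k. h (\<eta> (q k) x)) \<longlonglongrightarrow> h (u x)"
          using F(2) elim by (auto intro: continuous_on_tendsto_compose)
        hence "(\<lambda>k. \<bar>h (\<eta> (q k) x) - h (u x)\<bar> * \<bar>Du x i\<bar>) \<longlonglongrightarrow> \<bar>h (u x) - h (u x)\<bar> * \<bar>Du x i\<bar>"
          by (intro tendsto_intros)
        hence "(\<lambda>k. ennreal (\<bar>h (\<eta> (q k) x) - h (u x)\<bar> * \<bar>Du x i\<bar>)) \<longlonglongrightarrow> ennreal 0"
          by (intro tendsto_ennrealI) simp
        thus ?case by simp
      qed
    qed measurable
    have s: "(\<lambda>k. (\<integral>\<^sup>+x. ennreal \<bar>D\<eta> (q k) x i - Du x i\<bar> \<partial>Mx)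
        + (\<integral>\<^sup>+x. ennreal (\<bar>h (\<eta> (q k) x) - h (u x)\<bar> * \<bar>Du x i\<bar>) \<partial>Mx)) \<longlonglongrightarrow> 0 + 0"
      using LIMSEQ_subseq_LIMSEQ[OF e2[OF i] q] d by (intro tendsto_add) (auto simp: o_def)
    show ?thesis
    proof (rule tendsto_sandwich[OF _ _ tendsto_const])
      show "(\<lambda>k. (\<integral>\<^sup>+x. ennreal \<bar>D\<eta> (q k) x i - Du x i\<bar> \<partial>Mx)
        + (\<integral>\<^sup>+x. ennreal (\<bar>h (\<eta> (q k) x) - h (u x)\<bar> * \<bar>Du x i\<bar>) \<partial>Mx)) \<longlonglongrightarrow> 0" using s by simp
      show "\<forall>\<^sub>F k in sequentially. (\<integral>\<^sup>+x. ennreal \<bar>h (\<eta> (q k) x) * D\<eta> (q k) x i - h (u x) * Du x i\<bar> \<partial>Mx)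
        \<le> (\<integral>\<^sup>+x. ennreal \<bar>D\<eta> (q k) x i - Du x i\<bar> \<partial>Mx)
        + (\<integral>\<^sup>+x. ennreal (\<bar>h (\<eta> (q k) x) - h (u x)\<bar> * \<bar>Du x i\<bar>) \<partial>Mx)"
      proof (intro always_eventually allI)
        fix k
        have b: "\<bar>h a * b - h c * d\<bar> \<le> \<bar>b - d\<bar> + \<bar>h a - h c\<bar> * \<bar>d\<bar>" for a b c d
        proof -
          have "h a * b - h c * d = h a * (b - d) + (h a - h c) * d" by (simp add: algebra_simps)
          also have "\<bar>\<dots>\<bar> \<le> \<bar>h a\<bar> * \<bar>b - d\<bar> + \<bar>h a - h c\<bar> * \<bar>d\<bar>"
            by (metis abs_mult abs_triangle_ineq)
          also have "\<dots> \<le> 1 * \<bar>b - d\<bar> + \<bar>h a - h c\<bar> * \<bar>d\<bar>"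
            by (intro add_mono mult_right_mono F(4)) auto
          finally show ?thesis by simp
        qed
        have "(\<integral>\<^sup>+x. ennreal \<bar>h (\<eta> (q k) x) * D\<eta> (q k) x i - h (u x) * Du x i\<bar> \<partial>Mx)
          \<le> (\<integral>\<^sup>+x. ennreal \<bar>D\<eta> (q k) x i - Du x i\<bar> + ennreal (\<bar>h (\<eta> (q k) x) - h (u x)\<bar> * \<bar>Du x i\<bar>) \<partial>Mx)"
          by (intro nn_integral_mono) (simp add: b ennreal_leI flip: ennreal_plus)
        also have "\<dots> = (\<integral>\<^sup>+x. ennreal \<bar>D\<eta> (q k) x i - Du x i\<bar> \<partial>Mx)
          + (\<integral>\<^sup>+x. ennreal (\<bar>h (\<eta> (q k) x) - h (u x)\<bar> * \<bar>Du x i\<bar>) \<partial>Mx)"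
          by (intro nn_integral_add) measurable
        finally show "(\<integral>\<^sup>+x. ennreal \<bar>h (\<eta> (q k) x) * D\<eta> (q k) x i - h (u x) * Du x i\<bar> \<partial>Mx) \<le> \<dots>" .
      qed
    qed auto
  qed
  have "integrable Mx (\<lambda>x. F (u x))"
    by (rule Bochner_Integration.integrable_bound[OF ui]) (use lip[of _ 0] F(3) in \<open>auto\<close>)
  moreover have "integrable Mx (\<lambda>x. h (u x) * Du x i)" if "i < n" for i
  proof (rule Bochner_Integration.integrable_bound[OF Dui[OF that]])
    note [measurable] = borel_measurable_integrable[OF Dui[OF that]]
    show "(\<lambda>x. h (u x) * Du x i) \<in> borel_measurable Mx" by measurable
    show "AE x in Mx. norm (h (u x) * Du x i) \<le> norm (Du x i)"
      using F(4) by (auto simp: abs_mult intro!: mult_left_le_one_le)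
  qed
  moreover have "C1c n U (\<lambda>x. F (\<eta> (q k) x)) (\<lambda>x i. h (\<eta> (q k) x) * D\<eta> (q k) x i)" for k
    by (rule C1c_compose[OF e F(1-3)])
  ultimately show ?thesis
    unfolding W0_def seti nni using t1 t2
    by (intro conjI allI impI exI[of _ "\<lambda>k x. F (\<eta> (q k) x)"] exI[of _ "\<lambda>k x i. h (\<eta> (q k) x) * D\<eta> (q k) x i"]) auto
qed

section \<open>The Hoelder inequality\<close>

text \<open>Young's inequality for the functions divided by bounds of their norms. Stating it with
  upper bounds \<open>A\<close> and \<open>B\<close> instead of the norms spares a discussion of
  infinite values; a bound 0, by which one cannot divide, is a separate case.\<close>

lemma nn_integral_Holder:
  fixes f g :: "'a \<Rightarrow> real"
  assumes pq: "p > 1" "q > 1" "1 / p + 1 / q = 1"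
    and [measurable]: "f \<in> borel_measurable M" "g \<in> borel_measurable M"
    and fg: "\<And>x. x \<in> space M \<Longrightarrow> 0 \<le> f x" "\<And>x. x \<in> space M \<Longrightarrow> 0 \<le> g x"
    and A: "(\<integral>\<^sup>+x. ennreal (f x powr p) \<partial>M) \<le> ennreal A" "0 \<le> A"
    and B: "(\<integral>\<^sup>+x. ennreal (g x powr q) \<partial>M) \<le> ennreal B" "0 \<le> B"
  shows "(\<integral>\<^sup>+x. ennreal (f x * g x) \<partial>M) \<le> ennreal (A powr (1 / p) * B powr (1 / q))"
proof (cases "A = 0 \<or> B = 0")
  case True
  hence "(\<integral>\<^sup>+x. ennreal (f x powr p) \<partial>M) = 0 \<or> (\<integral>\<^sup>+x. ennreal (g x powr q) \<partial>M) = 0"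
    using A B by auto
  hence "AE x in M. f x * g x = 0"
    by (subst (asm) (1 2) nn_integral_0_iff_AE) (auto simp: ennreal_eq_0_iff elim!: eventually_mono)
  hence "(\<integral>\<^sup>+x. ennreal (f x * g x) \<partial>M) = 0"
    by (subst nn_integral_0_iff_AE) (auto elim!: eventually_mono)
  thus ?thesis by simp
next
  case False
  hence ab: "A > 0" "B > 0" using A B by auto
  define c where "c = A powr (1 / p) * B powr (1 / q)"
  have c: "c > 0" using ab by (simp add: c_def)
  have y: "f x * g x \<le> (c / (p * A)) * f x powr p + (c / (q * B)) * g x powr q" if "x \<in> space M" for x
  proof -
    have "(f x / A powr (1 / p)) * (g x / B powr (1 / q))
        \<le> (f x / A powr (1 / p)) powr p / p + (g x / B powr (1 / q)) powr q / q"
      using pq ab fg[OF that] by (intro Youngs_inequality) auto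
    also have "\<dots> = (1 / (p * A)) * f x powr p + (1 / (q * B)) * g x powr q"
      using pq ab fg[OF that] by (simp add: powr_divide powr_powr mult.commute)
    finally have "f x * g x / c \<le> (1 / (p * A)) * f x powr p + (1 / (q * B)) * g x powr q"
      by (simp add: c_def)
    hence "f x * g x \<le> c * ((1 / (p * A)) * f x powr p + (1 / (q * B)) * g x powr q)"
      using c by (simp add: pos_divide_le_eq mult.commute)
    thus ?thesis by (simp add: distrib_left)
  qed
  have "(\<integral>\<^sup>+x. ennreal (f x * g x) \<partial>M)
    \<le> (\<integral>\<^sup>+x. ennreal (c / (p * A)) * ennreal (f x powr p) + ennreal (c / (q * B)) * ennreal (g x powr q) \<partial>M)"
    using c pq ab
    by (intro nn_integral_mono) (simp add: ennreal_leI order_trans[OF y] flip: ennreal_mult ennreal_plus)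
  also have "\<dots> = ennreal (c / (p * A)) * (\<integral>\<^sup>+x. ennreal (f x powr p) \<partial>M)
      + ennreal (c / (q * B)) * (\<integral>\<^sup>+x. ennreal (g x powr q) \<partial>M)"
    by (simp add: nn_integral_add nn_integral_cmult)
  also have "\<dots> \<le> ennreal (c / (p * A)) * ennreal A + ennreal (c / (q * B)) * ennreal B"
    using A B by (intro add_mono mult_left_mono) auto
  also have "\<dots> = ennreal (c / (p * A) * A + c / (q * B) * B)"
    using c pq ab by (simp flip: ennreal_mult ennreal_plus)
  also have "c / (p * A) * A + c / (q * B) * B = c * (1 / p + 1 / q)"
    using ab by (simp add: distrib_left)
  also have "\<dots> = c" using pq by simp
  finally show ?thesis by (simp add: c_def)
qed

section \<open>Truncations\<close>

text \<open>\<open>rampD k l\<close> is the piecewise linear function of \<open>\<bar>u\<bar>\<close> that rises from 0 at \<open>k\<close> to 1 at \<open>l\<close>;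
  \<open>rampF\<close> and \<open>rampP\<close> are its first two antiderivatives.\<close>

definition rampD :: "real \<Rightarrow> real \<Rightarrow> real \<Rightarrow> real"
  where "rampD k l u = (max 0 (\<bar>u\<bar> - k) - max 0 (\<bar>u\<bar> - l)) / (l - k)"

definition rampF :: "real \<Rightarrow> real \<Rightarrow> real \<Rightarrow> real"
  where "rampF k l u = ((max 0 (u - k))\<^sup>2 - (max 0 (- u - k))\<^sup>2 - (max 0 (u - l))\<^sup>2 + (max 0 (- u - l))\<^sup>2) / (2 * (l - k))"

definition rampP :: "real \<Rightarrow> real \<Rightarrow> real \<Rightarrow> real"
  where "rampP k l u = ((max 0 (u - k)) ^ 3 + (max 0 (- u - k)) ^ 3 - (max 0 (u - l)) ^ 3 - (max 0 (- u - l)) ^ 3) / (6 * (l - k))"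

text \<open>The exponent is at least 2, so at the kink the difference quotient is bounded by a
  positive power of |h|. Elsewhere the function agrees locally with 0 or with a polynomial.\<close>

lemma DERIV_max_power:
  "((\<lambda>u. (max 0 (u - k)) ^ Suc (Suc n)) has_real_derivative real (Suc (Suc n)) * (max 0 (u - k)) ^ Suc n) (at u)"
proof -
  consider "u < k" | "u > k" | "u = k" by linarith
  thus ?thesis
  proof cases
    case 1
    show ?thesis
      by (rule has_field_derivative_transform_within_open[of "\<lambda>_. 0" _ _ "{..<k}"]) (use 1 in auto)
  next
    case 2
    have "((\<lambda>u. (u - k) ^ Suc (Suc n)) has_real_derivative real (Suc (Suc n)) * (u - k) ^ Suc n) (at u)"
      by (auto intro!: derivative_eq_intros simp del: power_Suc)
    moreover have "(u - k) ^ Suc n = max 0 (u - k) ^ Suc n" using 2 by simp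
    ultimately have "((\<lambda>u. (u - k) ^ Suc (Suc n)) has_real_derivative real (Suc (Suc n)) * max 0 (u - k) ^ Suc n) (at u)"
      by metis
    thus ?thesis
      by (rule has_field_derivative_transform_within_open[of _ _ _ "{k<..}"]) (use 2 in \<open>auto simp: max_def\<close>)
  next
    case 3
    have "(\<lambda>h. ((max 0 (u + h - k)) ^ Suc (Suc n) - (max 0 (u - k)) ^ Suc (Suc n)) / h) \<midarrow>0\<rightarrow> 0"
    proof (rule Lim_null_comparison)
      show "\<forall>\<^sub>F h in at 0. norm (((max 0 (u + h - k)) ^ Suc (Suc n) - (max 0 (u - k)) ^ Suc (Suc n)) / h) \<le> \<bar>h\<bar> ^ Suc n"
      proof (intro always_eventually allI)
        fix h show "norm (((max 0 (u + h - k)) ^ Suc (Suc n) - (max 0 (u - k)) ^ Suc (Suc n)) / h) \<le> \<bar>h\<bar> ^ Suc n"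
        proof (cases "h > 0")
          case True thus ?thesis using 3 by (simp add: max_def)
        next
          case False thus ?thesis using 3 by (simp add: max_def zero_le_power_abs del: power_Suc)
        qed
      qed
      have "(\<lambda>h::real. \<bar>h\<bar> ^ Suc n) \<midarrow>0\<rightarrow> \<bar>0\<bar> ^ Suc n" by (intro tendsto_intros)
      thus "(\<lambda>h::real. \<bar>h\<bar> ^ Suc n) \<midarrow>0\<rightarrow> 0" by simp
    qed
    thus ?thesis using 3 by (simp add: DERIV_def)
  qed
qed

lemma DERIV_max_power':
  "((\<lambda>u. (max 0 (- u - k)) ^ Suc (Suc n)) has_real_derivative - real (Suc (Suc n)) * (max 0 (- u - k)) ^ Suc n) (at u)"
  using DERIV_chain2[where f = "\<lambda>v. max 0 (v - k) ^ Suc (Suc n)" and g = uminus and x = u and s = UNIV and Db = "-1",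
      OF DERIV_max_power DERIV_minus[OF DERIV_ident]] by (simp del: power_Suc of_nat_Suc)

lemma rampF_has_derivative:
  assumes "0 \<le> k" "k < l"
  shows "(rampF k l has_real_derivative rampD k l u) (at u)"
proof -
  \<comment> \<open>For \<open>k\<close> \<ge> 0 at most one of the two one-sided parts is
    nonzero.\<close>
  have *: "max 0 (\<bar>u\<bar> - k) = max 0 (u - k) + max 0 (- u - k)" if "0 \<le> k" for k :: real
    using that by (auto simp: max_def)
  have "((\<lambda>u. ((max 0 (u - k))\<^sup>2 - (max 0 (- u - k))\<^sup>2 - (max 0 (u - l))\<^sup>2 + (max 0 (- u - l))\<^sup>2) / (2 * (l - k)))
     has_real_derivative (2 * max 0 (u - k) - (- 2 * max 0 (- u - k)) - 2 * max 0 (u - l) + (- 2 * max 0 (- u - l))) / (2 * (l - k))) (at u)"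
    using DERIV_max_power[of _ 0] DERIV_max_power'[of _ 0]
    by (intro DERIV_cdivide DERIV_add DERIV_diff) (auto simp: numeral_2_eq_2)
  moreover have "(2 * max 0 (u - k) - (- 2 * max 0 (- u - k)) - 2 * max 0 (u - l) + (- 2 * max 0 (- u - l))) / (2 * (l - k)) = rampD k l u"
    using assms by (simp add: rampD_def * field_simps)
  ultimately show ?thesis unfolding rampF_def[abs_def] by simp
qed

lemma rampP_has_derivative:
  assumes "0 \<le> k" "k < l"
  shows "(rampP k l has_real_derivative rampF k l u) (at u)"
proof -
  have "((\<lambda>u. ((max 0 (u - k)) ^ 3 + (max 0 (- u - k)) ^ 3 - (max 0 (u - l)) ^ 3 - (max 0 (- u - l)) ^ 3) / (6 * (l - k)))
     has_real_derivative (3 * (max 0 (u - k))\<^sup>2 + (- 3 * (max 0 (- u - k))\<^sup>2) - 3 * (max 0 (u - l))\<^sup>2 - (- 3 * (max 0 (- u - l))\<^sup>2)) / (6 * (l - k))) (at u)"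
    using DERIV_max_power[of _ 1] DERIV_max_power'[of _ 1]
    by (intro DERIV_cdivide DERIV_add DERIV_diff) (auto simp: numeral_2_eq_2 numeral_3_eq_3)
  moreover have "(3 * (max 0 (u - k))\<^sup>2 + (- 3 * (max 0 (- u - k))\<^sup>2) - 3 * (max 0 (u - l))\<^sup>2 - (- 3 * (max 0 (- u - l))\<^sup>2)) / (6 * (l - k)) = rampF k l u"
    using assms by (simp add: rampF_def field_simps)
  ultimately show ?thesis unfolding rampP_def[abs_def] by simp
qed

lemma rampD_continuous: "continuous_on UNIV (rampD k l)"
  unfolding rampD_def[abs_def] divide_inverse by (intro continuous_intros)

lemma rampD_bounds:
  assumes "0 \<le> k" "k < l"
  shows "0 \<le> rampD k l u" "rampD k l u \<le> 1" "\<bar>u\<bar> \<le> k \<Longrightarrow> rampD k l u = 0" "l \<le> \<bar>u\<bar> \<Longrightarrow> rampD k l u = 1"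
  using assms unfolding rampD_def by (auto simp: divide_simps max_def)

lemma rampF_minus: "rampF k l (- u) = - rampF k l u"
  unfolding rampF_def by (simp add: minus_divide_left)

lemma rampP_minus: "rampP k l (- u) = rampP k l u"
  unfolding rampP_def by (simp add: algebra_simps)

text \<open>By these bounds the C^1 test function lies between the truncations at the two levels:
  its energy is bounded by the excess above \<open>k\<close>, and it controls the excess above
  \<open>l\<close>. By parity nonnegative arguments suffice; on the three ranges cut out by
  \<open>k\<close> and \<open>l\<close> the functions are explicit polynomials.\<close>

lemma rampF_bounds:
  assumes kl: "0 \<le> k" "k < l"
  shows "\<bar>rampF k l u\<bar> \<le> max 0 (\<bar>u\<bar> - k)" "max 0 (\<bar>u\<bar> - l) \<le> \<bar>rampF k l u\<bar>"
    "rampP k l u \<le> (max 0 (\<bar>u\<bar> - k))\<^sup>2 / 2" "\<bar>u\<bar> \<le> k \<Longrightarrow> rampF k l u = 0" "\<bar>u\<bar> \<le> k \<Longrightarrow> rampP k l u = 0"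
proof -
  have *: "rampF k l v \<le> max 0 (v - k) \<and> max 0 (v - l) \<le> rampF k l v \<and> 0 \<le> rampF k l v
      \<and> rampP k l v \<le> (max 0 (v - k))\<^sup>2 / 2 \<and> (v \<le> k \<longrightarrow> rampF k l v = 0 \<and> rampP k l v = 0)" if v: "v \<ge> 0" for v
  proof -
    define d where "d = l - k" define A where "A = v - k"
    have d: "d > 0" "l = k + d" using kl by (auto simp: d_def)
    have m: "max 0 (- v - k) = 0" "max 0 (- v - l) = 0" using v kl by auto
    consider "A \<le> 0" | "0 < A" "A \<le> d" | "A > d" by linarith
    thus ?thesis
    proof cases
      case 1 thus ?thesis using d v kl by (simp add: rampF_def rampP_def m A_def)
    next
      case 2
      have F: "rampF k l v = A\<^sup>2 / (2 * d)" and P: "rampP k l v = A ^ 3 / (6 * d)"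
        using 2 by (simp_all add: rampF_def rampP_def m A_def d_def)
      have 1: "A\<^sup>2 \<le> A * d" using 2 by (simp add: power2_eq_square)
      have "A\<^sup>2 * A \<le> A\<^sup>2 * d" using 2 by (intro mult_left_mono) auto
      hence 3: "A ^ 3 \<le> A\<^sup>2 * d" by (simp add: power3_eq_cube power2_eq_square)
      have "0 \<le> A * d" using 2 by simp
      hence "A\<^sup>2 \<le> 2 * (A * d)" using 1 by linarith
      hence "A\<^sup>2 / (2 * d) \<le> A" using d by (simp add: pos_divide_le_eq mult.left_commute)
      have "0 \<le> A\<^sup>2 * d" using d by simp
      hence "A ^ 3 \<le> 3 * (A\<^sup>2 * d)" using 3 by linarith
      hence "A ^ 3 / (6 * d) \<le> A\<^sup>2 / 2" using d by (simp add: pos_divide_le_eq mult.left_commute)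
      with \<open>A\<^sup>2 / (2 * d) \<le> A\<close> show ?thesis unfolding F P using 2 d by (simp add: A_def)
    next
      case 3
      have F: "rampF k l v = (A\<^sup>2 - (A - d)\<^sup>2) / (2 * d)" and P: "rampP k l v = (A ^ 3 - (A - d) ^ 3) / (6 * d)"
        using 3 d(1) by (simp_all add: rampF_def rampP_def m A_def d_def)
      have F': "rampF k l v = A - d / 2" unfolding F using d(1) by (simp add: field_simps power2_eq_square)
      have P': "rampP k l v = A\<^sup>2 / 2 - d * (3 * A - d) / 6" unfolding P
        using d(1) by (simp add: field_simps power2_eq_square power3_eq_cube)
      have "0 \<le> d * (3 * A - d) / 6" using 3 d by simp
      thus ?thesis using 3 d unfolding F' P' by (simp add: A_def)
    qed
  qed
  have a: "rampF k l u = rampF k l \<bar>u\<bar> \<or> rampF k l u = - rampF k l \<bar>u\<bar>"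
    by (cases "u \<ge> 0") (auto simp: rampF_minus)
  have b: "rampP k l u = rampP k l \<bar>u\<bar>" by (cases "u \<ge> 0") (auto simp: rampP_minus)
  show "\<bar>rampF k l u\<bar> \<le> max 0 (\<bar>u\<bar> - k)" "max 0 (\<bar>u\<bar> - l) \<le> \<bar>rampF k l u\<bar>"
    "rampP k l u \<le> (max 0 (\<bar>u\<bar> - k))\<^sup>2 / 2" "\<bar>u\<bar> \<le> k \<Longrightarrow> rampF k l u = 0" "\<bar>u\<bar> \<le> k \<Longrightarrow> rampP k l u = 0"
    using *[of "\<bar>u\<bar>"] a b by auto
qed

section \<open>The conductivity\<close>

text \<open>The upper bounds are the origin of the denominator of \<open>W1\<close>: each of the N +
  1 \<le> 2 N summands is at most \<open>M\<close> times the dominating power, which is 1 for s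
  \<le> 1 and the top power for s \<ge> 1.\<close>

lemma gF_bounds:
  assumes P: "medium P" and x: "x \<in> Dom P" and s: "0 \<le> s"
  defines "N \<equiv> Deg P" and "M \<equiv> Max ((\<lambda>j. Coef P j x) ` {..Deg P})" and "\<alpha> \<equiv> Expo P (Deg P)"
  shows "Coef P 0 x \<le> gF P x s" "Coef P N x * s powr \<alpha> \<le> gF P x s"
    "s \<le> 1 \<Longrightarrow> gF P x s \<le> 2 * real N * M" "1 \<le> s \<Longrightarrow> gF P x s \<le> 2 * real N * M * s powr \<alpha>"
    "0 < Coef P 0 x" "0 < Coef P N x" "Coef P N x \<le> M" "0 < \<alpha>" "1 \<le> N"
proof -
  have U: "openin (Rn (Dim P)) (Dom P)" using P by (simp add: medium_def bounded_domain_def)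
  have "Dom P \<subseteq> Rn (Dim P) closure_of Dom P"
    by (rule closure_of_subset[OF openin_subset[OF U]])
  hence c: "0 < Coef P 0 x" "0 < Coef P N x" "\<And>j. j \<le> N \<Longrightarrow> 0 \<le> Coef P j x"
    using P x unfolding medium_def N_def by auto
  show N: "1 \<le> N" using P by (simp add: medium_def N_def)
  have mono: "strict_mono_on {..N} (Expo P)" and e0: "Expo P 0 = 0" using P by (auto simp: medium_def N_def)
  have e: "0 < Expo P j" "Expo P j \<le> \<alpha>" if "1 \<le> j" "j \<le> N" for j
  proof -
    show "0 < Expo P j" using strict_mono_onD[OF mono, of 0 j] that e0 by auto
    show "Expo P j \<le> \<alpha>" using strict_mono_onD[OF mono, of j N] that by (cases "j = N") (auto simp: \<alpha>_def N_def)
  qed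
  show "0 < \<alpha>" using e(1)[of N] N by (simp add: \<alpha>_def N_def)
  have M: "Coef P j x \<le> M" if "j \<le> N" for j unfolding M_def using that by (intro Max_ge) (auto simp: N_def)
  show "0 < Coef P 0 x" "0 < Coef P N x" "Coef P N x \<le> M" using c M by auto
  have t: "0 \<le> Coef P j x * s powr Expo P j" if "j \<in> {1..N}" for j using c(3) that by simp
  show "Coef P 0 x \<le> gF P x s" unfolding gF_def using t by (auto simp: N_def intro!: sum_nonneg)
  have "(\<lambda>j. Coef P j x * s powr Expo P j) N \<le> (\<Sum>j=1..N. Coef P j x * s powr Expo P j)"
    by (rule member_le_sum) (use N t in auto)
  hence "Coef P N x * s powr \<alpha> \<le> (\<Sum>j=1..N. Coef P j x * s powr Expo P j)"
    by (simp add: \<alpha>_def N_def)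
  thus "Coef P N x * s powr \<alpha> \<le> gF P x s" unfolding gF_def using c(1) by (simp add: N_def)
  have N2: "real N + 1 \<le> 2 * real N" using N by simp
  have M0: "0 \<le> M" using c(1) M[of 0] by simp
  show "gF P x s \<le> 2 * real N * M" if s1: "s \<le> 1"
  proof -
    have "gF P x s \<le> M + (\<Sum>j=1..N. M)"
      unfolding gF_def N_def[symmetric]
    proof (intro add_mono sum_mono M)
      fix j assume j: "j \<in> {1..N}"
      have "Coef P j x * s powr Expo P j \<le> Coef P j x * 1"
        using c(3)[of j] j s s1 e(1)[of j] by (intro mult_left_mono powr_le1) auto
      thus "Coef P j x * s powr Expo P j \<le> M" using M[of j] j by simp
    qed simp
    also have "\<dots> = (real N + 1) * M" by (simp add: algebra_simps)
    also have "\<dots> \<le> 2 * real N * M" by (rule mult_right_mono[OF N2 M0])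
    finally show ?thesis .
  qed
  show "gF P x s \<le> 2 * real N * M * s powr \<alpha>" if s1: "1 \<le> s"
  proof -
    have p1: "1 \<le> s powr \<alpha>" using s1 \<open>0 < \<alpha>\<close> by (simp add: ge_one_powr_ge_zero)
    have "gF P x s \<le> M * s powr \<alpha> + (\<Sum>j=1..N. M * s powr \<alpha>)"
      unfolding gF_def N_def[symmetric]
    proof (intro add_mono sum_mono)
      have "Coef P 0 x \<le> M * 1" using M[of 0] by simp
      also have "\<dots> \<le> M * s powr \<alpha>" using M0 p1 by (intro mult_left_mono) auto
      finally show "Coef P 0 x \<le> M * s powr \<alpha>" .
      fix j assume j: "j \<in> {1..N}"
      show "Coef P j x * s powr Expo P j \<le> M * s powr \<alpha>"
        using c(3)[of j] j s1 e(2)[of j] M[of j] by (intro mult_mono powr_mono) auto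
    qed
    also have "\<dots> = (real N + 1) * (M * s powr \<alpha>)" by (simp add: algebra_simps)
    also have "\<dots> \<le> 2 * real N * (M * s powr \<alpha>)" using M0 by (intro mult_right_mono[OF N2]) auto
    finally show ?thesis by (simp add: mult.assoc)
  qed
qed

text \<open>The function s g(x, s) is continuous and strictly increasing, so the description
  operator picks a genuine root. At \<xi> / a_0 it is at least \<xi>, because g is at least
  a_0.\<close>

lemma sF_solves:
  assumes P: "medium P" and x: "x \<in> Dom P" and \<xi>: "0 \<le> \<xi>"
  shows "0 \<le> sF P x \<xi> \<and> sF P x \<xi> * gF P x (sF P x \<xi>) = \<xi>"
  unfolding sF_def
proof (rule theI')
  note b = gF_bounds[OF P x]
  have U: "openin (Rn (Dim P)) (Dom P)" using P by (simp add: medium_def bounded_domain_def)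
  have "Dom P \<subseteq> Rn (Dim P) closure_of Dom P"
    by (rule closure_of_subset[OF openin_subset[OF U]])
  hence c: "\<And>j. j \<le> Deg P \<Longrightarrow> 0 \<le> Coef P j x" using P x unfolding medium_def by auto
  have e: "0 < Expo P j" if "1 \<le> j" "j \<le> Deg P" for j
    using P strict_mono_onD[of "{..Deg P}" "Expo P" 0 j] that by (auto simp: medium_def)
  have gm: "gF P x s \<le> gF P x t" if "0 \<le> s" "s \<le> t" for s t
    unfolding gF_def using that c e by (intro add_left_mono sum_mono mult_left_mono powr_mono2) (auto intro: less_imp_le)
  have g0: "0 < gF P x s" if "0 \<le> s" for s using b(1)[OF that] b(5)[OF that] by linarith
  have strict: "s * gF P x s < t * gF P x t" if "0 \<le> s" "s < t" for s t
  proof -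
    have "s * gF P x s \<le> s * gF P x t" using that gm[of s t] by (intro mult_left_mono) auto
    also have "\<dots> < t * gF P x t" using that g0[of t] by (intro mult_strict_right_mono) auto
    finally show ?thesis .
  qed
  have cont: "continuous_on {0..} (\<lambda>s. s * gF P x s)"
    unfolding gF_def using e by (intro continuous_intros continuous_on_powr') auto
  define T where "T = \<xi> / Coef P 0 x"
  have T: "0 \<le> T" using \<xi> b(5)[of 0] by (simp add: T_def)
  have "\<xi> = T * Coef P 0 x" using b(5)[of 0] by (simp add: T_def)
  also have "\<dots> \<le> T * gF P x T" using T b(1)[OF T] by (intro mult_left_mono) auto
  finally have "\<exists>s\<ge>0. s \<le> T \<and> s * gF P x s = \<xi>"
    using \<xi> T by (intro IVT' continuous_on_subset[OF cont]) auto
  then obtain s where s: "0 \<le> s" "s * gF P x s = \<xi>" by blast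
  show "\<exists>!s. 0 \<le> s \<and> s * gF P x s = \<xi>"
  proof (rule ex1I[of _ s])
    fix t assume t: "0 \<le> t \<and> t * gF P x t = \<xi>"
    show "t = s" using strict[of s t] strict[of t s] s t by (cases t s rule: linorder_cases) auto
  qed (use s in auto)
qed

text \<open>For the third claim put L = 2 N M. The left-hand side is (a_N / \<xi>)^a \<xi>^2 / L, so
  it suffices to bound (a_N / \<xi>)^a by L / g = L K. If s \<ge> 1, then a_N s^(\<alpha> + 1) \<le>
  s g = \<xi>, and since a (\<alpha> + 1) = \<alpha>, the quantity is at most s^(-\<alpha>), hence
  at most L / g. If s < 1, then g \<le> L, and a_N \<le> \<xi> is enough; otherwise the additive
  term a_N / 2 takes over.\<close>

lemma KF_bounds:
  assumes P: "medium P" and x: "x \<in> Dom P" and \<xi>: "0 \<le> \<xi>"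
  shows "0 < KF P x \<xi>" "KF P x \<xi> \<le> 1 / Coef P 0 x"
    "W1 P x * \<xi> powr (2 - aF P) \<le> KF P x \<xi> * \<xi>\<^sup>2 + Coef P (Deg P) x / 2"
    "0 < W1 P x" "0 < aF P" "aF P < 1"
proof -
  define s where "s = sF P x \<xi>"
  define g where "g = gF P x s"
  define A where "A = Coef P (Deg P) x"
  define M where "M = Max ((\<lambda>j. Coef P j x) ` {..Deg P})"
  define \<alpha> where "\<alpha> = Expo P (Deg P)"
  define L where "L = 2 * real (Deg P) * M"
  define a where "a = aF P"
  have s: "0 \<le> s" "s * g = \<xi>" using sF_solves[OF P x \<xi>] by (auto simp: s_def g_def)
  note b = gF_bounds[OF P x s(1), folded g_def A_def M_def \<alpha>_def L_def]
  have g0: "0 < g" using b(1,5) by linarith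
  have K: "KF P x \<xi> = 1 / g" by (simp add: KF_def g_def s_def)
  show "0 < KF P x \<xi>" using g0 by (simp add: K)
  show "KF P x \<xi> \<le> 1 / Coef P 0 x" unfolding K using b(1,5) by (intro divide_left_mono) auto
  have aa: "a = \<alpha> / (\<alpha> + 1)" by (simp add: a_def aF_def \<alpha>_def)
  have a: "0 < a" "a < 1" using b(8) by (auto simp: aa)
  show "0 < aF P" "aF P < 1" using a by (auto simp: a_def)
  have M0: "0 < M" using b(6,7) by linarith
  have L2: "2 * M \<le> L" using M0 b(9) by (auto simp: L_def)
  hence L: "0 < L" using M0 by linarith
  have W: "W1 P x = A powr a / L" by (simp add: W1_def A_def a_def L_def M_def)
  show "0 < W1 P x" unfolding W using b(6) L by simp
  have "W1 P x * \<xi> powr (2 - a) \<le> KF P x \<xi> * \<xi>\<^sup>2 + A / 2"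
  proof (cases "\<xi> = 0")
    case True thus ?thesis using b(6) by simp
  next
    case False
    hence xp: "0 < \<xi>" using \<xi> by simp
    have e: "A powr a * \<xi> powr (2 - a) = (A / \<xi>) powr a * \<xi>\<^sup>2"
      using xp b(6) by (simp add: powr_diff powr_divide powr_numeral)
    consider "1 \<le> s" | "s < 1" "A \<le> \<xi>" | "\<xi> < A" "s < 1" by linarith
    thus ?thesis
    proof cases
      case 1
      have sp: "0 < s" using 1 by simp
      have "A * s powr (\<alpha> + 1) \<le> \<xi>"
      proof -
        have "A * s powr (\<alpha> + 1) = s * (A * s powr \<alpha>)" using sp by (simp add: powr_add)
        also have "\<dots> \<le> s * g" using b(2) sp by (intro mult_left_mono) auto
        finally show ?thesis using s by simp
      qed
      hence "A / \<xi> \<le> 1 / s powr (\<alpha> + 1)" using xp sp by (simp add: field_simps)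
      hence "A / \<xi> \<le> s powr (- (\<alpha> + 1))" by (simp only: powr_minus inverse_eq_divide)
      hence "(A / \<xi>) powr a \<le> (s powr (- (\<alpha> + 1))) powr a"
        using a b(6) xp by (intro powr_mono2) auto
      also have "\<dots> = s powr (- \<alpha>)"
      proof -
        have "(\<alpha> + 1) * a = \<alpha>" using b(8) by (simp add: aa)
        hence "- (\<alpha> + 1) * a = - \<alpha>" by (simp only: mult_minus_left)
        thus ?thesis by (simp only: powr_powr)
      qed
      finally have "(A / \<xi>) powr a \<le> s powr (- \<alpha>)" .
      also have "s powr (- \<alpha>) \<le> L / g"
        using b(4)[OF 1] g0 sp by (simp add: powr_minus field_simps)
      finally have "(A / \<xi>) powr a * \<xi>\<^sup>2 / L \<le> (L / g) * \<xi>\<^sup>2 / L"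
        using L by (intro divide_right_mono mult_right_mono) auto
      also have "\<dots> = KF P x \<xi> * \<xi>\<^sup>2" using L by (simp add: K)
      finally show ?thesis using e b(6) by (simp add: W)
    next
      case 2
      have "(A / \<xi>) powr a \<le> 1" using 2 a xp b(6) by (intro powr_le1) auto
      also have "1 \<le> L / g" using b(3) 2 g0 by simp
      finally have "(A / \<xi>) powr a * \<xi>\<^sup>2 / L \<le> (L / g) * \<xi>\<^sup>2 / L"
        using L by (intro divide_right_mono mult_right_mono) auto
      also have "\<dots> = KF P x \<xi> * \<xi>\<^sup>2" using L by (simp add: K)
      finally show ?thesis using e b(6) by (simp add: W)
    next
      \<comment> \<open>Now the left-hand side is at most a_N^2 / L, and L \<ge> 2 M \<ge> 2
        a_N.\<close>
      case 3
      have "A powr a * \<xi> powr (2 - a) \<le> A powr a * A powr (2 - a)"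
        using 3 a xp by (intro mult_left_mono powr_mono2) auto
      also have "\<dots> = A * A" using b(6) by (simp flip: powr_add add: power2_eq_square)
      also have "\<dots> \<le> A * M" using b(6,7) by (intro mult_left_mono) auto
      also have "\<dots> \<le> A * (L / 2)" using b(6) L2 by (intro mult_left_mono) auto
      finally have "W1 P x * \<xi> powr (2 - a) \<le> A / 2" using L by (simp add: W field_simps)
      moreover have "0 \<le> KF P x \<xi> * \<xi>\<^sup>2" using g0 by (simp add: K)
      ultimately show ?thesis by linarith
    qed
  qed
  thus "W1 P x * \<xi> powr (2 - aF P) \<le> KF P x \<xi> * \<xi>\<^sup>2 + Coef P (Deg P) x / 2"
    by (simp add: a_def A_def)
qed

text \<open>Fubini's theorem is applied on the product of the domain with the time axis, whereas
  measurability of the data is given on a restriction of the full product; this identifies the two.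
  The sigma-algebras agree because the identity is measurable in both directions.\<close>

lemma pair_measure_restrict_space:
  assumes A: "sigma_finite_measure A" and B: "sigma_finite_measure B" and U: "U \<in> sets A"
  shows "restrict_space A U \<Otimes>\<^sub>M B = restrict_space (A \<Otimes>\<^sub>M B) (U \<times> space B)"
proof (rule measure_eqI)
  interpret B: sigma_finite_measure B by fact
  have sub: "U \<subseteq> space A" using U by (rule sets.sets_into_space)
  have UB: "U \<times> space B \<in> sets (A \<Otimes>\<^sub>M B)" using U by simp
  have sp: "space (restrict_space A U \<Otimes>\<^sub>M B) = U \<times> space B" "space (restrict_space (A \<Otimes>\<^sub>M B) (U \<times> space B)) = U \<times> space B"
    using sub by (auto simp: space_pair_measure space_restrict_space)
  have 1: "(\<lambda>z. z) \<in> restrict_space (A \<Otimes>\<^sub>M B) (U \<times> space B) \<rightarrow>\<^sub>M restrict_space A U \<Otimes>\<^sub>M B"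
  proof (subst measurable_pair_iff, intro conjI)
    have "fst \<in> restrict_space (A \<Otimes>\<^sub>M B) (U \<times> space B) \<rightarrow>\<^sub>M restrict_space A U"
      by (rule measurable_restrict_space2) (auto simp: space_restrict_space intro: measurable_restrict_space1)
    thus "fst \<circ> (\<lambda>z. z) \<in> restrict_space (A \<Otimes>\<^sub>M B) (U \<times> space B) \<rightarrow>\<^sub>M restrict_space A U" by (simp add: o_def)
    have "snd \<in> restrict_space (A \<Otimes>\<^sub>M B) (U \<times> space B) \<rightarrow>\<^sub>M B" by (rule measurable_restrict_space1) simp
    thus "snd \<circ> (\<lambda>z. z) \<in> restrict_space (A \<Otimes>\<^sub>M B) (U \<times> space B) \<rightarrow>\<^sub>M B" by (simp add: o_def)
  qed
  have 2: "(\<lambda>z. z) \<in> restrict_space A U \<Otimes>\<^sub>M B \<rightarrow>\<^sub>M A \<Otimes>\<^sub>M B"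
  proof (subst measurable_pair_iff, intro conjI)
    have "(\<lambda>x. x) \<in> restrict_space A U \<rightarrow>\<^sub>M A" by (rule measurable_restrict_space1) simp
    hence "(\<lambda>z. fst z) \<in> restrict_space A U \<Otimes>\<^sub>M B \<rightarrow>\<^sub>M A" using measurable_compose[OF measurable_fst] by blast
    thus "fst \<circ> (\<lambda>z. z) \<in> restrict_space A U \<Otimes>\<^sub>M B \<rightarrow>\<^sub>M A" by (simp add: o_def)
    show "snd \<circ> (\<lambda>z. z) \<in> restrict_space A U \<Otimes>\<^sub>M B \<rightarrow>\<^sub>M B" by (simp add: o_def)
  qed
  show sets: "sets (restrict_space A U \<Otimes>\<^sub>M B) = sets (restrict_space (A \<Otimes>\<^sub>M B) (U \<times> space B))"
  proof (intro equalityI subsetI)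
    fix X assume X: "X \<in> sets (restrict_space A U \<Otimes>\<^sub>M B)"
    have "(\<lambda>z. z) -` X \<inter> space (restrict_space (A \<Otimes>\<^sub>M B) (U \<times> space B)) \<in> sets (restrict_space (A \<Otimes>\<^sub>M B) (U \<times> space B))"
      by (rule measurable_sets[OF 1 X])
    thus "X \<in> sets (restrict_space (A \<Otimes>\<^sub>M B) (U \<times> space B))"
      using sets.sets_into_space[OF X] sp by (simp add: Int_absorb2)
  next
    fix X assume "X \<in> sets (restrict_space (A \<Otimes>\<^sub>M B) (U \<times> space B))"
    then obtain Y where Y: "Y \<in> sets (A \<Otimes>\<^sub>M B)" "X = (U \<times> space B) \<inter> Y" by (auto simp: sets_restrict_space)
    have "(\<lambda>z. z) -` Y \<inter> space (restrict_space A U \<Otimes>\<^sub>M B) \<in> sets (restrict_space A U \<Otimes>\<^sub>M B)"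
      by (rule measurable_sets[OF 2 Y(1)])
    thus "X \<in> sets (restrict_space A U \<Otimes>\<^sub>M B)" using sp Y(2) by (simp add: Int_commute)
  qed
  fix X assume X: "X \<in> sets (restrict_space A U \<Otimes>\<^sub>M B)"
  hence XU: "X \<subseteq> U \<times> space B" using sets.sets_into_space[OF X] sp by simp
  have X': "X \<in> sets (A \<Otimes>\<^sub>M B)" using X UB unfolding sets by (auto simp: sets_restrict_space)
  have "emeasure (restrict_space A U \<Otimes>\<^sub>M B) X = (\<integral>\<^sup>+x. emeasure B (Pair x -` X) \<partial>restrict_space A U)"
    by (rule B.emeasure_pair_measure_alt[OF X])
  also have "\<dots> = (\<integral>\<^sup>+x. emeasure B (Pair x -` X) * indicator U x \<partial>A)"
    using U by (subst nn_integral_restrict_space) auto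
  also have "\<dots> = (\<integral>\<^sup>+x. emeasure B (Pair x -` X) \<partial>A)"
  proof (rule nn_integral_cong)
    fix x show "emeasure B (Pair x -` X) * indicator U x = emeasure B (Pair x -` X)"
    proof (cases "x \<in> U")
      case False
      hence "Pair x -` X = {}" using XU by auto
      thus ?thesis by simp
    qed simp
  qed
  also have "\<dots> = emeasure (A \<Otimes>\<^sub>M B) X" by (rule B.emeasure_pair_measure_alt[OF X', symmetric])
  also have "\<dots> = emeasure (restrict_space (A \<Otimes>\<^sub>M B) (U \<times> space B)) X"
    using XU UB by (intro emeasure_restrict_space[symmetric]) auto
  finally show "emeasure (restrict_space A U \<Otimes>\<^sub>M B) X = emeasure (restrict_space (A \<Otimes>\<^sub>M B) (U \<times> space B)) X" .
qed

lemma sigma_finite_leb: "sigma_finite_measure (leb n)"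
proof -
  interpret finite_product_sigma_finite "\<lambda>_::nat. lborel :: real measure" "{..<n}"
    by standard auto
  show ?thesis unfolding leb_def by unfold_locales
qed

section \<open>Extended powers and Euclidean norms\<close>

lemma epowr_epowr: "0 < y \<Longrightarrow> (x epowr y) epowr z = x epowr (y * z)"
  by (auto simp: epowr_def powr_powr)

lemma epowr_one [simp]: "x epowr 1 = x"
  by (cases x) (auto simp: epowr_def)

lemma epowr_ennreal: "0 \<le> x \<Longrightarrow> ennreal x epowr y = ennreal (x powr y)"
  by (simp add: epowr_def)

lemma epowr_mono:
  assumes "x \<le> x'" "0 \<le> y" shows "x epowr y \<le> x' epowr y"
proof (cases "x' = \<infinity>")
  case True thus ?thesis by (simp add: epowr_def)
next
  case False
  then obtain b where b: "x' = ennreal b" "0 \<le> b" by (cases x') auto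
  then obtain c where c: "x = ennreal c" "0 \<le> c" using assms by (cases x) (auto simp: top_unique)
  hence "c \<le> b" using assms b by simp
  thus ?thesis using b c assms by (simp add: epowr_ennreal ennreal_leI powr_mono2)
qed

lemma epowr_le_ennrealD:
  assumes "x epowr y \<le> ennreal b" "0 < y" "0 \<le> b"
  shows "x \<le> ennreal (b powr (1 / y))"
proof -
  have "(x epowr y) epowr (1 / y) \<le> ennreal b epowr (1 / y)" using assms by (intro epowr_mono) auto
  thus ?thesis using assms by (simp add: epowr_epowr epowr_ennreal)
qed

lemma vnorm_nonneg: "0 \<le> vnorm n v" by (simp add: vnorm_def)

lemma vnorm_scale: "vnorm n (\<lambda>i. c * v i) = \<bar>c\<bar> * vnorm n v"
  by (simp add: vnorm_def L2_set_right_distrib) (simp add: L2_set_def power_mult_distrib)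

lemma vnorm_diff_le: "vnorm n (\<lambda>i. v i - w i) \<le> vnorm n v + vnorm n w"
  using L2_set_triangle_ineq[of v "\<lambda>i. - w i" "{..<n}"] by (simp add: vnorm_def L2_set_def)

lemma vinner_le: "\<bar>vinner n v w\<bar> \<le> vnorm n v * vnorm n w"
proof -
  have "\<bar>vinner n v w\<bar> \<le> (\<Sum>i<n. \<bar>v i\<bar> * \<bar>w i\<bar>)"
    unfolding vinner_def by (rule order_trans[OF sum_abs]) (simp add: abs_mult)
  thus ?thesis using L2_set_mult_ineq[of v w "{..<n}"] by (simp add: vnorm_def)
qed

lemma vinner_self_diff: "vinner n v (\<lambda>i. v i - w i) = (vnorm n v)\<^sup>2 - vinner n v w"
  by (simp add: vinner_def vnorm_def L2_set_def sum_nonneg right_diff_distrib sum_subtractf power2_eq_square)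

lemma vnorm_measurable:
  assumes "\<And>i. i < n \<Longrightarrow> (\<lambda>x. q x i) \<in> borel_measurable N"
  shows "(\<lambda>x. vnorm n (q x)) \<in> borel_measurable N"
proof -
  have [measurable]: "(\<lambda>x. \<Sum>i<n. (q x i)\<^sup>2) \<in> borel_measurable N"
    using assms by (intro borel_measurable_sum borel_measurable_power) auto
  show ?thesis unfolding vnorm_def L2_set_def by measurable
qed

lemma abs_powr_2: "\<bar>y\<bar> powr 2 = y\<^sup>2" for y :: real
  by (cases "y = 0") auto

lemma powr_sum_le:
  fixes x y p :: real
  assumes "0 \<le> x" "0 \<le> y" "0 \<le> p"
  shows "(x + y) powr p \<le> 2 powr p * (x powr p + y powr p)"
proof -
  have "(x + y) powr p \<le> (2 * max x y) powr p" using assms by (intro powr_mono2) auto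
  also have "\<dots> = 2 powr p * (max x y) powr p" using assms by (simp add: powr_mult)
  also have "\<dots> \<le> 2 powr p * (x powr p + y powr p)" by (intro mult_left_mono) (auto simp: max_def)
  finally show ?thesis .
qed

text \<open>The restriction to p \<le> 2 gives a constant that does not depend on p; it leads to the
  fixed factor 1/8 in the energy inequality.\<close>

lemma powr_sum_le4:
  fixes x y p :: real
  assumes "0 \<le> x" "0 \<le> y" "0 \<le> p" "p \<le> 2"
  shows "(x + y) powr p \<le> 4 * (x powr p + y powr p)"
proof -
  have "2 powr p * (x powr p + y powr p) \<le> 2 powr 2 * (x powr p + y powr p)"
    using assms by (intro mult_right_mono powr_mono) auto
  thus ?thesis using powr_sum_le[OF assms(1-3)] by simp
qed

text \<open>Here \<open>p\<close> and \<open>q\<close> stand for the gradients of the pressure and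
  of the extension. By Cauchy-Schwarz, Young and K \<le> 1 / a_0, K |p| |q| is at most K |p|^2 / 2 +
  |q|^2 / (2 a_0), so half of K |p|^2 survives. The degenerate lower bound on it, together with |p -
  q|^(2-a) \<le> 4 (|p|^(2-a) + |q|^(2-a)), yields the factor 1/8. The other two claims supply the
  integrability that testing the equation requires.\<close>

lemma dissipation_lower_bound:
  fixes n :: nat and p q :: point
  assumes P: "medium P" and x: "x \<in> Dom P"
  defines "K \<equiv> KF P x (vnorm n p)" and "a0 \<equiv> Coef P 0 x"
  shows "K * vinner n p (\<lambda>i. p i - q i) \<ge> W1 P x * vnorm n (\<lambda>i. p i - q i) powr (2 - aF P) / 8
      - (Coef P (Deg P) x + W1 P x * vnorm n q powr (2 - aF P) + (vnorm n q)\<^sup>2 / a0)"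
    and "\<bar>K * vinner n p (\<lambda>i. p i - q i)\<bar> \<le> 2 * (K * (vnorm n p)\<^sup>2) + (vnorm n q)\<^sup>2 / a0"
    and "K * vnorm n p * vnorm n (\<lambda>i. p i - q i) \<le> 2 * (K * (vnorm n p)\<^sup>2) + (vnorm n q)\<^sup>2 / a0"
proof -
  note b = KF_bounds[OF P x vnorm_nonneg[of n p], folded K_def a0_def]
  define \<xi> where "\<xi> = vnorm n p" define \<eta> where "\<eta> = vnorm n q" define d where "d = vnorm n (\<lambda>i. p i - q i)"
  define aN where "aN = Coef P (Deg P) x"
  define \<theta> where "\<theta> = 2 - aF P"
  note b = b[folded \<xi>_def aN_def \<theta>_def]
  have nn: "0 \<le> \<xi>" "0 \<le> \<eta>" "0 \<le> d" by (auto simp: \<xi>_def \<eta>_def d_def vnorm_nonneg)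
  have \<theta>: "0 \<le> \<theta>" "\<theta> \<le> 2" using b(5,6) by (auto simp: \<theta>_def)
  have c0: "0 < a0" "0 < aN" using gF_bounds(5,6)[OF P x order_refl] by (auto simp: a0_def aN_def)
  define e where "e = \<eta>\<^sup>2 / a0"
  have K\<eta>: "K * \<eta>\<^sup>2 \<le> e" using mult_right_mono[OF b(2), of "\<eta>\<^sup>2"] by (simp add: e_def)
  have K\<eta>0: "0 \<le> e" using c0 by (simp add: e_def)
  have sq: "2 * (\<xi> * \<eta>) \<le> \<xi>\<^sup>2 + \<eta>\<^sup>2" using zero_le_power2[of "\<xi> - \<eta>"] by (simp add: power2_diff)
  have cross: "K * (\<xi> * \<eta>) \<le> K * \<xi>\<^sup>2 / 2 + e / 2"
  proof -
    have "K * (2 * (\<xi> * \<eta>)) \<le> K * (\<xi>\<^sup>2 + \<eta>\<^sup>2)" using sq b(1) by (intro mult_left_mono) auto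
    thus ?thesis using K\<eta> by (simp add: distrib_left)
  qed
  have K\<xi>: "0 \<le> K * \<xi>\<^sup>2" using b(1) by simp
  have vi: "K * \<bar>vinner n p q\<bar> \<le> K * (\<xi> * \<eta>)"
    using vinner_le[of n p q] b(1) by (intro mult_left_mono) (auto simp: \<xi>_def \<eta>_def)
  have eq: "K * vinner n p (\<lambda>i. p i - q i) = K * \<xi>\<^sup>2 - K * vinner n p q"
    by (simp add: vinner_self_diff \<xi>_def right_diff_distrib)
  have vi': "\<bar>K * vinner n p q\<bar> \<le> K * (\<xi> * \<eta>)" using vi b(1) by (simp add: abs_mult)
  show "\<bar>K * vinner n p (\<lambda>i. p i - q i)\<bar> \<le> 2 * (K * (vnorm n p)\<^sup>2) + (vnorm n q)\<^sup>2 / a0"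
    unfolding eq \<xi>_def[symmetric] \<eta>_def[symmetric] e_def[symmetric] using vi' cross K\<xi> K\<eta>0 by linarith
  have d: "d \<le> \<xi> + \<eta>" unfolding d_def \<xi>_def \<eta>_def by (rule vnorm_diff_le)
  have "K * \<xi> * d \<le> K * \<xi> * (\<xi> + \<eta>)" using d b(1) nn by (intro mult_left_mono) auto
  also have "\<dots> = K * \<xi>\<^sup>2 + K * (\<xi> * \<eta>)" by (simp add: power2_eq_square algebra_simps)
  finally show "K * vnorm n p * vnorm n (\<lambda>i. p i - q i) \<le> 2 * (K * (vnorm n p)\<^sup>2) + (vnorm n q)\<^sup>2 / a0"
    unfolding \<xi>_def[symmetric] \<eta>_def[symmetric] d_def[symmetric] e_def[symmetric] using cross K\<xi> K\<eta>0 by linarith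
  have "d powr \<theta> \<le> (\<xi> + \<eta>) powr \<theta>" using d nn \<theta> by (intro powr_mono2) auto
  also have "\<dots> \<le> 4 * (\<xi> powr \<theta> + \<eta> powr \<theta>)" by (rule powr_sum_le4[OF nn(1,2) \<theta>])
  finally have "W1 P x * d powr \<theta> \<le> W1 P x * (4 * (\<xi> powr \<theta> + \<eta> powr \<theta>))" using b(4) by (intro mult_left_mono) auto
  hence 1: "W1 P x * d powr \<theta> \<le> 4 * (W1 P x * \<xi> powr \<theta>) + 4 * (W1 P x * \<eta> powr \<theta>)" by (simp add: algebra_simps)
  have 2: "0 \<le> W1 P x * \<eta> powr \<theta>" using b(4) by simp
  have "K * vinner n p (\<lambda>i. p i - q i) \<ge> W1 P x * d powr \<theta> / 8 - (aN + W1 P x * \<eta> powr \<theta> + e)"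
    using eq vi' cross b(3) 1 2 K\<eta>0 c0 by linarith
  thus "K * vinner n p (\<lambda>i. p i - q i) \<ge> W1 P x * vnorm n (\<lambda>i. p i - q i) powr (2 - aF P) / 8
      - (Coef P (Deg P) x + W1 P x * vnorm n q powr (2 - aF P) + (vnorm n q)\<^sup>2 / a0)"
    by (simp add: d_def \<eta>_def aN_def \<theta>_def e_def)
qed

section \<open>Exponents and constants\<close>

text \<open>The exponents of the theorem are weaker than those produced by the iteration.\<close>

lemma exponent_relations:
  fixes a r r1 :: real
  assumes a: "0 < a" "a < 1" and r: "2 < r" and r1: "1 < r1" "r1 < r0 a r / 2"
  defines "R \<equiv> r0 a r"
  defines "P \<equiv> (R + a) / R" and "Q \<equiv> 1 - 2 / R"
  defines "W \<equiv> P / r1 + Q"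
  shows "2 < R" "0 < Q" "Q < 1" "0 < P" "1 < W" "W \<le> P + Q"
    "1 - Q \<le> 2 * Q * kappa3 a r r1" "2 * P + 2 * Q - 2 \<le> 2 * Q * nu2 a r"
    "P * ((r1 - 1) / r1) \<le> 2 * W * kappa2 a r r1" "W - 1 \<le> W * nu2 a r"
    "0 < kappa3 a r r1" "0 < kappa2 a r r1" "0 < nu2 a r" "1 \<le> nu2 a r"
proof -
  have "0 < (2 - a) * (1 - 2 / r)" using a r by simp
  thus R2: "2 < R" by (simp add: R_def r0_def)
  hence R: "0 < R" "0 < R - 2" by auto
  show Q: "0 < Q" "Q < 1" using R2 by (auto simp: Q_def)
  show P: "0 < P" using R a by (simp add: P_def)
  have r1R: "2 * r1 < R" using r1 by (simp add: R_def)
  have Weq: "W = ((R + a) + (R - 2) * r1) / (R * r1)" using R r1 by (simp add: W_def P_def Q_def field_simps)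
  \<comment> \<open>Superlinearity of the recursion; it rests on 2 r_1 < r_0.\<close>
  show "1 < W"
  proof -
    have "R * r1 < (R + a) + (R - 2) * r1" using r1R a by (simp add: algebra_simps)
    thus ?thesis unfolding Weq using R r1 by (simp add: pos_less_divide_eq)
  qed
  show "W \<le> P + Q" using P r1 by (simp add: W_def divide_le_eq)
  have nu2: "nu2 a r = 2 * (R - 2 + a) / ((2 - a) * (R - 2))" by (simp add: nu2_def R_def)
  \<comment> \<open>The factor 2 / (2 - a) > 1 is the slack of \<open>nu2\<close> over the exponent
    that the iteration yields.\<close>
  have nu2': "(R - 2 + a) / (R - 2) \<le> nu2 a r"
  proof -
    have "(R - 2 + a) / (R - 2) * 1 \<le> (R - 2 + a) / (R - 2) * (2 / (2 - a))"
      using R a by (intro mult_left_mono) auto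
    thus ?thesis using R by (simp add: nu2 field_simps)
  qed
  have "1 \<le> (R - 2 + a) / (R - 2)" using R a by simp
  thus n1: "1 \<le> nu2 a r" using nu2' by simp
  thus "0 < nu2 a r" by simp
  show "2 * P + 2 * Q - 2 \<le> 2 * Q * nu2 a r"
  proof -
    have "2 * P + 2 * Q - 2 = 2 * Q * ((R - 2 + a) / (R - 2))" using R by (simp add: P_def Q_def field_simps)
    also have "\<dots> \<le> 2 * Q * nu2 a r" using nu2' Q by (intro mult_left_mono) auto
    finally show ?thesis .
  qed
  show "W - 1 \<le> W * nu2 a r"
  proof -
    have "W * 1 \<le> W * nu2 a r" using n1 \<open>1 < W\<close> by (intro mult_left_mono) auto
    thus ?thesis by simp
  qed
  have d1: "0 < R + (R - 2) * r1" using R r1 by (simp add: add_pos_pos)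
  have nu1: "nu1 a r r1 \<le> 1"
  proof -
    have "nu1 a r r1 = (R - 2 * r1) / (R + (R - 2) * r1)" by (simp add: nu1_def R_def)
    also have "\<dots> \<le> 1"
    proof -
      have "0 \<le> (R - 2) * r1" using R r1 by simp
      hence "R - 2 * r1 \<le> R + (R - 2) * r1" using r1 by linarith
      thus ?thesis using d1 by (simp add: divide_le_eq)
    qed
    finally show ?thesis .
  qed
  \<comment> \<open>The iteration yields the power 1 / (R - 2) of 1/T; what \<open>kappa3\<close>
    has in addition is nonnegative because \<open>nu1\<close> is at most 1.\<close>
  have k3: "1 / (R - 2) \<le> kappa3 a r r1"
  proof -
    have "kappa3 a r r1 = R / ((2 - a) * (R - 2)) - nu1 a r r1 / 2"
      by (simp add: kappa3_def kappa1_def R_def)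
    also have "R / ((2 - a) * (R - 2)) = 1 / (R - 2) + (R - 2 + a) / ((2 - a) * (R - 2))"
    proof -
      have e: "1 / (R - 2) = (2 - a) / ((2 - a) * (R - 2))" using a by simp
      show ?thesis by (subst e) (simp only: add_divide_distrib[symmetric], simp)
    qed
    finally have 1: "kappa3 a r r1 = 1 / (R - 2) + (R - 2 + a) / ((2 - a) * (R - 2)) - nu1 a r r1 / 2" .
    have "1 / 2 \<le> (R - 2 + a) / ((2 - a) * (R - 2))"
    proof -
      have "(2 - a) * (R - 2) \<le> 2 * (R - 2)" using R a by (intro mult_right_mono) auto
      thus ?thesis using R a by (simp add: divide_simps)
    qed
    thus ?thesis using 1 nu1 by linarith
  qed
  show "0 < kappa3 a r r1" using k3 R by (smt (verit) divide_pos_pos)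
  show "1 - Q \<le> 2 * Q * kappa3 a r r1"
  proof -
    have "1 - Q = 2 * Q * (1 / (R - 2))" using R by (simp add: Q_def field_simps)
    also have "\<dots> \<le> 2 * Q * kappa3 a r r1" using k3 Q by (intro mult_left_mono) auto
    finally show ?thesis .
  qed
  define D where "D = 2 * R + (R - 2) * r1 * (2 - a)"
  have D: "0 < D" using R r1 a by (simp add: D_def add_pos_pos)
  have k2: "kappa2 a r r1 = R * (r1 - 1) / D" by (simp add: kappa2_def R_def D_def)
  show "0 < kappa2 a r r1" using R r1 D by (simp add: k2)
  show "P * ((r1 - 1) / r1) \<le> 2 * W * kappa2 a r r1"
  proof -
    \<comment> \<open>Expanded, this is (R + a)(2 - a) \<le> 2 R, which places the exponent of N
      demanded by the iteration below \<open>kappa2\<close>.\<close>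
    have "0 \<le> a * (R + a - 2)" using a R by simp
    hence "(R + a) * (2 - a) \<le> 2 * R" by (simp add: algebra_simps)
    hence "((R + a) * (2 - a)) * ((R - 2) * r1) \<le> (2 * R) * ((R - 2) * r1)"
      using R r1 by (intro mult_right_mono) auto
    hence "(R + a) * D \<le> 2 * ((R + a) + (R - 2) * r1) * R" by (simp add: D_def algebra_simps)
    hence 1: "(R + a) / R \<le> 2 * ((R + a) + (R - 2) * r1) / D" using D R by (simp add: field_simps)
    have "P * ((r1 - 1) / r1) \<le> (2 * ((R + a) + (R - 2) * r1) / D) * ((r1 - 1) / r1)"
      unfolding P_def using r1 by (intro mult_right_mono 1) auto
    also have "\<dots> = 2 * W * kappa2 a r r1" using R r1 D by (simp add: Weq k2)
    finally show ?thesis .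
  qed
qed

text \<open>With \<open>k\<close> as the supremum bound, \<open>Y\<close> bounds the excess energy at the \<open>i\<close>-th level and \<open>A\<close> the measure of
  the set where the next level is exceeded; the left-hand side bounds the next excess energy.\<close>

definition iteration_closes :: "real \<Rightarrow> real \<Rightarrow> real \<Rightarrow> real \<Rightarrow> real \<Rightarrow> real \<Rightarrow> bool"
  where "iteration_closes a r r1 c2 C \<rho> \<longleftrightarrow>
    0 < C \<and> 0 < \<rho> \<and> \<rho> < 1 \<and> (\<forall>T N Z k (i::nat) Y A E. 0 < T \<longrightarrow> T \<le> 1 \<longrightarrow> 1 \<le> N \<longrightarrow> 1 \<le> Z \<longrightarrow>
    k = C * T powr (- kappa3 a r r1) * N powr kappa2 a r r1 * Z powr nu2 a r \<longrightarrow>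
    Y = T * Z\<^sup>2 * \<rho> ^ i \<longrightarrow> A = Y / (k / 2 ^ (i + 2))\<^sup>2 \<longrightarrow>
    E = Y / (2 * (T / 2 ^ (i + 2))) + (2 * (N powr ((r1 - 1) / r1) * A powr (1 / r1)) + Y) \<longrightarrow>
    (c2 powr (2 - a) * (2 * E) powr ((r0 a r - 2 + a) / 2) * (8 * E)) powr (2 / r0 a r) * A powr (1 - 2 / r0 a r)
      \<le> T * Z\<^sup>2 * \<rho> ^ Suc i)"

text \<open>Fast geometric convergence. Refining levels and times by powers of 2 costs a factor B^i,
  but the geometric factor of the excess enters the next step with a power of at least W > 1. So the
  sequence with ratio \<rho>, where B \<rho>^(W - 1) = 1, closes the recursion, provided that
  \<open>k\<close>, which occurs in the denominators, is large.\<close>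

lemma degiorgi_constants:
  fixes a r r1 c2 :: real
  assumes a: "0 < a" "a < 1" and r: "2 < r" and r1: "1 < r1" "r1 < r0 a r / 2" and c2: "0 < c2"
  shows "\<exists>C \<rho>. iteration_closes a r r1 c2 C \<rho>"
proof -
  define R where "R = r0 a r"
  define P where "P = (R + a) / R" define Q where "Q = 1 - 2 / R"
  define W where "W = P / r1 + Q"
  note X = exponent_relations[OF a r r1, folded R_def, folded P_def Q_def, folded W_def]
  define Hc where "Hc = (8 * c2 powr (2 - a) * 2 powr ((R - 2 + a) / 2)) powr (2 / R)"
  define B where "B = (4::real) powr (P + Q)"
  define H where "H = Hc * 2 powr P * 16 powr (P + Q) * 2 powr P"
  have H: "0 < H" using c2 by (simp add: H_def Hc_def)
  have B: "1 < B" using X(2,4) by (simp add: B_def)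
  define \<rho> where "\<rho> = B powr (- 1 / (W - 1))"
  have \<rho>: "0 < \<rho>" "\<rho> < 1" using B X(5) by (auto simp: \<rho>_def powr_less_one divide_neg_pos)
  have B\<rho>: "B * \<rho> powr e \<le> \<rho>" if "W \<le> e" for e
  proof -
    have "\<rho> powr (e - 1) \<le> \<rho> powr (W - 1)" using \<rho> that by (intro powr_mono') auto
    also have "\<dots> = B powr (-1)" using X(5) by (simp add: \<rho>_def powr_powr)
    also have "\<dots> = 1 / B" using B by (simp add: powr_minus_divide)
    finally have "B * \<rho> powr (e - 1) \<le> 1" using B by (simp add: field_simps)
    hence "B * \<rho> powr (e - 1) * \<rho> \<le> 1 * \<rho>" using \<rho> by (intro mult_right_mono) auto
    moreover have "\<rho> powr (e - 1) * \<rho> = \<rho> powr e" using \<rho> by (simp add: powr_diff)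
    ultimately show ?thesis by (simp add: mult.assoc)
  qed
  \<comment> \<open>The next excess is bounded by two terms, each of which may use up half of the
    allowance; this is the 2.\<close>
  define M where "M = 2 * H / \<rho>"
  have M: "0 < M" using H \<rho> by (simp add: M_def)
  \<comment> \<open>\<open>C\<close> enters by its powers 2 Q and 2 W. As Q \<le> W, the first power
    is the one to be fitted, once C \<ge> 1; the summand 1 provides the latter.\<close>
  define C where "C = (M + 1) powr (1 / (2 * Q))"
  have C1: "1 \<le> C" using M X(2) by (simp add: C_def ge_one_powr_ge_zero)
  have CQ: "C powr (2 * Q) = M + 1" using M X(2) by (simp add: C_def powr_powr)
  have "Q \<le> W" using X(2,4) r1 by (simp add: W_def)
  hence CW: "M \<le> C powr (2 * W)" using powr_mono[of "2 * Q" "2 * W" C] C1 CQ by simp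
  have main: "(c2 powr (2 - a) * (2 * E) powr ((r0 a r - 2 + a) / 2) * (8 * E)) powr (2 / r0 a r) * A powr (1 - 2 / r0 a r)
      \<le> T * Z\<^sup>2 * \<rho> ^ Suc i"
    if T: "0 < T" "T \<le> 1" and N: "1 \<le> N" and Z: "1 \<le> Z"
      and k: "k = C * T powr (- kappa3 a r r1) * N powr kappa2 a r r1 * Z powr nu2 a r"
      and Y: "Y = T * Z\<^sup>2 * \<rho> ^ i" and A: "A = Y / (k / 2 ^ (i + 2))\<^sup>2"
      and E: "E = Y / (2 * (T / 2 ^ (i + 2))) + (2 * (N powr ((r1 - 1) / r1) * A powr (1 / r1)) + Y)"
    for T N Z k :: real and i :: nat and Y A E
  proof -
    define b0 where "b0 = T * Z\<^sup>2"
    have b0: "0 < b0" using T Z by (simp add: b0_def)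
    have k0: "0 < k" using C1 T N Z by (simp add: k)
    have Y0: "0 < Y" using T Z \<rho> by (simp add: Y)
    define f where "f = (4::real) ^ (i + 2)"
    have f1: "1 \<le> f" unfolding f_def by (rule one_le_power) simp
    define y where "y = Y / k\<^sup>2"
    have y0: "0 < y" using Y0 k0 by (simp add: y_def)
    have "(2 ^ (i + 2))\<^sup>2 = f" by (simp add: f_def power_mult_distrib flip: power_mult power_even_eq)
      (simp add: power_mult[symmetric] mult.commute[of _ 2] power_mult)
    hence Ay: "A = y * f" using k0 by (simp add: A y_def power_divide)
    define n where "n = N powr ((r1 - 1) / r1)"
    have n0: "0 < n" using N by (simp add: n_def)
    define e1 where "e1 = Y / T" define e2 where "e2 = n * y powr (1 / r1)"
    have e0: "0 < e1" "0 < e2" using Y0 T n0 y0 by (auto simp: e1_def e2_def)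
    \<comment> \<open>\<open>e1\<close> comes from averaging in time and \<open>e2\<close> from the
      sources; the remaining summand Y is at most \<open>e1\<close> because T \<le> 1.\<close>
    have E1: "E \<le> 2 * f * (e1 + e2)"
    proof -
      have "Y / (2 * (T / 2 ^ (i + 2))) = e1 * (2 ^ (i + 2) / 2)" using T by (simp add: e1_def)
      also have "\<dots> \<le> e1 * f" using e0 unfolding f_def by (intro mult_left_mono) (auto simp: field_simps intro!: order_trans[OF power_mono[of 2 4 i]])
      finally have 1: "Y / (2 * (T / 2 ^ (i + 2))) \<le> e1 * f" .
      have "Y \<le> e1" using T Y0 by (simp add: e1_def field_simps mult_left_le)
      also have "e1 \<le> e1 * f" using e0 f1 by simp
      finally have 2: "Y \<le> e1 * f" .
      have "A powr (1 / r1) = y powr (1 / r1) * f powr (1 / r1)" using y0 f1 by (simp add: Ay powr_mult)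
      also have "\<dots> \<le> y powr (1 / r1) * f powr 1" using f1 r1 by (intro mult_left_mono powr_mono) auto
      finally have "A powr (1 / r1) \<le> y powr (1 / r1) * f" using f1 by simp
      hence "n * A powr (1 / r1) \<le> n * (y powr (1 / r1) * f)" using n0 by (intro mult_left_mono) auto
      hence 3: "2 * (n * A powr (1 / r1)) \<le> 2 * (e2 * f)" by (simp add: e2_def)
      have "E = Y / (2 * (T / 2 ^ (i + 2))) + (2 * (n * A powr (1 / r1)) + Y)" by (simp add: E n_def)
      thus ?thesis using 1 2 3 by (simp add: algebra_simps)
    qed
    have E0: "0 < E" unfolding E using Y0 T by (intro add_pos_nonneg) auto
    have "(c2 powr (2 - a) * (2 * E) powr ((R - 2 + a) / 2) * (8 * E)) powr (2 / R) = Hc * E powr P"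
    proof -
      have "c2 powr (2 - a) * (2 * E) powr ((R - 2 + a) / 2) * (8 * E)
        = (8 * c2 powr (2 - a) * 2 powr ((R - 2 + a) / 2)) * (E powr ((R - 2 + a) / 2) * E powr 1)"
        using E0 by (simp add: powr_mult)
      also have "E powr ((R - 2 + a) / 2) * E powr 1 = E powr ((R + a) / 2)"
        by (subst powr_add[symmetric]) (simp add: field_simps)
      finally have eq: "c2 powr (2 - a) * (2 * E) powr ((R - 2 + a) / 2) * (8 * E)
        = (8 * c2 powr (2 - a) * 2 powr ((R - 2 + a) / 2)) * E powr ((R + a) / 2)" .
      have "(c2 powr (2 - a) * (2 * E) powr ((R - 2 + a) / 2) * (8 * E)) powr (2 / R)
        = Hc * (E powr ((R + a) / 2)) powr (2 / R)"
        unfolding eq by (subst powr_mult) (use c2 in \<open>auto simp: Hc_def\<close>)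
      also have "(E powr ((R + a) / 2)) powr (2 / R) = E powr P"
      proof -
        have "(R + a) / 2 * (2 / R) = P" using X(1) by (simp add: P_def divide_simps distrib_right)
        thus ?thesis by (simp only: powr_powr)
      qed
      finally show ?thesis .
    qed
    hence "(c2 powr (2 - a) * (2 * E) powr ((R - 2 + a) / 2) * (8 * E)) powr (2 / R) * A powr Q = Hc * E powr P * A powr Q"
      by simp
    also have "\<dots> \<le> Hc * (2 * f * (e1 + e2)) powr P * A powr Q"
      using E0 E1 X(4) by (intro mult_right_mono mult_left_mono powr_mono2) (auto simp: Hc_def)
    also have "\<dots> = Hc * 2 powr P * (f powr P * f powr Q) * (e1 + e2) powr P * y powr Q"
      using f1 e0 y0 by (simp add: powr_mult Ay)
    also have "f powr P * f powr Q = 16 powr (P + Q) * B ^ i"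
    proof -
      have f: "f = 16 * 4 ^ i" by (simp add: f_def)
      have "f powr P * f powr Q = f powr (P + Q)" by (simp add: powr_add)
      also have "\<dots> = 16 powr (P + Q) * (4 ^ i) powr (P + Q)" unfolding f by (simp add: powr_mult)
      also have "((4::real) ^ i) powr (P + Q) = B ^ i"
        by (simp add: B_def powr_powr mult.commute flip: powr_realpow)
      finally show ?thesis .
    qed
    also have "Hc * 2 powr P * (16 powr (P + Q) * B ^ i) * (e1 + e2) powr P * y powr Q
      \<le> Hc * 2 powr P * (16 powr (P + Q) * B ^ i) * (2 powr P * (e1 powr P + e2 powr P)) * y powr Q"
      using e0 X(4) B by (intro mult_right_mono mult_left_mono powr_sum_le) (auto simp: Hc_def)
    also have "\<dots> = H * B ^ i * (e1 powr P * y powr Q) + H * B ^ i * (e2 powr P * y powr Q)"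
      by (simp add: H_def algebra_simps)
    also have "\<dots> \<le> b0 * \<rho> ^ Suc i / 2 + b0 * \<rho> ^ Suc i / 2"
    proof (rule add_mono)
      have pw: "(\<rho> ^ i) powr e = (\<rho> powr e) ^ i" for e
        using \<rho> by (simp add: powr_powr mult.commute flip: powr_realpow)
      \<comment> \<open>Both terms have this form, with e = P + Q and e = W. The choice of \<rho>
        absorbs B^i, and only the constant \<open>c\<close> is left to be compared with
        \<open>b0\<close>.\<close>
      have fin: "H * B ^ i * (c * (\<rho> powr e) ^ i) \<le> b0 * \<rho> ^ Suc i / 2" if c: "0 \<le> c" "M * c \<le> b0" and e: "W \<le> e" for c e
      proof -
        have "H * B ^ i * (c * (\<rho> powr e) ^ i) = H * c * (B * \<rho> powr e) ^ i" by (simp add: power_mult_distrib)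
        also have "\<dots> \<le> H * c * \<rho> ^ i" using H c B B\<rho>[OF e] by (intro mult_left_mono power_mono) auto
        also have "H * c = \<rho> / 2 * (M * c)" using \<rho> by (simp add: M_def)
        also have "\<rho> / 2 * (M * c) * \<rho> ^ i \<le> \<rho> / 2 * b0 * \<rho> ^ i" using c \<rho> by (intro mult_right_mono mult_left_mono) auto
        finally show ?thesis by (simp add: mult_ac)
      qed
      have kQ: "k powr (2 * e) = C powr (2 * e) * T powr (- (2 * e * kappa3 a r r1)) * N powr (2 * e * kappa2 a r r1) * Z powr (2 * e * nu2 a r)" for e
        using C1 T N Z by (simp add: k powr_mult powr_powr mult_ac)
      have zz: "(Z\<^sup>2) powr e = Z powr (2 * e)" for e using Z by (simp add: powr_powr flip: powr_numeral)
      have kk: "(k\<^sup>2) powr e = k powr (2 * e)" for e using k0 by (simp add: powr_powr flip: powr_numeral)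
      have yb: "y = (b0 / k\<^sup>2) * \<rho> ^ i" "e1 = Z\<^sup>2 * \<rho> ^ i" using T by (simp_all add: y_def Y b0_def e1_def)
      have bk: "(b0 / k\<^sup>2) powr e = T powr e * Z powr (2 * e) / k powr (2 * e)" for e
        using b0 k0 T Z by (simp add: powr_divide powr_mult b0_def zz kk)
      have yp: "y powr e = (b0 / k\<^sup>2) powr e * (\<rho> powr e) ^ i" for e
        unfolding yb(1) using b0 k0 \<rho> by (subst powr_mult) (auto simp: pw)
      have ep: "e1 powr e = Z powr (2 * e) * (\<rho> powr e) ^ i" for e
        unfolding yb(2) using \<rho> by (subst powr_mult) (auto simp: pw zz)
      show "H * B ^ i * (e1 powr P * y powr Q) \<le> b0 * \<rho> ^ Suc i / 2"
      proof -
        have 1: "e1 powr P * y powr Q = (Z powr (2 * P) * (b0 / k\<^sup>2) powr Q) * (\<rho> powr (P + Q)) ^ i"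
          by (simp add: yp ep powr_add power_mult_distrib)
        have "M * (Z powr (2 * P) * (b0 / k\<^sup>2) powr Q) \<le> b0"
        proof -
          have "M * (Z powr (2 * P) * (T powr Q * Z powr (2 * Q))) = (T * Z\<^sup>2) * (M * T powr (Q - 1) * 1 * Z powr (2 * P + 2 * Q - 2))"
            using T Z by (simp add: powr_diff powr_add)
          also have "\<dots> \<le> (T * Z\<^sup>2) * k powr (2 * Q)"
            \<comment> \<open>As T \<le> 1 and N, Z are at least 1, comparing the exponents factor
              by factor is enough.\<close>
            unfolding kQ
          proof (intro mult_left_mono mult_mono)
            show "M \<le> C powr (2 * Q)" using CQ by simp
            show "T powr (Q - 1) \<le> T powr (- (2 * Q * kappa3 a r r1))" using T X(7) by (intro powr_mono') auto
            show "1 \<le> N powr (2 * Q * kappa2 a r r1)" using N X(2,12) by (intro ge_one_powr_ge_zero) auto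
            show "Z powr (2 * P + 2 * Q - 2) \<le> Z powr (2 * Q * nu2 a r)" using Z X(8) by (intro powr_mono) auto
          qed (use T M in auto)
          finally show ?thesis unfolding bk using k0 by (simp add: field_simps b0_def)
        qed
        thus ?thesis unfolding 1 using X(6) by (intro fin) auto
      qed
      show "H * B ^ i * (e2 powr P * y powr Q) \<le> b0 * \<rho> ^ Suc i / 2"
      proof -
        have "e2 powr P * y powr Q = n powr P * y powr W"
          using n0 y0 by (simp add: e2_def powr_mult powr_powr W_def powr_add)
        hence 1: "e2 powr P * y powr Q = (n powr P * (b0 / k\<^sup>2) powr W) * (\<rho> powr W) ^ i"
          by (simp add: yp)
        have "M * (n powr P * (b0 / k\<^sup>2) powr W) \<le> b0"
        proof -
          have "M * (n powr P * (T powr W * Z powr (2 * W))) = (T * Z\<^sup>2) * (M * T powr (W - 1) * N powr (P * ((r1 - 1) / r1)) * Z powr (2 * (W - 1)))"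
            using T Z by (simp add: powr_diff n_def powr_powr mult_ac right_diff_distrib)
          also have "\<dots> \<le> (T * Z\<^sup>2) * k powr (2 * W)"
            unfolding kQ
          proof (intro mult_left_mono mult_mono)
            show "M \<le> C powr (2 * W)" by (rule CW)
            have "T powr (W - 1) \<le> 1" using T X(5) by (intro powr_le1) auto
            also have "1 \<le> T powr (- (2 * W * kappa3 a r r1))"
              using powr_mono'[of "- (2 * W * kappa3 a r r1)" 0 T] T X(5,11) by simp
            finally show "T powr (W - 1) \<le> T powr (- (2 * W * kappa3 a r r1))" .
            show "N powr (P * ((r1 - 1) / r1)) \<le> N powr (2 * W * kappa2 a r r1)" using N X(9) by (intro powr_mono) auto
            have "2 * (W - 1) \<le> 2 * W * nu2 a r" using X(10) by simp
            thus "Z powr (2 * (W - 1)) \<le> Z powr (2 * W * nu2 a r)" using Z by (intro powr_mono) auto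
          qed (use T M in auto)
          finally show ?thesis unfolding bk using k0 by (simp add: field_simps b0_def)
        qed
        thus ?thesis unfolding 1 by (intro fin) auto
      qed
    qed
    also have "\<dots> = T * Z\<^sup>2 * \<rho> ^ Suc i" by (simp add: b0_def)
    finally show ?thesis by (simp add: R_def Q_def)
  qed
  show ?thesis
    unfolding iteration_closes_def using C1 by (intro exI[of _ C] exI[of _ \<rho>] conjI) (use \<rho> main in \<open>simp, blast+\<close>)
qed

section \<open>Estimates from the energy inequality\<close>

lemma nn_integral_truncation_LIMSEQ:
  assumes [measurable]: "f \<in> borel_measurable M" "v \<in> borel_measurable M"
  shows "(\<lambda>m. \<integral>\<^sup>+x. f x * indicator {y. \<bar>y :: real\<bar> \<le> real m} (v x) \<partial>M) \<longlonglongrightarrow> (\<integral>\<^sup>+x. f x \<partial>M)"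
proof (rule nn_integral_LIMSEQ)
  show "incseq (\<lambda>m x. f x * indicator {y. \<bar>y\<bar> \<le> real m} (v x))"
    by (auto simp: incseq_def le_fun_def indicator_def)
  show "(\<lambda>m. f x * indicator {y. \<bar>y\<bar> \<le> real m} (v x)) \<longlonglongrightarrow> f x" for x
  proof (rule tendsto_eventually, rule eventually_sequentiallyI)
    fix m assume "nat \<lceil>\<bar>v x\<bar>\<rceil> \<le> m"
    hence "\<bar>v x\<bar> \<le> real m" by linarith
    thus "f x * indicator {y. \<bar>y\<bar> \<le> real m} (v x) = f x" by simp
  qed
qed measurable

text \<open>\<open>F(u)\<close> is the test function of the energy estimate, \<open>h = F'\<close> and \<open>\<Phi>' = F\<close>.\<close>

definition admissible :: "(real \<Rightarrow> real) \<Rightarrow> (real \<Rightarrow> real) \<Rightarrow> (real \<Rightarrow> real) \<Rightarrow> bool"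
  where "admissible h F \<Phi> \<longleftrightarrow> continuous_on UNIV h \<and> (\<forall>u. 0 \<le> h u \<and> h u \<le> 1) \<and>
    (\<forall>u. (F has_real_derivative h u) (at u)) \<and> (\<forall>u. (\<Phi> has_real_derivative F u) (at u)) \<and> F 0 = 0 \<and> \<Phi> 0 = 0"

lemma admissibleD:
  assumes "admissible h F \<Phi>"
  shows "continuous_on UNIV h" "0 \<le> h u" "h u \<le> 1" "\<bar>h u\<bar> \<le> 1" "(F has_real_derivative h u) (at u)"
    "(\<Phi> has_real_derivative F u) (at u)" "F 0 = 0" "\<Phi> 0 = 0"
    "h \<in> borel_measurable borel" "F \<in> borel_measurable borel" "\<Phi> \<in> borel_measurable borel"
proof -
  have A: "continuous_on UNIV h" "\<And>u. 0 \<le> h u \<and> h u \<le> 1" "\<And>u. (F has_real_derivative h u) (at u)"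
    "\<And>u. (\<Phi> has_real_derivative F u) (at u)" "F 0 = 0" "\<Phi> 0 = 0"
    using assms unfolding admissible_def by auto
  have "continuous_on UNIV F" "continuous_on UNIV \<Phi>"
    by (rule DERIV_continuous_on, rule A)+
  thus "h \<in> borel_measurable borel" "F \<in> borel_measurable borel" "\<Phi> \<in> borel_measurable borel"
    using A(1) by (auto intro: borel_measurable_continuous_onI)
  show "continuous_on UNIV h" "0 \<le> h u" "h u \<le> 1" "\<bar>h u\<bar> \<le> 1" "(F has_real_derivative h u) (at u)"
    "(\<Phi> has_real_derivative F u) (at u)" "F 0 = 0" "\<Phi> 0 = 0"
    using A(1,3-6) A(2)[of u] by auto
qed

text \<open>For the last two claims: the derivative of \<Phi> - F^2 / 2 is F (1 - h), which has the
  sign of the argument, so the difference has its minimum 0 at the origin.\<close>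

lemma admissible_sign:
  assumes A: "admissible h F \<Phi>"
  shows "0 \<le> u \<Longrightarrow> 0 \<le> F u" "u \<le> 0 \<Longrightarrow> F u \<le> 0" "(F u)\<^sup>2 / 2 \<le> \<Phi> u" "0 \<le> \<Phi> u"
proof -
  note D = admissibleD[OF A]
  have F: "F u \<le> F v" if "u \<le> v" for u v
    by (rule DERIV_nonneg_imp_nondecreasing[OF that]) (use D in blast)
  show pos: "0 \<le> u \<Longrightarrow> 0 \<le> F u" for u using F[of 0 u] D(7) by simp
  show neg: "u \<le> 0 \<Longrightarrow> F u \<le> 0" for u using F[of u 0] D(7) by simp
  define H where "H u = \<Phi> u - (F u)\<^sup>2 / 2" for u
  have HD: "(H has_real_derivative F u * (1 - h u)) (at u)" for u
    unfolding H_def using D by (auto intro!: derivative_eq_intros simp: algebra_simps)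
  have "0 \<le> H u"
  proof (cases "0 \<le> u")
    case True
    have "H 0 \<le> H u"
      by (rule DERIV_nonneg_imp_nondecreasing[OF True]) (use HD D pos in \<open>auto intro!: exI mult_nonneg_nonneg\<close>)
    thus ?thesis using D by (simp add: H_def)
  next
    case False
    have "H u \<ge> H 0"
    proof (rule DERIV_nonpos_imp_nonincreasing[of u 0])
      fix x assume "u \<le> x" "x \<le> 0"
      thus "\<exists>y. (H has_real_derivative y) (at x) \<and> y \<le> 0"
        using HD[of x] D(3)[of x] neg[of x] by (auto intro!: exI mult_nonpos_nonneg)
    qed (use False in auto)
    thus ?thesis using D by (simp add: H_def)
  qed
  thus "(F u)\<^sup>2 / 2 \<le> \<Phi> u" by (simp add: H_def)
  thus "0 \<le> \<Phi> u" by (meson order_trans zero_le_power2 divide_nonneg_pos zero_less_numeral)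
qed

lemma admissible_ramp: "0 \<le> k \<Longrightarrow> k < l \<Longrightarrow> admissible (rampD k l) (rampF k l) (rampP k l)"
  unfolding admissible_def
  by (auto simp: rampD_continuous rampD_bounds rampF_has_derivative rampP_has_derivative rampF_bounds)

lemma admissible_id: "admissible (\<lambda>u. 1) (\<lambda>u. u) (\<lambda>u. u\<^sup>2 / 2)"
  unfolding admissible_def by (auto intro!: derivative_eq_intros)

text \<open>Makes a test function bounded. Since \<open>h\<close> equals 1 from \<open>l\<close> on,
  subtracting the ramp from \<open>m\<close> to m + 1 lets the derivative vanish for |u| \<ge> m +
  1. The new \<open>F\<close> is constant there, while nothing changes for |u| \<le> m.\<close>

lemma admissible_truncate:
  assumes A: "admissible h F \<Phi>" and l: "\<And>u. l \<le> \<bar>u\<bar> \<Longrightarrow> h u = 1" and m: "0 \<le> m" "l \<le> m"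
  defines "h' \<equiv> \<lambda>u. h u - rampD m (m + 1) u" and "F' \<equiv> \<lambda>u. F u - rampF m (m + 1) u"
    and "\<Phi>' \<equiv> \<lambda>u. \<Phi> u - rampP m (m + 1) u"
  shows "admissible h' F' \<Phi>'" "\<exists>B. \<forall>u. \<bar>F' u\<bar> \<le> B"
    "\<bar>u\<bar> \<le> m \<Longrightarrow> h' u = h u \<and> F' u = F u \<and> \<Phi>' u = \<Phi> u" "h' u \<le> h u" "\<bar>F' u\<bar> \<le> \<bar>F u\<bar>" "\<Phi>' u \<le> \<Phi> u"
proof -
  note D = admissibleD[OF A]
  have R: "admissible (rampD m (m + 1)) (rampF m (m + 1)) (rampP m (m + 1))" using m by (simp add: admissible_ramp)
  note D' = admissibleD[OF R] and b = rampD_bounds[of m "m + 1"] rampF_bounds[of m "m + 1"]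
  have h: "0 \<le> h' u" "h' u \<le> h u" for u
    using b(1-4)[of u] D(2)[of u] l[of u] m by (cases "\<bar>u\<bar> \<le> m"; auto simp: h'_def)+
  show A': "admissible h' F' \<Phi>'"
    using h D(1-8) D'(1-8) order_trans[OF h(2) D(3)] unfolding admissible_def
    by (auto intro!: continuous_on_diff DERIV_diff simp: h'_def F'_def \<Phi>'_def)
  note D'' = admissibleD[OF A']
  show "h' u \<le> h u" by (rule h)
  show "\<Phi>' u \<le> \<Phi> u" using admissible_sign(4)[OF R] by (simp add: \<Phi>'_def)
  show "\<bar>F' u\<bar> \<le> \<bar>F u\<bar>"
    using admissible_sign(1,2)[OF A', of u] admissible_sign(1,2)[OF R, of u] by (cases "0 \<le> u") (auto simp: F'_def)
  show "\<bar>u\<bar> \<le> m \<Longrightarrow> h' u = h u \<and> F' u = F u \<and> \<Phi>' u = \<Phi> u"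
    using b[of u] m by (auto simp: h'_def F'_def \<Phi>'_def)
  have h0: "h' u = 0" if "m + 1 \<le> \<bar>u\<bar>" for u
    using b(4)[of u] l[of u] that m by (simp add: h'_def)
  have "\<bar>F' u\<bar> \<le> \<bar>F' (m + 1)\<bar> + \<bar>F' (- m - 1)\<bar>" for u
  proof -
    have mono: "F' u \<le> F' v" if "u \<le> v" for u v
      by (rule DERIV_nonneg_imp_nondecreasing[OF that]) (use D'' in blast)
    have "F' u = F' (m + 1)" if "m + 1 \<le> u"
    proof (rule antisym)
      show "F' u \<le> F' (m + 1)"
      proof (rule DERIV_nonpos_imp_nonincreasing[OF that])
        fix x assume "m + 1 \<le> x"
        thus "\<exists>y. (F' has_real_derivative y) (at x) \<and> y \<le> 0"
          using h0[of x] D''(5)[of x] m by (intro exI[of _ 0]) auto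
      qed
    qed (rule mono[OF that])
    moreover have "F' u = F' (- m - 1)" if "u \<le> - m - 1"
    proof (rule antisym)
      show "F' (- m - 1) \<le> F' u"
      proof (rule DERIV_nonpos_imp_nonincreasing[OF that])
        fix x assume "x \<le> - m - 1"
        thus "\<exists>y. (F' has_real_derivative y) (at x) \<and> y \<le> 0"
          using h0[of x] D''(5)[of x] m by (intro exI[of _ 0]) auto
      qed
    qed (rule mono[OF that])
    moreover have "F' u \<le> F' (m + 1) \<and> F' (- m - 1) \<le> F' u" if "- m - 1 \<le> u" "u \<le> m + 1"
      using mono that by auto
    ultimately show ?thesis by linarith
  qed
  thus "\<exists>B. \<forall>u. \<bar>F' u\<bar> \<le> B" by blast
qed

section \<open>Comparison with barriers, without continuity\<close>

lemma barrier_stays: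
  fixes z :: "real \<Rightarrow> real"
  assumes B: "\<And>s t. t0 \<le> s \<Longrightarrow> s < t \<Longrightarrow> t \<le> t1 \<Longrightarrow> z t \<le> z s + B * (t - s)" "0 \<le> B"
    and D: "\<And>s t. t0 \<le> s \<Longrightarrow> s < t \<Longrightarrow> t \<le> t1 \<Longrightarrow> (\<And>\<tau>. s < \<tau> \<Longrightarrow> \<tau> < t \<Longrightarrow> 0 < z \<tau>) \<Longrightarrow> z t \<le> z s"
    and s: "t0 \<le> s" "s \<le> t1" "z s \<le> 0"
  shows "z t1 \<le> 0"
proof (rule ccontr)
  assume pos: "\<not> z t1 \<le> 0"
  define S where "S = {\<sigma>. t0 \<le> \<sigma> \<and> \<sigma> \<le> t1 \<and> z \<sigma> \<le> 0}"
  \<comment> \<open>Beyond \<open>s0\<close> the function is positive. Its value at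
    \<open>s0\<close> itself is not controlled, as it may be discontinuous; the growth bound bridges
    a short interval from a point of \<open>S\<close> at or just before \<open>s0\<close> to a point
    just after it.\<close>
  define s0 where "s0 = Sup S"
  have S: "S \<noteq> {}" "bdd_above S" using s by (auto simp: S_def)
  have le: "s0 \<le> t1" unfolding s0_def using S by (intro cSup_least) (auto simp: S_def)
  have out: "0 < z \<tau>" if "s0 < \<tau>" "\<tau> \<le> t1" "t0 \<le> \<tau>" for \<tau>
  proof (rule ccontr)
    assume "\<not> 0 < z \<tau>"
    hence "\<tau> \<in> S" using that by (auto simp: S_def)
    hence "\<tau> \<le> s0" unfolding s0_def using S by (intro cSup_upper) auto
    thus False using that by simp
  qed
  have "z t1 \<le> 0 + e" if e: "0 < e" for e
  proof -
    \<comment> \<open>The bridged interval has length at most 2 d; B + 1 avoids a division by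
      zero.\<close>
    define d where "d = e / (2 * (B + 1))"
    have d: "0 < d" "B * (2 * d) \<le> e" using e B(2) by (auto simp: d_def field_simps)
    obtain \<sigma> where \<sigma>: "\<sigma> \<in> S" "s0 - d < \<sigma>"
      using less_cSupD[OF S(1), of "s0 - d"] d by (auto simp: s0_def)
    have \<sigma>s: "\<sigma> \<le> s0" unfolding s0_def using S \<sigma> by (intro cSup_upper) auto
    have \<sigma>t: "\<sigma> < t1" using \<sigma> pos by (cases "\<sigma> = t1") (auto simp: S_def)
    define \<tau> where "\<tau> = min t1 (s0 + d)"
    have \<tau>: "\<sigma> < \<tau>" "\<tau> \<le> t1" "\<tau> - \<sigma> \<le> 2 * d" using \<sigma> \<sigma>s \<sigma>t d by (auto simp: \<tau>_def)
    have "z \<tau> \<le> z \<sigma> + B * (\<tau> - \<sigma>)" using \<sigma> \<tau> by (intro B) (auto simp: S_def)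
    also have "\<dots> \<le> 0 + B * (2 * d)" using \<sigma> \<tau> B(2) by (intro add_mono mult_left_mono) (auto simp: S_def)
    also have "\<dots> \<le> e" using d by simp
    finally have 1: "z \<tau> \<le> e" .
    have "z t1 \<le> z \<tau>"
    proof (cases "\<tau> = t1")
      case False
      hence 2: "\<tau> = s0 + d" "\<tau> < t1" using \<tau> by (auto simp: \<tau>_def)
      have 3: "t0 \<le> \<tau>" using \<sigma> \<tau> by (auto simp: S_def)
      show ?thesis
      proof (rule D[OF 3 2(2) order_refl])
        fix \<rho> assume "\<tau> < \<rho>" "\<rho> < t1"
        thus "0 < z \<rho>" using 2 3 d by (intro out) auto
      qed
    qed simp
    thus ?thesis using 1 by simp
  qed
  hence "z t1 \<le> 0" by (rule field_le_epsilon)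
  thus False using pos by simp
qed

text \<open>Either \<open>z\<close> becomes nonpositive at some time and stays so, or it is positive
  throughout and falls at the rate \<delta>, which uses up its initial value by the time
  \<open>t1\<close>.\<close>

lemma barrier_reached:
  fixes z :: "real \<Rightarrow> real"
  assumes B: "\<And>s t. t0 \<le> s \<Longrightarrow> s < t \<Longrightarrow> t \<le> t1 \<Longrightarrow> z t \<le> z s + B * (t - s)" "0 \<le> B"
    and D: "\<And>s t. t0 \<le> s \<Longrightarrow> s < t \<Longrightarrow> t \<le> t1 \<Longrightarrow> (\<And>\<tau>. s < \<tau> \<Longrightarrow> \<tau> < t \<Longrightarrow> 0 < z \<tau>) \<Longrightarrow> z t \<le> z s - \<delta> * (t - s)"
    and \<delta>: "0 < \<delta>" and t: "t0 < t1" "z t0 \<le> \<delta> * (t1 - t0)"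
  shows "z t1 \<le> 0"
proof (cases "\<exists>s. t0 \<le> s \<and> s \<le> t1 \<and> z s \<le> 0")
  case True
  then obtain s where s: "t0 \<le> s" "s \<le> t1" "z s \<le> 0" by blast
  show ?thesis
  proof (rule barrier_stays[OF B _ s])
    fix s t assume st: "t0 \<le> s" "s < t" "t \<le> t1" "\<And>\<tau>. s < \<tau> \<Longrightarrow> \<tau> < t \<Longrightarrow> 0 < z \<tau>"
    have "z t \<le> z s - \<delta> * (t - s)" by (rule D[OF st])
    moreover have "0 \<le> \<delta> * (t - s)" using st \<delta> by simp
    ultimately show "z t \<le> z s" by linarith
  qed
next
  case False
  have "z t1 \<le> z t0 - \<delta> * (t1 - t0)"
    by (rule D) (use False t in \<open>auto simp: not_le\<close>, meson False less_imp_le not_le)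
  thus ?thesis using t by simp
qed

text \<open>The information about the solution that the estimates need: \<open>u\<close> stands for \<open>p - \<Psi>\<close>, \<open>w\<close> for
  \<open>W\<^sub>1 |\<nabla>u| powr (2 - a)\<close>, \<open>f\<close> for \<open>a\<^sub>N + W\<^sub>1 |\<nabla>\<Psi>| powr (2 - a) + |\<nabla>\<Psi>|\<^sup>2 / a\<^sub>0\<close>, \<open>\<psi>\<close> for \<open>|\<Psi>\<^sub>t|\<close> and \<open>g\<close> for \<open>G\<close>. Gradients
  enter through \<open>w\<close> only, so no space variable has to be differentiated below.\<close>

locale energy_flow = sigma_finite_measure Mx
  for Mx :: "'x measure" +
  fixes \<phi> :: "'x \<Rightarrow> real" and u w f \<psi> :: "real \<Rightarrow> 'x \<Rightarrow> real" and g :: "real \<Rightarrow> real"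
    and a r c1 c2 :: real
  assumes \<phi>_measurable [measurable]: "\<phi> \<in> borel_measurable Mx"
    and \<phi>_pos: "\<And>x. x \<in> space Mx \<Longrightarrow> 0 < \<phi> x"
    and joint_measurable:
      "(\<lambda>z. u (snd z) (fst z)) \<in> borel_measurable (Mx \<Otimes>\<^sub>M lborel)"
      "(\<lambda>z. w (snd z) (fst z)) \<in> borel_measurable (Mx \<Otimes>\<^sub>M lborel)"
      "(\<lambda>z. f (snd z) (fst z)) \<in> borel_measurable (Mx \<Otimes>\<^sub>M lborel)"
      "(\<lambda>z. \<psi> (snd z) (fst z)) \<in> borel_measurable (Mx \<Otimes>\<^sub>M lborel)"
    and nonneg: "\<And>\<tau> x. x \<in> space Mx \<Longrightarrow> 0 \<le> w \<tau> x" "\<And>\<tau> x. x \<in> space Mx \<Longrightarrow> 0 \<le> f \<tau> x" "\<And>\<tau> x. 0 \<le> \<psi> \<tau> x"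
    and params: "0 < a" "a < 1" "2 < r" "0 < c1" "0 < c2"
    and energy_bounded: "\<And>h F \<Phi> s t. admissible h F \<Phi> \<Longrightarrow> \<exists>B. \<forall>v. \<bar>F v\<bar> \<le> B \<Longrightarrow> 0 < s \<Longrightarrow> s < t \<Longrightarrow>
      (\<integral>\<^sup>+\<tau>\<in>{s..t}. (\<integral>\<^sup>+x. ennreal (w \<tau> x * h (u \<tau> x)) \<partial>Mx) \<partial>lborel) < \<infinity> \<and>
      (\<integral>\<^sup>+x. ennreal (\<phi> x * \<Phi> (u t x)) \<partial>Mx) + (\<integral>\<^sup>+\<tau>\<in>{s..t}. (\<integral>\<^sup>+x. ennreal (w \<tau> x * h (u \<tau> x) / 8) \<partial>Mx) \<partial>lborel)
      \<le> (\<integral>\<^sup>+x. ennreal (\<phi> x * \<Phi> (u s x)) \<partial>Mx)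
        + (\<integral>\<^sup>+\<tau>\<in>{s..t}. (\<integral>\<^sup>+x. ennreal (f \<tau> x * h (u \<tau> x) + \<phi> x * \<psi> \<tau> x * \<bar>F (u \<tau> x)\<bar>) \<partial>Mx) \<partial>lborel)"
    and sobolev: "\<And>h F \<Phi>. admissible h F \<Phi> \<Longrightarrow> AE \<tau> in lborel. 0 < \<tau> \<longrightarrow>
      (\<forall>D\<ge>0. (\<integral>\<^sup>+x. ennreal (w \<tau> x * h (u \<tau> x)) \<partial>Mx) \<le> ennreal D \<longrightarrow>
        (\<integral>\<^sup>+x. ennreal (\<phi> x * \<bar>F (u \<tau> x)\<bar> powr r) \<partial>Mx) \<le> ennreal ((c2 * D powr (1 / (2 - a))) powr r) \<and>
        (\<integral>\<^sup>+x. ennreal (\<phi> x * (F (u \<tau> x))\<^sup>2) \<partial>Mx) \<le> ennreal ((c1 * D powr (1 / (2 - a)))\<^sup>2))"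
    and source: "\<And>\<tau>. 0 \<le> \<tau> \<Longrightarrow> 1 \<le> g \<tau>" "\<And>\<tau>. 0 \<le> \<tau> \<Longrightarrow> (\<integral>\<^sup>+x. ennreal (f \<tau> x) \<partial>Mx) \<le> ennreal (g \<tau>)"
      "\<And>\<tau>. 0 \<le> \<tau> \<Longrightarrow> (\<integral>\<^sup>+x. ennreal (\<phi> x * (\<psi> \<tau> x)\<^sup>2) \<partial>Mx) \<le> ennreal (g \<tau> powr (2 * (1 - a) / (2 - a)))"
begin

section \<open>Energy inequalities for unbounded test functions\<close>

lemma raw_measurable [measurable (raw)]:
  assumes "p \<in> borel_measurable N" "q \<in> measurable N Mx"
  shows "(\<lambda>y. u (p y) (q y)) \<in> borel_measurable N" "(\<lambda>y. w (p y) (q y)) \<in> borel_measurable N"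
    "(\<lambda>y. f (p y) (q y)) \<in> borel_measurable N" "(\<lambda>y. \<psi> (p y) (q y)) \<in> borel_measurable N"
proof -
  have 1: "(\<lambda>y. (q y, p y)) \<in> measurable N (Mx \<Otimes>\<^sub>M lborel)" using assms by simp
  show "(\<lambda>y. u (p y) (q y)) \<in> borel_measurable N" "(\<lambda>y. w (p y) (q y)) \<in> borel_measurable N"
    "(\<lambda>y. f (p y) (q y)) \<in> borel_measurable N" "(\<lambda>y. \<psi> (p y) (q y)) \<in> borel_measurable N"
    using joint_measurable[THEN measurable_compose[OF 1]] by simp_all
qed

sublocale pair_sigma_finite Mx lborel ..

text \<open>On the product space monotone convergence, additivity and Hoelder's inequality apply to
  both integrations at once.\<close>

lemma II_eq:
  assumes [measurable]: "(\<lambda>z. p (snd z) (fst z)) \<in> borel_measurable (Mx \<Otimes>\<^sub>M lborel)" "A \<in> sets borel"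
  shows "(\<integral>\<^sup>+\<tau>\<in>A. (\<integral>\<^sup>+x. p \<tau> x \<partial>Mx) \<partial>lborel)
    = (\<integral>\<^sup>+z. p (snd z) (fst z) * indicator A (snd z) \<partial>(Mx \<Otimes>\<^sub>M lborel))"
proof -
  have 1: "(\<lambda>z. p (snd z) (fst z) * indicator A (snd z)) \<in> borel_measurable (Mx \<Otimes>\<^sub>M lborel)" by measurable
  have 2: "(\<lambda>x. p \<tau> x) \<in> borel_measurable Mx" for \<tau>
    proof -
    have "(\<lambda>x. (x, \<tau>)) \<in> Mx \<rightarrow>\<^sub>M Mx \<Otimes>\<^sub>M lborel" by simp
    from measurable_compose[OF this assms(1)] show ?thesis by simp
  qed
  have "(\<integral>\<^sup>+\<tau>\<in>A. (\<integral>\<^sup>+x. p \<tau> x \<partial>Mx) \<partial>lborel) = (\<integral>\<^sup>+\<tau>. (\<integral>\<^sup>+x. p \<tau> x * indicator A \<tau> \<partial>Mx) \<partial>lborel)"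
    using 2 by (intro nn_integral_cong) (simp add: nn_integral_multc)
  also have "\<dots> = (\<integral>\<^sup>+z. p (snd z) (fst z) * indicator A (snd z) \<partial>(Mx \<Otimes>\<^sub>M lborel))"
    using nn_integral_snd[OF 1] by simp
  finally show ?thesis .
qed

text \<open>Where |u| \<le> m the truncated functions agree with the full ones, so the integrals
  over this set are bounded by \<open>R\<close>; monotone convergence lets \<open>m\<close> grow.
  The integrals may be infinite a priori.\<close>

lemma truncation_limit:
  assumes A: "admissible h F \<Phi>" and l: "\<And>v. l \<le> \<bar>v\<bar> \<Longrightarrow> h v = 1" and c: "0 \<le> c"
    and R: "\<And>m. 0 \<le> m \<Longrightarrow> l \<le> m \<Longrightarrow>
      (\<integral>\<^sup>+x. ennreal (\<phi> x * (\<Phi> (u t x) - rampP m (m + 1) (u t x))) \<partial>Mx)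
      + (\<integral>\<^sup>+\<tau>\<in>{s..t}. (\<integral>\<^sup>+x. ennreal (c * (w \<tau> x * (h (u \<tau> x) - rampD m (m + 1) (u \<tau> x)))) \<partial>Mx) \<partial>lborel) \<le> R"
  shows "(\<integral>\<^sup>+x. ennreal (\<phi> x * \<Phi> (u t x)) \<partial>Mx)
      + (\<integral>\<^sup>+\<tau>\<in>{s..t}. (\<integral>\<^sup>+x. ennreal (c * (w \<tau> x * h (u \<tau> x))) \<partial>Mx) \<partial>lborel) \<le> R"
proof -
  note D = admissibleD[OF A]
  note [measurable] = D(9-11)
  have [measurable]: "rampD m (m + 1) \<in> borel_measurable borel" "rampP m (m + 1) \<in> borel_measurable borel" if "0 \<le> m" for m
    using admissibleD[OF admissible_ramp[of m "m + 1"]] that by auto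
  define X where "X m = (\<integral>\<^sup>+x. ennreal (\<phi> x * \<Phi> (u t x)) * indicator {y. \<bar>y\<bar> \<le> real m} (u t x) \<partial>Mx)" for m
  define Y where "Y m = (\<integral>\<^sup>+z. (ennreal (c * (w (snd z) (fst z) * h (u (snd z) (fst z)))) * indicator {s..t} (snd z))
      * indicator {y. \<bar>y\<bar> \<le> real m} (u (snd z) (fst z)) \<partial>(Mx \<Otimes>\<^sub>M lborel))" for m
  have 1: "X \<longlonglongrightarrow> (\<integral>\<^sup>+x. ennreal (\<phi> x * \<Phi> (u t x)) \<partial>Mx)"
    unfolding X_def by (rule nn_integral_truncation_LIMSEQ) measurable
  have 2: "Y \<longlonglongrightarrow> (\<integral>\<^sup>+z. ennreal (c * (w (snd z) (fst z) * h (u (snd z) (fst z)))) * indicator {s..t} (snd z) \<partial>(Mx \<Otimes>\<^sub>M lborel))"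
    unfolding Y_def by (rule nn_integral_truncation_LIMSEQ) measurable
  have 3: "(\<integral>\<^sup>+\<tau>\<in>{s..t}. (\<integral>\<^sup>+x. ennreal (c * (w \<tau> x * h (u \<tau> x))) \<partial>Mx) \<partial>lborel)
    = (\<integral>\<^sup>+z. ennreal (c * (w (snd z) (fst z) * h (u (snd z) (fst z)))) * indicator {s..t} (snd z) \<partial>(Mx \<Otimes>\<^sub>M lborel))"
    by (rule II_eq) measurable
  have le: "X m + Y m \<le> R" if m: "nat \<lceil>max l 0\<rceil> \<le> m" for m
  proof -
    have m': "0 \<le> real m" "l \<le> real m" using m by linarith+
    note T = admissible_truncate[OF A l m']
    have "X m \<le> (\<integral>\<^sup>+x. ennreal (\<phi> x * (\<Phi> (u t x) - rampP m (real m + 1) (u t x))) \<partial>Mx)"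
      unfolding X_def
    proof (rule nn_integral_mono)
      fix x assume "x \<in> space Mx"
      show "ennreal (\<phi> x * \<Phi> (u t x)) * indicator {y. \<bar>y\<bar> \<le> real m} (u t x)
        \<le> ennreal (\<phi> x * (\<Phi> (u t x) - rampP m (real m + 1) (u t x)))"
        using T(3)[of "u t x"] by (cases "\<bar>u t x\<bar> \<le> real m") auto
    qed
    moreover have "Y m \<le> (\<integral>\<^sup>+\<tau>\<in>{s..t}. (\<integral>\<^sup>+x. ennreal (c * (w \<tau> x * (h (u \<tau> x) - rampD m (real m + 1) (u \<tau> x)))) \<partial>Mx) \<partial>lborel)"
    proof -
      have "Y m \<le> (\<integral>\<^sup>+z. ennreal (c * (w (snd z) (fst z) * (h (u (snd z) (fst z)) - rampD m (real m + 1) (u (snd z) (fst z)))))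
          * indicator {s..t} (snd z) \<partial>(Mx \<Otimes>\<^sub>M lborel))"
        unfolding Y_def
      proof (rule nn_integral_mono)
        fix z :: "'x \<times> real" assume "z \<in> space (Mx \<Otimes>\<^sub>M lborel)"
        show "ennreal (c * (w (snd z) (fst z) * h (u (snd z) (fst z)))) * indicator {s..t} (snd z)
            * indicator {y. \<bar>y\<bar> \<le> real m} (u (snd z) (fst z))
          \<le> ennreal (c * (w (snd z) (fst z) * (h (u (snd z) (fst z)) - rampD m (real m + 1) (u (snd z) (fst z))))) * indicator {s..t} (snd z)"
          using T(3)[of "u (snd z) (fst z)"] by (cases "\<bar>u (snd z) (fst z)\<bar> \<le> real m") auto
      qed
      also have "\<dots> = (\<integral>\<^sup>+\<tau>\<in>{s..t}. (\<integral>\<^sup>+x. ennreal (c * (w \<tau> x * (h (u \<tau> x) - rampD m (real m + 1) (u \<tau> x)))) \<partial>Mx) \<partial>lborel)"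
        using m' by (intro II_eq[symmetric]) measurable
      finally show ?thesis .
    qed
    ultimately have "X m + Y m \<le> (\<integral>\<^sup>+x. ennreal (\<phi> x * (\<Phi> (u t x) - rampP m (real m + 1) (u t x))) \<partial>Mx)
      + (\<integral>\<^sup>+\<tau>\<in>{s..t}. (\<integral>\<^sup>+x. ennreal (c * (w \<tau> x * (h (u \<tau> x) - rampD m (real m + 1) (u \<tau> x)))) \<partial>Mx) \<partial>lborel)"
      by (rule add_mono)
    also have "\<dots> \<le> R" by (rule R[OF m'])
    finally show ?thesis .
  qed
  have "(\<lambda>m. X m + Y m) \<longlonglongrightarrow> (\<integral>\<^sup>+x. ennreal (\<phi> x * \<Phi> (u t x)) \<partial>Mx)
      + (\<integral>\<^sup>+\<tau>\<in>{s..t}. (\<integral>\<^sup>+x. ennreal (c * (w \<tau> x * h (u \<tau> x))) \<partial>Mx) \<partial>lborel)"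
    unfolding 3 by (intro tendsto_add 1 2)
  thus ?thesis by (rule LIMSEQ_le_const2) (use le in blast)
qed

text \<open>The truncated functions lie below the full ones, so the right-hand side is bounded
  independently of the truncation before the limit on the left is taken.\<close>

lemma energy_cutoff:
  assumes A: "admissible h F \<Phi>" and l: "\<And>v. l \<le> \<bar>v\<bar> \<Longrightarrow> h v = 1" and st: "0 < s" "s < t"
  shows "(\<integral>\<^sup>+x. ennreal (\<phi> x * \<Phi> (u t x)) \<partial>Mx)
      + (\<integral>\<^sup>+\<tau>\<in>{s..t}. (\<integral>\<^sup>+x. ennreal (1/8 * (w \<tau> x * h (u \<tau> x))) \<partial>Mx) \<partial>lborel)
    \<le> (\<integral>\<^sup>+x. ennreal (\<phi> x * \<Phi> (u s x)) \<partial>Mx)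
      + (\<integral>\<^sup>+\<tau>\<in>{s..t}. (\<integral>\<^sup>+x. ennreal (f \<tau> x * h (u \<tau> x) + \<phi> x * \<psi> \<tau> x * \<bar>F (u \<tau> x)\<bar>) \<partial>Mx) \<partial>lborel)"
proof (rule truncation_limit[OF A l])
  fix m :: real assume m: "0 \<le> m" "l \<le> m"
  note T = admissible_truncate[OF A l m]
  let ?h = "\<lambda>u. h u - rampD m (m + 1) u" and ?F = "\<lambda>u. F u - rampF m (m + 1) u"
    and ?\<Phi> = "\<lambda>u. \<Phi> u - rampP m (m + 1) u"
  have "(\<integral>\<^sup>+x. ennreal (\<phi> x * ?\<Phi> (u t x)) \<partial>Mx) + (\<integral>\<^sup>+\<tau>\<in>{s..t}. (\<integral>\<^sup>+x. ennreal (1/8 * (w \<tau> x * ?h (u \<tau> x))) \<partial>Mx) \<partial>lborel)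
      \<le> (\<integral>\<^sup>+x. ennreal (\<phi> x * ?\<Phi> (u s x)) \<partial>Mx)
        + (\<integral>\<^sup>+\<tau>\<in>{s..t}. (\<integral>\<^sup>+x. ennreal (f \<tau> x * ?h (u \<tau> x) + \<phi> x * \<psi> \<tau> x * \<bar>?F (u \<tau> x)\<bar>) \<partial>Mx) \<partial>lborel)"
    using energy_bounded[OF T(1,2) st, THEN conjunct2] by simp
  also have "\<dots> \<le> (\<integral>\<^sup>+x. ennreal (\<phi> x * \<Phi> (u s x)) \<partial>Mx)
      + (\<integral>\<^sup>+\<tau>\<in>{s..t}. (\<integral>\<^sup>+x. ennreal (f \<tau> x * h (u \<tau> x) + \<phi> x * \<psi> \<tau> x * \<bar>F (u \<tau> x)\<bar>) \<partial>Mx) \<partial>lborel)"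
  proof (intro add_mono nn_integral_mono mult_right_mono ennreal_leI mult_left_mono T(4-6))
    fix x assume "x \<in> space Mx"
    thus "0 \<le> \<phi> x" "0 \<le> f \<tau> x" "0 \<le> \<phi> x * \<psi> \<tau> x" for \<tau> using \<phi>_pos[of x] nonneg by auto
  qed auto
  finally show "(\<integral>\<^sup>+x. ennreal (\<phi> x * ?\<Phi> (u t x)) \<partial>Mx) + (\<integral>\<^sup>+\<tau>\<in>{s..t}. (\<integral>\<^sup>+x. ennreal (1/8 * (w \<tau> x * ?h (u \<tau> x))) \<partial>Mx) \<partial>lborel)
    \<le> \<dots>" .
qed auto

text \<open>The constant of Young's inequality with exponents 2 - a and (2 - a) / (1 - a), scaled
  such that 1/16 of the dissipation pays for the term with \<psi>; the summand 1 is for the term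
  with \<open>f\<close>.\<close>

definition "C1 = 1 + (16 powr (1 / (2 - a)) * c1) powr ((2 - a) / (1 - a))"

text \<open>Cauchy-Schwarz splits the term with \<psi> into the norm of \<psi>, at most
  g^((1-a)/(2-a)), and the norm of F(u), which the weighted inequality bounds by the power 1/(2-a)
  of the dissipation. These two powers add up to 1, so Young's inequality gives a bound linear in
  the dissipation and in \<open>g\<close>.\<close>

lemma source_absorption:
  assumes A: "admissible h F \<Phi>"
  shows "AE \<tau> in lborel. 0 < \<tau> \<longrightarrow>
    (\<integral>\<^sup>+x. ennreal (f \<tau> x * h (u \<tau> x) + \<phi> x * \<psi> \<tau> x * \<bar>F (u \<tau> x)\<bar>) \<partial>Mx)
    \<le> (\<integral>\<^sup>+x. ennreal (1/16 * (w \<tau> x * h (u \<tau> x))) \<partial>Mx) + ennreal (C1 * g \<tau>)"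
  using sobolev[OF A]
proof eventually_elim
  case (elim \<tau>)
  note D = admissibleD[OF A]
  note [measurable] = D(9-11)
  let ?D = "\<integral>\<^sup>+x. ennreal (w \<tau> x * h (u \<tau> x)) \<partial>Mx"
  have D16: "(\<integral>\<^sup>+x. ennreal (1/16 * (w \<tau> x * h (u \<tau> x))) \<partial>Mx) = ennreal (1/16) * ?D"
    using nonneg D by (subst nn_integral_cmult[symmetric]) (auto simp flip: ennreal_mult intro!: nn_integral_cong)
  show ?case
  proof
    assume \<tau>: "0 < \<tau>"
    show "(\<integral>\<^sup>+x. ennreal (f \<tau> x * h (u \<tau> x) + \<phi> x * \<psi> \<tau> x * \<bar>F (u \<tau> x)\<bar>) \<partial>Mx)
      \<le> (\<integral>\<^sup>+x. ennreal (1/16 * (w \<tau> x * h (u \<tau> x))) \<partial>Mx) + ennreal (C1 * g \<tau>)"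
    proof (cases "?D = \<infinity>")
      case True thus ?thesis unfolding D16 by (simp add: ennreal_mult_eq_top_iff)
    next
      case False
      define d where "d = enn2real ?D"
      have d: "?D = ennreal d" "0 \<le> d" using False by (auto simp: d_def less_top)
      define p where "p = 2 - a" define q where "q = (2 - a) / (1 - a)"
      have pq: "1 < p" "1 < q" "1 / p + 1 / q = 1" using params by (auto simp: p_def q_def field_simps)
      have g: "1 \<le> g \<tau>" using source(1) \<tau> by simp
      have fF: "(\<integral>\<^sup>+x. ennreal (\<phi> x * (F (u \<tau> x))\<^sup>2) \<partial>Mx) \<le> ennreal ((c1 * d powr (1 / (2 - a)))\<^sup>2)"
        using elim \<tau> d by auto
      have "(\<integral>\<^sup>+x. ennreal ((sqrt (\<phi> x) * \<psi> \<tau> x) * (sqrt (\<phi> x) * \<bar>F (u \<tau> x)\<bar>)) \<partial>Mx)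
        \<le> ennreal ((g \<tau> powr (2 * (1 - a) / (2 - a))) powr (1 / 2) * ((c1 * d powr (1 / (2 - a)))\<^sup>2) powr (1 / 2))"
      proof (rule nn_integral_Holder)
        have "(\<integral>\<^sup>+x. ennreal ((sqrt (\<phi> x) * \<psi> \<tau> x) powr 2) \<partial>Mx) = (\<integral>\<^sup>+x. ennreal (\<phi> x * (\<psi> \<tau> x)\<^sup>2) \<partial>Mx)"
          using \<phi>_pos nonneg by (intro nn_integral_cong) (simp add: power_mult_distrib less_imp_le)
        thus "(\<integral>\<^sup>+x. ennreal ((sqrt (\<phi> x) * \<psi> \<tau> x) powr 2) \<partial>Mx) \<le> ennreal (g \<tau> powr (2 * (1 - a) / (2 - a)))"
          using source(3)[of \<tau>] \<tau> by simp
        have "(\<integral>\<^sup>+x. ennreal ((sqrt (\<phi> x) * \<bar>F (u \<tau> x)\<bar>) powr 2) \<partial>Mx) = (\<integral>\<^sup>+x. ennreal (\<phi> x * (F (u \<tau> x))\<^sup>2) \<partial>Mx)"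
          using \<phi>_pos by (intro nn_integral_cong) (simp add: power_mult_distrib less_imp_le)
        thus "(\<integral>\<^sup>+x. ennreal ((sqrt (\<phi> x) * \<bar>F (u \<tau> x)\<bar>) powr 2) \<partial>Mx) \<le> ennreal ((c1 * d powr (1 / (2 - a)))\<^sup>2)"
          using fF by simp
      qed (use \<phi>_pos nonneg in \<open>auto simp: less_imp_le\<close>)
      also have "(g \<tau> powr (2 * (1 - a) / (2 - a))) powr (1 / 2) = g \<tau> powr (1 / q)"
      proof -
        have "2 * (1 - a) / (2 - a) * (1 / 2) = 1 / q" using params by (simp add: q_def divide_simps) (simp add: algebra_simps)
        thus ?thesis by (simp only: powr_powr)
      qed
      also have "((c1 * d powr (1 / (2 - a)))\<^sup>2) powr (1 / 2) = c1 * d powr (1 / p)"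
        using params by (simp add: powr_half_sqrt p_def)
      also have "ennreal (g \<tau> powr (1 / q) * (c1 * d powr (1 / p))) \<le> ennreal (d / 16 + (C1 - 1) * g \<tau>)"
      proof (rule ennreal_leI)
        have "(d / 16) powr (1 / p) * (16 powr (1 / p) * c1 * g \<tau> powr (1 / q))
          \<le> ((d / 16) powr (1 / p)) powr p / p + (16 powr (1 / p) * c1 * g \<tau> powr (1 / q)) powr q / q"
          using pq d params by (intro Youngs_inequality) auto
        also have "((d / 16) powr (1 / p)) powr p = d / 16" using pq d by (simp add: powr_powr)
        also have "(16 powr (1 / p) * c1 * g \<tau> powr (1 / q)) powr q = (C1 - 1) * g \<tau>"
          using pq params g by (simp add: powr_mult powr_powr C1_def p_def q_def)
        also have "(d / 16) / p + ((C1 - 1) * g \<tau>) / q \<le> d / 16 + (C1 - 1) * g \<tau>"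
        proof (rule add_mono)
          show "(d / 16) / p \<le> d / 16" using pq d by (simp add: divide_le_eq mult_le_cancel_left1)
          have "0 \<le> (C1 - 1) * g \<tau>" using g by (simp add: C1_def)
          thus "(C1 - 1) * g \<tau> / q \<le> (C1 - 1) * g \<tau>" using pq by (simp add: divide_le_eq mult_le_cancel_left1)
        qed
        also have "(d / 16) powr (1 / p) * (16 powr (1 / p) * c1 * g \<tau> powr (1 / q)) = g \<tau> powr (1 / q) * (c1 * d powr (1 / p))"
          using d by (simp add: powr_divide)
        finally show "g \<tau> powr (1 / q) * (c1 * d powr (1 / p)) \<le> d / 16 + (C1 - 1) * g \<tau>" .
      qed
      finally have A: "(\<integral>\<^sup>+x. ennreal ((sqrt (\<phi> x) * \<psi> \<tau> x) * (sqrt (\<phi> x) * \<bar>F (u \<tau> x)\<bar>)) \<partial>Mx)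
        \<le> ennreal (d / 16 + (C1 - 1) * g \<tau>)" .
      have psi: "(\<integral>\<^sup>+x. ennreal (\<phi> x * \<psi> \<tau> x * \<bar>F (u \<tau> x)\<bar>) \<partial>Mx) \<le> ennreal (d / 16 + (C1 - 1) * g \<tau>)"
      proof -
        have "(\<integral>\<^sup>+x. ennreal ((sqrt (\<phi> x) * \<psi> \<tau> x) * (sqrt (\<phi> x) * \<bar>F (u \<tau> x)\<bar>)) \<partial>Mx)
          = (\<integral>\<^sup>+x. ennreal (\<phi> x * \<psi> \<tau> x * \<bar>F (u \<tau> x)\<bar>) \<partial>Mx)"
        proof (rule nn_integral_cong)
          fix x assume "x \<in> space Mx"
          hence "sqrt (\<phi> x) * sqrt (\<phi> x) = \<phi> x" using \<phi>_pos[of x] by simp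
          hence "(sqrt (\<phi> x) * \<psi> \<tau> x) * (sqrt (\<phi> x) * \<bar>F (u \<tau> x)\<bar>) = \<phi> x * \<psi> \<tau> x * \<bar>F (u \<tau> x)\<bar>"
            by (metis mult.assoc mult.left_commute)
          thus "ennreal ((sqrt (\<phi> x) * \<psi> \<tau> x) * (sqrt (\<phi> x) * \<bar>F (u \<tau> x)\<bar>)) = ennreal (\<phi> x * \<psi> \<tau> x * \<bar>F (u \<tau> x)\<bar>)"
            by (simp only:)
        qed
        thus ?thesis using A by simp
      qed
      have fh: "(\<integral>\<^sup>+x. ennreal (f \<tau> x * h (u \<tau> x)) \<partial>Mx) \<le> ennreal (g \<tau>)"
      proof -
        have "(\<integral>\<^sup>+x. ennreal (f \<tau> x * h (u \<tau> x)) \<partial>Mx) \<le> (\<integral>\<^sup>+x. ennreal (f \<tau> x) \<partial>Mx)"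
          using nonneg D by (intro nn_integral_mono ennreal_leI mult_left_le) auto
        also have "\<dots> \<le> ennreal (g \<tau>)" using source(2) \<tau> by simp
        finally show ?thesis .
      qed
      have "(\<integral>\<^sup>+x. ennreal (f \<tau> x * h (u \<tau> x) + \<phi> x * \<psi> \<tau> x * \<bar>F (u \<tau> x)\<bar>) \<partial>Mx)
        = (\<integral>\<^sup>+x. ennreal (f \<tau> x * h (u \<tau> x)) + ennreal (\<phi> x * \<psi> \<tau> x * \<bar>F (u \<tau> x)\<bar>) \<partial>Mx)"
        using nonneg D \<phi>_pos by (intro nn_integral_cong ennreal_plus) (auto simp: less_imp_le)
      also have "\<dots> = (\<integral>\<^sup>+x. ennreal (f \<tau> x * h (u \<tau> x)) \<partial>Mx) + (\<integral>\<^sup>+x. ennreal (\<phi> x * \<psi> \<tau> x * \<bar>F (u \<tau> x)\<bar>) \<partial>Mx)"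
        by (rule nn_integral_add) measurable
      also have "\<dots> \<le> ennreal (g \<tau>) + ennreal (d / 16 + (C1 - 1) * g \<tau>)" by (rule add_mono[OF fh psi])
      also have "\<dots> = ennreal (g \<tau> + (d / 16 + (C1 - 1) * g \<tau>))"
        using g d by (intro ennreal_plus[symmetric]) (auto simp: C1_def)
      also have "g \<tau> + (d / 16 + (C1 - 1) * g \<tau>) = d / 16 + C1 * g \<tau>" by (simp add: algebra_simps)
      also have "ennreal \<dots> = ennreal (1/16) * ?D + ennreal (C1 * g \<tau>)"
        using d g by (simp add: ennreal_plus C1_def flip: ennreal_mult)
      finally show ?thesis unfolding D16 .
    qed
  qed
qed

lemma C1_ge_1: "1 \<le> C1" by (simp add: C1_def)

text \<open>Absorbing 1/16 of the dissipation into the 1/8 on the left requires it to be finite.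
  This is known for truncated functions, so the cancellation precedes the limit. The majorant
  \<open>gh\<close> serves the integration in time, since \<open>g\<close> is not assumed to be
  measurable.\<close>

lemma energy_L2:
  assumes st: "0 < s" "s < t" and [measurable]: "gh \<in> borel_measurable borel"
    and G: "\<And>\<tau>. \<tau> \<in> {s..t} \<Longrightarrow> g \<tau> \<le> gh \<tau>"
  shows "(\<integral>\<^sup>+x. ennreal (\<phi> x * ((u t x)\<^sup>2 / 2)) \<partial>Mx) + (\<integral>\<^sup>+\<tau>\<in>{s..t}. (\<integral>\<^sup>+x. ennreal (1/16 * (w \<tau> x * 1)) \<partial>Mx) \<partial>lborel)
    \<le> (\<integral>\<^sup>+x. ennreal (\<phi> x * ((u s x)\<^sup>2 / 2)) \<partial>Mx) + (\<integral>\<^sup>+\<tau>\<in>{s..t}. ennreal (C1 * gh \<tau>) \<partial>lborel)"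
proof (rule truncation_limit[OF admissible_id, of 0])
  fix m :: real assume m: "0 \<le> m"
  note T = admissible_truncate[OF admissible_id refl m m]
  let ?h = "\<lambda>u. 1 - rampD m (m + 1) u" and ?F = "\<lambda>u. u - rampF m (m + 1) u"
    and ?\<Phi> = "\<lambda>u. u\<^sup>2 / 2 - rampP m (m + 1) u"
  note D = admissibleD[OF T(1)]
  note [measurable] = D(9-11)
  define X where "X = (\<integral>\<^sup>+\<tau>\<in>{s..t}. (\<integral>\<^sup>+x. ennreal (w \<tau> x * ?h (u \<tau> x)) \<partial>Mx) \<partial>lborel)"
  have E: "X < \<infinity>"
    "(\<integral>\<^sup>+x. ennreal (\<phi> x * ?\<Phi> (u t x)) \<partial>Mx) + (\<integral>\<^sup>+\<tau>\<in>{s..t}. (\<integral>\<^sup>+x. ennreal (w \<tau> x * ?h (u \<tau> x) / 8) \<partial>Mx) \<partial>lborel)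
      \<le> (\<integral>\<^sup>+x. ennreal (\<phi> x * ?\<Phi> (u s x)) \<partial>Mx)
        + (\<integral>\<^sup>+\<tau>\<in>{s..t}. (\<integral>\<^sup>+x. ennreal (f \<tau> x * ?h (u \<tau> x) + \<phi> x * \<psi> \<tau> x * \<bar>?F (u \<tau> x)\<bar>) \<partial>Mx) \<partial>lborel)"
    using energy_bounded[OF T(1,2) st] unfolding X_def by auto
  have scale: "(\<integral>\<^sup>+\<tau>\<in>{s..t}. (\<integral>\<^sup>+x. ennreal (c * (w \<tau> x * ?h (u \<tau> x))) \<partial>Mx) \<partial>lborel) = ennreal c * X" if "0 \<le> c" for c
  proof -
    have "(\<integral>\<^sup>+x. ennreal (c * (w \<tau> x * ?h (u \<tau> x))) \<partial>Mx) = ennreal c * (\<integral>\<^sup>+x. ennreal (w \<tau> x * ?h (u \<tau> x)) \<partial>Mx)" for \<tau>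
      using that nonneg D by (subst nn_integral_cmult[symmetric]) (auto simp flip: ennreal_mult intro!: nn_integral_cong)
    thus ?thesis unfolding X_def by (subst nn_integral_cmult[symmetric]) (auto simp: mult.assoc)
  qed
  obtain \<xi> where \<xi>: "X = ennreal \<xi>" "0 \<le> \<xi>" using E(1) by (cases X) auto
  have src: "(\<integral>\<^sup>+\<tau>\<in>{s..t}. (\<integral>\<^sup>+x. ennreal (f \<tau> x * ?h (u \<tau> x) + \<phi> x * \<psi> \<tau> x * \<bar>?F (u \<tau> x)\<bar>) \<partial>Mx) \<partial>lborel)
    \<le> (\<integral>\<^sup>+\<tau>\<in>{s..t}. (\<integral>\<^sup>+x. ennreal (1/16 * (w \<tau> x * ?h (u \<tau> x))) \<partial>Mx) + ennreal (C1 * gh \<tau>) \<partial>lborel)"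
  proof (rule nn_integral_mono_AE)
    show "AE \<tau> in lborel. (\<integral>\<^sup>+x. ennreal (f \<tau> x * ?h (u \<tau> x) + \<phi> x * \<psi> \<tau> x * \<bar>?F (u \<tau> x)\<bar>) \<partial>Mx) * indicator {s..t} \<tau>
       \<le> ((\<integral>\<^sup>+x. ennreal (1/16 * (w \<tau> x * ?h (u \<tau> x))) \<partial>Mx) + ennreal (C1 * gh \<tau>)) * indicator {s..t} \<tau>"
      using source_absorption[OF T(1)]
    proof eventually_elim
      case (elim \<tau>)
      show ?case
      proof (cases "\<tau> \<in> {s..t}")
        case True
        hence "ennreal (C1 * g \<tau>) \<le> ennreal (C1 * gh \<tau>)"
          using G C1_ge_1 by (intro ennreal_leI mult_left_mono) auto
        with elim True st show ?thesis by (auto intro: order_trans add_left_mono)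
      qed simp
    qed
  qed
  also have "\<dots> = (\<integral>\<^sup>+\<tau>\<in>{s..t}. (\<integral>\<^sup>+x. ennreal (1/16 * (w \<tau> x * ?h (u \<tau> x))) \<partial>Mx) \<partial>lborel) + (\<integral>\<^sup>+\<tau>\<in>{s..t}. ennreal (C1 * gh \<tau>) \<partial>lborel)"
    by (subst nn_integral_add[symmetric]) (auto simp: distrib_right)
  also have "\<dots> = ennreal (\<xi> / 16) + (\<integral>\<^sup>+\<tau>\<in>{s..t}. ennreal (C1 * gh \<tau>) \<partial>lborel)"
    using \<xi> by (subst scale) (auto simp flip: ennreal_mult)
  finally have "(\<integral>\<^sup>+x. ennreal (\<phi> x * ?\<Phi> (u t x)) \<partial>Mx) + ennreal (\<xi> / 8)
      \<le> (\<integral>\<^sup>+x. ennreal (\<phi> x * ?\<Phi> (u s x)) \<partial>Mx) + (ennreal (\<xi> / 16) + (\<integral>\<^sup>+\<tau>\<in>{s..t}. ennreal (C1 * gh \<tau>) \<partial>lborel))"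
    using E(2) scale[of "1/8"] \<xi> by (auto simp flip: ennreal_mult intro: order_trans add_left_mono)
  hence "ennreal (\<xi> / 16) + ((\<integral>\<^sup>+x. ennreal (\<phi> x * ?\<Phi> (u t x)) \<partial>Mx) + ennreal (\<xi> / 16))
      \<le> ennreal (\<xi> / 16) + ((\<integral>\<^sup>+x. ennreal (\<phi> x * ?\<Phi> (u s x)) \<partial>Mx) + (\<integral>\<^sup>+\<tau>\<in>{s..t}. ennreal (C1 * gh \<tau>) \<partial>lborel))"
  proof -
    have "ennreal (\<xi> / 8) = ennreal (\<xi> / 16) + ennreal (\<xi> / 16)" using \<xi> by (simp flip: ennreal_plus)
    thus ?thesis
      using \<open>(\<integral>\<^sup>+x. ennreal (\<phi> x * ?\<Phi> (u t x)) \<partial>Mx) + ennreal (\<xi> / 8) \<le> _\<close> by (simp add: ac_simps)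
  qed
  hence "(\<integral>\<^sup>+x. ennreal (\<phi> x * ?\<Phi> (u t x)) \<partial>Mx) + ennreal (\<xi> / 16)
      \<le> (\<integral>\<^sup>+x. ennreal (\<phi> x * ?\<Phi> (u s x)) \<partial>Mx) + (\<integral>\<^sup>+\<tau>\<in>{s..t}. ennreal (C1 * gh \<tau>) \<partial>lborel)"
    by (simp add: ennreal_add_left_cancel_le)
  also have "\<dots> \<le> (\<integral>\<^sup>+x. ennreal (\<phi> x * ((u s x)\<^sup>2 / 2)) \<partial>Mx) + (\<integral>\<^sup>+\<tau>\<in>{s..t}. ennreal (C1 * gh \<tau>) \<partial>lborel)"
  proof (intro add_right_mono nn_integral_mono ennreal_leI mult_left_mono T(6))
    fix x assume "x \<in> space Mx" thus "0 \<le> \<phi> x" using \<phi>_pos[of x] by simp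
  qed
  finally show "(\<integral>\<^sup>+x. ennreal (\<phi> x * ?\<Phi> (u t x)) \<partial>Mx)
      + (\<integral>\<^sup>+\<tau>\<in>{s..t}. (\<integral>\<^sup>+x. ennreal (1/16 * (w \<tau> x * ?h (u \<tau> x))) \<partial>Mx) \<partial>lborel)
    \<le> (\<integral>\<^sup>+x. ennreal (\<phi> x * ((u s x)\<^sup>2 / 2)) \<partial>Mx) + (\<integral>\<^sup>+\<tau>\<in>{s..t}. ennreal (C1 * gh \<tau>) \<partial>lborel)"
    using \<xi> by (subst scale) (auto simp flip: ennreal_mult)
qed auto

text \<open>The weighted inequality with exponent 2 read backwards: a large L^2_\<phi> norm forces a
  large dissipation. The factor 1/16 is the share that \<open>energy_L2\<close> leaves.\<close>

lemma coercivity: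
  "AE \<tau> in lborel. 0 < \<tau> \<longrightarrow> (\<forall>v\<ge>0. ennreal (v\<^sup>2) \<le> (\<integral>\<^sup>+x. ennreal (\<phi> x * (u \<tau> x)\<^sup>2) \<partial>Mx) \<longrightarrow>
    ennreal ((v / c1) powr (2 - a) / 16) \<le> (\<integral>\<^sup>+x. ennreal (1/16 * (w \<tau> x * 1)) \<partial>Mx))"
  using sobolev[OF admissible_id]
proof eventually_elim
  case (elim \<tau>)
  let ?D = "\<integral>\<^sup>+x. ennreal (w \<tau> x * 1) \<partial>Mx"
  have D16: "(\<integral>\<^sup>+x. ennreal (1/16 * (w \<tau> x * 1)) \<partial>Mx) = ennreal (1/16) * ?D"
    using nonneg by (subst nn_integral_cmult[symmetric]) (auto simp flip: ennreal_mult intro!: nn_integral_cong)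
  show ?case
  proof (intro impI allI)
    fix v :: real assume \<tau>: "0 < \<tau>" and v: "0 \<le> v" "ennreal (v\<^sup>2) \<le> (\<integral>\<^sup>+x. ennreal (\<phi> x * (u \<tau> x)\<^sup>2) \<partial>Mx)"
    show "ennreal ((v / c1) powr (2 - a) / 16) \<le> (\<integral>\<^sup>+x. ennreal (1/16 * (w \<tau> x * 1)) \<partial>Mx)"
    proof (cases "?D = \<infinity>")
      case True thus ?thesis unfolding D16 by (simp add: ennreal_mult_eq_top_iff)
    next
      case False
      define d where "d = enn2real ?D"
      have d: "?D = ennreal d" "0 \<le> d" using False by (auto simp: d_def less_top)
      have "(\<integral>\<^sup>+x. ennreal (\<phi> x * (u \<tau> x)\<^sup>2) \<partial>Mx) \<le> ennreal ((c1 * d powr (1 / (2 - a)))\<^sup>2)"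
        using elim \<tau> d by auto
      hence "ennreal (v\<^sup>2) \<le> ennreal ((c1 * d powr (1 / (2 - a)))\<^sup>2)" by (rule order_trans[OF v(2)])
      hence "v\<^sup>2 \<le> (c1 * d powr (1 / (2 - a)))\<^sup>2" by (subst (asm) ennreal_le_iff) auto
      hence "v \<le> c1 * d powr (1 / (2 - a))" by (rule power2_le_imp_le) (use params in auto)
      hence "v / c1 \<le> d powr (1 / (2 - a))" using params by (simp add: pos_divide_le_eq mult.commute)
      hence "(v / c1) powr (2 - a) \<le> (d powr (1 / (2 - a))) powr (2 - a)"
        using v params by (intro powr_mono2) auto
      also have "\<dots> = d" using params d by (simp add: powr_powr)
      finally show ?thesis unfolding D16 d(1) using d(2) by (simp flip: ennreal_mult)
    qed
  qed
qed

section \<open>Growth and decay of the squared L^2_phi norm\<close>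

definition V :: "real \<Rightarrow> ennreal"
  where "V t = (\<integral>\<^sup>+x. ennreal (\<phi> x * (u t x)\<^sup>2) \<partial>Mx)"

lemma V_half: "2 * (\<integral>\<^sup>+x. ennreal (\<phi> x * ((u t x)\<^sup>2 / 2)) \<partial>Mx) = V t"
proof -
  have "2 * (\<integral>\<^sup>+x. ennreal (\<phi> x * ((u t x)\<^sup>2 / 2)) \<partial>Mx) = (\<integral>\<^sup>+x. 2 * ennreal (\<phi> x * ((u t x)\<^sup>2 / 2)) \<partial>Mx)"
    by (rule nn_integral_cmult[symmetric]) measurable
  also have "\<dots> = V t" unfolding V_def
  proof (rule nn_integral_cong)
    fix x assume "x \<in> space Mx"
    have "ennreal 2 * ennreal (\<phi> x * ((u t x)\<^sup>2 / 2)) = ennreal (2 * (\<phi> x * ((u t x)\<^sup>2 / 2)))"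
      by (rule ennreal_mult'[symmetric]) simp
    thus "2 * ennreal (\<phi> x * ((u t x)\<^sup>2 / 2)) = ennreal (\<phi> x * (u t x)\<^sup>2)" by simp
  qed
  finally show ?thesis .
qed

lemma energy_V:
  assumes "0 < s" "s < t" "gh \<in> borel_measurable borel" "\<And>\<tau>. \<tau> \<in> {s..t} \<Longrightarrow> g \<tau> \<le> gh \<tau>"
  shows "V t + 2 * (\<integral>\<^sup>+\<tau>\<in>{s..t}. (\<integral>\<^sup>+x. ennreal (1/16 * (w \<tau> x * 1)) \<partial>Mx) \<partial>lborel)
    \<le> V s + 2 * (\<integral>\<^sup>+\<tau>\<in>{s..t}. ennreal (C1 * gh \<tau>) \<partial>lborel)"
  unfolding V_half[symmetric] distrib_left[symmetric] by (intro mult_left_mono energy_L2 assms) auto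

text \<open>Dropping the dissipation leaves a bound from one side only; the norm may fall at any
  rate.\<close>

lemma V_growth:
  assumes st: "0 < s" "s < t" and G: "\<And>\<tau>. \<tau> \<in> {s..t} \<Longrightarrow> g \<tau> \<le> m" and V: "V s < \<infinity>"
  shows "V t < \<infinity>" "enn2real (V t) \<le> enn2real (V s) + 2 * C1 * m * (t - s)"
proof -
  have m: "1 \<le> m" using source(1)[of s] G[of s] st by simp
  have "V t \<le> V s + 2 * (\<integral>\<^sup>+\<tau>\<in>{s..t}. ennreal (C1 * m) \<partial>lborel)"
    by (rule order_trans[OF _ energy_V[OF st, of "\<lambda>_. m"]]) (use G in auto)
  also have "(\<integral>\<^sup>+\<tau>\<in>{s..t}. ennreal (C1 * m) \<partial>lborel) = ennreal (C1 * m * (t - s))"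
    using st m C1_ge_1 by (simp add: nn_integral_cmult_indicator ennreal_mult)
  also have "2 * \<dots> = ennreal (2 * C1 * m * (t - s))"
    using ennreal_mult'[of 2 "C1 * m * (t - s)"] by (simp add: mult.assoc)
  finally have 1: "V t \<le> V s + ennreal (2 * C1 * m * (t - s))" .
  have nn: "0 \<le> 2 * C1 * m * (t - s)" using st m C1_ge_1 by simp
  obtain b where b: "V s = ennreal b" "0 \<le> b" using V by (cases "V s") auto
  have 2: "V t \<le> ennreal (b + 2 * C1 * m * (t - s))"
    using 1 b nn by (simp add: ennreal_plus)
  show fin: "V t < \<infinity>" using le_less_trans[OF 2] by simp
  then obtain v where v: "V t = ennreal v" "0 \<le> v" by (cases "V t") auto
  have "0 \<le> b + 2 * C1 * m * (t - s)" using b nn by simp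
  hence "v \<le> b + 2 * C1 * m * (t - s)" using 2 v by (simp add: ennreal_le_iff)
  thus "enn2real (V t) \<le> enn2real (V s) + 2 * C1 * m * (t - s)" using v b by simp
qed

text \<open>While the norm is at least \<beta>, coercivity makes the dissipation exceed the source
  \<open>C1 * gh\<close> by \<open>q\<close>, and this surplus is a rate of decrease. \<beta> and
  \<open>q\<close> depend on time so that a barrier can follow \<open>g\<close>. Their bounds are
  required in the open interval, where barrier arguments provide them; the endpoints are null
  sets.\<close>

lemma V_decay:
  assumes st: "0 < s" "s < t" and V: "V s < \<infinity>"
    and [measurable]: "gh \<in> borel_measurable borel" "q \<in> borel_measurable borel"
    and G: "\<And>\<tau>. \<tau> \<in> {s..t} \<Longrightarrow> g \<tau> \<le> gh \<tau>" "\<And>\<tau>. \<tau> \<in> {s..t} \<Longrightarrow> gh \<tau> \<le> m"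
    and \<beta>: "\<And>\<tau>. s < \<tau> \<Longrightarrow> \<tau> < t \<Longrightarrow> 0 \<le> \<beta> \<tau>" "\<And>\<tau>. s < \<tau> \<Longrightarrow> \<tau> < t \<Longrightarrow> (\<beta> \<tau>)\<^sup>2 \<le> enn2real (V \<tau>)"
    and q: "\<And>\<tau>. s < \<tau> \<Longrightarrow> \<tau> < t \<Longrightarrow> 0 \<le> q \<tau>" "\<And>\<tau>. s < \<tau> \<Longrightarrow> \<tau> < t \<Longrightarrow> C1 * gh \<tau> + q \<tau> \<le> (\<beta> \<tau> / c1) powr (2 - a) / 16"
  shows "ennreal (enn2real (V t)) + 2 * (\<integral>\<^sup>+\<tau>\<in>{s<..<t}. ennreal (q \<tau>) \<partial>lborel) \<le> ennreal (enn2real (V s))"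
proof -
  have fin: "V \<tau> < \<infinity>" if "\<tau> \<in> {s..t}" for \<tau>
  proof (cases "\<tau> = s")
    case True thus ?thesis using V by simp
  next
    case False
    have "g \<rho> \<le> m" if "\<rho> \<in> {s..\<tau>}" for \<rho>
      using G[of \<rho>] that \<open>\<tau> \<in> {s..t}\<close> by auto
    thus ?thesis using False \<open>\<tau> \<in> {s..t}\<close> by (intro V_growth(1)[OF st(1) _ _ V]) auto
  qed
  have gpos: "1 \<le> gh \<tau>" if "\<tau> \<in> {s..t}" for \<tau> using G(1)[OF that] source(1)[of \<tau>] that st by auto
  define I where "I = (\<integral>\<^sup>+\<tau>\<in>{s..t}. ennreal (C1 * gh \<tau>) \<partial>lborel)"
  define J where "J = (\<integral>\<^sup>+\<tau>\<in>{s<..<t}. ennreal (q \<tau>) \<partial>lborel)"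
  have IJ: "I + J \<le> (\<integral>\<^sup>+\<tau>\<in>{s..t}. (\<integral>\<^sup>+x. ennreal (1/16 * (w \<tau> x * 1)) \<partial>Mx) \<partial>lborel)"
  proof -
    have "I + J = (\<integral>\<^sup>+\<tau>. ennreal (C1 * gh \<tau>) * indicator {s..t} \<tau> + ennreal (q \<tau>) * indicator {s<..<t} \<tau> \<partial>lborel)"
      unfolding I_def J_def by (rule nn_integral_add[symmetric]) measurable
    also have "\<dots> \<le> (\<integral>\<^sup>+\<tau>\<in>{s..t}. (\<integral>\<^sup>+x. ennreal (1/16 * (w \<tau> x * 1)) \<partial>Mx) \<partial>lborel)"
    proof (rule nn_integral_mono_AE)
      have ne: "AE \<tau> in lborel. \<tau> \<noteq> s \<and> \<tau> \<noteq> t" using AE_lborel_singleton[of s] AE_lborel_singleton[of t] by eventually_elim auto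
      show "AE \<tau> in lborel. ennreal (C1 * gh \<tau>) * indicator {s..t} \<tau> + ennreal (q \<tau>) * indicator {s<..<t} \<tau>
        \<le> (\<integral>\<^sup>+x. ennreal (1/16 * (w \<tau> x * 1)) \<partial>Mx) * indicator {s..t} \<tau>"
        using coercivity ne
      proof eventually_elim
        case (elim \<tau>)
        show ?case
        proof (cases "\<tau> \<in> {s<..<t}")
          case True
          have "ennreal (C1 * gh \<tau>) + ennreal (q \<tau>) = ennreal (C1 * gh \<tau> + q \<tau>)"
            using True q gpos[of \<tau>] C1_ge_1 by (intro ennreal_plus[symmetric]) auto
          also have "\<dots> \<le> ennreal ((\<beta> \<tau> / c1) powr (2 - a) / 16)" using q True by (intro ennreal_leI) auto
          also have "\<dots> \<le> (\<integral>\<^sup>+x. ennreal (1/16 * (w \<tau> x * 1)) \<partial>Mx)"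
          proof -
            have "ennreal ((\<beta> \<tau>)\<^sup>2) \<le> V \<tau>" using \<beta>(2)[of \<tau>] fin[of \<tau>] True
              by (cases "V \<tau>") (auto intro: ennreal_leI)
            thus ?thesis using elim True st \<beta>(1)[of \<tau>] unfolding V_def by auto
          qed
          finally show ?thesis using True by simp
        next
          case False
          hence "\<tau> \<notin> {s..t}" using elim by auto
          thus ?thesis using False by simp
        qed
      qed
    qed
    finally show ?thesis .
  qed
  \<comment> \<open>The source is going to be cancelled from both sides.\<close>
  have Ifin: "I < \<infinity>"
  proof -
    have "I \<le> (\<integral>\<^sup>+\<tau>\<in>{s..t}. ennreal (C1 * m) \<partial>lborel)"
      unfolding I_def using G(2) C1_ge_1 by (intro nn_integral_mono) (auto simp: indicator_def intro!: ennreal_leI mult_left_mono)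
    also have "\<dots> < \<infinity>" using st by (simp add: nn_integral_cmult_indicator ennreal_mult_less_top)
    finally show ?thesis .
  qed
  have "V t + 2 * (I + J) \<le> V t + 2 * (\<integral>\<^sup>+\<tau>\<in>{s..t}. (\<integral>\<^sup>+x. ennreal (1/16 * (w \<tau> x * 1)) \<partial>Mx) \<partial>lborel)"
    by (intro add_left_mono mult_left_mono IJ) simp
  also have "\<dots> \<le> V s + 2 * I" unfolding I_def by (rule energy_V[OF st]) (use G in auto)
  finally have "2 * I + (V t + 2 * J) \<le> 2 * I + V s" by (simp add: ac_simps distrib_left)
  hence "V t + 2 * J \<le> V s" using Ifin by (simp add: ennreal_add_left_cancel_le ennreal_mult_eq_top_iff less_top[symmetric])
  thus ?thesis using fin[of s] fin[of t] st unfolding J_def by (simp add: less_top)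
qed

subsection \<open>The De Giorgi iteration\<close>

abbreviation II :: "real set \<Rightarrow> (real \<Rightarrow> 'x \<Rightarrow> real) \<Rightarrow> ennreal"
  where "II A p \<equiv> (\<integral>\<^sup>+\<tau>\<in>A. (\<integral>\<^sup>+x. ennreal (p \<tau> x) \<partial>Mx) \<partial>lborel)"

lemma II_mono:
  assumes "A \<subseteq> B" "\<And>\<tau> x. \<tau> \<in> A \<Longrightarrow> x \<in> space Mx \<Longrightarrow> p \<tau> x \<le> q \<tau> x"
  shows "II A p \<le> II B q"
proof (rule nn_integral_mono)
  fix \<tau> :: real
  show "(\<integral>\<^sup>+x. ennreal (p \<tau> x) \<partial>Mx) * indicator A \<tau> \<le> (\<integral>\<^sup>+x. ennreal (q \<tau> x) \<partial>Mx) * indicator B \<tau>"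
  proof (cases "\<tau> \<in> A")
    case True
    hence "\<tau> \<in> B" using assms(1) by auto
    thus ?thesis using True assms(2) by (auto intro!: nn_integral_mono ennreal_leI)
  qed simp
qed

lemma II_add:
  assumes [measurable]: "(\<lambda>z. p (snd z) (fst z)) \<in> borel_measurable (Mx \<Otimes>\<^sub>M lborel)"
    "(\<lambda>z. q (snd z) (fst z)) \<in> borel_measurable (Mx \<Otimes>\<^sub>M lborel)" "A \<in> sets borel"
    and nn: "\<And>\<tau> x. x \<in> space Mx \<Longrightarrow> 0 \<le> p \<tau> x" "\<And>\<tau> x. x \<in> space Mx \<Longrightarrow> 0 \<le> q \<tau> x"
  shows "II A (\<lambda>\<tau> x. p \<tau> x + q \<tau> x) = II A p + II A q"
proof -
  have "II A (\<lambda>\<tau> x. p \<tau> x + q \<tau> x) = (\<integral>\<^sup>+z. ennreal (p (snd z) (fst z) + q (snd z) (fst z)) * indicator A (snd z) \<partial>(Mx \<Otimes>\<^sub>M lborel))"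
    by (rule II_eq) measurable
  also have "\<dots> = (\<integral>\<^sup>+z. ennreal (p (snd z) (fst z)) * indicator A (snd z) + ennreal (q (snd z) (fst z)) * indicator A (snd z) \<partial>(Mx \<Otimes>\<^sub>M lborel))"
    using nn by (intro nn_integral_cong) (auto simp: space_pair_measure distrib_right)
  also have "\<dots> = (\<integral>\<^sup>+z. ennreal (p (snd z) (fst z)) * indicator A (snd z) \<partial>(Mx \<Otimes>\<^sub>M lborel))
      + (\<integral>\<^sup>+z. ennreal (q (snd z) (fst z)) * indicator A (snd z) \<partial>(Mx \<Otimes>\<^sub>M lborel))"
    by (rule nn_integral_add) measurable
  also have "\<dots> = II A p + II A q" by (subst (1 2) II_eq) auto
  finally show ?thesis .
qed

lemma II_cmult:
  assumes [measurable]: "(\<lambda>z. p (snd z) (fst z)) \<in> borel_measurable (Mx \<Otimes>\<^sub>M lborel)" "A \<in> sets borel" and c: "0 \<le> c"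
  shows "II A (\<lambda>\<tau> x. c * p \<tau> x) = ennreal c * II A p"
proof -
  have "II A (\<lambda>\<tau> x. c * p \<tau> x) = (\<integral>\<^sup>+z. ennreal (c * p (snd z) (fst z)) * indicator A (snd z) \<partial>(Mx \<Otimes>\<^sub>M lborel))"
    by (rule II_eq) measurable
  also have "\<dots> = (\<integral>\<^sup>+z. ennreal c * (ennreal (p (snd z) (fst z)) * indicator A (snd z)) \<partial>(Mx \<Otimes>\<^sub>M lborel))"
    using c by (intro nn_integral_cong) (simp add: ennreal_mult' mult.assoc)
  also have "\<dots> = ennreal c * (\<integral>\<^sup>+z. ennreal (p (snd z) (fst z)) * indicator A (snd z) \<partial>(Mx \<Otimes>\<^sub>M lborel))"
    by (rule nn_integral_cmult) measurable
  also have "\<dots> = ennreal c * II A p" by (subst II_eq) auto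
  finally show ?thesis .
qed

lemma II_Holder:
  assumes pq: "p > 1" "q > 1" "1 / p + 1 / q = 1"
    and [measurable]: "(\<lambda>z. P (snd z) (fst z)) \<in> borel_measurable (Mx \<Otimes>\<^sub>M lborel)"
    "(\<lambda>z. Q (snd z) (fst z)) \<in> borel_measurable (Mx \<Otimes>\<^sub>M lborel)" "A \<in> sets borel"
    and nn: "\<And>\<tau> x. x \<in> space Mx \<Longrightarrow> 0 \<le> P \<tau> x" "\<And>\<tau> x. x \<in> space Mx \<Longrightarrow> 0 \<le> Q \<tau> x"
    and X: "II A (\<lambda>\<tau> x. P \<tau> x powr p) \<le> ennreal X" "0 \<le> X" and Y: "II A (\<lambda>\<tau> x. Q \<tau> x powr q) \<le> ennreal Y" "0 \<le> Y"
  shows "II A (\<lambda>\<tau> x. P \<tau> x * Q \<tau> x) \<le> ennreal (X powr (1 / p) * Y powr (1 / q))"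
proof -
  have e: "(\<integral>\<^sup>+z. ennreal ((S (snd z) (fst z) * indicator A (snd z)) powr b) \<partial>(Mx \<Otimes>\<^sub>M lborel)) = II A (\<lambda>\<tau> x. S \<tau> x powr b)"
    if [measurable]: "(\<lambda>z. S (snd z) (fst z)) \<in> borel_measurable (Mx \<Otimes>\<^sub>M lborel)" and b: "b > 1" for S :: "real \<Rightarrow> 'x \<Rightarrow> real" and b
  proof -
    have "II A (\<lambda>\<tau> x. S \<tau> x powr b) = (\<integral>\<^sup>+z. ennreal (S (snd z) (fst z) powr b) * indicator A (snd z) \<partial>(Mx \<Otimes>\<^sub>M lborel))"
      by (rule II_eq) measurable
    also have "\<dots> = (\<integral>\<^sup>+z. ennreal ((S (snd z) (fst z) * indicator A (snd z)) powr b) \<partial>(Mx \<Otimes>\<^sub>M lborel))"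
      using b by (intro nn_integral_cong) (auto simp: indicator_def)
    finally show ?thesis by simp
  qed
  have "II A (\<lambda>\<tau> x. P \<tau> x * Q \<tau> x) = (\<integral>\<^sup>+z. ennreal (P (snd z) (fst z) * Q (snd z) (fst z)) * indicator A (snd z) \<partial>(Mx \<Otimes>\<^sub>M lborel))"
    by (rule II_eq) measurable
  also have "\<dots> = (\<integral>\<^sup>+z. ennreal ((P (snd z) (fst z) * indicator A (snd z)) * (Q (snd z) (fst z) * indicator A (snd z))) \<partial>(Mx \<Otimes>\<^sub>M lborel))"
    by (intro nn_integral_cong) (auto simp: indicator_def)
  also have "\<dots> \<le> ennreal (X powr (1 / p) * Y powr (1 / q))"
    by (rule nn_integral_Holder[OF pq]) (use X Y nn pq in \<open>auto simp: e space_pair_measure\<close>)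
  finally show ?thesis .
qed

text \<open>One step of the De Giorgi iteration, from the level \<open>k\<close> and the times \<open>{\<sigma>..t}\<close> to the level
  \<open>k''\<close> and the times \<open>{\<sigma>'..t}\<close>.\<close>

context
  fixes \<sigma> \<sigma>' t k k' k'' Y N r1 :: real
  assumes times: "0 \<le> \<sigma>" "\<sigma> < \<sigma>'" "\<sigma>' < t" and levels: "0 \<le> k" "k < k'" "k' < k''"
    and Y: "0 < Y" "II {\<sigma>..t} (\<lambda>\<tau> x. \<phi> x * (max 0 (\<bar>u \<tau> x\<bar> - k))\<^sup>2) \<le> ennreal Y"
    and r1: "1 < r1" and N: "0 \<le> N"
      "II {\<sigma>..t} (\<lambda>\<tau> x. f \<tau> x powr (r1 / (r1 - 1)) * \<phi> x powr (1 - r1 / (r1 - 1))) \<le> ennreal N"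
      "II {\<sigma>..t} (\<lambda>\<tau> x. \<psi> \<tau> x powr (2 * (r1 / (r1 - 1))) * \<phi> x) \<le> ennreal N"
begin

text \<open>Chebyshev bound for the \<phi>-weighted measure of the set where |u| exceeds
  \<open>k'\<close>.\<close>

definition "Am = Y / (k' - k)\<^sup>2"
text \<open>The first summand is twice the Hoelder bound on that set, once for \<open>f\<close> and
  once for \<psi>^2; \<open>Y\<close> accounts for the square of the test function.\<close>

definition "Src = 2 * (N powr ((r1 - 1) / r1) * Am powr (1 / r1)) + Y"
text \<open>The first summand results from averaging the energy inequality over its initial
  time.\<close>

definition "En = Y / (2 * (\<sigma>' - \<sigma>)) + Src"
definition chi :: "real \<Rightarrow> 'x \<Rightarrow> real" where "chi \<tau> x = indicator {y. k' < y} \<bar>u \<tau> x\<bar>"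

lemma Am_pos: "0 < Am" using Y levels by (simp add: Am_def)
lemma Src_pos: "0 < Src" using Y by (simp add: Src_def add_nonneg_pos)
lemma En_pos: "0 < En" using Y times Src_pos by (simp add: En_def add_nonneg_pos)

lemma chi_measurable [measurable]: "(\<lambda>z. chi (snd z) (fst z)) \<in> borel_measurable (Mx \<Otimes>\<^sub>M lborel)"
  unfolding chi_def by measurable

lemma chi_bound: "II {\<sigma>..t} (\<lambda>\<tau> x. \<phi> x * chi \<tau> x) \<le> ennreal Am"
proof -
  have d: "0 < (k' - k)\<^sup>2" using levels by simp
  have "II {\<sigma>..t} (\<lambda>\<tau> x. \<phi> x * chi \<tau> x)
    \<le> II {\<sigma>..t} (\<lambda>\<tau> x. (1 / (k' - k)\<^sup>2) * (\<phi> x * (max 0 (\<bar>u \<tau> x\<bar> - k))\<^sup>2))"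
  proof (rule II_mono)
    fix \<tau> x assume x: "x \<in> space Mx"
    show "\<phi> x * chi \<tau> x \<le> (1 / (k' - k)\<^sup>2) * (\<phi> x * (max 0 (\<bar>u \<tau> x\<bar> - k))\<^sup>2)"
    proof (cases "k' < \<bar>u \<tau> x\<bar>")
      case True
      have "(k' - k)\<^sup>2 \<le> (max 0 (\<bar>u \<tau> x\<bar> - k))\<^sup>2" using True levels by (intro power_mono) auto
      hence "\<phi> x * (k' - k)\<^sup>2 \<le> \<phi> x * (max 0 (\<bar>u \<tau> x\<bar> - k))\<^sup>2"
        using \<phi>_pos[OF x] by (intro mult_left_mono) auto
      thus ?thesis using d True by (simp add: chi_def field_simps)
    next
      case False thus ?thesis using \<phi>_pos[OF x] by (simp add: chi_def less_imp_le)
    qed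
  qed simp
  also have "\<dots> = ennreal (1 / (k' - k)\<^sup>2) * II {\<sigma>..t} (\<lambda>\<tau> x. \<phi> x * (max 0 (\<bar>u \<tau> x\<bar> - k))\<^sup>2)"
    by (rule II_cmult) auto
  also have "\<dots> \<le> ennreal (1 / (k' - k)\<^sup>2) * ennreal Y" by (rule mult_left_mono[OF Y(2)]) simp
  also have "\<dots> = ennreal Am" using Y by (simp add: Am_def flip: ennreal_mult)
  finally show ?thesis .
qed

text \<open>Hoelder with r_1' and r_1, after inserting the factor \<phi>^(-1/r_1) \<phi>^(1/r_1) =
  1. The power r_1' of \<phi>^(-1/r_1) is the weight \<phi>^(1 - r_1') of \<open>N1\<close>.\<close>

lemma source_f: "II {\<sigma>..t} (\<lambda>\<tau> x. f \<tau> x * chi \<tau> x) \<le> ennreal (N powr ((r1 - 1) / r1) * Am powr (1 / r1))"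
proof -
  define s where "s = r1 / (r1 - 1)"
  have s: "s > 1" "1 / s + 1 / r1 = 1" "1 / s = (r1 - 1) / r1" "1 / r1 * s = s - 1"
    using r1 by (auto simp: s_def field_simps)
  have "II {\<sigma>..t} (\<lambda>\<tau> x. f \<tau> x * chi \<tau> x)
    \<le> II {\<sigma>..t} (\<lambda>\<tau> x. (f \<tau> x * \<phi> x powr (- 1 / r1)) * (\<phi> x powr (1 / r1) * chi \<tau> x))"
  proof (rule II_mono)
    fix \<tau> x assume "x \<in> space Mx"
    hence "\<phi> x powr (- 1 / r1) * \<phi> x powr (1 / r1) = 1" using \<phi>_pos[of x] by (simp flip: powr_add)
    thus "f \<tau> x * chi \<tau> x \<le> (f \<tau> x * \<phi> x powr (- 1 / r1)) * (\<phi> x powr (1 / r1) * chi \<tau> x)"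
      by (metis (no_types, opaque_lifting) mult.assoc mult.commute mult_1 order_refl)
  qed simp
  also have "\<dots> \<le> ennreal (N powr (1 / s) * Am powr (1 / r1))"
  proof (rule II_Holder[OF s(1) r1 s(2)])
    have "II {\<sigma>..t} (\<lambda>\<tau> x. (f \<tau> x * \<phi> x powr (- 1 / r1)) powr s) \<le> II {\<sigma>..t} (\<lambda>\<tau> x. f \<tau> x powr s * \<phi> x powr (1 - s))"
    proof (rule II_mono)
      fix \<tau> x assume x: "x \<in> space Mx"
      have "- 1 / r1 * s = 1 - s" using s(4) by simp
      thus "(f \<tau> x * \<phi> x powr (- 1 / r1)) powr s \<le> f \<tau> x powr s * \<phi> x powr (1 - s)"
        using nonneg(2)[OF x] by (simp only: powr_mult powr_powr powr_ge_zero order_refl)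
    qed simp
    also have "\<dots> \<le> ennreal N" using N(2) by (simp only: s_def)
    finally show "II {\<sigma>..t} (\<lambda>\<tau> x. (f \<tau> x * \<phi> x powr (- 1 / r1)) powr s) \<le> ennreal N" .
    have "II {\<sigma>..t} (\<lambda>\<tau> x. (\<phi> x powr (1 / r1) * chi \<tau> x) powr r1) \<le> II {\<sigma>..t} (\<lambda>\<tau> x. \<phi> x * chi \<tau> x)"
      using r1 \<phi>_pos by (intro II_mono) (auto simp: chi_def indicator_def powr_powr less_imp_le)
    also have "\<dots> \<le> ennreal Am" by (rule chi_bound)
    finally show "II {\<sigma>..t} (\<lambda>\<tau> x. (\<phi> x powr (1 / r1) * chi \<tau> x) powr r1) \<le> ennreal Am" .
  qed (use nonneg N Am_pos in \<open>auto simp: chi_def less_imp_le\<close>)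
  finally show ?thesis by (simp only: s(3))
qed

text \<open>As for \<open>f\<close>, but here the weight \<phi> is at hand and is split into
  \<phi>^(1/r_1') \<phi>^(1/r_1).\<close>

lemma source_psi: "II {\<sigma>..t} (\<lambda>\<tau> x. \<phi> x * (\<psi> \<tau> x)\<^sup>2 * chi \<tau> x) \<le> ennreal (N powr ((r1 - 1) / r1) * Am powr (1 / r1))"
proof -
  define s where "s = r1 / (r1 - 1)"
  have s: "s > 1" "1 / s + 1 / r1 = 1" "1 / s = (r1 - 1) / r1"
    using r1 by (auto simp: s_def field_simps)
  have "II {\<sigma>..t} (\<lambda>\<tau> x. \<phi> x * (\<psi> \<tau> x)\<^sup>2 * chi \<tau> x)
    \<le> II {\<sigma>..t} (\<lambda>\<tau> x. ((\<psi> \<tau> x)\<^sup>2 * \<phi> x powr (1 / s)) * (\<phi> x powr (1 / r1) * chi \<tau> x))"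
  proof (rule II_mono)
    fix \<tau> x assume "x \<in> space Mx"
    hence "\<phi> x powr (1 / s) * \<phi> x powr (1 / r1) = \<phi> x" using \<phi>_pos[of x] s(2) by (simp flip: powr_add)
    thus "\<phi> x * (\<psi> \<tau> x)\<^sup>2 * chi \<tau> x \<le> ((\<psi> \<tau> x)\<^sup>2 * \<phi> x powr (1 / s)) * (\<phi> x powr (1 / r1) * chi \<tau> x)"
      by (metis (no_types, opaque_lifting) mult.assoc mult.commute order_refl)
  qed simp
  also have "\<dots> \<le> ennreal (N powr (1 / s) * Am powr (1 / r1))"
  proof (rule II_Holder[OF s(1) r1 s(2)])
    have "II {\<sigma>..t} (\<lambda>\<tau> x. ((\<psi> \<tau> x)\<^sup>2 * \<phi> x powr (1 / s)) powr s) \<le> II {\<sigma>..t} (\<lambda>\<tau> x. \<psi> \<tau> x powr (2 * s) * \<phi> x)"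
    proof (rule II_mono)
      fix \<tau> x assume x: "x \<in> space Mx"
      have "((\<psi> \<tau> x)\<^sup>2) powr s = \<psi> \<tau> x powr (2 * s)"
        using nonneg(3)[of \<tau> x] s by (cases "\<psi> \<tau> x = 0") (simp_all add: powr_powr flip: powr_numeral)
      thus "((\<psi> \<tau> x)\<^sup>2 * \<phi> x powr (1 / s)) powr s \<le> \<psi> \<tau> x powr (2 * s) * \<phi> x"
        using s(1) \<phi>_pos[OF x] by (simp add: powr_mult powr_powr)
    qed simp
    also have "\<dots> \<le> ennreal N" using N(3) by (simp only: s_def)
    finally show "II {\<sigma>..t} (\<lambda>\<tau> x. ((\<psi> \<tau> x)\<^sup>2 * \<phi> x powr (1 / s)) powr s) \<le> ennreal N" .
    have "II {\<sigma>..t} (\<lambda>\<tau> x. (\<phi> x powr (1 / r1) * chi \<tau> x) powr r1) \<le> II {\<sigma>..t} (\<lambda>\<tau> x. \<phi> x * chi \<tau> x)"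
      using r1 \<phi>_pos by (intro II_mono) (auto simp: chi_def indicator_def powr_powr less_imp_le)
    also have "\<dots> \<le> ennreal Am" by (rule chi_bound)
    finally show "II {\<sigma>..t} (\<lambda>\<tau> x. (\<phi> x powr (1 / r1) * chi \<tau> x) powr r1) \<le> ennreal Am" .
  qed (use nonneg N Am_pos in \<open>auto simp: chi_def less_imp_le\<close>)
  finally show ?thesis by (simp only: s(3))
qed

lemma adm: "admissible (rampD k' k'') (rampF k' k'') (rampP k' k'')"
  using levels by (intro admissible_ramp) auto

lemmas ramp_measurable [measurable] = admissibleD(9-11)[OF adm]
lemmas ramp_b = rampD_bounds[of k' k''] rampF_bounds[of k' k'']

text \<open>Where |u| \<le> \<open>k'\<close> the ramp and its antiderivative vanish. Elsewhere
  \<psi> |F| \<le> \<psi>^2 + F^2, and F^2 is bounded by the squared excess above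
  \<open>k\<close>.\<close>

lemma source_total:
  "II {\<sigma>..t} (\<lambda>\<tau> x. f \<tau> x * rampD k' k'' (u \<tau> x) + \<phi> x * \<psi> \<tau> x * \<bar>rampF k' k'' (u \<tau> x)\<bar>) \<le> ennreal Src"
proof -
  have "II {\<sigma>..t} (\<lambda>\<tau> x. f \<tau> x * rampD k' k'' (u \<tau> x) + \<phi> x * \<psi> \<tau> x * \<bar>rampF k' k'' (u \<tau> x)\<bar>)
    \<le> II {\<sigma>..t} (\<lambda>\<tau> x. (f \<tau> x * chi \<tau> x + \<phi> x * (\<psi> \<tau> x)\<^sup>2 * chi \<tau> x) + \<phi> x * (max 0 (\<bar>u \<tau> x\<bar> - k))\<^sup>2)"
  proof (rule II_mono)
    fix \<tau> x assume x: "x \<in> space Mx"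
    show "f \<tau> x * rampD k' k'' (u \<tau> x) + \<phi> x * \<psi> \<tau> x * \<bar>rampF k' k'' (u \<tau> x)\<bar>
      \<le> (f \<tau> x * chi \<tau> x + \<phi> x * (\<psi> \<tau> x)\<^sup>2 * chi \<tau> x) + \<phi> x * (max 0 (\<bar>u \<tau> x\<bar> - k))\<^sup>2"
    proof (cases "k' < \<bar>u \<tau> x\<bar>")
      case True
      define F where "F = \<bar>rampF k' k'' (u \<tau> x)\<bar>"
      have 1: "f \<tau> x * rampD k' k'' (u \<tau> x) \<le> f \<tau> x"
        using nonneg(2)[OF x, of \<tau>] ramp_b(2)[of "u \<tau> x"] levels by (intro mult_left_le) auto
      have "F \<le> max 0 (\<bar>u \<tau> x\<bar> - k)" using ramp_b(5)[of "u \<tau> x"] levels by (auto simp: F_def)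
      hence F: "F\<^sup>2 \<le> (max 0 (\<bar>u \<tau> x\<bar> - k))\<^sup>2" by (intro power_mono) (auto simp: F_def)
      have "0 \<le> (\<psi> \<tau> x - F)\<^sup>2" by simp
      hence "2 * (\<psi> \<tau> x * F) \<le> (\<psi> \<tau> x)\<^sup>2 + F\<^sup>2" by (simp add: power2_diff algebra_simps)
      moreover have "0 \<le> \<psi> \<tau> x * F" using nonneg(3)[of \<tau> x] by (simp add: F_def)
      ultimately have "\<psi> \<tau> x * F \<le> (\<psi> \<tau> x)\<^sup>2 + (max 0 (\<bar>u \<tau> x\<bar> - k))\<^sup>2" using F by linarith
      hence "\<phi> x * (\<psi> \<tau> x * F) \<le> \<phi> x * ((\<psi> \<tau> x)\<^sup>2 + (max 0 (\<bar>u \<tau> x\<bar> - k))\<^sup>2)"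
        using \<phi>_pos[OF x] by (intro mult_left_mono) auto
      thus ?thesis using 1 True by (simp add: chi_def F_def algebra_simps)
    next
      case False
      thus ?thesis using ramp_b(3,8)[of "u \<tau> x"] levels \<phi>_pos[OF x] by (simp add: chi_def less_imp_le)
    qed
  qed simp
  also have "\<dots> = (II {\<sigma>..t} (\<lambda>\<tau> x. f \<tau> x * chi \<tau> x) + II {\<sigma>..t} (\<lambda>\<tau> x. \<phi> x * (\<psi> \<tau> x)\<^sup>2 * chi \<tau> x))
      + II {\<sigma>..t} (\<lambda>\<tau> x. \<phi> x * (max 0 (\<bar>u \<tau> x\<bar> - k))\<^sup>2)"
    using nonneg \<phi>_pos by (subst II_add, measurable) (auto simp: chi_def less_imp_le II_add)
  also have "\<dots> \<le> (ennreal (N powr ((r1 - 1) / r1) * Am powr (1 / r1)) + ennreal (N powr ((r1 - 1) / r1) * Am powr (1 / r1))) + ennreal Y"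
    by (intro add_mono source_f source_psi Y)
  also have "\<dots> = ennreal Src" using Y by (simp add: Src_def ennreal_plus[symmetric] del: ennreal_plus)
  finally show ?thesis .
qed

text \<open>The energy inequality holds from every initial time \<open>s\<close>. Its average over
  \<open>s\<close> between \<sigma> and \<sigma>' has the time integral of the initial energy on the
  right, which \<open>Y\<close> controls, while no bound at a single time is known.\<close>

lemma energy_averaged:
  assumes \<tau>: "\<sigma>' < \<tau>" "\<tau> \<le> t"
  shows "(\<integral>\<^sup>+x. ennreal (\<phi> x * rampP k' k'' (u \<tau> x)) \<partial>Mx) + II {\<sigma>'..\<tau>} (\<lambda>\<rho> x. 1/8 * (w \<rho> x * rampD k' k'' (u \<rho> x)))
    \<le> ennreal En"
proof -
  define L where "L = (\<integral>\<^sup>+x. ennreal (\<phi> x * rampP k' k'' (u \<tau> x)) \<partial>Mx) + II {\<sigma>'..\<tau>} (\<lambda>\<rho> x. 1/8 * (w \<rho> x * rampD k' k'' (u \<rho> x)))"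
  define q where "q s = (\<integral>\<^sup>+x. ennreal (1/2 * (\<phi> x * (max 0 (\<bar>u s x\<bar> - k))\<^sup>2)) \<partial>Mx)" for s
  define d where "d = \<sigma>' - \<sigma>"
  have d: "0 < d" using times by (simp add: d_def)
  have [measurable]: "q \<in> borel_measurable lborel" unfolding q_def by measurable
  have le: "L \<le> q s + ennreal Src" if s: "\<sigma> < s" "s < \<sigma>'" for s
  proof -
    have st: "0 < s" "s < \<tau>" using s times \<tau> by auto
    have "L \<le> (\<integral>\<^sup>+x. ennreal (\<phi> x * rampP k' k'' (u \<tau> x)) \<partial>Mx) + II {s..\<tau>} (\<lambda>\<rho> x. 1/8 * (w \<rho> x * rampD k' k'' (u \<rho> x)))"
      unfolding L_def using s by (intro add_left_mono II_mono) auto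
    also have "\<dots> \<le> (\<integral>\<^sup>+x. ennreal (\<phi> x * rampP k' k'' (u s x)) \<partial>Mx)
        + II {s..\<tau>} (\<lambda>\<rho> x. f \<rho> x * rampD k' k'' (u \<rho> x) + \<phi> x * \<psi> \<rho> x * \<bar>rampF k' k'' (u \<rho> x)\<bar>)"
      by (rule energy_cutoff[OF adm _ st, of k'']) (use ramp_b levels in auto)
    also have "\<dots> \<le> q s + ennreal Src"
    proof (rule add_mono)
      show "(\<integral>\<^sup>+x. ennreal (\<phi> x * rampP k' k'' (u s x)) \<partial>Mx) \<le> q s"
        unfolding q_def
      proof (intro nn_integral_mono ennreal_leI)
        fix x assume x: "x \<in> space Mx"
        have "rampP k' k'' (u s x) \<le> (max 0 (\<bar>u s x\<bar> - k'))\<^sup>2 / 2" using ramp_b(7) levels by auto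
        also have "\<dots> \<le> (max 0 (\<bar>u s x\<bar> - k))\<^sup>2 / 2" using levels by (intro divide_right_mono power_mono) auto
        finally have "\<phi> x * rampP k' k'' (u s x) \<le> \<phi> x * ((max 0 (\<bar>u s x\<bar> - k))\<^sup>2 / 2)"
          using \<phi>_pos[OF x] by (intro mult_left_mono) auto
        thus "\<phi> x * rampP k' k'' (u s x) \<le> 1/2 * (\<phi> x * (max 0 (\<bar>u s x\<bar> - k))\<^sup>2)" by simp
      qed
      have "II {s..\<tau>} (\<lambda>\<rho> x. f \<rho> x * rampD k' k'' (u \<rho> x) + \<phi> x * \<psi> \<rho> x * \<bar>rampF k' k'' (u \<rho> x)\<bar>)
        \<le> II {\<sigma>..t} (\<lambda>\<rho> x. f \<rho> x * rampD k' k'' (u \<rho> x) + \<phi> x * \<psi> \<rho> x * \<bar>rampF k' k'' (u \<rho> x)\<bar>)"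
        using s \<tau> by (intro II_mono) auto
      also have "\<dots> \<le> ennreal Src" by (rule source_total)
      finally show "II {s..\<tau>} (\<lambda>\<rho> x. f \<rho> x * rampD k' k'' (u \<rho> x) + \<phi> x * \<psi> \<rho> x * \<bar>rampF k' k'' (u \<rho> x)\<bar>) \<le> ennreal Src" .
    qed
    finally show ?thesis .
  qed
  have "L * ennreal d = (\<integral>\<^sup>+s\<in>{\<sigma><..<\<sigma>'}. L \<partial>lborel)"
    using times by (simp add: nn_integral_cmult_indicator d_def)
  also have "\<dots> \<le> (\<integral>\<^sup>+s\<in>{\<sigma><..<\<sigma>'}. (q s + ennreal Src) \<partial>lborel)"
    using le by (intro nn_integral_mono) (auto simp: indicator_def)
  also have "\<dots> = (\<integral>\<^sup>+s\<in>{\<sigma><..<\<sigma>'}. q s \<partial>lborel) + (\<integral>\<^sup>+s\<in>{\<sigma><..<\<sigma>'}. ennreal Src \<partial>lborel)"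
    by (subst nn_integral_add[symmetric]) (auto simp: distrib_right)
  also have "(\<integral>\<^sup>+s\<in>{\<sigma><..<\<sigma>'}. ennreal Src \<partial>lborel) = ennreal (Src * d)"
    using times Src_pos by (simp add: nn_integral_cmult_indicator d_def ennreal_mult)
  also have "(\<integral>\<^sup>+s\<in>{\<sigma><..<\<sigma>'}. q s \<partial>lborel) \<le> II {\<sigma>..t} (\<lambda>s x. 1/2 * (\<phi> x * (max 0 (\<bar>u s x\<bar> - k))\<^sup>2))"
    unfolding q_def using times by (intro II_mono) auto
  also have "\<dots> = ennreal (1/2) * II {\<sigma>..t} (\<lambda>s x. \<phi> x * (max 0 (\<bar>u s x\<bar> - k))\<^sup>2)"
    by (rule II_cmult) auto
  also have "\<dots> \<le> ennreal (1/2) * ennreal Y" by (rule mult_left_mono[OF Y(2)]) simp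
  also have "\<dots> = ennreal (1/2 * Y)" using Y by (intro ennreal_mult[symmetric]) auto
  also have "ennreal (1/2 * Y) + ennreal (Src * d) = ennreal (1/2 * Y + Src * d)"
    using Y Src_pos d by (intro ennreal_plus[symmetric]) auto
  also have "1/2 * Y + Src * d = En * d" using d by (simp add: En_def d_def[symmetric] field_simps)
  also have "ennreal (En * d) = ennreal En * ennreal d" using En_pos d by (intro ennreal_mult) auto
  finally have "ennreal d * L \<le> ennreal d * ennreal En" by (simp add: mult.commute add_right_mono)
  hence "L \<le> ennreal En" using d by (simp add: ennreal_mult_le_mult_iff)
  thus ?thesis by (simp add: L_def)
qed

lemma energy_sup:
  assumes \<tau>: "\<sigma>' < \<tau>" "\<tau> \<le> t"
  shows "(\<integral>\<^sup>+x. ennreal (\<phi> x * (rampF k' k'' (u \<tau> x))\<^sup>2) \<partial>Mx) \<le> ennreal (2 * En)"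
proof -
  have "(\<integral>\<^sup>+x. ennreal (\<phi> x * (rampF k' k'' (u \<tau> x))\<^sup>2) \<partial>Mx) \<le> (\<integral>\<^sup>+x. ennreal 2 * ennreal (\<phi> x * rampP k' k'' (u \<tau> x)) \<partial>Mx)"
  proof (rule nn_integral_mono)
    fix x assume x: "x \<in> space Mx"
    have "(rampF k' k'' (u \<tau> x))\<^sup>2 \<le> 2 * rampP k' k'' (u \<tau> x)" using admissible_sign(3)[OF adm, of "u \<tau> x"] by simp
    hence "\<phi> x * (rampF k' k'' (u \<tau> x))\<^sup>2 \<le> \<phi> x * (2 * rampP k' k'' (u \<tau> x))"
      using \<phi>_pos[OF x] by (intro mult_left_mono) auto
    also have "\<dots> = 2 * (\<phi> x * rampP k' k'' (u \<tau> x))" by simp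
    finally show "ennreal (\<phi> x * (rampF k' k'' (u \<tau> x))\<^sup>2) \<le> ennreal 2 * ennreal (\<phi> x * rampP k' k'' (u \<tau> x))"
      by (subst ennreal_mult'[symmetric]) (auto intro: ennreal_leI)
  qed
  also have "\<dots> = ennreal 2 * (\<integral>\<^sup>+x. ennreal (\<phi> x * rampP k' k'' (u \<tau> x)) \<partial>Mx)"
    by (rule nn_integral_cmult) measurable
  also have "\<dots> \<le> ennreal 2 * ennreal En"
    by (intro mult_left_mono order_trans[OF _ energy_averaged[OF \<tau>]]) auto
  also have "\<dots> = ennreal (2 * En)" using En_pos by (intro ennreal_mult[symmetric]) auto
  finally show ?thesis .
qed

lemma energy_gradient: "II {\<sigma>'..t} (\<lambda>\<rho> x. w \<rho> x * rampD k' k'' (u \<rho> x)) \<le> ennreal (8 * En)"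
proof -
  have "II {\<sigma>'..t} (\<lambda>\<rho> x. w \<rho> x * rampD k' k'' (u \<rho> x))
    = II {\<sigma>'..t} (\<lambda>\<rho> x. 8 * (1/8 * (w \<rho> x * rampD k' k'' (u \<rho> x))))" by simp
  also have "\<dots> = ennreal 8 * II {\<sigma>'..t} (\<lambda>\<rho> x. 1/8 * (w \<rho> x * rampD k' k'' (u \<rho> x)))"
    by (rule II_cmult) auto
  also have "\<dots> \<le> ennreal 8 * ennreal En"
    using energy_averaged[of t] times by (intro mult_left_mono order_trans[OF _ energy_averaged[of t]]) auto
  also have "\<dots> = ennreal (8 * En)" using En_pos by (intro ennreal_mult[symmetric]) auto
  finally show ?thesis .
qed

abbreviation "R \<equiv> r0 a r"

lemma R_facts: "2 < R" "R - 2 + a = 2 * ((r - 2 + a) / r)" "0 < r - 2 + a"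
proof -
  show "R - 2 + a = 2 * ((r - 2 + a) / r)" using params by (simp add: r0_def field_simps)
  have "0 < (2 - a) * (1 - 2 / r)" using params by simp
  thus "2 < R" by (simp add: r0_def)
  show "0 < r - 2 + a" using params by simp
qed

definition "Kn = c2 powr (2 - a) * (2 * En) powr ((R - 2 + a) / 2)"

lemma Kn_pos: "0 < Kn" using params En_pos by (simp add: Kn_def)

text \<open>At a fixed time write F^R = F^(2-a) F^(R-2+a). Hoelder with the exponents r / (2 - a)
  and r / (r - 2 + a) separates the L^r_\<phi> norm from the L^2_\<phi> norm, because (R - 2 + a) r
  / (r - 2 + a) = 2. The first factor is the L^r_\<phi> norm to the power 2 - a, hence linear in the
  dissipation and integrable in time; the second is bounded by the supremum of the energy.\<close>

lemma parabolic_sobolev: "II {\<sigma>'..t} (\<lambda>\<tau> x. \<phi> x * \<bar>rampF k' k'' (u \<tau> x)\<bar> powr R) \<le> ennreal (Kn * (8 * En))"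
proof -
  have "AE \<tau> in lborel. (\<integral>\<^sup>+x. ennreal (\<phi> x * \<bar>rampF k' k'' (u \<tau> x)\<bar> powr R) \<partial>Mx) * indicator {\<sigma>'..t} \<tau>
      \<le> ennreal Kn * ((\<integral>\<^sup>+x. ennreal (w \<tau> x * rampD k' k'' (u \<tau> x)) \<partial>Mx) * indicator {\<sigma>'..t} \<tau>)"
    \<comment> \<open>The supremum bound of the energy is available strictly after \<sigma>', so
      this one time is discarded.\<close>
    using sobolev[OF adm] AE_lborel_singleton[of \<sigma>']
  proof eventually_elim
    case (elim \<tau>)
    let ?D = "\<integral>\<^sup>+x. ennreal (w \<tau> x * rampD k' k'' (u \<tau> x)) \<partial>Mx"
    show ?case
    proof (cases "\<tau> \<in> {\<sigma>'..t}")
      case True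
      hence \<tau>: "\<sigma>' < \<tau>" "\<tau> \<le> t" "0 < \<tau>" using elim times by auto
      show ?thesis
      proof (cases "?D = \<infinity>")
        case True
        have "ennreal Kn * top = top" using Kn_pos by (simp add: ennreal_mult_eq_top_iff)
        thus ?thesis using True \<open>\<tau> \<in> {\<sigma>'..t}\<close> by simp
      next
        case False
        define d where "d = enn2real ?D"
        have d: "?D = ennreal d" "0 \<le> d" using False by (auto simp: d_def less_top)
        define F where "F x = \<bar>rampF k' k'' (u \<tau> x)\<bar>" for x
        have Fm [measurable]: "F \<in> borel_measurable Mx" unfolding F_def by measurable
        define p where "p = r / (2 - a)" define q where "q = r / (r - 2 + a)"
        have pq: "1 < p" "1 < q" "1 / p + 1 / q = 1" using params by (auto simp: p_def q_def field_simps)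
        have "1 / q = (r - 2 + a) / r" by (simp add: q_def)
        hence ip: "1 / q = (R - 2 + a) / 2" using R_facts(2)
          by (metis nonzero_mult_div_cancel_left zero_neq_numeral)
        have S: "(\<integral>\<^sup>+x. ennreal (\<phi> x * F x powr r) \<partial>Mx) \<le> ennreal ((c2 * d powr (1 / (2 - a))) powr r)"
          using elim(1) \<tau> d by (auto simp: F_def)
        have "(\<integral>\<^sup>+x. ennreal ((\<phi> x powr (1 / p) * F x powr (2 - a)) * (\<phi> x powr (1 / q) * F x powr (R - 2 + a))) \<partial>Mx)
          \<le> ennreal (((c2 * d powr (1 / (2 - a))) powr r) powr (1 / p) * (2 * En) powr (1 / q))"
        proof (rule nn_integral_Holder[OF pq])
          have "(\<integral>\<^sup>+x. ennreal ((\<phi> x powr (1 / p) * F x powr (2 - a)) powr p) \<partial>Mx) = (\<integral>\<^sup>+x. ennreal (\<phi> x * F x powr r) \<partial>Mx)"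
          proof (rule nn_integral_cong)
            fix x assume "x \<in> space Mx"
            hence "(\<phi> x powr (1 / p) * F x powr (2 - a)) powr p = \<phi> x * F x powr ((2 - a) * p)"
              using \<phi>_pos[of x] pq(1) by (simp add: powr_mult powr_powr)
            moreover have "(2 - a) * p = r" using params by (simp add: p_def)
            ultimately show "ennreal ((\<phi> x powr (1 / p) * F x powr (2 - a)) powr p) = ennreal (\<phi> x * F x powr r)" by simp
          qed
          thus "(\<integral>\<^sup>+x. ennreal ((\<phi> x powr (1 / p) * F x powr (2 - a)) powr p) \<partial>Mx) \<le> ennreal ((c2 * d powr (1 / (2 - a))) powr r)"
            using S by simp
          have "R - 2 + a = 2 * (1 / q)" by (subst ip) simp
          hence e: "(R - 2 + a) * q = 2" using pq(2) by simp
          have "(\<integral>\<^sup>+x. ennreal ((\<phi> x powr (1 / q) * F x powr (R - 2 + a)) powr q) \<partial>Mx) = (\<integral>\<^sup>+x. ennreal (\<phi> x * (rampF k' k'' (u \<tau> x))\<^sup>2) \<partial>Mx)"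
          proof (rule nn_integral_cong)
            fix x assume "x \<in> space Mx"
            hence "(\<phi> x powr (1 / q) * F x powr (R - 2 + a)) powr q = \<phi> x * F x powr ((R - 2 + a) * q)"
              using \<phi>_pos[of x] pq(2) by (simp add: powr_mult powr_powr)
            thus "ennreal ((\<phi> x powr (1 / q) * F x powr (R - 2 + a)) powr q) = ennreal (\<phi> x * (rampF k' k'' (u \<tau> x))\<^sup>2)"
              unfolding e by (simp add: F_def)
          qed
          thus "(\<integral>\<^sup>+x. ennreal ((\<phi> x powr (1 / q) * F x powr (R - 2 + a)) powr q) \<partial>Mx) \<le> ennreal (2 * En)"
            using energy_sup[OF \<tau>(1,2)] by simp
        qed (use En_pos in auto)
        also have "((c2 * d powr (1 / (2 - a))) powr r) powr (1 / p) * (2 * En) powr (1 / q) = Kn * d"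
        proof -
          have "((c2 * d powr (1 / (2 - a))) powr r) powr (1 / p) = c2 powr (2 - a) * d"
            using params d by (simp add: powr_powr p_def powr_mult)
          thus ?thesis by (simp add: Kn_def ip)
        qed
        also have "ennreal (Kn * d) = ennreal Kn * ?D" using Kn_pos d by (simp add: ennreal_mult)
        also have "(\<integral>\<^sup>+x. ennreal ((\<phi> x powr (1 / p) * F x powr (2 - a)) * (\<phi> x powr (1 / q) * F x powr (R - 2 + a))) \<partial>Mx)
          = (\<integral>\<^sup>+x. ennreal (\<phi> x * F x powr R) \<partial>Mx)"
        proof (rule nn_integral_cong)
          fix x assume "x \<in> space Mx"
          hence 1: "\<phi> x powr (1 / p) * \<phi> x powr (1 / q) = \<phi> x" using \<phi>_pos[of x] pq(3) by (simp flip: powr_add)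
          have 2: "F x powr (2 - a) * F x powr (R - 2 + a) = F x powr R" by (simp flip: powr_add)
          have "(\<phi> x powr (1 / p) * F x powr (2 - a)) * (\<phi> x powr (1 / q) * F x powr (R - 2 + a))
            = (\<phi> x powr (1 / p) * \<phi> x powr (1 / q)) * (F x powr (2 - a) * F x powr (R - 2 + a))" by (simp only: mult_ac)
          thus "ennreal ((\<phi> x powr (1 / p) * F x powr (2 - a)) * (\<phi> x powr (1 / q) * F x powr (R - 2 + a))) = ennreal (\<phi> x * F x powr R)"
            by (simp only: 1 2)
        qed
        finally show ?thesis using True by (simp add: F_def)
      qed
    qed simp
  qed
  hence "II {\<sigma>'..t} (\<lambda>\<tau> x. \<phi> x * \<bar>rampF k' k'' (u \<tau> x)\<bar> powr R)
    \<le> (\<integral>\<^sup>+\<tau>. ennreal Kn * ((\<integral>\<^sup>+x. ennreal (w \<tau> x * rampD k' k'' (u \<tau> x)) \<partial>Mx) * indicator {\<sigma>'..t} \<tau>) \<partial>lborel)"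
    by (rule nn_integral_mono_AE)
  also have "\<dots> = ennreal Kn * II {\<sigma>'..t} (\<lambda>\<tau> x. w \<tau> x * rampD k' k'' (u \<tau> x))"
    by (rule nn_integral_cmult) measurable
  also have "\<dots> \<le> ennreal Kn * ennreal (8 * En)" by (rule mult_left_mono[OF energy_gradient]) simp
  also have "\<dots> = ennreal (Kn * (8 * En))" using Kn_pos En_pos by (intro ennreal_mult[symmetric]) auto
  finally show ?thesis .
qed

text \<open>Hoelder with R / 2 and R / (R - 2) trades the integrability gained in
  \<open>parabolic_sobolev\<close> for the power 1 - 2 / R of the measure of the set |u| >
  \<open>k'\<close>, outside which the integrand vanishes.\<close>

lemma degiorgi_step:
  "II {\<sigma>'..t} (\<lambda>\<tau> x. \<phi> x * (max 0 (\<bar>u \<tau> x\<bar> - k''))\<^sup>2)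
    \<le> ennreal ((Kn * (8 * En)) powr (2 / R) * Am powr (1 - 2 / R))"
proof -
  define p where "p = R / 2" define q where "q = R / (R - 2)"
  have pq: "1 < p" "1 < q" "1 / p + 1 / q = 1" using R_facts(1) by (auto simp: p_def q_def field_simps)
  have ip: "1 / p = 2 / R" "1 / q = 1 - 2 / R" using R_facts(1) by (auto simp: p_def q_def field_simps)
  define F where "F \<tau> x = \<bar>rampF k' k'' (u \<tau> x)\<bar>" for \<tau> x
  have Fm [measurable]: "(\<lambda>z. F (snd z) (fst z)) \<in> borel_measurable (Mx \<Otimes>\<^sub>M lborel)" unfolding F_def by measurable
  have "II {\<sigma>'..t} (\<lambda>\<tau> x. \<phi> x * (max 0 (\<bar>u \<tau> x\<bar> - k''))\<^sup>2)
    \<le> II {\<sigma>'..t} (\<lambda>\<tau> x. (\<phi> x powr (1 / p) * (F \<tau> x)\<^sup>2) * (\<phi> x powr (1 / q) * chi \<tau> x))"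
  proof (rule II_mono)
    fix \<tau> x assume x: "x \<in> space Mx"
    show "\<phi> x * (max 0 (\<bar>u \<tau> x\<bar> - k''))\<^sup>2 \<le> (\<phi> x powr (1 / p) * (F \<tau> x)\<^sup>2) * (\<phi> x powr (1 / q) * chi \<tau> x)"
    proof (cases "k' < \<bar>u \<tau> x\<bar>")
      case True
      have 1: "\<phi> x powr (1 / p) * \<phi> x powr (1 / q) = \<phi> x" using \<phi>_pos[OF x] pq(3) by (simp flip: powr_add)
      have "(max 0 (\<bar>u \<tau> x\<bar> - k''))\<^sup>2 \<le> (F \<tau> x)\<^sup>2"
        unfolding F_def using ramp_b(6)[of "u \<tau> x"] levels by (intro power_mono) auto
      hence "\<phi> x * (max 0 (\<bar>u \<tau> x\<bar> - k''))\<^sup>2 \<le> \<phi> x * (F \<tau> x)\<^sup>2" using \<phi>_pos[OF x] by (intro mult_left_mono) auto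
      also have "\<dots> = (\<phi> x powr (1 / p) * \<phi> x powr (1 / q)) * (F \<tau> x)\<^sup>2" by (simp only: 1)
      finally show ?thesis using True by (simp add: chi_def mult_ac)
    next
      case False
      thus ?thesis using levels \<phi>_pos[OF x] by (simp add: chi_def)
    qed
  qed simp
  also have "\<dots> \<le> ennreal ((Kn * (8 * En)) powr (1 / p) * Am powr (1 / q))"
  proof (rule II_Holder[OF pq])
    have "II {\<sigma>'..t} (\<lambda>\<tau> x. (\<phi> x powr (1 / p) * (F \<tau> x)\<^sup>2) powr p) \<le> II {\<sigma>'..t} (\<lambda>\<tau> x. \<phi> x * F \<tau> x powr R)"
    proof (rule II_mono)
      fix \<tau> x assume x: "x \<in> space Mx"
      have "((F \<tau> x)\<^sup>2) powr p = F \<tau> x powr R"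
      proof (cases "F \<tau> x = 0")
        case False
        moreover have "0 \<le> F \<tau> x" by (simp add: F_def)
        ultimately show ?thesis by (simp add: p_def powr_powr flip: powr_numeral)
      qed simp
      thus "(\<phi> x powr (1 / p) * (F \<tau> x)\<^sup>2) powr p \<le> \<phi> x * F \<tau> x powr R"
        using \<phi>_pos[OF x] pq(1) by (simp add: powr_mult powr_powr)
    qed simp
    also have "\<dots> \<le> ennreal (Kn * (8 * En))" unfolding F_def by (rule parabolic_sobolev)
    finally show "II {\<sigma>'..t} (\<lambda>\<tau> x. (\<phi> x powr (1 / p) * (F \<tau> x)\<^sup>2) powr p) \<le> ennreal (Kn * (8 * En))" .
    have "II {\<sigma>'..t} (\<lambda>\<tau> x. (\<phi> x powr (1 / q) * chi \<tau> x) powr q) \<le> II {\<sigma>..t} (\<lambda>\<tau> x. \<phi> x * chi \<tau> x)"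
      using pq(2) \<phi>_pos times by (intro II_mono) (auto simp: chi_def indicator_def powr_powr less_imp_le)
    also have "\<dots> \<le> ennreal Am" by (rule chi_bound)
    finally show "II {\<sigma>'..t} (\<lambda>\<tau> x. (\<phi> x powr (1 / q) * chi \<tau> x) powr q) \<le> ennreal Am" .
  qed (use Am_pos Kn_pos En_pos in \<open>auto simp: chi_def less_imp_le\<close>)
  finally show ?thesis by (simp only: ip)
qed

end

text \<open>The times increase to t - T / 2 and the levels to \<open>k\<close>, with gaps that are
  halved in each step. The excess tends to 0, so after t - T / 2 the value \<open>k\<close> is
  exceeded on a null set only.\<close>

lemma degiorgi_bound:
  assumes closes: "iteration_closes a r r1 c2 C \<rho>"
    and r1: "1 < r1"
    and T: "0 < T" "T \<le> 1" "T \<le> t" and N: "1 \<le> N" and Z: "1 \<le> Z"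
    and V: "\<And>\<tau>. t - T < \<tau> \<Longrightarrow> \<tau> \<le> t \<Longrightarrow> V \<tau> \<le> ennreal (Z\<^sup>2)"
    and NB: "II {t - T..t} (\<lambda>\<tau> x. f \<tau> x powr (r1 / (r1 - 1)) * \<phi> x powr (1 - r1 / (r1 - 1))) \<le> ennreal N"
      "II {t - T..t} (\<lambda>\<tau> x. \<psi> \<tau> x powr (2 * (r1 / (r1 - 1))) * \<phi> x) \<le> ennreal N"
    and k: "k = C * T powr (- kappa3 a r r1) * N powr kappa2 a r r1 * Z powr nu2 a r"
  shows "AE z in Mx \<Otimes>\<^sub>M lborel. t - T / 2 < snd z \<longrightarrow> snd z < t \<longrightarrow> \<bar>u (snd z) (fst z)\<bar> \<le> k"
proof -
  note C = closes[unfolded iteration_closes_def, THEN conjunct1]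
  have \<rho>: "0 < \<rho>" "\<rho> < 1" using closes by (auto simp: iteration_closes_def)
  note step = closes[unfolded iteration_closes_def, THEN conjunct2, THEN conjunct2, THEN conjunct2, rule_format]
  have k0: "0 < k" using C T N Z by (simp add: k)
  define \<sigma> where "\<sigma> i = t - T + (T / 2) * (1 - 1 / 2 ^ i)" for i :: nat
  define K where "K i = k * (1 - 1 / 2 ^ i)" for i :: nat
  have pw: "0 < (1::real) / 2 ^ i" "(1::real) / 2 ^ i \<le> 1" for i :: nat by auto
  have \<sigma>0: "t - T \<le> \<sigma> i" "\<sigma> i < t - T / 2" for i
  proof -
    have "0 \<le> (T / 2) * (1 - 1 / 2 ^ i)" using T pw[of i] by (intro mult_nonneg_nonneg) auto
    thus "t - T \<le> \<sigma> i" by (simp add: \<sigma>_def)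
    have "(T / 2) * (1 - 1 / 2 ^ i) < (T / 2) * 1" using T by (intro mult_strict_left_mono) auto
    moreover have "T / 2 * 1 = T - T / 2" by simp
    ultimately show "\<sigma> i < t - T / 2" unfolding \<sigma>_def by linarith
  qed
  have \<sigma>S: "\<sigma> (Suc i) - \<sigma> i = T / 2 ^ (i + 2)" for i by (simp add: \<sigma>_def field_simps)
  have K0: "0 \<le> K i" "K i \<le> k" for i
    using k0 pw[of i] by (auto simp: K_def intro!: mult_nonneg_nonneg mult_left_le)
  \<comment> \<open>The gap is twice k / 2^(i+2), which leaves equal room below and above the
    intermediate level of the step.\<close>
  have KS: "K (Suc i) = K i + 2 * (k / 2 ^ (i + 2))" for i by (simp add: K_def field_simps)
  have claim: "II {\<sigma> i..t} (\<lambda>\<tau> x. \<phi> x * (max 0 (\<bar>u \<tau> x\<bar> - K i))\<^sup>2) \<le> ennreal (T * Z\<^sup>2 * \<rho> ^ i)" for i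
  proof (induction i)
    case 0
    \<comment> \<open>At level 0 the excess is the integral of the squared L^2_\<phi> norm over a
      time interval of length \<open>T\<close>.\<close>
    have "II {\<sigma> 0..t} (\<lambda>\<tau> x. \<phi> x * (max 0 (\<bar>u \<tau> x\<bar> - K 0))\<^sup>2) = (\<integral>\<^sup>+\<tau>\<in>{t - T..t}. V \<tau> \<partial>lborel)"
      by (simp add: \<sigma>_def K_def V_def)
    also have "\<dots> \<le> (\<integral>\<^sup>+\<tau>\<in>{t - T..t}. ennreal (Z\<^sup>2) \<partial>lborel)"
    proof (rule nn_integral_mono_AE)
      show "AE \<tau> in lborel. V \<tau> * indicator {t - T..t} \<tau> \<le> ennreal (Z\<^sup>2) * indicator {t - T..t} \<tau>"
        using AE_lborel_singleton[of "t - T"] by eventually_elim (auto simp: indicator_def intro!: V)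
    qed
    also have "\<dots> = ennreal (T * Z\<^sup>2)"
      using T by (simp add: nn_integral_cmult_indicator ennreal_mult mult.commute)
    finally show ?case by simp
  next
    case (Suc i)
    define Y where "Y = T * Z\<^sup>2 * \<rho> ^ i"
    define k' where "k' = K i + k / 2 ^ (i + 2)"
    have Y0: "0 < Y" using T Z \<rho> by (simp add: Y_def)
    have kd: "0 < k / 2 ^ (i + 2)" using k0 by simp
    have sub: "{\<sigma> i..t} \<subseteq> {t - T..t}" using \<sigma>0[of i] by auto
    have s1: "0 \<le> \<sigma> i" using \<sigma>0(1)[of i] T by simp
    have s2: "\<sigma> i < \<sigma> (Suc i)" using \<sigma>S[of i] T by (smt (verit) divide_pos_pos zero_less_power)
    have s3: "\<sigma> (Suc i) < t" using \<sigma>0(2)[of "Suc i"] T by simp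
    have l: "K i < k'" "k' < K (Suc i)" using kd KS[of i] by (auto simp: k'_def)
    have N0: "0 \<le> N" using N by simp
    have n1: "II {\<sigma> i..t} (\<lambda>\<tau> x. f \<tau> x powr (r1 / (r1 - 1)) * \<phi> x powr (1 - r1 / (r1 - 1))) \<le> ennreal N"
      by (rule order_trans[OF II_mono NB(1)]) (use sub in auto)
    have n2: "II {\<sigma> i..t} (\<lambda>\<tau> x. \<psi> \<tau> x powr (2 * (r1 / (r1 - 1))) * \<phi> x) \<le> ennreal N"
      by (rule order_trans[OF II_mono NB(2)]) (use sub in auto)
    define A where "A = Y / (k' - K i)\<^sup>2"
    define E where "E = Y / (2 * (\<sigma> (Suc i) - \<sigma> i)) + (2 * (N powr ((r1 - 1) / r1) * A powr (1 / r1)) + Y)"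
    note args = s1 s2 s3 K0(1) l Y0 Suc.IH[folded Y_def] r1 N0 n1 n2
    have "II {\<sigma> (Suc i)..t} (\<lambda>\<tau> x. \<phi> x * (max 0 (\<bar>u \<tau> x\<bar> - K (Suc i)))\<^sup>2)
      \<le> ennreal ((c2 powr (2 - a) * (2 * E) powr ((r0 a r - 2 + a) / 2) * (8 * E)) powr (2 / r0 a r) * A powr (1 - 2 / r0 a r))"
      using degiorgi_step[OF args]
      unfolding Kn_def[OF args] En_def[OF args] Src_def[OF args] Am_def[OF args] A_def E_def .
    also have "\<dots> \<le> ennreal (T * Z\<^sup>2 * \<rho> ^ Suc i)"
      by (intro ennreal_leI step[OF T(1,2) N Z k Y_def]) (simp_all add: A_def E_def \<sigma>S k'_def)
    finally show ?case .
  qed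
  define X where "X = II {t - T / 2..t} (\<lambda>\<tau> x. \<phi> x * (max 0 (\<bar>u \<tau> x\<bar> - k))\<^sup>2)"
  have "X \<le> ennreal (T * Z\<^sup>2 * \<rho> ^ i)" for i
  proof -
    have "X \<le> II {\<sigma> i..t} (\<lambda>\<tau> x. \<phi> x * (max 0 (\<bar>u \<tau> x\<bar> - K i))\<^sup>2)"
      unfolding X_def
    proof (rule II_mono)
      show "{t - T / 2..t} \<subseteq> {\<sigma> i..t}" using \<sigma>0(2)[of i] by auto
      fix \<tau> x assume "x \<in> space Mx"
      thus "\<phi> x * (max 0 (\<bar>u \<tau> x\<bar> - k))\<^sup>2 \<le> \<phi> x * (max 0 (\<bar>u \<tau> x\<bar> - K i))\<^sup>2"
        using \<phi>_pos[of x] K0(2)[of i] by (intro mult_left_mono power_mono) auto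
    qed
    thus ?thesis using claim[of i] by (rule order_trans)
  qed
  moreover have "(\<lambda>i. ennreal (T * Z\<^sup>2 * \<rho> ^ i)) \<longlonglongrightarrow> ennreal (T * Z\<^sup>2 * 0)"
    using \<rho> by (intro tendsto_ennrealI tendsto_mult tendsto_const LIMSEQ_power_zero) auto
  ultimately have "X \<le> ennreal (T * Z\<^sup>2 * 0)" by (intro LIMSEQ_le_const) auto
  hence "X = 0" by simp
  hence "(\<integral>\<^sup>+z. ennreal (\<phi> (fst z) * (max 0 (\<bar>u (snd z) (fst z)\<bar> - k))\<^sup>2) * indicator {t - T / 2..t} (snd z) \<partial>(Mx \<Otimes>\<^sub>M lborel)) = 0"
    unfolding X_def by (subst (asm) II_eq) auto
  hence "AE z in Mx \<Otimes>\<^sub>M lborel. ennreal (\<phi> (fst z) * (max 0 (\<bar>u (snd z) (fst z)\<bar> - k))\<^sup>2) * indicator {t - T / 2..t} (snd z) = 0"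
    by (subst (asm) nn_integral_0_iff_AE) auto
  moreover have "AE z in Mx \<Otimes>\<^sub>M lborel. fst z \<in> space Mx" by (rule AE_I2) (auto simp: space_pair_measure)
  ultimately show ?thesis
  proof eventually_elim
    case (elim z)
    show ?case
    proof (intro impI)
      assume "t - T / 2 < snd z" "snd z < t"
      hence "\<phi> (fst z) * (max 0 (\<bar>u (snd z) (fst z)\<bar> - k))\<^sup>2 \<le> 0" using elim by (simp add: ennreal_eq_0_iff)
      hence "(max 0 (\<bar>u (snd z) (fst z)\<bar> - k))\<^sup>2 \<le> 0" using \<phi>_pos[of "fst z"] elim by (simp add: mult_le_0_iff)
      thus "\<bar>u (snd z) (fst z)\<bar> \<le> k" by simp
    qed
  qed
qed

end

text \<open>The energy inequality starts at positive times, so the initial datum enters by a bound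
  at small positive times. \<open>y0\<close> stands for the squared initial norm; the 3 and the 1
  leave room for the convergence to the initial values.\<close>

locale energy_flow_initial = energy_flow +
  fixes y0 :: real and Mf :: "real \<Rightarrow> real"
  assumes initial: "\<exists>\<delta>>0. \<forall>s. 0 < s \<longrightarrow> s < \<delta> \<longrightarrow> V s \<le> ennreal (3 * y0 + 1)"
    and y0_nonneg: "0 \<le> y0"
    and source_le: "\<And>t \<tau>. 0 \<le> \<tau> \<Longrightarrow> \<tau> \<le> t \<Longrightarrow> g \<tau> \<le> Mf t"
begin

section \<open>Bounds on the L^2_phi norm by comparison\<close>

definition v :: "real \<Rightarrow> real" where "v t = enn2real (V t)"

lemma V_finite: assumes t: "0 < t" shows "V t < \<infinity>"
proof -
  obtain \<delta> where d: "0 < \<delta>" "\<And>s. 0 < s \<Longrightarrow> s < \<delta> \<Longrightarrow> V s \<le> ennreal (3 * y0 + 1)"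
    using initial by blast
  define s where "s = min (\<delta> / 2) (t / 2)"
  have s: "0 < s" "s < t" "s < \<delta>" using d t by (auto simp: s_def)
  have "V s < \<infinity>" using le_less_trans[OF d(2)[OF s(1,3)]] by simp
  thus ?thesis using s source_le by (intro V_growth(1)[OF s(1,2), of "Mf t"]) auto
qed

lemma V_eq: "0 < t \<Longrightarrow> V t = ennreal (v t)" using V_finite[of t] by (simp add: v_def less_top)

lemma v_growth:
  assumes "0 < s" "s < t" "\<And>\<tau>. \<tau> \<in> {s..t} \<Longrightarrow> g \<tau> \<le> m"
  shows "v t \<le> v s + 2 * C1 * m * (t - s)"
  unfolding v_def using V_growth(2)[OF assms V_finite] assms by simp

lemma v_decay:
  assumes st: "0 < s" "s < t" and m: "\<And>\<tau>. \<tau> \<in> {s..t} \<Longrightarrow> g \<tau> \<le> m"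
    and \<beta>: "0 \<le> \<beta>" "\<And>\<tau>. s < \<tau> \<Longrightarrow> \<tau> < t \<Longrightarrow> \<beta>\<^sup>2 \<le> v \<tau>"
    and q: "0 \<le> q" "C1 * m + q \<le> (\<beta> / c1) powr (2 - a) / 16"
  shows "v t \<le> v s - 2 * q * (t - s)"
proof -
  have "ennreal (v t) + 2 * (\<integral>\<^sup>+\<tau>\<in>{s<..<t}. ennreal q \<partial>lborel) \<le> ennreal (v s)"
    unfolding v_def by (rule V_decay[OF st V_finite[OF st(1)], of "\<lambda>_. m" "\<lambda>_. q" m "\<lambda>_. \<beta>"])
      (use m \<beta> q in \<open>auto simp: v_def\<close>)
  also have "2 * (\<integral>\<^sup>+\<tau>\<in>{s<..<t}. ennreal q \<partial>lborel) = ennreal (2 * (q * (t - s)))"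
    using st q ennreal_mult'[of 2 "q * (t - s)"] by (simp add: nn_integral_cmult_indicator ennreal_mult)
  also have "2 * (q * (t - s)) = 2 * q * (t - s)" by simp
  finally have "ennreal (v t + 2 * q * (t - s)) \<le> ennreal (v s)"
    using st q by (simp add: v_def ennreal_plus)
  hence "v t + 2 * q * (t - s) \<le> v s" by (subst (asm) ennreal_le_iff) (auto simp: v_def)
  thus ?thesis by simp
qed

text \<open>Chosen so that at the norm Lc m^(1/(2-a)) the coercive term is (C1 + 1) m, which beats
  the source C1 m by m.\<close>

definition "Lc = c1 * (16 * (C1 + 1)) powr (1 / (2 - a))"

lemma Lc_pos: "0 < Lc" using params C1_ge_1 by (simp add: Lc_def)

lemma Lc_threshold:
  assumes "0 \<le> m" shows "(Lc * m powr (1 / (2 - a)) / c1) powr (2 - a) / 16 = C1 * m + m"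
proof -
  have "(Lc * m powr (1 / (2 - a)) / c1) powr (2 - a) = 16 * (C1 + 1) * m"
    using params C1_ge_1 assms by (simp add: Lc_def powr_mult powr_powr)
  thus ?thesis by (simp add: algebra_simps)
qed

text \<open>The barrier is the sum of the initial bound and of the level above which dissipation
  exceeds the source. It starts above \<open>v\<close>, and \<open>v\<close> decreases where it is
  larger than the barrier.\<close>

lemma v_bound_initial:
  assumes t: "0 < t"
  shows "v t \<le> 3 * y0 + 1 + (Lc * Mf t powr (1 / (2 - a)))\<^sup>2"
proof -
  obtain \<delta> where d: "0 < \<delta>" "\<And>s. 0 < s \<Longrightarrow> s < \<delta> \<Longrightarrow> V s \<le> ennreal (3 * y0 + 1)"
    using initial by blast
  define s where "s = min (\<delta> / 2) (t / 2)"
  have s: "0 < s" "s < t" "s < \<delta>" using d t by (auto simp: s_def)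
  define m where "m = Mf t"
  have m1: "1 \<le> m" using source(1)[of t] source_le[of t t] t by (simp add: m_def)
  have gm: "g \<tau> \<le> m" if "0 < \<tau>" "\<tau> \<le> t" for \<tau> using source_le[of \<tau> t] that by (simp add: m_def)
  define \<beta> where "\<beta> = Lc * m powr (1 / (2 - a))"
  have \<beta>: "0 \<le> \<beta>" using Lc_pos by (simp add: \<beta>_def)
  define z where "z \<tau> = v \<tau> - (3 * y0 + 1 + \<beta>\<^sup>2)" for \<tau>
  have "z t \<le> 0"
  proof (rule barrier_stays[of s t z "2 * C1 * m" s])
    fix \<sigma> \<rho> assume "s \<le> \<sigma>" "\<sigma> < \<rho>" "\<rho> \<le> t"
    thus "z \<rho> \<le> z \<sigma> + 2 * C1 * m * (\<rho> - \<sigma>)"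
      unfolding z_def using v_growth[of \<sigma> \<rho> m] gm s by auto
  next
    fix \<sigma> \<rho> assume \<sigma>: "s \<le> \<sigma>" "\<sigma> < \<rho>" "\<rho> \<le> t" and z: "\<And>\<tau>. \<sigma> < \<tau> \<Longrightarrow> \<tau> < \<rho> \<Longrightarrow> 0 < z \<tau>"
    have "v \<rho> \<le> v \<sigma> - 2 * m * (\<rho> - \<sigma>)"
    proof (rule v_decay[of _ _ m \<beta>])
      fix \<tau> assume "\<sigma> < \<tau>" "\<tau> < \<rho>"
      thus "\<beta>\<^sup>2 \<le> v \<tau>" using z[of \<tau>] y0_nonneg by (simp add: z_def)
    next
      show "C1 * m + m \<le> (\<beta> / c1) powr (2 - a) / 16" unfolding \<beta>_def using Lc_threshold[of m] m1 by simp
    qed (use \<sigma> s gm \<beta> m1 in auto)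
    moreover have "0 \<le> 2 * m * (\<rho> - \<sigma>)" using m1 \<sigma> by simp
    ultimately show "z \<rho> \<le> z \<sigma>" by (simp add: z_def)
  next
    have "ennreal (v s) \<le> ennreal (3 * y0 + 1)" using d(2)[OF s(1,3)] V_eq[OF s(1)] by simp
    hence "v s \<le> 3 * y0 + 1" using y0_nonneg by (subst (asm) ennreal_le_iff) auto
    thus "z s \<le> 0" by (simp add: z_def add_increasing2)
  qed (use m1 C1_ge_1 s in auto)
  thus ?thesis by (simp add: z_def \<beta>_def m_def)
qed

text \<open>Above the barrier \<open>v\<close> falls at least at the rate 2 m, so the barrier is
  reached within time v T / (2 m) whatever the initial data, and it is not crossed again.\<close>

lemma v_bound_limsup:
  assumes T: "0 < T" "\<And>\<tau>. T \<le> \<tau> \<Longrightarrow> g \<tau> \<le> m"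
  shows "\<exists>T'\<ge>T. \<forall>t\<ge>T'. v t \<le> (Lc * m powr (1 / (2 - a)))\<^sup>2"
proof -
  have m1: "1 \<le> m" using source(1)[of T] T(2)[of T] T(1) by simp
  define \<beta> where "\<beta> = Lc * m powr (1 / (2 - a))"
  have \<beta>: "0 \<le> \<beta>" using Lc_pos by (simp add: \<beta>_def)
  define z where "z \<tau> = v \<tau> - \<beta>\<^sup>2" for \<tau>
  define T' where "T' = T + (v T / (2 * m) + 1)"
  have vT: "0 \<le> v T" by (simp add: v_def)
  have vm: "0 \<le> v T / (2 * m)" using vT m1 by simp
  have "v t \<le> \<beta>\<^sup>2" if t: "T' \<le> t" for t
  proof -
    have "z t \<le> 0"
    proof (rule barrier_reached[of T t z "2 * C1 * m" "2 * m"])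
      fix \<sigma> \<rho> assume "T \<le> \<sigma>" "\<sigma> < \<rho>" "\<rho> \<le> t"
      thus "z \<rho> \<le> z \<sigma> + 2 * C1 * m * (\<rho> - \<sigma>)"
        unfolding z_def using v_growth[of \<sigma> \<rho> m] T by auto
    next
      fix \<sigma> \<rho> assume \<sigma>: "T \<le> \<sigma>" "\<sigma> < \<rho>" "\<rho> \<le> t" and z: "\<And>\<tau>. \<sigma> < \<tau> \<Longrightarrow> \<tau> < \<rho> \<Longrightarrow> 0 < z \<tau>"
      have "v \<rho> \<le> v \<sigma> - 2 * m * (\<rho> - \<sigma>)"
      proof (rule v_decay[of _ _ m \<beta>])
        fix \<tau> assume "\<sigma> < \<tau>" "\<tau> < \<rho>"
        thus "\<beta>\<^sup>2 \<le> v \<tau>" using z[of \<tau>] by (simp add: z_def)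
      next
        show "C1 * m + m \<le> (\<beta> / c1) powr (2 - a) / 16" unfolding \<beta>_def using Lc_threshold[of m] m1 by simp
      qed (use \<sigma> T \<beta> m1 in auto)
      thus "z \<rho> \<le> z \<sigma> - 2 * m * (\<rho> - \<sigma>)" by (simp add: z_def)
    next
      have 1: "v T / (2 * m) \<le> t - T" using t by (simp add: T'_def)
      have "z T \<le> v T" by (simp add: z_def)
      also have "\<dots> \<le> 2 * m * (t - T)" using 1 m1 by (simp add: pos_divide_le_eq mult.commute)
      finally show "z T \<le> 2 * m * (t - T)" .
      show "T < t" using t vm by (simp add: T'_def)
    qed (use m1 C1_ge_1 in auto)
    thus ?thesis by (simp add: z_def)
  qed
  moreover have "T \<le> T'" using vm by (simp add: T'_def)
  ultimately show ?thesis unfolding \<beta>_def by blast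
qed

text \<open>The barrier is \<open>Lc\<^sup>2 (g + Kc b powr p) powr (2 / (2 - a))\<close>, with \<open>p = (2 - a) / (2 (1 - a))\<close> such that
  the derivative of the barrier, of size \<open>b (g + Kc b powr p) powr (a / (2 - a))\<close>, is at most
  linear in \<open>g + Kc b powr p\<close>; the factor \<open>Kc\<close> makes it small.\<close>

definition "Kc = (Lc\<^sup>2 * (2 / (2 - a)) + 1) powr ((2 - a) / (2 * (1 - a)))"

lemma v_bound_slow:
  assumes T: "0 < T" and b: "1 \<le> b"
    and g': "\<And>\<tau>. T \<le> \<tau> \<Longrightarrow> (g has_real_derivative g' \<tau>) (at \<tau>)" "\<And>\<tau>. T \<le> \<tau> \<Longrightarrow> - b \<le> g' \<tau>"
  shows "\<exists>T'\<ge>T. \<forall>t\<ge>T'. v t \<le> (Lc * (g t + Kc * b powr ((2 - a) / (2 * (1 - a)))) powr (1 / (2 - a)))\<^sup>2"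
proof -
  define p where "p = 2 - a"
  have p: "1 < p" "p < 2" "0 < 1 - a" using params by (auto simp: p_def)
  define \<nu> where "\<nu> = Kc * b powr (p / (2 * (1 - a)))"
  have Kc: "1 \<le> Kc" unfolding Kc_def using p by (intro ge_one_powr_ge_zero) (auto simp: p_def)
  have \<nu>: "0 < \<nu>" using Kc b by (simp add: \<nu>_def)
  have g1: "1 \<le> g \<tau>" if "T \<le> \<tau>" for \<tau> using source(1)[of \<tau>] that T by simp
  define W where "W \<tau> = (Lc * (g \<tau> + \<nu>) powr (1 / p))\<^sup>2" for \<tau>
  have W: "W \<tau> = Lc\<^sup>2 * (g \<tau> + \<nu>) powr (2 / p)" if "T \<le> \<tau>" for \<tau>
    using g1[OF that] \<nu> by (simp add: W_def power_mult_distrib powr_power)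
  \<comment> \<open>A bound for the speed at which the barrier \<open>W\<close> can fall.\<close>
  define E where "E \<tau> = Lc\<^sup>2 * (2 / p) * b * (g \<tau> + \<nu>) powr (a / p)" for \<tau>
  \<comment> \<open>Twice \<open>q\<close> exceeds that speed by 1, so \<open>v\<close> minus the
    barrier falls at least at the rate 1 while it is positive.\<close>
  define q where "q \<tau> = (E \<tau> + 1) / 2" for \<tau>
  have E0: "0 \<le> E \<tau>" if "T \<le> \<tau>" for \<tau> using p b by (simp add: E_def)
  have Eb: "E \<tau> \<le> g \<tau> + \<nu>" if \<tau>: "T \<le> \<tau>" for \<tau>
  proof -
    define X where "X = g \<tau> + \<nu>"
    have X: "\<nu> \<le> X" "0 < X" using g1[OF \<tau>] \<nu> by (auto simp: X_def)
    have "(Lc\<^sup>2 * (2 / p) + 1) * b = \<nu> powr (2 * (1 - a) / p)"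
      using p b Kc by (simp add: \<nu>_def Kc_def powr_mult powr_powr p_def[symmetric])
    also have "\<dots> \<le> X powr (2 * (1 - a) / p)" using X \<nu> p by (intro powr_mono2) auto
    finally have 1: "(Lc\<^sup>2 * (2 / p) + 1) * b \<le> X powr (2 * (1 - a) / p)" .
    have "E \<tau> \<le> (Lc\<^sup>2 * (2 / p) + 1) * b * X powr (a / p)"
      using b by (simp add: E_def X_def algebra_simps)
    also have "\<dots> \<le> X powr (2 * (1 - a) / p) * X powr (a / p)" by (intro mult_right_mono 1) simp
    also have "\<dots> = X"
    proof -
      have "2 * (1 - a) / p + a / p = 1" using p by (simp add: add_divide_distrib[symmetric] p_def)
      thus ?thesis using X by (simp only: powr_add[symmetric]) simp
    qed
    finally show ?thesis by (simp add: X_def)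
  qed
  have Wder: "(W has_real_derivative Lc\<^sup>2 * ((2 / p) * (g \<tau> + \<nu>) powr (a / p) * g' \<tau>)) (at \<tau>)" if \<tau>: "T < \<tau>" for \<tau>
  proof -
    have e: "2 / p - 1 = a / p" using p by (simp add: p_def field_simps)
    have "((\<lambda>x. Lc\<^sup>2 * (g x + \<nu>) powr (2 / p)) has_real_derivative Lc\<^sup>2 * ((2 / p) * (g \<tau> + \<nu>) powr (a / p) * g' \<tau>)) (at \<tau>)"
      using g1[of \<tau>] \<nu> \<tau> g'(1)[of \<tau>] e by (auto intro!: derivative_eq_intros)
    thus ?thesis
      by (rule has_field_derivative_transform_within_open[of _ _ _ "{T<..}"]) (use \<tau> W in auto)
  qed
  have gc: "continuous_on {T..} g" using g'(1) by (intro DERIV_continuous_on) (auto intro: has_field_derivative_at_within)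
  have qc: "continuous_on {T..} q"
    unfolding q_def E_def using \<nu> g1 by (intro continuous_intros gc) force+
  define z where "z \<tau> = v \<tau> - W \<tau>" for \<tau>
  have step: "z \<rho> \<le> z \<sigma> - (\<rho> - \<sigma>)" if \<sigma>: "T < \<sigma>" "\<sigma> < \<rho>" and zp: "\<And>\<tau>. \<sigma> < \<tau> \<Longrightarrow> \<tau> < \<rho> \<Longrightarrow> 0 < z \<tau>" for \<sigma> \<rho>
  proof -
    have sub: "{\<sigma>..\<rho>} \<subseteq> {T..}" using \<sigma> by auto
    \<comment> \<open>\<open>g\<close> is known to be continuous after \<open>T\<close> only; the
      indicators make the functions measurable on the whole line.\<close>
    have [measurable]: "(\<lambda>\<tau>. indicator {\<sigma>..\<rho>} \<tau> * g \<tau>) \<in> borel_measurable borel"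
      "(\<lambda>\<tau>. indicator {\<sigma>..\<rho>} \<tau> * q \<tau>) \<in> borel_measurable borel"
      using borel_measurable_continuous_on_indicator[OF _ continuous_on_subset[OF gc sub]]
        borel_measurable_continuous_on_indicator[OF _ continuous_on_subset[OF qc sub]] by simp_all
    have main: "ennreal (v \<rho>) + 2 * (\<integral>\<^sup>+\<tau>\<in>{\<sigma><..<\<rho>}. ennreal (indicator {\<sigma>..\<rho>} \<tau> * q \<tau>) \<partial>lborel) \<le> ennreal (v \<sigma>)"
      unfolding v_def
    proof (rule V_decay[of \<sigma> \<rho> "\<lambda>\<tau>. indicator {\<sigma>..\<rho>} \<tau> * g \<tau>" _ "Mf \<rho>" "\<lambda>\<tau>. Lc * (g \<tau> + \<nu>) powr (1 / p)"])
      fix \<tau> assume \<tau>: "\<sigma> < \<tau>" "\<tau> < \<rho>"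
      hence T\<tau>: "T \<le> \<tau>" using \<sigma> by simp
      show "0 \<le> Lc * (g \<tau> + \<nu>) powr (1 / p)" using Lc_pos by simp
      show "(Lc * (g \<tau> + \<nu>) powr (1 / p))\<^sup>2 \<le> enn2real (V \<tau>)"
        using zp[OF \<tau>] by (simp add: z_def W_def v_def)
      show "0 \<le> indicator {\<sigma>..\<rho>} \<tau> * q \<tau>" using E0[OF T\<tau>] by (simp add: q_def)
      have "C1 * g \<tau> + q \<tau> \<le> C1 * (g \<tau> + \<nu>) + (g \<tau> + \<nu>)"
      proof -
        have "C1 * g \<tau> \<le> C1 * (g \<tau> + \<nu>)" using \<nu> C1_ge_1 by (intro mult_left_mono) auto
        moreover have "q \<tau> \<le> g \<tau> + \<nu>" using Eb[OF T\<tau>] g1[OF T\<tau>] \<nu> by (simp add: q_def)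
        ultimately show ?thesis by simp
      qed
      also have "\<dots> = (Lc * (g \<tau> + \<nu>) powr (1 / p) / c1) powr (2 - a) / 16"
        using Lc_threshold[of "g \<tau> + \<nu>"] g1[OF T\<tau>] \<nu> by (simp add: p_def)
      finally show "C1 * (indicator {\<sigma>..\<rho>} \<tau> * g \<tau>) + indicator {\<sigma>..\<rho>} \<tau> * q \<tau>
        \<le> (Lc * (g \<tau> + \<nu>) powr (1 / p) / c1) powr (2 - a) / 16" using \<tau> by simp
    qed (use \<sigma> T V_finite source_le in auto)
    have qi: "(q has_integral integral {\<sigma>..\<rho>} q) {\<sigma>..\<rho>}"
      by (intro integrable_integral integrable_continuous_interval continuous_on_subset[OF qc sub])
    have q0: "0 \<le> q \<tau>" if "\<tau> \<in> {\<sigma>..\<rho>}" for \<tau> using E0[of \<tau>] that \<sigma> by (simp add: q_def)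
    have Iq: "(\<integral>\<^sup>+\<tau>\<in>{\<sigma><..<\<rho>}. ennreal (indicator {\<sigma>..\<rho>} \<tau> * q \<tau>) \<partial>lborel) = ennreal (integral {\<sigma>..\<rho>} q)"
    proof -
      have "(\<integral>\<^sup>+\<tau>\<in>{\<sigma><..<\<rho>}. ennreal (indicator {\<sigma>..\<rho>} \<tau> * q \<tau>) \<partial>lborel) = (\<integral>\<^sup>+\<tau>. ennreal (indicator {\<sigma>..\<rho>} \<tau> * q \<tau>) \<partial>lborel)"
      proof (rule nn_integral_cong_AE)
        show "AE \<tau> in lborel. ennreal (indicator {\<sigma>..\<rho>} \<tau> * q \<tau>) * indicator {\<sigma><..<\<rho>} \<tau> = ennreal (indicator {\<sigma>..\<rho>} \<tau> * q \<tau>)"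
          using AE_lborel_singleton[of \<sigma>] AE_lborel_singleton[of \<rho>]
          by eventually_elim (auto simp: indicator_def)
      qed
      also have "\<dots> = ennreal (integral {\<sigma>..\<rho>} q)"
      proof (rule nn_integral_has_integral_lborel)
        show "((\<lambda>\<tau>. indicator {\<sigma>..\<rho>} \<tau> * q \<tau>) has_integral integral {\<sigma>..\<rho>} q) UNIV"
        proof -
          have "(\<lambda>\<tau>. indicator {\<sigma>..\<rho>} \<tau> * q \<tau>) = (\<lambda>\<tau>. if \<tau> \<in> {\<sigma>..\<rho>} then q \<tau> else 0)" by (auto simp: fun_eq_iff)
          thus ?thesis using qi by (simp only: has_integral_restrict_UNIV)
        qed
        show "(\<lambda>\<tau>. indicator {\<sigma>..\<rho>} \<tau> * q \<tau>) \<in> borel_measurable borel" by measurable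
        show "0 \<le> indicator {\<sigma>..\<rho>} \<tau> * q \<tau>" for \<tau> using q0 by (auto simp: indicator_def)
      qed
      finally show ?thesis .
    qed
    have Iq0: "0 \<le> integral {\<sigma>..\<rho>} q" using q0 by (intro integral_nonneg has_integral_integrable[OF qi]) auto
    have "ennreal (v \<rho> + 2 * integral {\<sigma>..\<rho>} q) \<le> ennreal (v \<sigma>)"
      using main Iq0 ennreal_mult'[of 2 "integral {\<sigma>..\<rho>} q"] unfolding Iq by (simp add: ennreal_plus v_def)
    hence 1: "v \<rho> + 2 * integral {\<sigma>..\<rho>} q \<le> v \<sigma>" by (subst (asm) ennreal_le_iff) (auto simp: v_def)
    have W': "((\<lambda>\<tau>. Lc\<^sup>2 * ((2 / p) * (g \<tau> + \<nu>) powr (a / p) * g' \<tau>)) has_integral (W \<rho> - W \<sigma>)) {\<sigma>..\<rho>}"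
    proof (rule fundamental_theorem_of_calculus)
      fix x assume x: "x \<in> {\<sigma>..\<rho>}"
      have "(W has_real_derivative Lc\<^sup>2 * ((2 / p) * (g x + \<nu>) powr (a / p) * g' x)) (at x within {\<sigma>..\<rho>})"
        by (rule DERIV_subset[OF Wder subset_UNIV]) (use x \<sigma> in auto)
      thus "(W has_vector_derivative Lc\<^sup>2 * ((2 / p) * (g x + \<nu>) powr (a / p) * g' x)) (at x within {\<sigma>..\<rho>})"
        by (simp only: has_real_derivative_iff_has_vector_derivative)
    qed (use \<sigma> in simp)
    have "((\<lambda>\<tau>. 1 - 2 * q \<tau>) has_integral ((\<rho> - \<sigma>) - 2 * integral {\<sigma>..\<rho>} q)) {\<sigma>..\<rho>}"
      using \<sigma> qi has_integral_const_real[of "1::real" \<sigma> \<rho>] by (intro has_integral_diff has_integral_mult_right) auto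
    hence "(\<rho> - \<sigma>) - 2 * integral {\<sigma>..\<rho>} q \<le> W \<rho> - W \<sigma>"
    proof (rule has_integral_le[OF _ W'])
      fix \<tau> assume \<tau>: "\<tau> \<in> {\<sigma>..\<rho>}"
      have "Lc\<^sup>2 * ((2 / p) * (g \<tau> + \<nu>) powr (a / p) * (- b)) \<le> Lc\<^sup>2 * ((2 / p) * (g \<tau> + \<nu>) powr (a / p) * g' \<tau>)"
        using g'(2)[of \<tau>] \<tau> \<sigma> p by (intro mult_left_mono) auto
      moreover have "Lc\<^sup>2 * ((2 / p) * (g \<tau> + \<nu>) powr (a / p) * (- b)) = 1 - 2 * q \<tau>"
        by (simp add: q_def E_def add_divide_distrib)
      ultimately show "1 - 2 * q \<tau> \<le> Lc\<^sup>2 * ((2 / p) * (g \<tau> + \<nu>) powr (a / p) * g' \<tau>)" by simp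
    qed
    thus ?thesis using 1 by (simp add: z_def)
  qed
  \<comment> \<open>One unit after \<open>T\<close>, because the derivative of \<open>W\<close> is
    available strictly after \<open>T\<close>.\<close>
  define S where "S = T + 1"
  define T' where "T' = S + (v S + 1)"
  have vS: "0 \<le> v S" by (simp add: v_def)
  have "v t \<le> W t" if t: "T' \<le> t" for t
  proof -
    \<comment> \<open>Otherwise the difference \<open>z\<close>, at most \<open>v S\<close> at the
      time \<open>S\<close>, would have fallen by more than \<open>v S\<close>.\<close>
    have "\<exists>\<sigma>. S \<le> \<sigma> \<and> \<sigma> \<le> t \<and> z \<sigma> \<le> 0"
    proof (rule ccontr)
      assume neg: "\<not> ?thesis"
      hence "0 < z \<tau>" if "S < \<tau>" "\<tau> < t" for \<tau> using that by (metis less_imp_le not_le)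
      hence "z t \<le> z S - (t - S)" using t vS by (intro step) (auto simp: T'_def S_def)
      moreover have "z S \<le> v S" by (simp add: z_def W_def)
      ultimately have "z t \<le> 0" using t by (simp add: T'_def)
      thus False using neg t vS by (auto simp: T'_def)
    qed
    then obtain \<sigma> where \<sigma>: "S \<le> \<sigma>" "\<sigma> \<le> t" "z \<sigma> \<le> 0" by blast
    define m where "m = Mf t"
    have m1: "1 \<le> m" using source(1)[of t] source_le[of t t] \<sigma> T by (simp add: m_def S_def)
    have E_le: "E \<tau> \<le> m + \<nu>" if "T \<le> \<tau>" "\<tau> \<le> t" for \<tau>
      using Eb[OF that(1)] source_le[of \<tau> t] that T by (simp add: m_def)
    have "z t \<le> 0"
    \<comment> \<open>The growth bound for \<open>z\<close> consists of the growth of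
      \<open>v\<close> and the possible fall of the barrier.\<close>
    proof (rule barrier_stays[of S t z "2 * C1 * m + (m + \<nu>)" \<sigma>])
      fix s \<rho> assume s: "S \<le> s" "s < \<rho>" "\<rho> \<le> t"
      have 1: "v \<rho> \<le> v s + 2 * C1 * m * (\<rho> - s)"
        using s T source_le by (intro v_growth) (auto simp: S_def m_def)
      have "W \<rho> - W s \<ge> - ((m + \<nu>) * (\<rho> - s))"
      proof -
        have "\<exists>x>s. x < \<rho> \<and> W \<rho> - W s = (\<rho> - s) * (Lc\<^sup>2 * ((2 / p) * (g x + \<nu>) powr (a / p) * g' x))"
          using s by (intro MVT2 Wder) (auto simp: S_def)
        then obtain x where x: "s < x" "x < \<rho>" "W \<rho> - W s = (\<rho> - s) * (Lc\<^sup>2 * ((2 / p) * (g x + \<nu>) powr (a / p) * g' x))"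
          by blast
        have "Lc\<^sup>2 * ((2 / p) * (g x + \<nu>) powr (a / p) * (- b)) \<le> Lc\<^sup>2 * ((2 / p) * (g x + \<nu>) powr (a / p) * g' x)"
          using g'(2)[of x] x s p by (intro mult_left_mono) (auto simp: S_def)
        moreover have "Lc\<^sup>2 * ((2 / p) * (g x + \<nu>) powr (a / p) * (- b)) = - E x" by (simp add: E_def)
        moreover have "E x \<le> m + \<nu>" using x s by (intro E_le) (auto simp: S_def)
        ultimately have "- (m + \<nu>) \<le> Lc\<^sup>2 * ((2 / p) * (g x + \<nu>) powr (a / p) * g' x)" by linarith
        hence "(\<rho> - s) * - (m + \<nu>) \<le> W \<rho> - W s" unfolding x(3) using s by (intro mult_left_mono) auto
        thus ?thesis by (simp add: algebra_simps)
      qed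
      with 1 show "z \<rho> \<le> z s + (2 * C1 * m + (m + \<nu>)) * (\<rho> - s)" by (simp add: z_def algebra_simps)
    next
      fix s \<rho> assume s: "S \<le> s" "s < \<rho>" "\<rho> \<le> t" and zp: "\<And>\<tau>. s < \<tau> \<Longrightarrow> \<tau> < \<rho> \<Longrightarrow> 0 < z \<tau>"
      have "z \<rho> \<le> z s - (\<rho> - s)" using s zp by (intro step) (auto simp: S_def)
      thus "z \<rho> \<le> z s" using s by simp
    qed (use m1 C1_ge_1 \<nu> \<sigma> in auto)
    thus ?thesis by (simp add: z_def)
  qed
  moreover have "T \<le> T'" using vS by (simp add: T'_def S_def)
  ultimately show ?thesis unfolding W_def \<nu>_def p_def by blast
qed

end

section \<open>The initial boundary value problem\<close>

text \<open>Extended nonnegative numbers admit no signed terms; a term \<open>J\<close> of unknown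
  sign is carried along as its positive part on one side and its negative part on the other.\<close>

lemma ennreal_pos_neg_le:
  assumes "0 \<le> D" "0 \<le> S" "D + J \<le> S"
  shows "ennreal D + ennreal J \<le> ennreal S + ennreal (- J)"
proof (cases "0 \<le> J")
  case True
  hence "ennreal D + ennreal J = ennreal (D + J)" using assms by (intro ennreal_plus[symmetric]) auto
  also have "\<dots> \<le> ennreal S" using assms by (intro ennreal_leI) auto
  also have "\<dots> \<le> ennreal S + ennreal (- J)" by simp
  finally show ?thesis .
next
  case False
  hence "ennreal D + ennreal J = ennreal D" by (simp add: ennreal_neg)
  also have "\<dots> \<le> ennreal (S + - J)" using assms by (intro ennreal_leI) auto
  also have "\<dots> = ennreal S + ennreal (- J)" using assms False by (intro ennreal_plus) auto
  finally show ?thesis .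
qed

locale ibvp =
  fixes P :: flow and M :: "real \<Rightarrow> real" and r c1 c2 :: real
  assumes medium: "medium P"
    and por_integrable: "set_integrable (leb (Dim P)) (Dom P) (Por P)"
    and weighted_r: "weighted_ineq P r c2" and weighted_2: "weighted_ineq P 2 c1"
    and extension: "extension P" and solution: "solution P" and majorant: "majorant P M"
    and param_pos: "2 < r" "0 < c1" "0 < c2"
begin

section \<open>The domain as a measure space and the fields on it\<close>

definition Mx :: "point measure" where "Mx = restrict_space (leb (Dim P)) (Dom P)"

abbreviation "a \<equiv> aF P"

lemma Dom_open: "openin (Rn (Dim P)) (Dom P)"
  using medium by (simp add: medium_def bounded_domain_def)

lemma Dom_sets: "Dom P \<in> sets (leb (Dim P))"
  by (rule openin_Rn_sets[OF Dom_open])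

lemma Dom_sets': "Dom P \<inter> space (leb (Dim P)) \<in> sets (leb (Dim P))" using Dom_sets by simp

lemma space_Mx: "space Mx = Dom P"
  using sets.sets_into_space[OF Dom_sets] by (auto simp: Mx_def space_restrict_space)

lemma nn_Mx: "(\<integral>\<^sup>+x\<in>Dom P. q x \<partial>leb (Dim P)) = (\<integral>\<^sup>+x. q x \<partial>Mx)"
  unfolding Mx_def using Dom_sets' by (simp add: nn_integral_restrict_space)

lemma int_Mx: "(LINT x:Dom P|leb (Dim P). q x) = (\<integral>x. q x \<partial>Mx)" for q :: "point \<Rightarrow> real"
  unfolding Mx_def set_lebesgue_integral_def using Dom_sets' by (simp add: integral_restrict_space)

lemma seti_Mx: "set_integrable (leb (Dim P)) (Dom P) q \<longleftrightarrow> integrable Mx q" for q :: "point \<Rightarrow> real"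
  unfolding Mx_def by (rule set_integrable_iff_restrict[OF Dom_sets])

lemma sigma_Mx: "sigma_finite_measure Mx"
  unfolding Mx_def by (rule sigma_finite_measure_restrict_space[OF sigma_finite_leb Dom_sets])

lemma pair_Mx: "Mx \<Otimes>\<^sub>M lborel = restrict_space (leb (Dim P) \<Otimes>\<^sub>M lborel) (Dom P \<times> (UNIV :: real set))"
  unfolding Mx_def
  using pair_measure_restrict_space[OF sigma_finite_leb lborel.sigma_finite_measure_axioms Dom_sets] by simp

lemma prod_sets: "J \<in> sets borel \<Longrightarrow> Dom P \<times> (J :: real set) \<in> sets (leb (Dim P) \<Otimes>\<^sub>M lborel)"
  using Dom_sets by auto

text \<open>All fields are cut off to \<open>0\<close> for \<open>\<tau> \<le> 0\<close>, which makes them measurable on \<open>U \<times> \<real>\<close>.\<close>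

definition ext :: "(real \<Rightarrow> point \<Rightarrow> real) \<Rightarrow> real \<Rightarrow> point \<Rightarrow> real"
  where "ext q \<tau> x = (if 0 < \<tau> then q \<tau> x else 0)"

lemma ext_measurable:
  assumes "spacetime_measurable (Dim P) (Dom P) J q" "{0<..} \<subseteq> J"
  shows "(\<lambda>z. ext q (snd z) (fst z)) \<in> borel_measurable (Mx \<Otimes>\<^sub>M lborel)"
proof -
  have s: "Dom P \<times> {0::real<..} \<in> sets (leb (Dim P) \<Otimes>\<^sub>M lborel)" by (rule prod_sets) simp
  have "(\<lambda>(x, t). q t x) \<in> borel_measurable (restrict_space (leb (Dim P) \<Otimes>\<^sub>M lborel) (Dom P \<times> {0<..}))"
    by (rule measurable_restrict_mono[OF assms(1)[unfolded spacetime_measurable_def]]) (use assms(2) in auto)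
  hence "(\<lambda>z. indicator (Dom P \<times> {0<..}) z *\<^sub>R (case z of (x, t) \<Rightarrow> q t x)) \<in> borel_measurable (leb (Dim P) \<Otimes>\<^sub>M lborel)"
    by (subst (asm) borel_measurable_restrict_space_iff) (use s in auto)
  hence "(\<lambda>z. indicator (Dom P \<times> {0<..}) z *\<^sub>R (case z of (x, t) \<Rightarrow> q t x)) \<in> borel_measurable (Mx \<Otimes>\<^sub>M lborel)"
    unfolding pair_Mx by (rule measurable_restrict_space1)
  moreover have "(\<lambda>z. indicator (Dom P \<times> {0<..}) z *\<^sub>R (case z of (x, t) \<Rightarrow> q t x)) \<in> borel_measurable (Mx \<Otimes>\<^sub>M lborel)
    \<longleftrightarrow> (\<lambda>z. ext q (snd z) (fst z)) \<in> borel_measurable (Mx \<Otimes>\<^sub>M lborel)"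
    by (rule measurable_cong) (auto simp: space_pair_measure space_Mx ext_def indicator_def)
  ultimately show ?thesis by simp
qed

definition "uu = ext (pbar P)"
definition "pt = ext (DtPres P)"
definition "st = ext (DtPsi P)"
definition gP :: "real \<Rightarrow> point \<Rightarrow> point" where "gP \<tau> x = (\<lambda>i. ext (\<lambda>\<tau> x. GradPres P \<tau> x i) \<tau> x)"
definition gS :: "real \<Rightarrow> point \<Rightarrow> point" where "gS \<tau> x = (\<lambda>i. ext (\<lambda>\<tau> x. GradPsi P \<tau> x i) \<tau> x)"
definition gd :: "real \<Rightarrow> point \<Rightarrow> point" where "gd \<tau> x = (\<lambda>i. gP \<tau> x i - gS \<tau> x i)"
definition "ww \<tau> x = W1 P x * vnorm (Dim P) (gd \<tau> x) powr (2 - a)"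
definition "ff \<tau> x = Coef P (Deg P) x + W1 P x * vnorm (Dim P) (gS \<tau> x) powr (2 - a) + (vnorm (Dim P) (gS \<tau> x))\<^sup>2 / Coef P 0 x"
definition "psi \<tau> x = \<bar>st \<tau> x\<bar>"

lemma ext_pos [simp]: "0 < \<tau> \<Longrightarrow> ext q \<tau> x = q \<tau> x" by (simp add: ext_def)

lemma joint:
  "(\<lambda>z. uu (snd z) (fst z)) \<in> borel_measurable (Mx \<Otimes>\<^sub>M lborel)"
  "(\<lambda>z. pt (snd z) (fst z)) \<in> borel_measurable (Mx \<Otimes>\<^sub>M lborel)"
  "(\<lambda>z. st (snd z) (fst z)) \<in> borel_measurable (Mx \<Otimes>\<^sub>M lborel)"
  "i < Dim P \<Longrightarrow> (\<lambda>z. gP (snd z) (fst z) i) \<in> borel_measurable (Mx \<Otimes>\<^sub>M lborel)"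
  "i < Dim P \<Longrightarrow> (\<lambda>z. gS (snd z) (fst z) i) \<in> borel_measurable (Mx \<Otimes>\<^sub>M lborel)"
proof -
  have "(\<lambda>z. uu (snd z) (fst z)) = (\<lambda>z. ext (Pres P) (snd z) (fst z) - ext (Psi P) (snd z) (fst z))"
    by (auto simp: uu_def ext_def pbar_def fun_eq_iff)
  thus "(\<lambda>z. uu (snd z) (fst z)) \<in> borel_measurable (Mx \<Otimes>\<^sub>M lborel)"
    using solution extension unfolding solution_def extension_def
    by (auto intro!: borel_measurable_diff ext_measurable[where J = "{0..}"])
  show "(\<lambda>z. pt (snd z) (fst z)) \<in> borel_measurable (Mx \<Otimes>\<^sub>M lborel)" unfolding pt_def
    using solution unfolding solution_def by (auto intro!: ext_measurable[where J = "{0<..}"])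
  show "(\<lambda>z. st (snd z) (fst z)) \<in> borel_measurable (Mx \<Otimes>\<^sub>M lborel)" unfolding st_def
    using extension unfolding extension_def by (auto intro!: ext_measurable[where J = "{0..}"])
  show "i < Dim P \<Longrightarrow> (\<lambda>z. gP (snd z) (fst z) i) \<in> borel_measurable (Mx \<Otimes>\<^sub>M lborel)" unfolding gP_def
    using solution unfolding solution_def by (auto intro!: ext_measurable[where J = "{0<..}"])
  show "i < Dim P \<Longrightarrow> (\<lambda>z. gS (snd z) (fst z) i) \<in> borel_measurable (Mx \<Otimes>\<^sub>M lborel)" unfolding gS_def
    using extension unfolding extension_def by (auto intro!: ext_measurable[where J = "{0..}"])
qed

lemma joint_section:
  assumes "(\<lambda>z. q (snd z) (fst z)) \<in> borel_measurable (Mx \<Otimes>\<^sub>M lborel)"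
    "f \<in> borel_measurable N" "h \<in> measurable N Mx"
  shows "(\<lambda>y. q (f y) (h y)) \<in> borel_measurable N"
proof -
  have "(\<lambda>y. (h y, f y)) \<in> measurable N (Mx \<Otimes>\<^sub>M lborel)" using assms by simp
  from measurable_compose[OF this assms(1)] show ?thesis by simp
qed

lemma raw_uu [measurable (raw)]: "f \<in> borel_measurable N \<Longrightarrow> h \<in> measurable N Mx \<Longrightarrow> (\<lambda>y. uu (f y) (h y)) \<in> borel_measurable N"
  by (rule joint_section[OF joint(1)])
lemma raw_pt [measurable (raw)]: "f \<in> borel_measurable N \<Longrightarrow> h \<in> measurable N Mx \<Longrightarrow> (\<lambda>y. pt (f y) (h y)) \<in> borel_measurable N"
  by (rule joint_section[OF joint(2)])
lemma raw_st [measurable (raw)]: "f \<in> borel_measurable N \<Longrightarrow> h \<in> measurable N Mx \<Longrightarrow> (\<lambda>y. st (f y) (h y)) \<in> borel_measurable N"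
  by (rule joint_section[OF joint(3)])
lemma raw_gP: "i < Dim P \<Longrightarrow> f \<in> borel_measurable N \<Longrightarrow> h \<in> measurable N Mx \<Longrightarrow> (\<lambda>y. gP (f y) (h y) i) \<in> borel_measurable N"
  by (rule joint_section[OF joint(4)])
lemma raw_gS: "i < Dim P \<Longrightarrow> f \<in> borel_measurable N \<Longrightarrow> h \<in> measurable N Mx \<Longrightarrow> (\<lambda>y. gS (f y) (h y) i) \<in> borel_measurable N"
  by (rule joint_section[OF joint(5)])

lemma raw_vnorm [measurable (raw)]:
  assumes "f \<in> borel_measurable N" "h \<in> measurable N Mx"
  shows "(\<lambda>y. vnorm (Dim P) (gP (f y) (h y))) \<in> borel_measurable N"
    "(\<lambda>y. vnorm (Dim P) (gS (f y) (h y))) \<in> borel_measurable N"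
    "(\<lambda>y. vnorm (Dim P) (gd (f y) (h y))) \<in> borel_measurable N"
  unfolding gd_def using assms
  by (auto intro!: vnorm_measurable borel_measurable_diff raw_gP raw_gS)

lemma coef_measurable [measurable]:
  "Por P \<in> borel_measurable Mx" "Coef P 0 \<in> borel_measurable Mx" "Coef P (Deg P) \<in> borel_measurable Mx" "W1 P \<in> borel_measurable Mx"
proof -
  have c: "Coef P j \<in> borel_measurable Mx" if "j \<le> Deg P" for j using medium that by (simp add: medium_def Mx_def)
  show "Por P \<in> borel_measurable Mx" using medium by (simp add: medium_def Mx_def)
  show [measurable]: "Coef P 0 \<in> borel_measurable Mx" "Coef P (Deg P) \<in> borel_measurable Mx" using c by auto
  have [measurable]: "(\<lambda>x. Max ((\<lambda>j. Coef P j x) ` {..Deg P})) \<in> borel_measurable Mx"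
    using c by (intro borel_measurable_Max) auto
  show "W1 P \<in> borel_measurable Mx" unfolding W1_def[abs_def] by measurable
qed

lemma raw_densities [measurable (raw)]:
  assumes [measurable]: "f \<in> borel_measurable N" "h \<in> measurable N Mx"
  shows "(\<lambda>y. ww (f y) (h y)) \<in> borel_measurable N"
    "(\<lambda>y. ff (f y) (h y)) \<in> borel_measurable N"
    "(\<lambda>y. psi (f y) (h y)) \<in> borel_measurable N"
  unfolding ww_def ff_def psi_def by measurable

lemma coef_pos: "x \<in> Dom P \<Longrightarrow> 0 < Por P x" "x \<in> Dom P \<Longrightarrow> 0 < Coef P 0 x" "x \<in> Dom P \<Longrightarrow> 0 < Coef P (Deg P) x"
  "x \<in> Dom P \<Longrightarrow> 0 < W1 P x"
  using medium gF_bounds(5,6)[OF medium, of x 0] KF_bounds(4)[OF medium, of x 0] by (auto simp: medium_def)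

lemma Dom_nonempty: "Dom P \<noteq> {}" using medium by (simp add: medium_def bounded_domain_def)

lemma a_bounds: "0 < a" "a < 1"
proof -
  obtain x where "x \<in> Dom P" using Dom_nonempty by blast
  thus "0 < a" "a < 1" using KF_bounds(5,6)[OF medium, of x 0] by auto
qed

lemma densities_nonneg: "x \<in> Dom P \<Longrightarrow> 0 \<le> ww \<tau> x" "x \<in> Dom P \<Longrightarrow> 0 \<le> ff \<tau> x" "0 \<le> psi \<tau> x"
  using coef_pos[of x] by (auto simp: ww_def ff_def psi_def less_imp_le intro!: add_nonneg_nonneg)

section \<open>The data bounded by G\<close>

definition gg :: "real \<Rightarrow> real" where "gg \<tau> = Greal P \<tau>"

lemma G_finite: "0 \<le> \<tau> \<Longrightarrow> G P \<tau> = ennreal (gg \<tau>)"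
proof -
  assume "0 \<le> \<tau>"
  hence "G P \<tau> \<le> ennreal (M \<tau>)" using majorant by (simp add: majorant_def)
  hence "G P \<tau> < \<infinity>" using le_less_trans by fastforce
  thus ?thesis by (simp add: gg_def Greal_def less_top)
qed

lemma M_ge_1: "0 \<le> \<tau> \<Longrightarrow> 1 \<le> M \<tau>" and gg_ge_1: "0 \<le> \<tau> \<Longrightarrow> 1 \<le> gg \<tau>" and gg_le_M: "0 \<le> \<tau> \<Longrightarrow> \<tau> \<le> t \<Longrightarrow> gg \<tau> \<le> M t"
proof -
  show 1: "1 \<le> gg \<tau>" if "0 \<le> \<tau>" for \<tau>
  proof -
    have "1 \<le> Bstar P" by (simp add: Bstar_def)
    also have "\<dots> \<le> G P \<tau>" unfolding G_def by (simp add: add.assoc)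
    finally have "ennreal 1 \<le> ennreal (gg \<tau>)" using G_finite[OF that] by simp
    moreover have "0 \<le> gg \<tau>" by (simp add: gg_def Greal_def)
    ultimately show ?thesis by (subst (asm) ennreal_le_iff) auto
  qed
  show 2: "gg \<tau> \<le> M t" if "0 \<le> \<tau>" "\<tau> \<le> t" for \<tau> t
  proof -
    have "G P \<tau> \<le> ennreal (M \<tau>)" using majorant that by (simp add: majorant_def)
    hence "ennreal (gg \<tau>) \<le> ennreal (M \<tau>)" using G_finite[OF that(1)] by simp
    \<comment> \<open>\<open>ennreal\<close> sends negative numbers to 0, so a negative value of the
      majorant has to be excluded; it is impossible since G is at least 1.\<close>
    moreover have "0 \<le> M \<tau>"
    proof (rule ccontr)
      assume "\<not> 0 \<le> M \<tau>"
      hence "ennreal (gg \<tau>) = 0" using \<open>ennreal (gg \<tau>) \<le> ennreal (M \<tau>)\<close> by (simp add: ennreal_neg)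
      thus False using 1[OF that(1)] by (simp add: ennreal_eq_0_iff)
    qed
    ultimately have "gg \<tau> \<le> M \<tau>" by (subst (asm) ennreal_le_iff) auto
    also have "\<dots> \<le> M t" using majorant that by (auto simp: majorant_def mono_on_def)
    finally show ?thesis .
  qed
  show "1 \<le> M \<tau>" if "0 \<le> \<tau>" for \<tau> using 1[OF that] 2[OF that order_refl] by simp
qed

text \<open>The powers in \<open>G\<close> undo the roots in the norms, except for the time
  derivative of \<Psi>, whose L^2_\<phi> norm is raised to a power other than 2; there the exponent
  (2 - a) / (2 (1 - a)) remains.\<close>

lemma G_parts:
  assumes \<tau>: "0 < \<tau>"
  shows "G P \<tau> = Bstar P + (\<integral>\<^sup>+x. ennreal ((vnorm (Dim P) (gS \<tau> x))\<^sup>2 / Coef P 0 x) \<partial>Mx)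
    + (\<integral>\<^sup>+x. ennreal (W1 P x * vnorm (Dim P) (gS \<tau> x) powr (2 - a)) \<partial>Mx)
    + (\<integral>\<^sup>+x. ennreal (Por P x * (psi \<tau> x)\<^sup>2) \<partial>Mx) epowr ((2 - a) / (2 * (1 - a)))"
proof -
  have g: "gS \<tau> x = GradPsi P \<tau> x" for x using \<tau> by (auto simp: gS_def)
  have s: "psi \<tau> x = \<bar>DtPsi P \<tau> x\<bar>" for x using \<tau> by (auto simp: psi_def st_def)
  have e: "(1::real) / 2 * ((2 - a) / (1 - a)) = (2 - a) / (2 * (1 - a))" by simp
  show ?thesis
    unfolding G_def wnorm_def nn_Mx using a_bounds
    by (simp add: epowr_epowr g s vnorm_nonneg mult.commute[of _ "W1 P _"] mult.commute[of _ "Por P _"])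
qed

lemma G_parts_le:
  assumes \<tau>: "0 < \<tau>"
  shows "(\<integral>\<^sup>+x. ennreal (ff \<tau> x) \<partial>Mx) \<le> ennreal (gg \<tau>)"
    "(\<integral>\<^sup>+x. ennreal (Por P x * (psi \<tau> x)\<^sup>2) \<partial>Mx) \<le> ennreal (gg \<tau> powr (2 * (1 - a) / (2 - a)))"
proof -
  have "(\<integral>\<^sup>+x. ennreal (ff \<tau> x) \<partial>Mx) = (\<integral>\<^sup>+x. ennreal (Coef P (Deg P) x) + ennreal ((vnorm (Dim P) (gS \<tau> x))\<^sup>2 / Coef P 0 x)
      + ennreal (W1 P x * vnorm (Dim P) (gS \<tau> x) powr (2 - a)) \<partial>Mx)"
  proof (rule nn_integral_cong)
    fix x assume x: "x \<in> space Mx"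
    have nn: "0 \<le> Coef P (Deg P) x" "0 \<le> (vnorm (Dim P) (gS \<tau> x))\<^sup>2 / Coef P 0 x"
      "0 \<le> W1 P x * vnorm (Dim P) (gS \<tau> x) powr (2 - a)"
      using coef_pos[of x] x by (auto simp: space_Mx less_imp_le)
    show "ennreal (ff \<tau> x) = ennreal (Coef P (Deg P) x) + ennreal ((vnorm (Dim P) (gS \<tau> x))\<^sup>2 / Coef P 0 x)
      + ennreal (W1 P x * vnorm (Dim P) (gS \<tau> x) powr (2 - a))"
      using nn by (simp add: ff_def add_ac flip: ennreal_plus)
  qed
  also have "\<dots> = (\<integral>\<^sup>+x. ennreal (Coef P (Deg P) x) \<partial>Mx) + (\<integral>\<^sup>+x. ennreal ((vnorm (Dim P) (gS \<tau> x))\<^sup>2 / Coef P 0 x) \<partial>Mx)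
      + (\<integral>\<^sup>+x. ennreal (W1 P x * vnorm (Dim P) (gS \<tau> x) powr (2 - a)) \<partial>Mx)"
    by (subst nn_integral_add, measurable)+
  also have "\<dots> \<le> G P \<tau>"
    unfolding G_parts[OF \<tau>] by (rule order_trans[OF _ add_increasing2[OF zero_le order_refl]], intro add_mono)
      (auto simp: Bstar_def nn_Mx)
  finally show "(\<integral>\<^sup>+x. ennreal (ff \<tau> x) \<partial>Mx) \<le> ennreal (gg \<tau>)" using G_finite \<tau> by simp
  have "(\<integral>\<^sup>+x. ennreal (Por P x * (psi \<tau> x)\<^sup>2) \<partial>Mx) epowr ((2 - a) / (2 * (1 - a))) \<le> G P \<tau>"
    unfolding G_parts[OF \<tau>] by simp
  hence "(\<integral>\<^sup>+x. ennreal (Por P x * (psi \<tau> x)\<^sup>2) \<partial>Mx) epowr ((2 - a) / (2 * (1 - a))) \<le> ennreal (gg \<tau>)"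
    using G_finite \<tau> by simp
  hence "(\<integral>\<^sup>+x. ennreal (Por P x * (psi \<tau> x)\<^sup>2) \<partial>Mx) \<le> ennreal (gg \<tau> powr (1 / ((2 - a) / (2 * (1 - a)))))"
    using a_bounds gg_ge_1[of \<tau>] \<tau> by (intro epowr_le_ennrealD) auto
  thus "(\<integral>\<^sup>+x. ennreal (Por P x * (psi \<tau> x)\<^sup>2) \<partial>Mx) \<le> ennreal (gg \<tau> powr (2 * (1 - a) / (2 - a)))" by simp
qed

section \<open>The equation tested with functions of the solution\<close>

definition good :: "real \<Rightarrow> bool"
  where "good \<tau> \<longleftrightarrow> W0 (Dim P) (Dom P) (uu \<tau>) (gd \<tau>) \<and>
    integrable Mx (\<lambda>x. KF P x (vnorm (Dim P) (gP \<tau> x)) * (vnorm (Dim P) (gP \<tau> x))\<^sup>2) \<and> equation_at P \<tau>"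

lemma AE_good: "AE \<tau> in lborel. 0 < \<tau> \<longrightarrow> good \<tau>"
proof -
  have "AE t in lborel. 0 < t \<longrightarrow>
       weak_gradient (Dim P) (Dom P) (Pres P t) (GradPres P t) \<and>
       W0 (Dim P) (Dom P) (pbar P t) (\<lambda>x i. GradPres P t x i - GradPsi P t x i) \<and>
       set_integrable (leb (Dim P)) (Dom P)
         (\<lambda>x. KF P x (vnorm (Dim P) (GradPres P t x)) * (vnorm (Dim P) (GradPres P t x))\<^sup>2) \<and>
       equation_at P t"
    using solution by (simp add: solution_def)
  thus ?thesis
  proof eventually_elim
    case (elim t)
    show ?case
    proof
      assume t: "0 < t"
      have "uu t = pbar P t" "gP t = GradPres P t" "gd t = (\<lambda>x i. GradPres P t x i - GradPsi P t x i)"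
        using t by (auto simp: uu_def gP_def gd_def gS_def fun_eq_iff)
      thus "good t" using elim t by (simp add: good_def seti_Mx)
    qed
  qed
qed

lemma W0_truncated:
  assumes "good \<tau>" "admissible h F \<Phi>"
  shows "W0 (Dim P) (Dom P) (\<lambda>x. F (uu \<tau> x)) (\<lambda>x i. h (uu \<tau> x) * gd \<tau> x i)"
  using assms admissibleD[OF assms(2)] by (intro W0_compose[OF Dom_open]) (auto simp: good_def)

text \<open>The gradient of F(u) is h(u) times that of u. Since 0 \<le> h \<le> 1 and 2 - a > 1,
  h^(2-a) \<le> h, so its weighted norm is controlled by the dissipation with the factor
  \<open>h\<close> that occurs in the energy inequality.\<close>

lemma sobolev_one:
  assumes \<tau>: "good \<tau>" and A: "admissible h F \<Phi>" and w: "weighted_ineq P q c" "0 < c" "0 < q"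
    and D: "0 \<le> D" "(\<integral>\<^sup>+x. ennreal (ww \<tau> x * h (uu \<tau> x)) \<partial>Mx) \<le> ennreal D"
  shows "(\<integral>\<^sup>+x. ennreal (Por P x * \<bar>F (uu \<tau> x)\<bar> powr q) \<partial>Mx) \<le> ennreal ((c * D powr (1 / (2 - a))) powr q)"
proof -
  have 1: "wnorm (Dim P) (Dom P) q (Por P) (\<lambda>x. F (uu \<tau> x))
      \<le> ennreal c * wnorm (Dim P) (Dom P) (2 - a) (W1 P) (\<lambda>x. vnorm (Dim P) (\<lambda>i. h (uu \<tau> x) * gd \<tau> x i))"
    using w(1) W0_truncated[OF \<tau> A] unfolding weighted_ineq_def by blast
  have 2: "wnorm (Dim P) (Dom P) (2 - a) (W1 P) (\<lambda>x. vnorm (Dim P) (\<lambda>i. h (uu \<tau> x) * gd \<tau> x i)) \<le> ennreal D epowr (1 / (2 - a))"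
    unfolding wnorm_def nn_Mx
  proof (intro epowr_mono)
    have "(\<integral>\<^sup>+x. ennreal (\<bar>vnorm (Dim P) (\<lambda>i. h (uu \<tau> x) * gd \<tau> x i)\<bar> powr (2 - a) * W1 P x) \<partial>Mx)
      \<le> (\<integral>\<^sup>+x. ennreal (ww \<tau> x * h (uu \<tau> x)) \<partial>Mx)"
    proof (intro nn_integral_mono ennreal_leI)
      fix x assume x: "x \<in> space Mx"
      have h: "0 \<le> h (uu \<tau> x)" "h (uu \<tau> x) \<le> 1" using admissibleD[OF A] by auto
      have "h (uu \<tau> x) powr (2 - a) \<le> h (uu \<tau> x)"
        using powr_mono'[of 1 "2 - a" "h (uu \<tau> x)"] h a_bounds by simp
      hence "h (uu \<tau> x) powr (2 - a) * (vnorm (Dim P) (gd \<tau> x) powr (2 - a) * W1 P x)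
          \<le> h (uu \<tau> x) * (vnorm (Dim P) (gd \<tau> x) powr (2 - a) * W1 P x)"
        using coef_pos(4)[of x] x by (intro mult_right_mono) (auto simp: space_Mx less_imp_le)
      moreover have "vnorm (Dim P) (\<lambda>i. h (uu \<tau> x) * gd \<tau> x i) = h (uu \<tau> x) * vnorm (Dim P) (gd \<tau> x)"
        using h by (simp add: vnorm_scale)
      ultimately show "\<bar>vnorm (Dim P) (\<lambda>i. h (uu \<tau> x) * gd \<tau> x i)\<bar> powr (2 - a) * W1 P x \<le> ww \<tau> x * h (uu \<tau> x)"
        using h by (simp add: vnorm_nonneg powr_mult ww_def mult_ac)
    qed
    thus "(\<integral>\<^sup>+x. ennreal (\<bar>vnorm (Dim P) (\<lambda>i. h (uu \<tau> x) * gd \<tau> x i)\<bar> powr (2 - a) * W1 P x) \<partial>Mx) \<le> ennreal D"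
      using D(2) by (rule order_trans)
  qed (use a_bounds in auto)
  have "ennreal c * (ennreal D epowr (1 / (2 - a))) = ennreal (c * D powr (1 / (2 - a)))"
    using w D by (simp add: epowr_ennreal ennreal_mult)
  hence "wnorm (Dim P) (Dom P) q (Por P) (\<lambda>x. F (uu \<tau> x)) \<le> ennreal (c * D powr (1 / (2 - a)))"
    using order_trans[OF 1 mult_left_mono[OF 2, of "ennreal c"]] by simp
  hence "(\<integral>\<^sup>+x. ennreal (Por P x * \<bar>F (uu \<tau> x)\<bar> powr q) \<partial>Mx) epowr (1 / q) \<le> ennreal (c * D powr (1 / (2 - a)))"
    unfolding wnorm_def nn_Mx by (simp add: mult.commute)
  hence "(\<integral>\<^sup>+x. ennreal (Por P x * \<bar>F (uu \<tau> x)\<bar> powr q) \<partial>Mx) \<le> ennreal ((c * D powr (1 / (2 - a))) powr (1 / (1 / q)))"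
    using w by (intro epowr_le_ennrealD) auto
  thus ?thesis by simp
qed

lemma integrable_por: "integrable Mx (Por P)"
  using por_integrable by (simp add: seti_Mx)

lemma integrable_of_bound:
  assumes [measurable]: "q \<in> borel_measurable Mx" and "\<And>x. x \<in> Dom P \<Longrightarrow> 0 \<le> q x"
    and "(\<integral>\<^sup>+x. ennreal (q x) \<partial>Mx) \<le> ennreal b"
  shows "integrable Mx q"
proof (rule integrableI_bounded)
  have "(\<integral>\<^sup>+x. ennreal (norm (q x)) \<partial>Mx) = (\<integral>\<^sup>+x. ennreal (q x) \<partial>Mx)"
    using assms(2) by (intro nn_integral_cong) (auto simp: space_Mx)
  also have "\<dots> < \<infinity>" using le_less_trans[OF assms(3)] by simp
  finally show "(\<integral>\<^sup>+x. ennreal (norm (q x)) \<partial>Mx) < \<infinity>" .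
qed measurable

lemma integrable_ff: "0 < \<tau> \<Longrightarrow> integrable Mx (ff \<tau>)"
  using G_parts_le(1) densities_nonneg by (intro integrable_of_bound[of _ "gg \<tau>"]) auto

lemma integrable_psi2: "0 < \<tau> \<Longrightarrow> integrable Mx (\<lambda>x. Por P x * (psi \<tau> x)\<^sup>2)"
  using G_parts_le(2) coef_pos by (intro integrable_of_bound) (auto simp: less_imp_le)

text \<open>From \<psi> \<le> 1 + \<psi>^2, where the 1 is integrable because \<phi> is.\<close>

lemma integrable_psi: "0 < \<tau> \<Longrightarrow> integrable Mx (\<lambda>x. Por P x * psi \<tau> x)"
proof -
  assume \<tau>: "0 < \<tau>"
  have "integrable Mx (\<lambda>x. Por P x + Por P x * (psi \<tau> x)\<^sup>2)"
    using integrable_por integrable_psi2[OF \<tau>] by (rule Bochner_Integration.integrable_add)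
  thus ?thesis
  proof (rule Bochner_Integration.integrable_bound)
    show "AE x in Mx. norm (Por P x * psi \<tau> x) \<le> norm (Por P x + Por P x * (psi \<tau> x)\<^sup>2)"
    proof (rule AE_I2)
      fix x assume "x \<in> space Mx"
      hence p: "0 < Por P x" using coef_pos by (simp add: space_Mx)
      have "0 \<le> (psi \<tau> x - 1)\<^sup>2" by simp
      hence "2 * psi \<tau> x \<le> 1 + (psi \<tau> x)\<^sup>2" by (simp add: power2_diff algebra_simps)
      hence "psi \<tau> x \<le> 1 + (psi \<tau> x)\<^sup>2" using densities_nonneg(3)[of \<tau> x] by linarith
      hence "Por P x * psi \<tau> x \<le> Por P x * (1 + (psi \<tau> x)\<^sup>2)" using p by (intro mult_left_mono) auto
      thus "norm (Por P x * psi \<tau> x) \<le> norm (Por P x + Por P x * (psi \<tau> x)\<^sup>2)"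
        using p densities_nonneg(3)[of \<tau> x] by (simp add: distrib_left)
    qed
  qed measurable
qed

text \<open>The test function is F(u), with gradient h(u) times that of u. Integrability of every
  term comes first, as it is part of being a test function and allows the integrals to be split.
  \<open>J\<close> is the rate of change of the energy and may have either sign.\<close>

lemma energy_at:
  assumes \<tau>: "0 < \<tau>" and good: "good \<tau>" and pt: "integrable Mx (\<lambda>x. Por P x * pt \<tau> x)"
    and A: "admissible h F \<Phi>" and B: "\<And>v. \<bar>F v\<bar> \<le> B"
  defines "J \<equiv> (\<integral>x. Por P x * F (uu \<tau> x) * (pt \<tau> x - st \<tau> x) \<partial>Mx)"
  shows "(\<integral>\<^sup>+x. ennreal (ww \<tau> x * h (uu \<tau> x) / 8) \<partial>Mx) + ennreal J
    \<le> (\<integral>\<^sup>+x. ennreal (ff \<tau> x * h (uu \<tau> x) + Por P x * psi \<tau> x * \<bar>F (uu \<tau> x)\<bar>) \<partial>Mx) + ennreal (- J)"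
proof -
  let ?n = "Dim P"
  note D = admissibleD[OF A]
  note [measurable] = D(9-11)
  define K where "K x = KF P x (vnorm ?n (gP \<tau> x))" for x
  define k2 where "k2 x = K x * (vnorm ?n (gP \<tau> x))\<^sup>2" for x
  define e where "e x = (vnorm ?n (gS \<tau> x))\<^sup>2 / Coef P 0 x" for x
  define H where "H x = h (uu \<tau> x)" for x
  have H: "0 \<le> H x" "H x \<le> 1" for x using D(2,3) by (auto simp: H_def)
  have Hm [measurable]: "H \<in> borel_measurable Mx" unfolding H_def by measurable
  have k2i: "integrable Mx k2" using good unfolding good_def k2_def[abs_def] K_def by simp
  note [measurable] = borel_measurable_integrable[OF k2i]
  have em [measurable]: "e \<in> borel_measurable Mx" unfolding e_def by measurable
  have x_pos: "0 < K x" "0 \<le> k2 x" "0 \<le> e x" "0 \<le> ff \<tau> x" "0 \<le> ww \<tau> x" "0 < Por P x" "0 \<le> psi \<tau> x" if "x \<in> Dom P" for x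
    using KF_bounds(1)[OF medium that vnorm_nonneg] densities_nonneg that coef_pos[OF that]
    by (auto simp: K_def k2_def e_def less_imp_le)
  have bd: "K x * vinner ?n (gP \<tau> x) (gd \<tau> x) \<ge> ww \<tau> x / 8 - ff \<tau> x"
    "\<bar>K x * vinner ?n (gP \<tau> x) (gd \<tau> x)\<bar> \<le> 2 * k2 x + e x"
    "K x * vnorm ?n (gP \<tau> x) * vnorm ?n (gd \<tau> x) \<le> 2 * k2 x + e x" if "x \<in> Dom P" for x
    using dissipation_lower_bound[OF medium that, of ?n "gP \<tau> x" "gS \<tau> x"]
    by (simp_all add: K_def k2_def e_def ww_def ff_def gd_def)
  have ei: "integrable Mx e"
  proof (rule Bochner_Integration.integrable_bound[OF integrable_ff[OF \<tau>]])
    show "AE x in Mx. norm (e x) \<le> norm (ff \<tau> x)"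
    proof (rule AE_I2)
      fix x assume "x \<in> space Mx"
      hence x: "x \<in> Dom P" by (simp add: space_Mx)
      have "e x \<le> ff \<tau> x" using coef_pos[OF x] by (simp add: e_def ff_def less_imp_le)
      thus "norm (e x) \<le> norm (ff \<tau> x)" using x_pos[OF x] by simp
    qed
  qed measurable
  have bi: "integrable Mx (\<lambda>x. 2 * k2 x + e x)" using k2i ei by auto
  have vin0: "vinner ?n (gP \<tau> x) q = 0" if "vnorm ?n (gP \<tau> x) = 0" for x q
    using vinner_le[of ?n "gP \<tau> x" q] that by simp
  have vinm [measurable]: "(\<lambda>x. vinner ?n (gP \<tau> x) (gd \<tau> x)) \<in> borel_measurable Mx"
    unfolding vinner_def gd_def by (auto intro!: borel_measurable_sum borel_measurable_times borel_measurable_diff raw_gP raw_gS)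
  text \<open>Measurability of \<open>K\<close> where \<open>\<nabla>p \<noteq> 0\<close> comes from that of \<open>K \<bar>\<nabla>p\<bar>\<^sup>2\<close>.\<close>
  define q where "q x = K x * vinner ?n (gP \<tau> x) (gd \<tau> x) * H x" for x
  have qm [measurable]: "q \<in> borel_measurable Mx"
  proof -
    have "q = (\<lambda>x. k2 x * (vinner ?n (gP \<tau> x) (gd \<tau> x) / (vnorm ?n (gP \<tau> x))\<^sup>2) * H x)"
      using vin0 by (auto simp: q_def k2_def fun_eq_iff)
    thus ?thesis by simp
  qed
  have qi: "integrable Mx q"
  proof (rule Bochner_Integration.integrable_bound[OF bi qm])
    show "AE x in Mx. norm (q x) \<le> norm (2 * k2 x + e x)"
    proof (rule AE_I2)
      fix x assume "x \<in> space Mx"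
      hence x: "x \<in> Dom P" by (simp add: space_Mx)
      have "norm (q x) = \<bar>K x * vinner ?n (gP \<tau> x) (gd \<tau> x)\<bar> * H x" using H[of x] by (simp add: q_def abs_mult)
      also have "\<dots> \<le> \<bar>K x * vinner ?n (gP \<tau> x) (gd \<tau> x)\<bar>" using H[of x] by (intro mult_left_le) auto
      also have "\<dots> \<le> 2 * k2 x + e x" by (rule bd[OF x])
      finally show "norm (q x) \<le> norm (2 * k2 x + e x)" by simp
    qed
  qed
  have test: "(\<integral>x. Por P x * pt \<tau> x * F (uu \<tau> x) \<partial>Mx) = - (\<integral>x. q x \<partial>Mx)"
  proof -
    have fl: "vnorm ?n (flux P \<tau> x) = K x * vnorm ?n (gP \<tau> x)"
      "vinner ?n (flux P \<tau> x) (\<lambda>i. h (uu \<tau> x) * gd \<tau> x i) = q x" if "x \<in> Dom P" for x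
    proof -
      have g: "gP \<tau> x = GradPres P \<tau> x" using \<tau> by (simp add: gP_def)
      show "vnorm ?n (flux P \<tau> x) = K x * vnorm ?n (gP \<tau> x)"
        using x_pos[OF that] by (simp add: flux_def vnorm_scale K_def g)
      show "vinner ?n (flux P \<tau> x) (\<lambda>i. h (uu \<tau> x) * gd \<tau> x i) = q x"
        by (simp add: flux_def vinner_def q_def K_def g H_def sum_distrib_left sum_distrib_right mult_ac)
    qed
    have vd: "vnorm ?n (\<lambda>i. h (uu \<tau> x) * gd \<tau> x i) = H x * vnorm ?n (gd \<tau> x)" for x
      using H by (simp add: vnorm_scale H_def)
    have "integrable Mx (\<lambda>x. K x * vnorm ?n (gP \<tau> x) * vnorm ?n (gd \<tau> x) * H x)"
    proof (rule Bochner_Integration.integrable_bound[OF bi])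
      have "(\<lambda>x. K x * vnorm ?n (gP \<tau> x) * vnorm ?n (gd \<tau> x) * H x)
        = (\<lambda>x. k2 x * (vnorm ?n (gd \<tau> x) / vnorm ?n (gP \<tau> x)) * H x)"
        by (auto simp: k2_def fun_eq_iff power2_eq_square)
      thus "(\<lambda>x. K x * vnorm ?n (gP \<tau> x) * vnorm ?n (gd \<tau> x) * H x) \<in> borel_measurable Mx" by simp
      show "AE x in Mx. norm (K x * vnorm ?n (gP \<tau> x) * vnorm ?n (gd \<tau> x) * H x) \<le> norm (2 * k2 x + e x)"
      proof (rule AE_I2)
        fix x assume "x \<in> space Mx"
        hence x: "x \<in> Dom P" by (simp add: space_Mx)
        have n: "0 \<le> K x * vnorm ?n (gP \<tau> x) * vnorm ?n (gd \<tau> x)" using x_pos[OF x] vnorm_nonneg by simp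
        hence "norm (K x * vnorm ?n (gP \<tau> x) * vnorm ?n (gd \<tau> x) * H x) = K x * vnorm ?n (gP \<tau> x) * vnorm ?n (gd \<tau> x) * H x"
          using H[of x] by simp
        also have "\<dots> \<le> K x * vnorm ?n (gP \<tau> x) * vnorm ?n (gd \<tau> x)" using H[of x] n by (intro mult_left_le) auto
        also have "\<dots> \<le> 2 * k2 x + e x" by (rule bd[OF x])
        finally show "norm (K x * vnorm ?n (gP \<tau> x) * vnorm ?n (gd \<tau> x) * H x) \<le> norm (2 * k2 x + e x)" by simp
      qed
    qed
    hence "integrable Mx (\<lambda>x. vnorm ?n (flux P \<tau> x) * vnorm ?n (\<lambda>i. h (uu \<tau> x) * gd \<tau> x i))"
      by (rule Bochner_Integration.integrable_cong[THEN iffD1, rotated -1]) (auto simp: space_Mx fl vd)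
    hence "(LINT x:Dom P|leb ?n. Por P x * DtPres P \<tau> x * F (uu \<tau> x))
         = - (LINT x:Dom P|leb ?n. vinner ?n (flux P \<tau> x) (\<lambda>i. h (uu \<tau> x) * gd \<tau> x i))"
      using good[unfolded good_def equation_at_def, THEN conjunct2, THEN conjunct2, THEN conjunct2, rule_format,
        of "\<lambda>x. F (uu \<tau> x)" "\<lambda>x i. h (uu \<tau> x) * gd \<tau> x i"] W0_truncated[OF good A] B
      by (auto simp: seti_Mx)
    moreover have "(LINT x:Dom P|leb ?n. vinner ?n (flux P \<tau> x) (\<lambda>i. h (uu \<tau> x) * gd \<tau> x i)) = (\<integral>x. q x \<partial>Mx)"
      unfolding int_Mx by (rule Bochner_Integration.integral_cong) (auto simp: space_Mx fl)
    moreover have "pt \<tau> = DtPres P \<tau>" using \<tau> by (auto simp: pt_def)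
    ultimately show ?thesis by (simp add: int_Mx)
  qed
  have pF: "integrable Mx (\<lambda>x. Por P x * pt \<tau> x * F (uu \<tau> x))"
  proof (rule Bochner_Integration.integrable_bound[of _ "\<lambda>x. B * (Por P x * pt \<tau> x)"])
    show "integrable Mx (\<lambda>x. B * (Por P x * pt \<tau> x))" using pt by auto
    show "AE x in Mx. norm (Por P x * pt \<tau> x * F (uu \<tau> x)) \<le> norm (B * (Por P x * pt \<tau> x))"
    proof (rule AE_I2)
      fix x
      have "\<bar>F (uu \<tau> x)\<bar> \<le> \<bar>B\<bar>" using B[of "uu \<tau> x"] by linarith
      hence "\<bar>F (uu \<tau> x)\<bar> * \<bar>Por P x * pt \<tau> x\<bar> \<le> \<bar>B\<bar> * \<bar>Por P x * pt \<tau> x\<bar>" by (intro mult_right_mono) auto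
      thus "norm (Por P x * pt \<tau> x * F (uu \<tau> x)) \<le> norm (B * (Por P x * pt \<tau> x))" by (simp add: abs_mult mult_ac)
    qed
  qed measurable
  have sF: "integrable Mx (\<lambda>x. Por P x * psi \<tau> x * \<bar>F (uu \<tau> x)\<bar>)"
  proof (rule Bochner_Integration.integrable_bound[of _ "\<lambda>x. B * (Por P x * psi \<tau> x)"])
    show "integrable Mx (\<lambda>x. B * (Por P x * psi \<tau> x))" using integrable_psi[OF \<tau>] by auto
    show "AE x in Mx. norm (Por P x * psi \<tau> x * \<bar>F (uu \<tau> x)\<bar>) \<le> norm (B * (Por P x * psi \<tau> x))"
    proof (rule AE_I2)
      fix x
      have "\<bar>F (uu \<tau> x)\<bar> \<le> \<bar>B\<bar>" using B[of "uu \<tau> x"] by linarith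
      hence "\<bar>F (uu \<tau> x)\<bar> * \<bar>Por P x * psi \<tau> x\<bar> \<le> \<bar>B\<bar> * \<bar>Por P x * psi \<tau> x\<bar>" by (intro mult_right_mono) auto
      thus "norm (Por P x * psi \<tau> x * \<bar>F (uu \<tau> x)\<bar>) \<le> norm (B * (Por P x * psi \<tau> x))" by (simp add: abs_mult mult_ac)
    qed
  qed measurable
  have sF': "integrable Mx (\<lambda>x. Por P x * st \<tau> x * F (uu \<tau> x))"
    by (rule Bochner_Integration.integrable_bound[OF sF]) (auto simp: psi_def abs_mult)
  have fH: "integrable Mx (\<lambda>x. ff \<tau> x * H x)"
  proof (rule Bochner_Integration.integrable_bound[OF integrable_ff[OF \<tau>]])
    show "AE x in Mx. norm (ff \<tau> x * H x) \<le> norm (ff \<tau> x)"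
      using H by (intro AE_I2) (auto simp: abs_mult intro!: mult_left_le)
  qed measurable
  have lower: "ww \<tau> x * H x / 8 \<le> q x + ff \<tau> x * H x" if "x \<in> Dom P" for x
  proof -
    have "(ww \<tau> x / 8 - ff \<tau> x) * H x \<le> q x" unfolding q_def using bd(1)[OF that] H[of x] by (intro mult_right_mono) auto
    thus ?thesis by (simp add: left_diff_distrib)
  qed
  have wH: "integrable Mx (\<lambda>x. ww \<tau> x * H x / 8)"
  proof (rule Bochner_Integration.integrable_bound[OF Bochner_Integration.integrable_add[OF qi fH]])
    show "AE x in Mx. norm (ww \<tau> x * H x / 8) \<le> norm (q x + ff \<tau> x * H x)"
    proof (rule AE_I2)
      fix x assume "x \<in> space Mx"
      hence x: "x \<in> Dom P" by (simp add: space_Mx)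
      have "0 \<le> ww \<tau> x * H x / 8" using x_pos[OF x] H[of x] by simp
      thus "norm (ww \<tau> x * H x / 8) \<le> norm (q x + ff \<tau> x * H x)" using lower[OF x] by simp
    qed
  qed measurable
  define Dr where "Dr = (\<integral>x. ww \<tau> x * H x / 8 \<partial>Mx)"
  define Sr where "Sr = (\<integral>x. ff \<tau> x * H x + Por P x * psi \<tau> x * \<bar>F (uu \<tau> x)\<bar> \<partial>Mx)"
  have "J = (\<integral>x. Por P x * pt \<tau> x * F (uu \<tau> x) - Por P x * st \<tau> x * F (uu \<tau> x) \<partial>Mx)"
    unfolding J_def by (rule Bochner_Integration.integral_cong) (auto simp: algebra_simps)
  also have "\<dots> = - (\<integral>x. q x \<partial>Mx) - (\<integral>x. Por P x * st \<tau> x * F (uu \<tau> x) \<partial>Mx)"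
    using pF sF' by (simp add: test)
  finally have Jeq: "J = - (\<integral>x. q x \<partial>Mx) - (\<integral>x. Por P x * st \<tau> x * F (uu \<tau> x) \<partial>Mx)" .
  have "Dr \<le> (\<integral>x. q x + ff \<tau> x * H x \<partial>Mx)"
    unfolding Dr_def using lower by (intro integral_mono wH Bochner_Integration.integrable_add qi fH) (auto simp: space_Mx)
  also have "\<dots> = (\<integral>x. q x \<partial>Mx) + (\<integral>x. ff \<tau> x * H x \<partial>Mx)" using qi fH by simp
  finally have 1: "Dr \<le> (\<integral>x. q x \<partial>Mx) + (\<integral>x. ff \<tau> x * H x \<partial>Mx)" .
  have "- (\<integral>x. Por P x * st \<tau> x * F (uu \<tau> x) \<partial>Mx) = (\<integral>x. - (Por P x * st \<tau> x * F (uu \<tau> x)) \<partial>Mx)" by simp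
  also have "\<dots> \<le> (\<integral>x. Por P x * psi \<tau> x * \<bar>F (uu \<tau> x)\<bar> \<partial>Mx)"
  proof (rule integral_mono)
    fix x assume "x \<in> space Mx"
    hence "Por P x > 0" using x_pos by (simp add: space_Mx)
    hence "Por P x * psi \<tau> x * \<bar>F (uu \<tau> x)\<bar> = \<bar>Por P x * st \<tau> x * F (uu \<tau> x)\<bar>" by (simp add: psi_def abs_mult)
    thus "- (Por P x * st \<tau> x * F (uu \<tau> x)) \<le> Por P x * psi \<tau> x * \<bar>F (uu \<tau> x)\<bar>" by linarith
  qed (use sF sF' in auto)
  finally have 2: "- (\<integral>x. Por P x * st \<tau> x * F (uu \<tau> x) \<partial>Mx) \<le> (\<integral>x. Por P x * psi \<tau> x * \<bar>F (uu \<tau> x)\<bar> \<partial>Mx)" .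
  have 3: "Sr = (\<integral>x. ff \<tau> x * H x \<partial>Mx) + (\<integral>x. Por P x * psi \<tau> x * \<bar>F (uu \<tau> x)\<bar> \<partial>Mx)"
    unfolding Sr_def using fH sF by simp
  have DJ: "Dr + J \<le> Sr" using Jeq 1 2 3 by linarith
  have Dn: "AE x in Mx. 0 \<le> ww \<tau> x * H x / 8" using x_pos H by (intro AE_I2) (simp add: space_Mx)
  have D_eq: "(\<integral>\<^sup>+x. ennreal (ww \<tau> x * h (uu \<tau> x) / 8) \<partial>Mx) = ennreal Dr" "0 \<le> Dr"
    unfolding Dr_def H_def[symmetric]
    by (rule nn_integral_eq_integral[OF wH Dn], rule integral_nonneg_AE[OF Dn])
  have Sn: "AE x in Mx. 0 \<le> ff \<tau> x * H x + Por P x * psi \<tau> x * \<bar>F (uu \<tau> x)\<bar>"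
    using x_pos H by (intro AE_I2 add_nonneg_nonneg mult_nonneg_nonneg) (auto simp: space_Mx less_imp_le)
  have S_eq: "(\<integral>\<^sup>+x. ennreal (ff \<tau> x * h (uu \<tau> x) + Por P x * psi \<tau> x * \<bar>F (uu \<tau> x)\<bar>) \<partial>Mx) = ennreal Sr" "0 \<le> Sr"
    unfolding Sr_def H_def[symmetric]
    by (rule nn_integral_eq_integral[OF Bochner_Integration.integrable_add[OF fH sF] Sn], rule integral_nonneg_AE[OF Sn])
  show ?thesis unfolding D_eq S_eq by (rule ennreal_pos_neg_le[OF D_eq(2) S_eq(2) DJ])
qed

lemma pair_sigma: "pair_sigma_finite Mx (lborel :: real measure)"
  by (intro pair_sigma_finite.intro sigma_Mx lborel.sigma_finite_measure_axioms)

lemma time_integrable_pt: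
  assumes "0 < s" "s < t"
  shows "integrable (Mx \<Otimes>\<^sub>M lborel) (\<lambda>z. Por P (fst z) * pt (snd z) (fst z) * indicator {s..t} (snd z))"
proof -
  have UU: "Dom P \<times> (UNIV :: real set) \<in> sets (leb (Dim P) \<Otimes>\<^sub>M lborel)" by (rule prod_sets) simp
  have "set_integrable (leb (Dim P) \<Otimes>\<^sub>M lborel) (Dom P \<times> {s..t}) (\<lambda>(x, \<tau>). Por P x * DtPres P \<tau> x)"
    using solution assms unfolding solution_def by blast
  hence "integrable (leb (Dim P) \<Otimes>\<^sub>M lborel) (\<lambda>z. indicator (Dom P \<times> {s..t}) z *\<^sub>R (case z of (x, \<tau>) \<Rightarrow> Por P x * DtPres P \<tau> x))"
    by (simp add: set_integrable_def)
  also have "(\<lambda>z. indicator (Dom P \<times> {s..t}) z *\<^sub>R (case z of (x, \<tau>) \<Rightarrow> Por P x * DtPres P \<tau> x))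
    = (\<lambda>z. indicator (Dom P \<times> UNIV) z *\<^sub>R (Por P (fst z) * pt (snd z) (fst z) * indicator {s..t} (snd z)))"
    using assms by (auto simp: fun_eq_iff indicator_def pt_def)
  finally show ?thesis unfolding pair_Mx using UU by (subst integrable_restrict_space) auto
qed

lemma source_psi_bound:
  assumes "0 < \<tau>" "\<tau> \<le> t"
  shows "(\<integral>\<^sup>+x. ennreal (Por P x * psi \<tau> x) \<partial>Mx) \<le> ennreal ((\<integral>x. Por P x \<partial>Mx) + M t powr (2 * (1 - a) / (2 - a)))"
proof -
  have "(\<integral>\<^sup>+x. ennreal (Por P x * psi \<tau> x) \<partial>Mx) \<le> (\<integral>\<^sup>+x. ennreal (Por P x) + ennreal (Por P x * (psi \<tau> x)\<^sup>2) \<partial>Mx)"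
  proof (rule nn_integral_mono)
    fix x assume "x \<in> space Mx"
    hence p: "0 < Por P x" using coef_pos by (simp add: space_Mx)
    have "0 \<le> (psi \<tau> x - 1)\<^sup>2" by simp
    hence "2 * psi \<tau> x \<le> 1 + (psi \<tau> x)\<^sup>2" by (simp add: power2_diff algebra_simps)
    hence "psi \<tau> x \<le> 1 + (psi \<tau> x)\<^sup>2" using densities_nonneg(3)[of \<tau> x] by linarith
    hence "Por P x * psi \<tau> x \<le> Por P x * (1 + (psi \<tau> x)\<^sup>2)" using p by (intro mult_left_mono) auto
    thus "ennreal (Por P x * psi \<tau> x) \<le> ennreal (Por P x) + ennreal (Por P x * (psi \<tau> x)\<^sup>2)"
      using p by (simp add: distrib_left ennreal_leI flip: ennreal_plus)
  qed
  also have "\<dots> = (\<integral>\<^sup>+x. ennreal (Por P x) \<partial>Mx) + (\<integral>\<^sup>+x. ennreal (Por P x * (psi \<tau> x)\<^sup>2) \<partial>Mx)"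
    by (rule nn_integral_add) measurable
  also have "(\<integral>\<^sup>+x. ennreal (Por P x) \<partial>Mx) = ennreal (\<integral>x. Por P x \<partial>Mx)"
    using coef_pos by (intro nn_integral_eq_integral integrable_por AE_I2) (auto simp: space_Mx less_imp_le)
  also have "(\<integral>\<^sup>+x. ennreal (Por P x * (psi \<tau> x)\<^sup>2) \<partial>Mx) \<le> ennreal (M t powr (2 * (1 - a) / (2 - a)))"
    using gg_le_M[of \<tau> t] gg_ge_1[of \<tau>] assms a_bounds
    by (intro order_trans[OF G_parts_le(2)] ennreal_leI powr_mono2) auto
  also have "ennreal (\<integral>x. Por P x \<partial>Mx) + ennreal (M t powr (2 * (1 - a) / (2 - a)))
    = ennreal ((\<integral>x. Por P x \<partial>Mx) + M t powr (2 * (1 - a) / (2 - a)))"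
    using coef_pos by (intro ennreal_plus[symmetric] integral_nonneg_AE AE_I2) (auto simp: space_Mx less_imp_le)
  finally show ?thesis by (simp add: add_left_mono)
qed

lemma time_integrable_st:
  assumes "0 < s" "s < t"
  shows "integrable (Mx \<Otimes>\<^sub>M lborel) (\<lambda>z. Por P (fst z) * st (snd z) (fst z) * indicator {s..t} (snd z))"
proof (rule integrableI_bounded)
  interpret pair_sigma_finite Mx "lborel :: real measure" by (rule pair_sigma)
  define c where "c = (\<integral>x. Por P x \<partial>Mx) + M t powr (2 * (1 - a) / (2 - a))"
  have "(\<integral>\<^sup>+z. ennreal (norm (Por P (fst z) * st (snd z) (fst z) * indicator {s..t} (snd z))) \<partial>(Mx \<Otimes>\<^sub>M lborel))
    = (\<integral>\<^sup>+\<tau>. (\<integral>\<^sup>+x. ennreal (norm (Por P x * st \<tau> x * indicator {s..t} \<tau>)) \<partial>Mx) \<partial>lborel)"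
    by (subst nn_integral_snd[symmetric]) auto
  also have "\<dots> \<le> (\<integral>\<^sup>+\<tau>\<in>{s..t}. ennreal c \<partial>lborel)"
  proof (rule nn_integral_mono)
    fix \<tau> :: real
    show "(\<integral>\<^sup>+x. ennreal (norm (Por P x * st \<tau> x * indicator {s..t} \<tau>)) \<partial>Mx) \<le> ennreal c * indicator {s..t} \<tau>"
    proof (cases "\<tau> \<in> {s..t}")
      case True
      have "(\<integral>\<^sup>+x. ennreal (norm (Por P x * st \<tau> x * indicator {s..t} \<tau>)) \<partial>Mx) = (\<integral>\<^sup>+x. ennreal (Por P x * psi \<tau> x) \<partial>Mx)"
      proof (rule nn_integral_cong)
        fix x assume "x \<in> space Mx"
        hence "0 < Por P x" using coef_pos(1) by (simp add: space_Mx)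
        thus "ennreal (norm (Por P x * st \<tau> x * indicator {s..t} \<tau>)) = ennreal (Por P x * psi \<tau> x)"
          using True by (simp add: psi_def abs_mult)
      qed
      also have "\<dots> \<le> ennreal c" unfolding c_def using True assms by (intro source_psi_bound) auto
      finally show ?thesis using True by simp
    qed simp
  qed
  also have "\<dots> < \<infinity>" using assms by (simp add: nn_integral_cmult_indicator ennreal_mult_less_top)
  finally show "(\<integral>\<^sup>+z. ennreal (norm (Por P (fst z) * st (snd z) (fst z) * indicator {s..t} (snd z))) \<partial>(Mx \<Otimes>\<^sub>M lborel)) < \<infinity>" .
qed measurable

text \<open>For almost every x both p and \<Psi> are absolutely continuous on the time interval, so
  the chain rule for absolutely continuous functions applies to each such x separately.\<close>

lemma chain_rule_in_time:
  assumes st: "0 < s" "s < t" and A: "admissible h F \<Phi>"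
  shows "AE x in Mx. \<Phi> (uu t x) - \<Phi> (uu s x) = (\<integral>\<tau>. F (uu \<tau> x) * (pt \<tau> x - st \<tau> x) * indicator {s..t} \<tau> \<partial>lborel)"
proof -
  note D = admissibleD[OF A]
  have t1: "AE x in leb (Dim P). x \<in> Dom P \<longrightarrow> (\<forall>s\<in>{0<..}. \<forall>t\<in>{0<..}. s < t \<longrightarrow>
       set_integrable lborel {s..t} (\<lambda>\<tau>. DtPres P \<tau> x) \<and> Pres P t x - Pres P s x = (LINT \<tau>:{s..t}|lborel. DtPres P \<tau> x))"
    using solution unfolding solution_def time_derivative_def by blast
  have t2: "AE x in leb (Dim P). x \<in> Dom P \<longrightarrow> (\<forall>s\<in>{0..}. \<forall>t\<in>{0..}. s < t \<longrightarrow>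
       set_integrable lborel {s..t} (\<lambda>\<tau>. DtPsi P \<tau> x) \<and> Psi P t x - Psi P s x = (LINT \<tau>:{s..t}|lborel. DtPsi P \<tau> x))"
    using extension unfolding extension_def time_derivative_def by blast
  have "AE x in leb (Dim P). x \<in> Dom P \<longrightarrow> \<Phi> (uu t x) - \<Phi> (uu s x) = (\<integral>\<tau>. F (uu \<tau> x) * (pt \<tau> x - st \<tau> x) * indicator {s..t} \<tau> \<partial>lborel)"
    using t1 t2
  proof eventually_elim
    case (elim x)
    show ?case
    proof
      assume x: "x \<in> Dom P"
      define g where "g \<tau> = DtPres P \<tau> x - DtPsi P \<tau> x" for \<tau>
      define w where "w \<tau> = pbar P \<tau> x" for \<tau>
      have gi: "set_integrable lborel {u..v} g" "w v - w u = (LINT \<tau>:{u..v}|lborel. g \<tau>)" if "s \<le> u" "u < v" for u v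
      proof -
        have a: "set_integrable lborel {u..v} (\<lambda>\<tau>. DtPres P \<tau> x)" "Pres P v x - Pres P u x = (LINT \<tau>:{u..v}|lborel. DtPres P \<tau> x)"
          using elim(1) x that st by auto
        have b: "set_integrable lborel {u..v} (\<lambda>\<tau>. DtPsi P \<tau> x)" "Psi P v x - Psi P u x = (LINT \<tau>:{u..v}|lborel. DtPsi P \<tau> x)"
          using elim(2) x that st by auto
        show "set_integrable lborel {u..v} g" unfolding g_def by (rule set_integral_diff(1)[OF a(1) b(1)])
        show "w v - w u = (LINT \<tau>:{u..v}|lborel. g \<tau>)"
          unfolding g_def set_integral_diff(2)[OF a(1) b(1)] using a(2) b(2) by (simp add: w_def pbar_def)
      qed
      have "w v - w u = (LINT \<tau>:{u..v}|lborel. g \<tau>)" if "s \<le> u" "u \<le> v" "v \<le> t" for u v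
      proof (cases "u = v")
        \<comment> \<open>\<open>time_derivative\<close> speaks of strictly ordered times; for equal
          ones the integral is over a single point.\<close>
        case True
        have "(LINT \<tau>:{v}|lborel. g \<tau>) = 0"
          unfolding set_lebesgue_integral_def
          by (rule integral_eq_zero_AE) (use AE_lborel_singleton[of v] in \<open>eventually_elim, auto\<close>)
        thus ?thesis using True by simp
      qed (use gi(2)[of u v] that in auto)
      hence "\<Phi> (w t) - \<Phi> (w s) = (LINT \<tau>:{s..t}|lborel. F (w \<tau>) * g \<tau>)"
        using st gi(1)[of s t] by (intro absolutely_continuous_chain_rule(2)[where h = h] D) auto
      also have "\<dots> = (\<integral>\<tau>. F (uu \<tau> x) * (pt \<tau> x - st \<tau> x) * indicator {s..t} \<tau> \<partial>lborel)"
        unfolding set_lebesgue_integral_def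
        using st by (intro Bochner_Integration.integral_cong) (auto simp: indicator_def uu_def pt_def st_def w_def g_def)
      finally show "\<Phi> (uu t x) - \<Phi> (uu s x) = (\<integral>\<tau>. F (uu \<tau> x) * (pt \<tau> x - st \<tau> x) * indicator {s..t} \<tau> \<partial>lborel)"
        using st by (simp add: w_def uu_def)
    qed
  qed
  thus ?thesis unfolding Mx_def using Dom_sets' by (simp add: AE_restrict_space_iff)
qed

text \<open>The chain rule is integrated in space and the tested equation in time; by Fubini the
  energy increment \<Delta> and the rate \<open>J\<close> have the same total integral. Both are
  kept as positive and negative parts, which are finite because \<open>F\<close> is bounded and can
  therefore be cancelled at the end.\<close>

lemma energy_truncated:
  assumes A: "admissible h F \<Phi>" and B: "\<exists>B. \<forall>v. \<bar>F v\<bar> \<le> B" and st: "0 < s" "s < t"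
  shows "(\<integral>\<^sup>+\<tau>\<in>{s..t}. (\<integral>\<^sup>+x. ennreal (ww \<tau> x * h (uu \<tau> x)) \<partial>Mx) \<partial>lborel) < \<infinity> \<and>
      (\<integral>\<^sup>+x. ennreal (Por P x * \<Phi> (uu t x)) \<partial>Mx) + (\<integral>\<^sup>+\<tau>\<in>{s..t}. (\<integral>\<^sup>+x. ennreal (ww \<tau> x * h (uu \<tau> x) / 8) \<partial>Mx) \<partial>lborel)
      \<le> (\<integral>\<^sup>+x. ennreal (Por P x * \<Phi> (uu s x)) \<partial>Mx)
        + (\<integral>\<^sup>+\<tau>\<in>{s..t}. (\<integral>\<^sup>+x. ennreal (ff \<tau> x * h (uu \<tau> x) + Por P x * psi \<tau> x * \<bar>F (uu \<tau> x)\<bar>) \<partial>Mx) \<partial>lborel)"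
proof -
  interpret pair_sigma_finite Mx "lborel :: real measure" by (rule pair_sigma)
  interpret sigma_finite_measure Mx by (rule sigma_Mx)
  note D = admissibleD[OF A]
  note [measurable] = D(9-11)
  obtain b where b: "\<And>v. \<bar>F v\<bar> \<le> b" using B by blast
  have b0: "0 \<le> b" using b[of 0] by linarith
  define H where "H = (\<lambda>z. Por P (fst z) * F (uu (snd z) (fst z)) * (pt (snd z) (fst z) - st (snd z) (fst z)) * indicator {s..t} (snd z))"
  have Hm [measurable]: "H \<in> borel_measurable (Mx \<Otimes>\<^sub>M lborel)" unfolding H_def by measurable
  \<comment> \<open>As \<open>F\<close> is bounded, integrability of \<phi> p_t and of \<phi>
    \<Psi>_t over the time interval suffices.\<close>
  have Hi: "integrable (Mx \<Otimes>\<^sub>M lborel) H"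
  proof (rule Bochner_Integration.integrable_bound[OF _ Hm])
    show "integrable (Mx \<Otimes>\<^sub>M lborel) (\<lambda>z. b * (Por P (fst z) * pt (snd z) (fst z) * indicator {s..t} (snd z)
        - Por P (fst z) * st (snd z) (fst z) * indicator {s..t} (snd z)))"
      by (intro integrable_mult_right Bochner_Integration.integrable_diff time_integrable_pt time_integrable_st st)
    show "AE z in Mx \<Otimes>\<^sub>M lborel. norm (H z) \<le> norm (b * (Por P (fst z) * pt (snd z) (fst z) * indicator {s..t} (snd z)
        - Por P (fst z) * st (snd z) (fst z) * indicator {s..t} (snd z)))"
    proof (rule AE_I2)
      fix z :: "point \<times> real"
      define y where "y = Por P (fst z) * pt (snd z) (fst z) * indicator {s..t} (snd z) - Por P (fst z) * st (snd z) (fst z) * indicator {s..t} (snd z)"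
      have "H z = F (uu (snd z) (fst z)) * y" by (simp add: H_def y_def algebra_simps)
      hence "norm (H z) = \<bar>F (uu (snd z) (fst z))\<bar> * \<bar>y\<bar>" by (simp add: abs_mult)
      also have "\<dots> \<le> b * \<bar>y\<bar>" using b by (intro mult_right_mono) auto
      also have "\<dots> = norm (b * y)" using b0 by (simp add: abs_mult)
      finally show "norm (H z) \<le> norm (b * (Por P (fst z) * pt (snd z) (fst z) * indicator {s..t} (snd z)
        - Por P (fst z) * st (snd z) (fst z) * indicator {s..t} (snd z)))" by (simp add: y_def)
    qed
  qed
  define \<Delta> where "\<Delta> x = Por P x * \<Phi> (uu t x) - Por P x * \<Phi> (uu s x)" for x
  define J where "J \<tau> = (\<integral>x. H (x, \<tau>) \<partial>Mx)" for \<tau>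
  have \<Delta>eq: "AE x in Mx. \<Delta> x = (\<integral>\<tau>. H (x, \<tau>) \<partial>lborel)"
    using chain_rule_in_time[OF st A]
  proof eventually_elim
    case (elim x)
    have "(\<integral>\<tau>. H (x, \<tau>) \<partial>lborel) = (\<integral>\<tau>. Por P x * (F (uu \<tau> x) * (pt \<tau> x - st \<tau> x) * indicator {s..t} \<tau>) \<partial>lborel)"
      by (rule Bochner_Integration.integral_cong) (auto simp: H_def)
    also have "\<dots> = Por P x * (\<Phi> (uu t x) - \<Phi> (uu s x))" using elim by simp
    finally show ?case by (simp add: \<Delta>_def right_diff_distrib)
  qed
  have \<Delta>m [measurable]: "\<Delta> \<in> borel_measurable Mx" unfolding \<Delta>_def by measurable
  have Hi': "integrable (Mx \<Otimes>\<^sub>M lborel) (case_prod (\<lambda>x \<tau>. H (x, \<tau>)))" using Hi by simp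
  have \<Delta>i: "integrable Mx \<Delta>"
    using integrable_fst[OF Hi'] \<Delta>eq by (subst integrable_cong_AE[of _ _ "\<lambda>x. \<integral>\<tau>. H (x, \<tau>) \<partial>lborel"]) auto
  have Ji: "integrable lborel J" unfolding J_def using integrable_snd[OF Hi'] .
  have \<Delta>J: "(\<integral>x. \<Delta> x \<partial>Mx) = (\<integral>\<tau>. J \<tau> \<partial>lborel)"
  proof -
    have "(\<integral>x. \<Delta> x \<partial>Mx) = (\<integral>x. (\<integral>\<tau>. H (x, \<tau>) \<partial>lborel) \<partial>Mx)"
      using \<Delta>eq by (intro integral_cong_AE) auto
    also have "\<dots> = (\<integral>\<tau>. (\<integral>x. H (x, \<tau>) \<partial>Mx) \<partial>lborel)" by (rule Fubini_integral[OF Hi', symmetric])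
    finally show ?thesis by (simp add: J_def)
  qed
  note [measurable] = borel_measurable_integrable[OF Ji]
  define X where "X \<tau> = (\<integral>\<^sup>+x. ennreal (ww \<tau> x * h (uu \<tau> x) / 8) \<partial>Mx)" for \<tau>
  define Y where "Y \<tau> = (\<integral>\<^sup>+x. ennreal (ff \<tau> x * h (uu \<tau> x) + Por P x * psi \<tau> x * \<bar>F (uu \<tau> x)\<bar>) \<partial>Mx)" for \<tau>
  have [measurable]: "X \<in> borel_measurable lborel" "Y \<in> borel_measurable lborel" unfolding X_def Y_def by measurable
  have pti: "AE \<tau> in lborel. integrable Mx (\<lambda>x. Por P x * pt \<tau> x * indicator {s..t} \<tau>)"
    using AE_integrable_snd[of "\<lambda>x \<tau>. Por P x * pt \<tau> x * indicator {s..t} \<tau>"] time_integrable_pt[OF st]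
    by (simp add: case_prod_beta')
  have XY: "AE \<tau> in lborel. X \<tau> * indicator {s..t} \<tau> + ennreal (J \<tau>) \<le> Y \<tau> * indicator {s..t} \<tau> + ennreal (- J \<tau>)"
    using AE_good pti
  proof eventually_elim
    case (elim \<tau>)
    show ?case
    proof (cases "\<tau> \<in> {s..t}")
      case True
      hence \<tau>: "0 < \<tau>" using st by simp
      have "J \<tau> = (\<integral>x. Por P x * F (uu \<tau> x) * (pt \<tau> x - st \<tau> x) \<partial>Mx)" using True by (simp add: J_def H_def)
      thus ?thesis using energy_at[OF \<tau> _ _ A b] elim \<tau> True by (simp add: X_def Y_def)
    next
      case False
      hence "J \<tau> = 0" by (simp add: J_def H_def)
      thus ?thesis using False by simp
    qed
  qed
  define Jp where "Jp = (\<integral>\<^sup>+\<tau>. ennreal (J \<tau>) \<partial>lborel)" define Jm where "Jm = (\<integral>\<^sup>+\<tau>. ennreal (- J \<tau>) \<partial>lborel)"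
  define Dp where "Dp = (\<integral>\<^sup>+x. ennreal (\<Delta> x) \<partial>Mx)" define Dm where "Dm = (\<integral>\<^sup>+x. ennreal (- \<Delta> x) \<partial>Mx)"
  have finite: "Jp < \<infinity>" "Jm < \<infinity>" "Dp < \<infinity>" "Dm < \<infinity>"
    using Ji \<Delta>i unfolding Jp_def Jm_def Dp_def Dm_def real_integrable_def by (auto simp: less_top)
  have DJ: "Dp + Jm = Dm + Jp"
  proof -
    have "enn2real Dp - enn2real Dm = enn2real Jp - enn2real Jm"
      using \<Delta>J unfolding real_lebesgue_integral_def[OF \<Delta>i] real_lebesgue_integral_def[OF Ji] Jp_def Jm_def Dp_def Dm_def .
    hence "enn2real Dp + enn2real Jm = enn2real Dm + enn2real Jp" by linarith
    hence "ennreal (enn2real Dp + enn2real Jm) = ennreal (enn2real Dm + enn2real Jp)" by simp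
    thus ?thesis using finite by (simp add: ennreal_plus less_top)
  qed
  have yD: "(\<integral>\<^sup>+x. ennreal (Por P x * \<Phi> (uu t x)) \<partial>Mx) + Dm = (\<integral>\<^sup>+x. ennreal (Por P x * \<Phi> (uu s x)) \<partial>Mx) + Dp"
  proof -
    have "(\<integral>\<^sup>+x. ennreal (Por P x * \<Phi> (uu t x)) \<partial>Mx) + Dm = (\<integral>\<^sup>+x. ennreal (Por P x * \<Phi> (uu t x)) + ennreal (- \<Delta> x) \<partial>Mx)"
      unfolding Dm_def by (rule nn_integral_add[symmetric]) measurable
    also have "\<dots> = (\<integral>\<^sup>+x. ennreal (Por P x * \<Phi> (uu s x)) + ennreal (\<Delta> x) \<partial>Mx)"
    proof (rule nn_integral_cong)
      fix x assume "x \<in> space Mx"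
      hence p: "0 \<le> Por P x * \<Phi> (uu t x)" "0 \<le> Por P x * \<Phi> (uu s x)"
        using coef_pos[of x] admissible_sign(4)[OF A] by (auto simp: space_Mx)
      show "ennreal (Por P x * \<Phi> (uu t x)) + ennreal (- \<Delta> x) = ennreal (Por P x * \<Phi> (uu s x)) + ennreal (\<Delta> x)"
      proof (cases "0 \<le> \<Delta> x")
        case True thus ?thesis using p by (simp add: ennreal_neg \<Delta>_def flip: ennreal_plus)
      next
        case False thus ?thesis using p by (simp add: ennreal_neg \<Delta>_def flip: ennreal_plus)
      qed
    qed
    also have "\<dots> = (\<integral>\<^sup>+x. ennreal (Por P x * \<Phi> (uu s x)) \<partial>Mx) + Dp"
      unfolding Dp_def by (rule nn_integral_add) measurable
    finally show ?thesis .
  qed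
  have XJ: "(\<integral>\<^sup>+\<tau>\<in>{s..t}. X \<tau> \<partial>lborel) + Jp \<le> (\<integral>\<^sup>+\<tau>\<in>{s..t}. Y \<tau> \<partial>lborel) + Jm"
  proof -
    have "(\<integral>\<^sup>+\<tau>\<in>{s..t}. X \<tau> \<partial>lborel) + Jp = (\<integral>\<^sup>+\<tau>. X \<tau> * indicator {s..t} \<tau> + ennreal (J \<tau>) \<partial>lborel)"
      unfolding Jp_def by (rule nn_integral_add[symmetric]) measurable
    also have "\<dots> \<le> (\<integral>\<^sup>+\<tau>. Y \<tau> * indicator {s..t} \<tau> + ennreal (- J \<tau>) \<partial>lborel)"
      by (rule nn_integral_mono_AE[OF XY])
    also have "\<dots> = (\<integral>\<^sup>+\<tau>\<in>{s..t}. Y \<tau> \<partial>lborel) + Jm"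
      unfolding Jm_def by (rule nn_integral_add) measurable
    finally show ?thesis .
  qed
  \<comment> \<open>The sources are finite by the majorant at the final time and the bound on
    \<open>F\<close>; finiteness of the dissipation follows from the inequality just shown.\<close>
  have Yfin: "(\<integral>\<^sup>+\<tau>\<in>{s..t}. Y \<tau> \<partial>lborel) < \<infinity>"
  proof -
    define c where "c = (\<integral>x. Por P x \<partial>Mx) + M t powr (2 * (1 - a) / (2 - a))"
    have "(\<integral>\<^sup>+\<tau>\<in>{s..t}. Y \<tau> \<partial>lborel) \<le> (\<integral>\<^sup>+\<tau>\<in>{s..t}. ennreal (M t) + ennreal b * ennreal c \<partial>lborel)"
    proof (rule nn_integral_mono)
      fix \<tau> :: real
      show "Y \<tau> * indicator {s..t} \<tau> \<le> (ennreal (M t) + ennreal b * ennreal c) * indicator {s..t} \<tau>"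
      proof (cases "\<tau> \<in> {s..t}")
        case True
        hence \<tau>: "0 < \<tau>" "\<tau> \<le> t" using st by auto
        have "Y \<tau> \<le> (\<integral>\<^sup>+x. ennreal (ff \<tau> x) + ennreal b * ennreal (Por P x * psi \<tau> x) \<partial>Mx)"
          unfolding Y_def
        proof (rule nn_integral_mono)
          fix x assume "x \<in> space Mx"
          hence x: "x \<in> Dom P" by (simp add: space_Mx)
          have p: "0 \<le> Por P x * psi \<tau> x" using coef_pos[OF x] densities_nonneg(3)[of \<tau> x] by simp
          have "ff \<tau> x * h (uu \<tau> x) \<le> ff \<tau> x" using densities_nonneg(2)[OF x, of \<tau>] D(2,3) by (intro mult_left_le) auto
          moreover have "Por P x * psi \<tau> x * \<bar>F (uu \<tau> x)\<bar> \<le> Por P x * psi \<tau> x * b" using b p by (intro mult_left_mono) auto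
          ultimately have "ff \<tau> x * h (uu \<tau> x) + Por P x * psi \<tau> x * \<bar>F (uu \<tau> x)\<bar> \<le> ff \<tau> x + b * (Por P x * psi \<tau> x)"
            by (simp add: mult_ac)
          thus "ennreal (ff \<tau> x * h (uu \<tau> x) + Por P x * psi \<tau> x * \<bar>F (uu \<tau> x)\<bar>)
              \<le> ennreal (ff \<tau> x) + ennreal b * ennreal (Por P x * psi \<tau> x)"
            using b0 p densities_nonneg(2)[OF x, of \<tau>] by (simp add: ennreal_leI flip: ennreal_mult ennreal_plus)
        qed
        also have "\<dots> = (\<integral>\<^sup>+x. ennreal (ff \<tau> x) \<partial>Mx) + ennreal b * (\<integral>\<^sup>+x. ennreal (Por P x * psi \<tau> x) \<partial>Mx)"
          by (simp add: nn_integral_add nn_integral_cmult)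
        also have "\<dots> \<le> ennreal (M t) + ennreal b * ennreal c"
          unfolding c_def using \<tau> gg_le_M[of \<tau> t]
          by (intro add_mono mult_left_mono source_psi_bound order_trans[OF G_parts_le(1)] ennreal_leI) auto
        finally show ?thesis using True by simp
      qed simp
    qed
    also have "\<dots> < \<infinity>" using st by (simp add: nn_integral_cmult_indicator ennreal_mult_less_top)
    finally show ?thesis .
  qed
  have Xfin: "(\<integral>\<^sup>+\<tau>\<in>{s..t}. X \<tau> \<partial>lborel) < \<infinity>"
  proof -
    have "(\<integral>\<^sup>+\<tau>\<in>{s..t}. X \<tau> \<partial>lborel) \<le> (\<integral>\<^sup>+\<tau>\<in>{s..t}. Y \<tau> \<partial>lborel) + Jm"
      by (rule order_trans[OF add_increasing2[OF zero_le order_refl] XJ])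
    also have "\<dots> < \<infinity>" using Yfin finite by simp
    finally show ?thesis .
  qed
  have "(\<integral>\<^sup>+\<tau>\<in>{s..t}. (\<integral>\<^sup>+x. ennreal (ww \<tau> x * h (uu \<tau> x)) \<partial>Mx) \<partial>lborel) = 8 * (\<integral>\<^sup>+\<tau>\<in>{s..t}. X \<tau> \<partial>lborel)"
  proof -
    have "(\<integral>\<^sup>+x. ennreal (ww \<tau> x * h (uu \<tau> x)) \<partial>Mx) = 8 * X \<tau>" for \<tau>
    proof -
      have "8 * X \<tau> = (\<integral>\<^sup>+x. 8 * ennreal (ww \<tau> x * h (uu \<tau> x) / 8) \<partial>Mx)"
        unfolding X_def by (rule nn_integral_cmult[symmetric]) measurable
      also have "\<dots> = (\<integral>\<^sup>+x. ennreal (ww \<tau> x * h (uu \<tau> x)) \<partial>Mx)"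
      proof (rule nn_integral_cong)
        fix x
        have "ennreal 8 * ennreal (ww \<tau> x * h (uu \<tau> x) / 8) = ennreal (8 * (ww \<tau> x * h (uu \<tau> x) / 8))"
          by (rule ennreal_mult'[symmetric]) simp
        thus "8 * ennreal (ww \<tau> x * h (uu \<tau> x) / 8) = ennreal (ww \<tau> x * h (uu \<tau> x))" by simp
      qed
      finally show ?thesis by simp
    qed
    thus ?thesis by (simp add: nn_integral_cmult mult.assoc)
  qed
  hence fin: "(\<integral>\<^sup>+\<tau>\<in>{s..t}. (\<integral>\<^sup>+x. ennreal (ww \<tau> x * h (uu \<tau> x)) \<partial>Mx) \<partial>lborel) < \<infinity>"
    using Xfin by (simp add: ennreal_mult_less_top)
  define y1 where "y1 = (\<integral>\<^sup>+x. ennreal (Por P x * \<Phi> (uu t x)) \<partial>Mx)"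
  define y2 where "y2 = (\<integral>\<^sup>+x. ennreal (Por P x * \<Phi> (uu s x)) \<partial>Mx)"
  define IX where "IX = (\<integral>\<^sup>+\<tau>\<in>{s..t}. X \<tau> \<partial>lborel)" define IY where "IY = (\<integral>\<^sup>+\<tau>\<in>{s..t}. Y \<tau> \<partial>lborel)"
  have "(Dm + Jp) + (y1 + IX) = (y1 + Dm) + (IX + Jp)" by (simp add: ac_simps)
  also have "\<dots> \<le> (y2 + Dp) + (IY + Jm)"
    unfolding y1_def y2_def IX_def IY_def by (rule add_mono[OF eq_refl[OF yD] XJ])
  also have "\<dots> = (Dp + Jm) + (y2 + IY)" by (simp add: ac_simps)
  also have "\<dots> = (Dm + Jp) + (y2 + IY)" by (simp only: DJ)
  finally have "y1 + IX \<le> y2 + IY" using finite by (simp add: ennreal_add_left_cancel_le less_top[symmetric])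
  thus ?thesis using fin unfolding y1_def y2_def IX_def IY_def X_def Y_def by simp
qed

section \<open>Attainment of the initial values\<close>

lemma section_measurable:
  assumes "spacetime_measurable (Dim P) (Dom P) J q" "t \<in> J"
  shows "q t \<in> borel_measurable Mx"
proof -
  have "(\<lambda>x. x) \<in> Mx \<rightarrow>\<^sub>M leb (Dim P)" unfolding Mx_def by (rule measurable_restrict_space1) simp
  hence "(\<lambda>x. (x, t)) \<in> Mx \<rightarrow>\<^sub>M leb (Dim P) \<Otimes>\<^sub>M lborel" by simp
  hence "(\<lambda>x. (x, t)) \<in> Mx \<rightarrow>\<^sub>M restrict_space (leb (Dim P) \<Otimes>\<^sub>M lborel) (Dom P \<times> J)"
    by (rule measurable_restrict_space2[rotated]) (use assms(2) in \<open>auto simp: space_Mx\<close>)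
  from measurable_compose[OF this assms(1)[unfolded spacetime_measurable_def]] show ?thesis by simp
qed

lemma initial_measurable [measurable]:
  assumes "0 \<le> t"
  shows "Pres P t \<in> borel_measurable Mx" "Psi P t \<in> borel_measurable Mx" "pbar P t \<in> borel_measurable Mx"
proof -
  show [measurable]: "Pres P t \<in> borel_measurable Mx" "Psi P t \<in> borel_measurable Mx"
    using solution extension assms unfolding solution_def extension_def
    by (auto intro: section_measurable[where J = "{0..}"])
  show "pbar P t \<in> borel_measurable Mx" unfolding pbar_def[abs_def] by measurable
qed

lemma wnorm_2_le:
  assumes "wnorm (Dim P) (Dom P) 2 (Por P) q \<le> ennreal b" "0 \<le> b"
  shows "(\<integral>\<^sup>+x. ennreal (Por P x * (q x)\<^sup>2) \<partial>Mx) \<le> ennreal (b\<^sup>2)"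
proof -
  have "(\<integral>\<^sup>+x. ennreal (Por P x * (q x)\<^sup>2) \<partial>Mx) epowr (1 / 2) \<le> ennreal b"
    using assms(1) unfolding wnorm_def nn_Mx by (simp add: abs_powr_2 mult.commute)
  hence "(\<integral>\<^sup>+x. ennreal (Por P x * (q x)\<^sup>2) \<partial>Mx) \<le> ennreal (b powr (1 / (1 / 2)))"
    by (rule epowr_le_ennrealD) (use assms in auto)
  thus ?thesis using abs_powr_2[of b] assms(2) by simp
qed

text \<open>For p the convergence to the initial values is part of the notion of solution, but
  \<Psi> is controlled through its time derivative only. The bound is Cauchy-Schwarz in time,
  integrated against \<phi> in space.\<close>

lemma psi_increment:
  assumes s: "0 < s" "s \<le> 1"
  shows "(\<integral>\<^sup>+x. ennreal (Por P x * (Psi P s x - Psi P 0 x)\<^sup>2) \<partial>Mx) \<le> ennreal (s\<^sup>2 * M 1 powr (2 * (1 - a) / (2 - a)))"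
proof -
  interpret pair_sigma_finite Mx "lborel :: real measure" by (rule pair_sigma)
  define c where "c = M 1 powr (2 * (1 - a) / (2 - a))"
  have "AE x in leb (Dim P). x \<in> Dom P \<longrightarrow> (\<forall>s\<in>{0..}. \<forall>t\<in>{0..}. s < t \<longrightarrow>
       set_integrable lborel {s..t} (\<lambda>\<tau>. DtPsi P \<tau> x) \<and>
       Psi P t x - Psi P s x = (LINT \<tau>:{s..t}|lborel. DtPsi P \<tau> x))"
    using extension unfolding extension_def time_derivative_def by blast
  hence AE: "AE x in Mx. (\<forall>s\<in>{0..}. \<forall>t\<in>{0..}. s < t \<longrightarrow>
       set_integrable lborel {s..t} (\<lambda>\<tau>. DtPsi P \<tau> x) \<and>
       Psi P t x - Psi P s x = (LINT \<tau>:{s..t}|lborel. DtPsi P \<tau> x))"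
    unfolding Mx_def by (subst AE_restrict_space_iff) (use Dom_sets' in auto)
  have 1: "AE x in Mx. ennreal (Por P x * (Psi P s x - Psi P 0 x)\<^sup>2)
      \<le> ennreal s * (\<integral>\<^sup>+\<tau>. ennreal (Por P x * (psi \<tau> x)\<^sup>2) * indicator {0..s} \<tau> \<partial>lborel)"
    using AE AE_space
  proof eventually_elim
    case (elim x)
    hence p: "0 < Por P x" using coef_pos by (simp add: space_Mx)
    have i: "integrable lborel (\<lambda>\<tau>. indicator {0..s} \<tau> *\<^sub>R DtPsi P \<tau> x)"
      and e: "Psi P s x - Psi P 0 x = (\<integral>\<tau>. indicator {0..s} \<tau> *\<^sub>R DtPsi P \<tau> x \<partial>lborel)"
      using elim(1) s by (auto simp: set_integrable_def set_lebesgue_integral_def)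
    have m [measurable]: "(\<lambda>\<tau>. psi \<tau> x) \<in> borel_measurable lborel" using elim(2) by measurable
    have "ennreal \<bar>Psi P s x - Psi P 0 x\<bar> \<le> (\<integral>\<^sup>+\<tau>. ennreal (norm (indicator {0..s} \<tau> *\<^sub>R DtPsi P \<tau> x)) \<partial>lborel)"
      unfolding e using integral_norm_bound_ennreal[OF i] by simp
    \<comment> \<open>The indicator is written twice so that the second factor in Cauchy-Schwarz is
      the length of the interval.\<close>
    also have "\<dots> = (\<integral>\<^sup>+\<tau>. (ennreal (psi \<tau> x) * indicator {0..s} \<tau>) * indicator {0..s} \<tau> \<partial>lborel)"
    proof (rule nn_integral_cong_AE)
      show "AE \<tau> in lborel. ennreal (norm (indicator {0..s} \<tau> *\<^sub>R DtPsi P \<tau> x)) = (ennreal (psi \<tau> x) * indicator {0..s} \<tau>) * indicator {0..s} \<tau>"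
        using AE_lborel_singleton[of 0] by eventually_elim (auto simp: psi_def st_def ext_def indicator_def)
    qed
    finally have "(ennreal \<bar>Psi P s x - Psi P 0 x\<bar>)\<^sup>2 \<le> (\<integral>\<^sup>+\<tau>. (ennreal (psi \<tau> x) * indicator {0..s} \<tau>) * indicator {0..s} \<tau> \<partial>lborel)\<^sup>2"
      by (intro power_mono) auto
    also have "\<dots> \<le> (\<integral>\<^sup>+\<tau>. (ennreal (psi \<tau> x) * indicator {0..s} \<tau>)\<^sup>2 \<partial>lborel) * (\<integral>\<^sup>+\<tau>. (indicator {0..s} \<tau>)\<^sup>2 \<partial>lborel)"
      by (rule Cauchy_Schwarz_nn_integral) measurable
    also have "(\<integral>\<^sup>+\<tau>. (indicator {0..s} \<tau>)\<^sup>2 \<partial>lborel) = (\<integral>\<^sup>+\<tau>. indicator {0..s} \<tau> \<partial>lborel)"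
      by (intro nn_integral_cong) (simp add: indicator_def)
    also have "\<dots> = ennreal s" using s by simp
    also have "(\<integral>\<^sup>+\<tau>. (ennreal (psi \<tau> x) * indicator {0..s} \<tau>)\<^sup>2 \<partial>lborel) = (\<integral>\<^sup>+\<tau>. ennreal ((psi \<tau> x)\<^sup>2) * indicator {0..s} \<tau> \<partial>lborel)"
      by (intro nn_integral_cong) (auto simp: indicator_def ennreal_power densities_nonneg)
    finally have "ennreal ((Psi P s x - Psi P 0 x)\<^sup>2) \<le> (\<integral>\<^sup>+\<tau>. ennreal ((psi \<tau> x)\<^sup>2) * indicator {0..s} \<tau> \<partial>lborel) * ennreal s"
      by (simp add: ennreal_power)
    hence "ennreal (Por P x) * ennreal ((Psi P s x - Psi P 0 x)\<^sup>2)
      \<le> ennreal (Por P x) * ((\<integral>\<^sup>+\<tau>. ennreal ((psi \<tau> x)\<^sup>2) * indicator {0..s} \<tau> \<partial>lborel) * ennreal s)"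
      by (rule mult_left_mono) simp
    also have "\<dots> = ennreal s * (\<integral>\<^sup>+\<tau>. ennreal (Por P x) * (ennreal ((psi \<tau> x)\<^sup>2) * indicator {0..s} \<tau>) \<partial>lborel)"
      by (subst nn_integral_cmult) (auto simp: mult_ac)
    finally show ?case using p by (simp add: ennreal_mult mult_ac)
  qed
  have "(\<integral>\<^sup>+x. ennreal (Por P x * (Psi P s x - Psi P 0 x)\<^sup>2) \<partial>Mx)
    \<le> (\<integral>\<^sup>+x. ennreal s * (\<integral>\<^sup>+\<tau>. ennreal (Por P x * (psi \<tau> x)\<^sup>2) * indicator {0..s} \<tau> \<partial>lborel) \<partial>Mx)"
    by (rule nn_integral_mono_AE[OF 1])
  also have "\<dots> = ennreal s * (\<integral>\<^sup>+x. (\<integral>\<^sup>+\<tau>. ennreal (Por P x * (psi \<tau> x)\<^sup>2) * indicator {0..s} \<tau> \<partial>lborel) \<partial>Mx)"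
    by (rule nn_integral_cmult) measurable
  also have "(\<integral>\<^sup>+x. (\<integral>\<^sup>+\<tau>. ennreal (Por P x * (psi \<tau> x)\<^sup>2) * indicator {0..s} \<tau> \<partial>lborel) \<partial>Mx)
    = (\<integral>\<^sup>+\<tau>. (\<integral>\<^sup>+x. ennreal (Por P x * (psi \<tau> x)\<^sup>2) * indicator {0..s} \<tau> \<partial>Mx) \<partial>lborel)"
    by (rule Fubini'[symmetric]) measurable
  also have "\<dots> \<le> (\<integral>\<^sup>+\<tau>. ennreal c * indicator {0..s} \<tau> \<partial>lborel)"
  proof (rule nn_integral_mono_AE)
    show "AE \<tau> in lborel. (\<integral>\<^sup>+x. ennreal (Por P x * (psi \<tau> x)\<^sup>2) * indicator {0..s} \<tau> \<partial>Mx) \<le> ennreal c * indicator {0..s} \<tau>"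
      using AE_lborel_singleton[of 0]
    proof eventually_elim
      case (elim \<tau>)
      show ?case
      proof (cases "\<tau> \<in> {0..s}")
        case True
        hence \<tau>: "0 < \<tau>" "\<tau> \<le> 1" using elim s by auto
        have "(\<integral>\<^sup>+x. ennreal (Por P x * (psi \<tau> x)\<^sup>2) \<partial>Mx) \<le> ennreal c"
          unfolding c_def using gg_le_M[of \<tau> 1] gg_ge_1[of \<tau>] \<tau> a_bounds
          by (intro order_trans[OF G_parts_le(2)] ennreal_leI powr_mono2) auto
        thus ?thesis using True by simp
      qed simp
    qed
  qed
  also have "\<dots> = ennreal (c * s)" using s by (simp add: nn_integral_cmult_indicator ennreal_mult c_def)
  finally have "(\<integral>\<^sup>+x. ennreal (Por P x * (Psi P s x - Psi P 0 x)\<^sup>2) \<partial>Mx) \<le> ennreal s * ennreal (c * s)"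
    by (simp add: mult_left_mono)
  thus ?thesis using s by (simp add: ennreal_mult'[symmetric] c_def power2_eq_square mult_ac)
qed

definition "y0 = (enn2real (wnorm (Dim P) (Dom P) 2 (Por P) (pbar P 0)))\<^sup>2"

text \<open>The 3 comes from (x + y - z)^2 \<le> 3 (x^2 + y^2 + z^2). At small times the increments
  of p and \<Psi> contribute at most 3 (1/9 + 1/9) < 1.\<close>

lemma initial_energy:
  "\<exists>\<delta>>0. \<forall>s. 0 < s \<longrightarrow> s < \<delta> \<longrightarrow> (\<integral>\<^sup>+x. ennreal (Por P x * (uu s x)\<^sup>2) \<partial>Mx) \<le> ennreal (3 * y0 + 1)"
proof -
  define c where "c = M 1 powr (2 * (1 - a) / (2 - a))"
  have c: "0 \<le> c" by (simp add: c_def)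
  have "((\<lambda>t. wnorm (Dim P) (Dom P) 2 (Por P) (\<lambda>x. Pres P t x - Pres P 0 x)) \<longlongrightarrow> 0) (at_right 0)"
    using solution by (simp add: solution_def)
  from order_tendstoD(2)[OF this, of "ennreal (1 / 3)"]
  have "eventually (\<lambda>t. wnorm (Dim P) (Dom P) 2 (Por P) (\<lambda>x. Pres P t x - Pres P 0 x) < ennreal (1 / 3)) (at_right 0)"
    by (simp add: ennreal_zero_less_divide)
  then obtain d where d: "0 < d" "\<And>s. 0 < s \<Longrightarrow> s < d \<Longrightarrow> wnorm (Dim P) (Dom P) 2 (Por P) (\<lambda>x. Pres P s x - Pres P 0 x) < ennreal (1 / 3)"
    unfolding eventually_at_right_field by auto
  define \<delta> where "\<delta> = Min {d, 1, 1 / (9 * (c + 1))}"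
  have \<delta>: "0 < \<delta>" using d c by (simp add: \<delta>_def)
  have "(\<integral>\<^sup>+x. ennreal (Por P x * (uu s x)\<^sup>2) \<partial>Mx) \<le> ennreal (3 * y0 + 1)" if s: "0 < s" "s < \<delta>" for s
  proof -
    have s': "s < d" "s < 1" "s < 1 / (9 * (c + 1))" using s by (auto simp: \<delta>_def)
    have [measurable]: "pbar P 0 \<in> borel_measurable Mx" "Pres P s \<in> borel_measurable Mx" "Pres P 0 \<in> borel_measurable Mx"
      "Psi P s \<in> borel_measurable Mx" "Psi P 0 \<in> borel_measurable Mx" using s by auto
    have A: "(\<integral>\<^sup>+x. ennreal (Por P x * (pbar P 0 x)\<^sup>2) \<partial>Mx) \<le> ennreal y0"
      unfolding y0_def using solution by (intro wnorm_2_le) (auto simp: solution_def less_top)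
    have B: "(\<integral>\<^sup>+x. ennreal (Por P x * (Pres P s x - Pres P 0 x)\<^sup>2) \<partial>Mx) \<le> ennreal ((1/3)\<^sup>2)"
      using d(2)[OF s(1) s'(1)] by (intro wnorm_2_le) auto
    have C: "(\<integral>\<^sup>+x. ennreal (Por P x * (Psi P s x - Psi P 0 x)\<^sup>2) \<partial>Mx) \<le> ennreal (1 / 9)"
    proof (rule order_trans[OF psi_increment ennreal_leI])
      have "s\<^sup>2 * c \<le> s * (c + 1)" using s s' c by (simp add: power2_eq_square mult_mono' mult_left_le)
      also have "\<dots> \<le> 1 / (9 * (c + 1)) * (c + 1)" using s' c by (intro mult_right_mono) auto
      also have "\<dots> = 1 / 9" using c by simp
      finally show "s\<^sup>2 * M 1 powr (2 * (1 - a) / (2 - a)) \<le> 1 / 9" by (simp add: c_def)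
    qed (use s s' in auto)
    have "(\<integral>\<^sup>+x. ennreal (Por P x * (uu s x)\<^sup>2) \<partial>Mx)
      \<le> (\<integral>\<^sup>+x. 3 * (ennreal (Por P x * (pbar P 0 x)\<^sup>2) + ennreal (Por P x * (Pres P s x - Pres P 0 x)\<^sup>2)
          + ennreal (Por P x * (Psi P s x - Psi P 0 x)\<^sup>2)) \<partial>Mx)"
    proof (rule nn_integral_mono)
      fix x assume "x \<in> space Mx"
      hence p: "0 < Por P x" using coef_pos by (simp add: space_Mx)
      define p0 where "p0 = pbar P 0 x" define y where "y = Pres P s x - Pres P 0 x" define z where "z = Psi P s x - Psi P 0 x"
      have "0 \<le> (p0 - y)\<^sup>2 + (p0 + z)\<^sup>2 + (y + z)\<^sup>2" by simp
      hence "(p0 + y - z)\<^sup>2 \<le> 3 * (p0\<^sup>2 + y\<^sup>2 + z\<^sup>2)" by (simp add: power2_eq_square algebra_simps)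
      moreover have "uu s x = p0 + y - z" using s by (simp add: uu_def p0_def y_def z_def pbar_def)
      ultimately have "Por P x * (uu s x)\<^sup>2 \<le> Por P x * (3 * (p0\<^sup>2 + y\<^sup>2 + z\<^sup>2))" using p by (intro mult_left_mono) auto
      hence "Por P x * (uu s x)\<^sup>2 \<le> 3 * (Por P x * p0\<^sup>2 + Por P x * y\<^sup>2 + Por P x * z\<^sup>2)" by (simp add: algebra_simps)
      hence "ennreal (Por P x * (uu s x)\<^sup>2) \<le> ennreal (3 * (Por P x * p0\<^sup>2 + Por P x * y\<^sup>2 + Por P x * z\<^sup>2))" by (rule ennreal_leI)
      also have "\<dots> = 3 * (ennreal (Por P x * p0\<^sup>2) + ennreal (Por P x * y\<^sup>2) + ennreal (Por P x * z\<^sup>2))"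
        using p by (simp add: ennreal_mult' ennreal_plus)
      finally show "ennreal (Por P x * (uu s x)\<^sup>2) \<le> 3 * (ennreal (Por P x * (pbar P 0 x)\<^sup>2) + ennreal (Por P x * (Pres P s x - Pres P 0 x)\<^sup>2)
          + ennreal (Por P x * (Psi P s x - Psi P 0 x)\<^sup>2))" by (simp add: p0_def y_def z_def)
    qed
    also have "\<dots> = 3 * ((\<integral>\<^sup>+x. ennreal (Por P x * (pbar P 0 x)\<^sup>2) \<partial>Mx) + (\<integral>\<^sup>+x. ennreal (Por P x * (Pres P s x - Pres P 0 x)\<^sup>2) \<partial>Mx)
        + (\<integral>\<^sup>+x. ennreal (Por P x * (Psi P s x - Psi P 0 x)\<^sup>2) \<partial>Mx))"
      by (simp add: nn_integral_cmult nn_integral_add)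
    also have "\<dots> \<le> 3 * (ennreal y0 + ennreal ((1/3)\<^sup>2) + ennreal (1 / 9))"
      by (intro mult_left_mono add_mono A B C) auto
    also have "\<dots> = 3 * ennreal (y0 + 2 / 9)" by (simp add: power2_eq_square y0_def add_ac flip: ennreal_plus)
    also have "\<dots> = ennreal (3 * (y0 + 2 / 9))" using ennreal_mult'[of 3 "y0 + 2 / 9"] by simp
    also have "\<dots> \<le> ennreal (3 * y0 + 1)" by (intro ennreal_leI) simp
    finally show ?thesis .
  qed
  thus ?thesis using \<delta> by blast
qed

text \<open>At time 0 the fields are cut off, so the bounds by G, which the abstract estimates
  assume from time 0 on, need a separate argument there.\<close>

lemma source_at_zero:
  "(\<integral>\<^sup>+x. ennreal (ff 0 x) \<partial>Mx) \<le> ennreal (gg 0)" "psi 0 x = 0"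
proof -
  have g: "vnorm (Dim P) (gS 0 x) = 0" for x by (simp add: gS_def ext_def vnorm_def L2_set_def)
  have "(\<integral>\<^sup>+x. ennreal (ff 0 x) \<partial>Mx) = (\<integral>\<^sup>+x. ennreal (Coef P (Deg P) x) \<partial>Mx)"
    by (simp add: ff_def g)
  also have "\<dots> \<le> Bstar P" by (simp add: Bstar_def nn_Mx)
  also have "\<dots> \<le> G P 0" by (simp add: G_def add.assoc)
  finally show "(\<integral>\<^sup>+x. ennreal (ff 0 x) \<partial>Mx) \<le> ennreal (gg 0)" using G_finite[of 0] by simp
  show "psi 0 x = 0" by (simp add: psi_def st_def ext_def)
qed

lemma flow: "energy_flow_initial Mx (Por P) uu ww ff psi gg a r c1 c2 y0 M"
proof -
  interpret sigma_finite_measure Mx by (rule sigma_Mx)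
  have ef: "energy_flow Mx (Por P) uu ww ff psi gg a r c1 c2"
  proof
    show "(\<lambda>z. uu (snd z) (fst z)) \<in> borel_measurable (Mx \<Otimes>\<^sub>M lborel)" "(\<lambda>z. ww (snd z) (fst z)) \<in> borel_measurable (Mx \<Otimes>\<^sub>M lborel)"
      "(\<lambda>z. ff (snd z) (fst z)) \<in> borel_measurable (Mx \<Otimes>\<^sub>M lborel)" "(\<lambda>z. psi (snd z) (fst z)) \<in> borel_measurable (Mx \<Otimes>\<^sub>M lborel)"
      by measurable
    fix h F \<Phi> assume A: "admissible h F \<Phi>"
    show "AE \<tau> in lborel. 0 < \<tau> \<longrightarrow>
      (\<forall>D\<ge>0. (\<integral>\<^sup>+x. ennreal (ww \<tau> x * h (uu \<tau> x)) \<partial>Mx) \<le> ennreal D \<longrightarrow>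
        (\<integral>\<^sup>+x. ennreal (Por P x * \<bar>F (uu \<tau> x)\<bar> powr r) \<partial>Mx) \<le> ennreal ((c2 * D powr (1 / (2 - a))) powr r) \<and>
        (\<integral>\<^sup>+x. ennreal (Por P x * (F (uu \<tau> x))\<^sup>2) \<partial>Mx) \<le> ennreal ((c1 * D powr (1 / (2 - a)))\<^sup>2))"
      using AE_good
    proof eventually_elim
      case (elim \<tau>)
      show ?case
      proof (intro impI allI conjI)
        fix D :: real assume \<tau>: "0 < \<tau>" and D: "0 \<le> D" "(\<integral>\<^sup>+x. ennreal (ww \<tau> x * h (uu \<tau> x)) \<partial>Mx) \<le> ennreal D"
        show "(\<integral>\<^sup>+x. ennreal (Por P x * \<bar>F (uu \<tau> x)\<bar> powr r) \<partial>Mx) \<le> ennreal ((c2 * D powr (1 / (2 - a))) powr r)"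
          using elim \<tau> param_pos by (intro sobolev_one[OF _ A weighted_r _ _ D]) auto
        have "(\<integral>\<^sup>+x. ennreal (Por P x * \<bar>F (uu \<tau> x)\<bar> powr 2) \<partial>Mx) \<le> ennreal ((c1 * D powr (1 / (2 - a))) powr 2)"
          using elim \<tau> param_pos by (intro sobolev_one[OF _ A weighted_2 _ _ D]) auto
        thus "(\<integral>\<^sup>+x. ennreal (Por P x * (F (uu \<tau> x))\<^sup>2) \<partial>Mx) \<le> ennreal ((c1 * D powr (1 / (2 - a)))\<^sup>2)"
          using abs_powr_2[of "c1 * D powr (1 / (2 - a))"] param_pos by (simp add: abs_powr_2)
      qed
    qed
  next
    fix h F \<Phi> s t assume "admissible h F \<Phi>" "\<exists>B. \<forall>v. \<bar>F v\<bar> \<le> B" "0 < s" "s < (t::real)"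
    thus "(\<integral>\<^sup>+\<tau>\<in>{s..t}. (\<integral>\<^sup>+x. ennreal (ww \<tau> x * h (uu \<tau> x)) \<partial>Mx) \<partial>lborel) < \<infinity> \<and>
      (\<integral>\<^sup>+x. ennreal (Por P x * \<Phi> (uu t x)) \<partial>Mx) + (\<integral>\<^sup>+\<tau>\<in>{s..t}. (\<integral>\<^sup>+x. ennreal (ww \<tau> x * h (uu \<tau> x) / 8) \<partial>Mx) \<partial>lborel)
      \<le> (\<integral>\<^sup>+x. ennreal (Por P x * \<Phi> (uu s x)) \<partial>Mx)
        + (\<integral>\<^sup>+\<tau>\<in>{s..t}. (\<integral>\<^sup>+x. ennreal (ff \<tau> x * h (uu \<tau> x) + Por P x * psi \<tau> x * \<bar>F (uu \<tau> x)\<bar>) \<partial>Mx) \<partial>lborel)"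
      by (rule energy_truncated)
  next
    fix \<tau> :: real assume "0 \<le> \<tau>"
    thus "1 \<le> gg \<tau>" by (rule gg_ge_1)
    show "(\<integral>\<^sup>+x. ennreal (ff \<tau> x) \<partial>Mx) \<le> ennreal (gg \<tau>)"
      "(\<integral>\<^sup>+x. ennreal (Por P x * (psi \<tau> x)\<^sup>2) \<partial>Mx) \<le> ennreal (gg \<tau> powr (2 * (1 - a) / (2 - a)))"
      using G_parts_le[of \<tau>] source_at_zero \<open>0 \<le> \<tau>\<close> by (cases "\<tau> = 0"; simp)+
  qed (use coef_pos densities_nonneg a_bounds param_pos in \<open>auto simp: space_Mx\<close>)
  interpret energy_flow Mx "Por P" uu ww ff psi gg "a" r c1 c2 by (rule ef)
  show ?thesis
  proof
    show "\<exists>\<delta>>0. \<forall>s>0. s < \<delta> \<longrightarrow> V s \<le> ennreal (3 * y0 + 1)" unfolding V_def by (rule initial_energy)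
    show "0 \<le> y0" by (simp add: y0_def)
  qed (rule gg_le_M)
qed

section \<open>Supremum bounds in terms of N1\<close>

lemma N1_eq:
  assumes "0 \<le> s"
  defines "r' \<equiv> \<lambda>r1::real. r1 / (r1 - 1)"
  shows "N1 P r1 s t = max 1 (\<integral>\<^sup>+x. ennreal (Coef P (Deg P) x powr r' r1 * Por P x powr (1 - r' r1)) \<partial>Mx)
    + (\<integral>\<^sup>+\<tau>\<in>{s..t}. (\<integral>\<^sup>+x. ennreal (
         (W1 P x * vnorm (Dim P) (gS \<tau> x) powr (2 - a) + (vnorm (Dim P) (gS \<tau> x))\<^sup>2 / Coef P 0 x) powr r' r1 * Por P x powr (1 - r' r1)
         + psi \<tau> x powr (2 * r' r1) * Por P x) \<partial>Mx) \<partial>lborel)"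
  unfolding N1_def Let_def nn_Mx r'_def
proof (intro arg_cong2[where f = plus] refl nn_integral_cong_AE)
  show "AE \<tau> in lborel. (\<integral>\<^sup>+x. ennreal (
         (W1 P x * vnorm (Dim P) (GradPsi P \<tau> x) powr (2 - a)
           + (vnorm (Dim P) (GradPsi P \<tau> x))\<^sup>2 / Coef P 0 x) powr (r1 / (r1 - 1)) * Por P x powr (1 - r1 / (r1 - 1))
         + \<bar>DtPsi P \<tau> x\<bar> powr (2 * (r1 / (r1 - 1))) * Por P x) \<partial>Mx) * indicator {s..t} \<tau>
    = (\<integral>\<^sup>+x. ennreal (
         (W1 P x * vnorm (Dim P) (gS \<tau> x) powr (2 - a) + (vnorm (Dim P) (gS \<tau> x))\<^sup>2 / Coef P 0 x) powr (r1 / (r1 - 1)) * Por P x powr (1 - r1 / (r1 - 1))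
         + psi \<tau> x powr (2 * (r1 / (r1 - 1))) * Por P x) \<partial>Mx) * indicator {s..t} \<tau>"
    using AE_lborel_singleton[of 0]
  proof eventually_elim
    case (elim \<tau>)
    show ?case
    proof (cases "\<tau> \<in> {s..t}")
      case True
      hence \<tau>: "0 < \<tau>" using elim assms(1) by auto
      have "gS \<tau> x = GradPsi P \<tau> x" "psi \<tau> x = \<bar>DtPsi P \<tau> x\<bar>" for x
        using \<tau> by (auto simp: gS_def psi_def st_def)
      thus ?thesis by simp
    qed simp
  qed
qed

text \<open>The inequality (x + y)^r' \<le> 2^r' (x^r' + y^r') separates a_N from the terms with the
  gradient of \<Psi>. In \<open>N1\<close> the part with a_N stands outside the time integral, which
  is why the interval must have length at most 1.\<close>

lemma N1_bounds:
  assumes r1: "1 < r1" and s: "0 \<le> s" "s \<le> t" "t \<le> s + 1"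
  shows "(\<integral>\<^sup>+\<tau>\<in>{s..t}. (\<integral>\<^sup>+x. ennreal (ff \<tau> x powr (r1 / (r1 - 1)) * Por P x powr (1 - r1 / (r1 - 1))) \<partial>Mx) \<partial>lborel)
      \<le> ennreal (2 powr (r1 / (r1 - 1))) * N1 P r1 s t"
    and "(\<integral>\<^sup>+\<tau>\<in>{s..t}. (\<integral>\<^sup>+x. ennreal (psi \<tau> x powr (2 * (r1 / (r1 - 1))) * Por P x) \<partial>Mx) \<partial>lborel) \<le> N1 P r1 s t"
    and "1 \<le> N1 P r1 s t"
proof -
  interpret sigma_finite_measure Mx by (rule sigma_Mx)
  define r' where "r' = r1 / (r1 - 1)"
  have r': "0 \<le> r'" using r1 by (simp add: r'_def)
  define A where "A = (\<integral>\<^sup>+x. ennreal (Coef P (Deg P) x powr r' * Por P x powr (1 - r')) \<partial>Mx)"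
  define b where "b \<tau> x = W1 P x * vnorm (Dim P) (gS \<tau> x) powr (2 - a) + (vnorm (Dim P) (gS \<tau> x))\<^sup>2 / Coef P 0 x" for \<tau> x
  define B where "B \<tau> = (\<integral>\<^sup>+x. ennreal (b \<tau> x powr r' * Por P x powr (1 - r') + psi \<tau> x powr (2 * r') * Por P x) \<partial>Mx)" for \<tau>
  have [measurable]: "B \<in> borel_measurable lborel" unfolding B_def b_def by measurable
  have N: "N1 P r1 s t = max 1 A + (\<integral>\<^sup>+\<tau>\<in>{s..t}. B \<tau> \<partial>lborel)"
    using N1_eq[OF s(1)] by (simp add: A_def B_def b_def r'_def)
  have b0: "0 \<le> b \<tau> x" if "x \<in> Dom P" for \<tau> x
    using coef_pos[OF that] by (auto simp: b_def intro!: add_nonneg_nonneg)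
  have 1: "(\<integral>\<^sup>+x. ennreal (ff \<tau> x powr r' * Por P x powr (1 - r')) \<partial>Mx) \<le> ennreal (2 powr r') * (A + B \<tau>)" for \<tau>
  proof -
    have "(\<integral>\<^sup>+x. ennreal (ff \<tau> x powr r' * Por P x powr (1 - r')) \<partial>Mx)
      \<le> (\<integral>\<^sup>+x. ennreal (2 powr r') * (ennreal (Coef P (Deg P) x powr r' * Por P x powr (1 - r'))
          + ennreal (b \<tau> x powr r' * Por P x powr (1 - r') + psi \<tau> x powr (2 * r') * Por P x)) \<partial>Mx)"
    proof (rule nn_integral_mono)
      fix x assume "x \<in> space Mx"
      hence x: "x \<in> Dom P" by (simp add: space_Mx)
      have "ff \<tau> x powr r' \<le> 2 powr r' * (Coef P (Deg P) x powr r' + b \<tau> x powr r')"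
        using powr_sum_le[of "Coef P (Deg P) x" "b \<tau> x" r'] coef_pos[OF x] b0[OF x] r' by (simp add: ff_def b_def add.assoc)
      hence "ff \<tau> x powr r' * Por P x powr (1 - r') \<le> 2 powr r' * (Coef P (Deg P) x powr r' + b \<tau> x powr r') * Por P x powr (1 - r')"
        by (rule mult_right_mono) simp
      also have "\<dots> \<le> 2 powr r' * (Coef P (Deg P) x powr r' * Por P x powr (1 - r')
          + (b \<tau> x powr r' * Por P x powr (1 - r') + psi \<tau> x powr (2 * r') * Por P x))"
        using coef_pos[OF x] by (simp add: algebra_simps)
      finally have "ennreal (ff \<tau> x powr r' * Por P x powr (1 - r')) \<le> ennreal (2 powr r' * (Coef P (Deg P) x powr r' * Por P x powr (1 - r')
          + (b \<tau> x powr r' * Por P x powr (1 - r') + psi \<tau> x powr (2 * r') * Por P x)))" by (rule ennreal_leI)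
      also have "\<dots> = ennreal (2 powr r') * (ennreal (Coef P (Deg P) x powr r' * Por P x powr (1 - r'))
          + ennreal (b \<tau> x powr r' * Por P x powr (1 - r') + psi \<tau> x powr (2 * r') * Por P x))"
        using coef_pos[OF x] by (subst ennreal_mult') (auto intro!: ennreal_plus)
      finally show "ennreal (ff \<tau> x powr r' * Por P x powr (1 - r')) \<le> \<dots>" .
    qed
    also have "\<dots> = ennreal (2 powr r') * (A + B \<tau>)"
      unfolding A_def B_def b_def by (subst nn_integral_cmult, measurable, subst nn_integral_add, measurable)
    finally show ?thesis .
  qed
  have "(\<integral>\<^sup>+\<tau>\<in>{s..t}. (\<integral>\<^sup>+x. ennreal (ff \<tau> x powr r' * Por P x powr (1 - r')) \<partial>Mx) \<partial>lborel)
    \<le> (\<integral>\<^sup>+\<tau>. ennreal (2 powr r') * (A * indicator {s..t} \<tau> + B \<tau> * indicator {s..t} \<tau>) \<partial>lborel)"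
  proof (rule nn_integral_mono)
    fix \<tau> :: real
    show "(\<integral>\<^sup>+x. ennreal (ff \<tau> x powr r' * Por P x powr (1 - r')) \<partial>Mx) * indicator {s..t} \<tau>
      \<le> ennreal (2 powr r') * (A * indicator {s..t} \<tau> + B \<tau> * indicator {s..t} \<tau>)"
      using 1[of \<tau>] by (cases "\<tau> \<in> {s..t}") auto
  qed
  also have "\<dots> = ennreal (2 powr r') * (A * ennreal (t - s) + (\<integral>\<^sup>+\<tau>\<in>{s..t}. B \<tau> \<partial>lborel))"
    using s by (simp add: nn_integral_cmult nn_integral_add nn_integral_cmult_indicator)
  also have "\<dots> \<le> ennreal (2 powr r') * N1 P r1 s t"
  proof -
    have "A * ennreal (t - s) \<le> A * ennreal 1" using s by (intro mult_left_mono ennreal_leI) auto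
    also have "\<dots> \<le> max 1 A" by simp
    finally show ?thesis unfolding N by (intro mult_left_mono add_right_mono) auto
  qed
  finally show "(\<integral>\<^sup>+\<tau>\<in>{s..t}. (\<integral>\<^sup>+x. ennreal (ff \<tau> x powr (r1 / (r1 - 1)) * Por P x powr (1 - r1 / (r1 - 1))) \<partial>Mx) \<partial>lborel)
      \<le> ennreal (2 powr (r1 / (r1 - 1))) * N1 P r1 s t" by (simp add: r'_def)
  have "(\<integral>\<^sup>+\<tau>\<in>{s..t}. (\<integral>\<^sup>+x. ennreal (psi \<tau> x powr (2 * r') * Por P x) \<partial>Mx) \<partial>lborel) \<le> (\<integral>\<^sup>+\<tau>\<in>{s..t}. B \<tau> \<partial>lborel)"
    unfolding B_def by (intro nn_integral_mono mult_right_mono ennreal_leI) auto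
  also have "\<dots> \<le> N1 P r1 s t" unfolding N by (rule add_increasing[OF zero_le order_refl])
  finally show "(\<integral>\<^sup>+\<tau>\<in>{s..t}. (\<integral>\<^sup>+x. ennreal (psi \<tau> x powr (2 * (r1 / (r1 - 1))) * Por P x) \<partial>Mx) \<partial>lborel) \<le> N1 P r1 s t"
    by (simp add: r'_def)
  show "1 \<le> N1 P r1 s t" unfolding N by (rule add_increasing2[OF zero_le]) simp
qed

lemma Linf_norm_le:
  assumes t1: "0 \<le> t1" and AE: "AE z in Mx \<Otimes>\<^sub>M lborel. t1 < snd z \<longrightarrow> snd z < t2 \<longrightarrow> \<bar>uu (snd z) (fst z)\<bar> \<le> k"
  shows "Linf_norm (Dim P) (Dom P) t1 t2 (pbar P) \<le> ennreal k"
proof -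
  define Q where "Q = restrict_space (leb (Dim P) \<Otimes>\<^sub>M (lborel :: real measure)) (Dom P \<times> {t1<..<t2})"
  have S: "Dom P \<times> {t1<..<t2} \<in> sets (leb (Dim P) \<Otimes>\<^sub>M (lborel :: real measure))"
    "Dom P \<times> (UNIV :: real set) \<in> sets (leb (Dim P) \<Otimes>\<^sub>M (lborel :: real measure))" by (rule prod_sets; simp)+
  have "(\<lambda>z. uu (snd z) (fst z)) \<in> borel_measurable Q"
    unfolding Q_def by (rule measurable_restrict_mono[OF joint(1)[unfolded pair_Mx]]) auto
  hence m: "(\<lambda>z. ennreal \<bar>uu (snd z) (fst z)\<bar>) \<in> borel_measurable Q" by measurable
  have sp: "space Q = Dom P \<times> {t1<..<t2}"
    using sets.sets_into_space[OF S(1)] by (auto simp: Q_def space_restrict_space)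
  have eq: "ennreal \<bar>uu (snd z) (fst z)\<bar> = (case z of (x, t) \<Rightarrow> ennreal \<bar>pbar P t x\<bar>)" if "z \<in> space Q" for z
    using that t1 by (auto simp: sp uu_def)
  have "(\<lambda>(x, t). ennreal \<bar>pbar P t x\<bar>) \<in> borel_measurable Q"
    using m by (subst (asm) measurable_cong[OF eq])
  moreover have "AE z in Q. (case z of (x, t) \<Rightarrow> ennreal \<bar>pbar P t x\<bar>) \<le> ennreal k"
  proof -
    have "AE z in leb (Dim P) \<Otimes>\<^sub>M (lborel :: real measure). z \<in> Dom P \<times> UNIV \<longrightarrow> t1 < snd z \<longrightarrow> snd z < t2 \<longrightarrow> \<bar>uu (snd z) (fst z)\<bar> \<le> k"
      using AE unfolding pair_Mx by (subst (asm) AE_restrict_space_iff) (use S in auto)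
    hence "AE z in Q. \<bar>uu (snd z) (fst z)\<bar> \<le> k"
      unfolding Q_def by (subst AE_restrict_space_iff) (use S in \<open>auto elim!: eventually_mono\<close>)
    thus ?thesis using AE_space[of Q]
      by eventually_elim (simp add: eq[symmetric] ennreal_leI)
  qed
  ultimately show ?thesis unfolding Linf_norm_def Q_def[symmetric] by (rule esssup_I)
qed

sublocale flow: energy_flow_initial Mx "Por P" uu ww ff psi gg "aF P" r c1 c2 y0 M
  by (rule flow)

text \<open>The power of 2 is the price for bounding the source \<open>ff\<close> by
  \<open>N1\<close>. If \<open>N1\<close> is infinite, so is the right-hand side, because its other
  factors are positive; otherwise the iteration applies.\<close>

lemma Linf_bound:
  assumes C: "iteration_closes a r r1 c2 C \<rho>" and r1: "1 < r1"
    and T: "0 < T" "T \<le> 1" "T \<le> t" and K: "0 < K" "1 \<le> K * X"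
    and v: "\<And>\<tau>. t - T < \<tau> \<Longrightarrow> \<tau> \<le> t \<Longrightarrow> flow.v \<tau> \<le> (K * X)\<^sup>2"
  shows "Linf_norm (Dim P) (Dom P) (t - T / 2) t (pbar P)
    \<le> ennreal (C * (2 powr (r1 / (r1 - 1))) powr kappa2 a r r1 * K powr nu2 a r * T powr (- kappa3 a r r1))
      * N1 P r1 (t - T) t epowr kappa2 a r r1 * ennreal (X powr nu2 a r)"
proof (cases "N1 P r1 (t - T) t = \<infinity>")
  case True
  have X: "0 < X" using K by (smt (verit) zero_less_mult_pos)
  have "0 < C" using C by (simp add: iteration_closes_def)
  thus ?thesis using True T K X by (simp add: epowr_def ennreal_mult_top ennreal_top_mult)
next
  case False
  have X: "0 < X" using K by (smt (verit) zero_less_mult_pos)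
  define n where "n = enn2real (N1 P r1 (t - T) t)"
  have n: "N1 P r1 (t - T) t = ennreal n" using False by (simp add: n_def less_top)
  define c where "c = 2 powr (r1 / (r1 - 1))"
  have c: "1 \<le> c" using r1 by (simp add: c_def ge_one_powr_ge_zero)
  have s: "0 \<le> t - T" "t - T \<le> t" "t \<le> t - T + 1" using T by auto
  note N = N1_bounds[OF r1 s]
  have n1: "1 \<le> n" using N(3) unfolding n by (simp add: n_def ennreal_ge_1)
  have c1n: "1 \<le> c * n" using mult_mono[of 1 c 1 n] c n1 by simp
  define k where "k = C * T powr (- kappa3 a r r1) * (c * n) powr kappa2 a r r1 * (K * X) powr nu2 a r"
  have C': "0 < C" using C by (simp add: iteration_closes_def)
  have "AE z in Mx \<Otimes>\<^sub>M lborel. t - T / 2 < snd z \<longrightarrow> snd z < t \<longrightarrow> \<bar>uu (snd z) (fst z)\<bar> \<le> k"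
  proof (rule flow.degiorgi_bound[OF C r1 T c1n K(2) _ _ _ k_def])
    fix \<tau> assume \<tau>: "t - T < \<tau>" "\<tau> \<le> t"
    hence "flow.V \<tau> = ennreal (flow.v \<tau>)" using s by (intro flow.V_eq) auto
    thus "flow.V \<tau> \<le> ennreal ((K * X)\<^sup>2)" using v[OF \<tau>] by (simp add: ennreal_leI)
  next
    show "(\<integral>\<^sup>+\<tau>\<in>{t - T..t}. (\<integral>\<^sup>+x. ennreal (ff \<tau> x powr (r1 / (r1 - 1)) * Por P x powr (1 - r1 / (r1 - 1))) \<partial>Mx) \<partial>lborel) \<le> ennreal (c * n)"
      using N(1) c n1 by (simp add: n c_def ennreal_mult)
    have "ennreal n \<le> ennreal (c * n)" using c n1 by (intro ennreal_leI) simp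
    thus "(\<integral>\<^sup>+\<tau>\<in>{t - T..t}. (\<integral>\<^sup>+x. ennreal (psi \<tau> x powr (2 * (r1 / (r1 - 1))) * Por P x) \<partial>Mx) \<partial>lborel) \<le> ennreal (c * n)"
      using N(2) unfolding n by (rule order_trans[rotated])
  qed
  hence "Linf_norm (Dim P) (Dom P) (t - T / 2) t (pbar P) \<le> ennreal k"
    using T by (intro Linf_norm_le) auto
  also have "k = (C * c powr kappa2 a r r1 * K powr nu2 a r * T powr (- kappa3 a r r1)) * n powr kappa2 a r r1 * X powr nu2 a r"
    using c n1 K X by (simp add: k_def powr_mult)
  also have "ennreal \<dots> = ennreal (C * c powr kappa2 a r r1 * K powr nu2 a r * T powr (- kappa3 a r r1)) * N1 P r1 (t - T) t epowr kappa2 a r r1 * ennreal (X powr nu2 a r)"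
    using C' n1 by (simp add: n epowr_ennreal ennreal_mult)
  finally show ?thesis by (simp add: c_def)
qed

section \<open>The bounds by initial data, by limits superior and for slowly decreasing G\<close>

abbreviation "L \<equiv> flow.Lc"
abbreviation "K \<equiv> flow.Kc"
text \<open>One factor for the L^2_\<phi> bounds of all cases: 2 + L suits those by initial data and
  by \<open>calA\<close>, and the second bracket collects the constants of
  \<open>slow_decay_majorant\<close>.\<close>

definition "energy_factor = (2 + L) * (2 * (K + 1) * (1 + 2 powr (1 / (2 * (1 - a)))))"

lemma K_nonneg: "0 \<le> K" by (simp add: flow.Kc_def)

lemma energy_factor_ge: "(2 + L) * 2 \<le> energy_factor" "2 \<le> energy_factor" "L * (2 * (K + 1) * (1 + 2 powr (1 / (2 * (1 - a))))) \<le> energy_factor"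
proof -
  have "1 * 1 \<le> (K + 1) * (1 + 2 powr (1 / (2 * (1 - a))))" using K_nonneg by (intro mult_mono) auto
  hence 1: "2 \<le> 2 * (K + 1) * (1 + 2 powr (1 / (2 * (1 - a))))" unfolding mult.assoc by linarith
  show 2: "(2 + L) * 2 \<le> energy_factor" unfolding energy_factor_def using 1 flow.Lc_pos by (intro mult_left_mono) auto
  thus "2 \<le> energy_factor" using flow.Lc_pos by (simp add: algebra_simps)
  show "L * (2 * (K + 1) * (1 + 2 powr (1 / (2 * (1 - a))))) \<le> energy_factor"
    unfolding energy_factor_def using 1 by (intro mult_right_mono) auto
qed

definition "sup_factor C r1 = C * (2 powr (r1 / (r1 - 1))) powr kappa2 a r r1 * energy_factor powr nu2 a r"

text \<open>With T = t and T = 1 this gives the two halves of (i). The 1 in the bound at small times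
  is absorbed by M(t)^(1/(2-a)) \<ge> 1.\<close>

lemma bound_initial:
  assumes C: "iteration_closes a r r1 c2 C \<rho>" and r1: "1 < r1" and T: "0 < T" "T \<le> 1" "T \<le> t"
  shows "Linf_norm (Dim P) (Dom P) (t - T / 2) t (pbar P)
    \<le> ennreal (sup_factor C r1 * T powr (- kappa3 a r r1)) * N1 P r1 (t - T) t epowr kappa2 a r r1
      * (wnorm (Dim P) (Dom P) 2 (Por P) (pbar P 0) + ennreal (M t powr (1 / (2 - a)))) epowr nu2 a r"
proof -
  define b where "b = enn2real (wnorm (Dim P) (Dom P) 2 (Por P) (pbar P 0))"
  have b: "wnorm (Dim P) (Dom P) 2 (Por P) (pbar P 0) = ennreal b" "0 \<le> b"
    using solution by (auto simp: b_def solution_def less_top)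
  define \<mu> where "\<mu> = M t powr (1 / (2 - a))"
  have \<mu>: "1 \<le> \<mu>" unfolding \<mu>_def using a_bounds M_ge_1[of t] T by (intro ge_one_powr_ge_zero) auto
  have v: "flow.v \<tau> \<le> (energy_factor * (b + \<mu>))\<^sup>2" if \<tau>: "t - T < \<tau>" "\<tau> \<le> t" for \<tau>
  proof -
    have \<tau>0: "0 < \<tau>" using \<tau> T by simp
    have M\<tau>: "M \<tau> \<le> M t" using majorant \<tau> \<tau>0 by (auto simp: majorant_def mono_on_def)
    have "flow.v \<tau> \<le> 3 * y0 + 1 + (L * M \<tau> powr (1 / (2 - a)))\<^sup>2" by (rule flow.v_bound_initial[OF \<tau>0])
    also have "\<dots> \<le> 3 * b\<^sup>2 + \<mu>\<^sup>2 + (L * \<mu>)\<^sup>2"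
    proof (intro add_mono power_mono mult_left_mono)
      show "M \<tau> powr (1 / (2 - a)) \<le> \<mu>" unfolding \<mu>_def using M\<tau> M_ge_1[of \<tau>] \<tau>0 a_bounds by (intro powr_mono2) auto
    qed (use flow.Lc_pos \<mu> in \<open>auto simp: y0_def b_def less_imp_le\<close>)
    also have "\<dots> \<le> (2 + L)\<^sup>2 * (b\<^sup>2 + \<mu>\<^sup>2)"
    proof -
      have "(2 + L)\<^sup>2 * (b\<^sup>2 + \<mu>\<^sup>2) - (3 * b\<^sup>2 + \<mu>\<^sup>2 + (L * \<mu>)\<^sup>2) = b\<^sup>2 + 3 * \<mu>\<^sup>2 + (4 * L + L\<^sup>2) * b\<^sup>2 + 4 * L * \<mu>\<^sup>2"
        by (simp add: power2_eq_square algebra_simps)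
      moreover have "0 \<le> \<dots>" using flow.Lc_pos by (intro add_nonneg_nonneg mult_nonneg_nonneg) auto
      ultimately show ?thesis by linarith
    qed
    also have "\<dots> \<le> (2 + L)\<^sup>2 * (b + \<mu>)\<^sup>2" using b \<mu> by (intro mult_left_mono zero_le_power2) (auto simp: power2_sum)
    also have "\<dots> = ((2 + L) * (b + \<mu>))\<^sup>2" by (simp add: power_mult_distrib)
    also have "\<dots> \<le> (energy_factor * (b + \<mu>))\<^sup>2"
      using energy_factor_ge(1) flow.Lc_pos b \<mu> by (intro power_mono mult_right_mono) auto
    finally show ?thesis .
  qed
  have "1 * 1 \<le> energy_factor * (b + \<mu>)" using energy_factor_ge(2) b \<mu> by (intro mult_mono) auto
  hence "1 \<le> energy_factor * (b + \<mu>)" by simp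
  from Linf_bound[OF C r1 T _ this v] energy_factor_ge(2) b(2) \<mu>
  show ?thesis unfolding b(1) \<mu>_def[symmetric] by (simp add: sup_factor_def mult_ac epowr_ennreal flip: ennreal_plus)
qed

text \<open>A limit superior that is finite and at least 1 is eventually exceeded by less than a
  factor 2. For \<open>N1\<close> this factor becomes 2^kappa2 in the constant; for
  \<open>calA\<close> it is contained in \<open>energy_factor\<close>. If the limit superior of
  \<open>N1\<close> is infinite, so is the right-hand side.\<close>

lemma bound_limsup:
  assumes C: "iteration_closes a r r1 c2 C \<rho>" and r1: "1 < r1"
    and pos: "0 < kappa2 a r r1" "0 < nu2 a r" and A: "calA P < \<infinity>"
  shows "Limsup at_top (\<lambda>t. Linf_norm (Dim P) (Dom P) (t - 1 / 2) t (pbar P))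
    \<le> ennreal (2 powr kappa2 a r r1 * sup_factor C r1) * Limsup at_top (\<lambda>t. N1 P r1 (t - 1) t) epowr kappa2 a r r1
      * calA P epowr (nu2 a r / (2 - a))"
proof -
  have C0: "0 < C" using C by (simp add: iteration_closes_def)
  have sup_factor: "0 < sup_factor C r1" using C0 energy_factor_ge(2) by (simp add: sup_factor_def)
  define A where "A = enn2real (calA P)"
  have A: "calA P = ennreal A" using assms by (simp add: A_def less_top)
  have ev1: "eventually (\<lambda>t. 1 \<le> G P t) at_top"
    using eventually_ge_at_top[of 0]
  proof eventually_elim
    case (elim t) thus ?case using G_finite[of t] gg_ge_1[of t] by (simp add: ennreal_ge_1)
  qed
  have "1 \<le> calA P" unfolding calA_def by (rule le_Limsup[OF _ ev1]) simp
  hence A1: "1 \<le> A" unfolding A by (simp add: A_def ennreal_ge_1)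
  have "Limsup at_top (G P) < ennreal (2 * A)" using A A1 by (simp add: calA_def ennreal_lessI)
  hence "eventually (\<lambda>t. G P t < ennreal (2 * A)) at_top" by (rule Limsup_lessD)
  then obtain T0 where T0: "\<And>t. T0 \<le> t \<Longrightarrow> G P t < ennreal (2 * A)" unfolding eventually_at_top_linorder by blast
  define T1 where "T1 = max T0 1"
  have T1: "0 < T1" "T0 \<le> T1" by (auto simp: T1_def)
  have g: "gg \<tau> \<le> 2 * A" if "T1 \<le> \<tau>" for \<tau>
  proof -
    have "ennreal (gg \<tau>) < ennreal (2 * A)" using T0[of \<tau>] G_finite[of \<tau>] that T1 by simp
    hence "gg \<tau> < 2 * A" by (simp add: ennreal_less_iff gg_def Greal_def)
    thus ?thesis by simp
  qed
  obtain T2 where T2: "T1 \<le> T2" "\<And>t. T2 \<le> t \<Longrightarrow> flow.v t \<le> (L * (2 * A) powr (1 / (2 - a)))\<^sup>2"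
    using flow.v_bound_limsup[OF T1(1) g] by blast
  define X where "X = A powr (1 / (2 - a))"
  have X: "1 \<le> X" unfolding X_def using a_bounds A1 by (intro ge_one_powr_ge_zero) auto
  have v: "flow.v t \<le> (energy_factor * X)\<^sup>2" if "T2 \<le> t" for t
  proof -
    have "(2 * A) powr (1 / (2 - a)) = 2 powr (1 / (2 - a)) * X" using A1 by (simp add: powr_mult X_def)
    also have "\<dots> \<le> 2 powr 1 * X" using a_bounds X by (intro mult_right_mono powr_mono) auto
    finally have "L * (2 * A) powr (1 / (2 - a)) \<le> L * (2 * X)" using flow.Lc_pos by (intro mult_left_mono) auto
    also have "\<dots> \<le> (2 + L) * 2 * X" using X flow.Lc_pos by (simp add: algebra_simps)
    also have "\<dots> \<le> energy_factor * X" using energy_factor_ge(1) X by (intro mult_right_mono) auto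
    finally have "(L * (2 * A) powr (1 / (2 - a)))\<^sup>2 \<le> (energy_factor * X)\<^sup>2" using flow.Lc_pos by (intro power_mono) auto
    thus ?thesis using T2(2)[OF that] by simp
  qed
  have "1 * 1 \<le> energy_factor * X" using energy_factor_ge(2) X by (intro mult_mono) auto
  hence ZX: "1 \<le> energy_factor * X" by simp
  have XA: "ennreal (X powr nu2 a r) = calA P epowr (nu2 a r / (2 - a))"
    using A1 by (simp add: A epowr_ennreal X_def powr_powr)
  have B: "Linf_norm (Dim P) (Dom P) (t - 1 / 2) t (pbar P)
    \<le> ennreal (sup_factor C r1) * N1 P r1 (t - 1) t epowr kappa2 a r r1 * calA P epowr (nu2 a r / (2 - a))" if t: "T2 + 1 \<le> t" for t
    unfolding XA[symmetric] using Linf_bound[OF C r1 _ _ _ _ ZX, of 1 t] v t T1 T2(1) energy_factor_ge(2) by (simp add: sup_factor_def)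
  define \<Lambda> where "\<Lambda> = Limsup at_top (\<lambda>t. N1 P r1 (t - 1) t)"
  show ?thesis
  proof (cases "\<Lambda> = \<infinity>")
    case True
    have "calA P epowr (nu2 a r / (2 - a)) \<noteq> 0" using X by (simp add: XA[symmetric])
    hence "ennreal (2 powr kappa2 a r r1 * sup_factor C r1) * \<Lambda> epowr kappa2 a r r1 * calA P epowr (nu2 a r / (2 - a)) = \<infinity>"
      using True sup_factor by (simp add: epowr_def ennreal_mult_top ennreal_top_mult)
    thus ?thesis by (simp add: \<Lambda>_def)
  next
    case False
    define l where "l = enn2real \<Lambda>"
    have l: "\<Lambda> = ennreal l" using False by (simp add: l_def less_top)
    have "1 \<le> \<Lambda>" unfolding \<Lambda>_def
    proof (rule le_Limsup)
      show "eventually (\<lambda>t. 1 \<le> N1 P r1 (t - 1) t) at_top"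
        using eventually_ge_at_top[of 1] by eventually_elim (intro N1_bounds(3) r1; simp)
    qed simp
    hence l1: "1 \<le> l" unfolding l by (simp add: l_def ennreal_ge_1)
    have "\<Lambda> < ennreal (2 * l)" using l1 by (simp add: l ennreal_lessI)
    hence "eventually (\<lambda>t. N1 P r1 (t - 1) t < ennreal (2 * l)) at_top" unfolding \<Lambda>_def by (rule Limsup_lessD)
    hence "eventually (\<lambda>t. Linf_norm (Dim P) (Dom P) (t - 1 / 2) t (pbar P)
      \<le> ennreal (2 powr kappa2 a r r1 * sup_factor C r1) * \<Lambda> epowr kappa2 a r r1 * calA P epowr (nu2 a r / (2 - a))) at_top"
      using eventually_ge_at_top[of "T2 + 1"]
    proof eventually_elim
      case (elim t)
      have "N1 P r1 (t - 1) t epowr kappa2 a r r1 \<le> ennreal (2 * l) epowr kappa2 a r r1"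
        using elim pos by (intro epowr_mono) auto
      also have "\<dots> = ennreal (2 powr kappa2 a r r1) * \<Lambda> epowr kappa2 a r r1"
        using l1 by (subst epowr_ennreal) (auto simp: l epowr_ennreal powr_mult ennreal_mult)
      finally have "ennreal (sup_factor C r1) * N1 P r1 (t - 1) t epowr kappa2 a r r1 * calA P epowr (nu2 a r / (2 - a))
        \<le> ennreal (sup_factor C r1) * (ennreal (2 powr kappa2 a r r1) * \<Lambda> epowr kappa2 a r r1) * calA P epowr (nu2 a r / (2 - a))"
        by (intro mult_right_mono mult_left_mono) auto
      also have "\<dots> = ennreal (2 powr kappa2 a r r1 * sup_factor C r1) * \<Lambda> epowr kappa2 a r r1 * calA P epowr (nu2 a r / (2 - a))"
        using sup_factor by (simp add: ennreal_mult mult_ac)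
      finally show ?case using B[OF elim(2)] by (rule order_trans[rotated])
    qed
    thus ?thesis unfolding \<Lambda>_def[symmetric] by (rule Limsup_bounded)
  qed
qed

text \<open>Here \<open>g'\<close> is a value of G at an earlier time, not a derivative. The number
  b = B + 1 leaves room above the limit superior \<open>B\<close>, and the added 1 is absorbed by g
  \<ge> 1. The exponents combine to (2 - a) / (2 (1 - a)) times 1 / (2 - a), that is 1 / (2 (1 -
  a)).\<close>

lemma slow_decay_majorant:
  assumes g: "1 \<le> g" "0 \<le> g'" "g' \<le> g + b" and B: "0 \<le> B" and b: "b = B + 1"
  shows "L * (g' + K * b powr ((2 - a) / (2 * (1 - a)))) powr (1 / (2 - a))
    \<le> energy_factor * (B powr (1 / (2 * (1 - a))) + g powr (1 / (2 - a)))"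
proof -
  define e where "e = 1 / (2 * (1 - a))" define q where "q = (2 - a) / (2 * (1 - a))" define p where "p = 1 / (2 - a)"
  have e: "0 < e" "1 \<le> q" "0 < p" "p \<le> 1" "q * p = e" using a_bounds by (auto simp: e_def q_def p_def field_simps)
  have b1: "1 \<le> b" using B b by simp
  have "b powr 1 \<le> b powr q" using e b1 by (intro powr_mono) auto
  hence bq: "b \<le> b powr q" using b1 by simp
  have "(g' + K * b powr q) powr p \<le> (g + (K + 1) * b powr q) powr p"
    using e g bq K_nonneg by (intro powr_mono2) (auto simp: algebra_simps)
  also have "\<dots> \<le> 2 powr p * (g powr p + ((K + 1) * b powr q) powr p)"
    using g K_nonneg e by (intro powr_sum_le) auto
  also have "((K + 1) * b powr q) powr p = (K + 1) powr p * b powr e"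
    using K_nonneg e by (simp add: powr_mult powr_powr)
  also have "2 powr p * (g powr p + (K + 1) powr p * b powr e) \<le> 2 * ((K + 1) * (g powr p + b powr e))"
  proof (intro mult_mono)
    show "2 powr p \<le> (2::real)" using powr_mono[of p 1 "2::real"] e by simp
    have k: "(K + 1) powr p \<le> K + 1" using powr_mono[of p 1 "K + 1"] K_nonneg e by simp
    have "0 \<le> K * g powr p" using K_nonneg by simp
    moreover have "(K + 1) powr p * b powr e \<le> (K + 1) * b powr e" using k by (intro mult_right_mono) auto
    ultimately show "g powr p + (K + 1) powr p * b powr e \<le> (K + 1) * (g powr p + b powr e)" by (simp add: algebra_simps)
  qed auto
  also have "\<dots> \<le> 2 * ((K + 1) * ((1 + 2 powr e) * (B powr e + g powr p)))"
  proof (intro mult_left_mono)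
    have "b powr e \<le> 2 powr e * (B powr e + 1 powr e)" unfolding b using B e by (intro powr_sum_le) auto
    hence 1: "b powr e \<le> 2 powr e * B powr e + 2 powr e" by (simp add: algebra_simps)
    have "1 \<le> g powr p" using g e by (intro ge_one_powr_ge_zero) auto
    hence "2 powr e \<le> 2 powr e * g powr p" by simp
    moreover have "0 \<le> B powr e" by simp
    ultimately have "g powr p + b powr e \<le> g powr p + (2 powr e * B powr e + 2 powr e * g powr p) + B powr e" using 1 by linarith
    also have "\<dots> = (1 + 2 powr e) * (B powr e + g powr p)" by (simp add: algebra_simps)
    finally show "g powr p + b powr e \<le> (1 + 2 powr e) * (B powr e + g powr p)" .
  qed (use K_nonneg in auto)
  finally have "L * (g' + K * b powr q) powr p \<le> L * (2 * ((K + 1) * ((1 + 2 powr e) * (B powr e + g powr p))))"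
    using flow.Lc_pos by (intro mult_left_mono) auto
  also have "\<dots> = L * (2 * (K + 1) * (1 + 2 powr e)) * (B powr e + g powr p)" by (simp add: mult_ac)
  also have "\<dots> \<le> energy_factor * (B powr e + g powr p)"
    using energy_factor_ge(3) by (intro mult_right_mono) (auto simp: e_def)
  finally show ?thesis unfolding e_def q_def p_def .
qed

lemma bound_slow:
  assumes C: "iteration_closes a r r1 c2 C \<rho>" and r1: "1 < r1"
    and G1: "G_C1 P" and B: "calB P < \<infinity>"
  shows "\<exists>T>0. \<forall>t>T. Linf_norm (Dim P) (Dom P) (t - 1 / 2) t (pbar P)
    \<le> ennreal (sup_factor C r1) * N1 P r1 (t - 1) t epowr kappa2 a r r1
      * (calB P epowr (1 / (2 * (1 - a))) + G P t epowr (1 / (2 - a))) epowr nu2 a r"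
proof -
  define B where "B = enn2real (calB P)"
  have B: "calB P = ennreal B" "0 \<le> B" using assms by (auto simp: B_def less_top)
  define b where "b = B + 1"
  have "calB P < ennreal b" using B by (simp add: b_def ennreal_lessI)
  hence "eventually (\<lambda>t. ennreal (max (- deriv (Greal P) t) 0) < ennreal b) at_top" unfolding calB_def by (rule Limsup_lessD)
  then obtain T0 where T0: "\<And>t. T0 \<le> t \<Longrightarrow> ennreal (max (- deriv (Greal P) t) 0) < ennreal b"
    unfolding eventually_at_top_linorder by blast
  define T1 where "T1 = max T0 1"
  have T1: "0 < T1" "T0 \<le> T1" by (auto simp: T1_def)
  have gd: "(gg has_real_derivative deriv (Greal P) \<tau>) (at \<tau>)" if "T1 \<le> \<tau>" for \<tau>
    using G1 that T1 unfolding G_C1_def gg_def[abs_def]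
    by (simp add: DERIV_deriv_iff_real_differentiable)
  have gb: "- b \<le> deriv (Greal P) \<tau>" if "T1 \<le> \<tau>" for \<tau>
  proof -
    have "ennreal (max (- deriv (Greal P) \<tau>) 0) < ennreal b" using T0[of \<tau>] that T1 by simp
    hence "max (- deriv (Greal P) \<tau>) 0 < b" by (subst (asm) ennreal_less_iff) auto
    thus ?thesis by simp
  qed
  have b1: "1 \<le> b" using B by (simp add: b_def)
  obtain T2 where T2: "T1 \<le> T2"
    "\<And>t. T2 \<le> t \<Longrightarrow> flow.v t \<le> (L * (gg t + K * b powr ((2 - a) / (2 * (1 - a)))) powr (1 / (2 - a)))\<^sup>2"
    using flow.v_bound_slow[OF T1(1) b1 gd gb] by blast
  have main: "Linf_norm (Dim P) (Dom P) (t - 1 / 2) t (pbar P)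
    \<le> ennreal (sup_factor C r1) * N1 P r1 (t - 1) t epowr kappa2 a r r1
      * (calB P epowr (1 / (2 * (1 - a))) + G P t epowr (1 / (2 - a))) epowr nu2 a r" if t: "T2 + 1 < t" for t
  proof -
    have t0: "0 \<le> t" "T1 \<le> t" using t T1 T2 by auto
    define X where "X = B powr (1 / (2 * (1 - a))) + gg t powr (1 / (2 - a))"
    have "1 \<le> gg t powr (1 / (2 - a))" using gg_ge_1[OF t0(1)] a_bounds by (intro ge_one_powr_ge_zero) auto
    hence X: "1 \<le> X" by (simp add: X_def add_increasing)
    have "1 * 1 \<le> energy_factor * X" using energy_factor_ge(2) X by (intro mult_mono) auto
    hence ZX: "1 \<le> energy_factor * X" by simp
    have v: "flow.v \<tau> \<le> (energy_factor * X)\<^sup>2" if \<tau>: "t - 1 < \<tau>" "\<tau> \<le> t" for \<tau>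
    proof -
      have \<tau>2: "T2 \<le> \<tau>" "T1 \<le> \<tau>" "0 \<le> \<tau>" using t \<tau> T2 T1 by auto
      \<comment> \<open>The supremum over the last unit of time needs \<open>v\<close> at earlier
        times, while the claim has G at the time \<open>t\<close>: within one unit of time G falls
        by at most \<open>b\<close>.\<close>
      have gt: "gg \<tau> \<le> gg t + b"
      proof (cases "\<tau> = t")
        case False
        then obtain z where z: "\<tau> < z" "z < t" "gg t - gg \<tau> = (t - \<tau>) * deriv (Greal P) z"
          using MVT2[of \<tau> t gg "deriv (Greal P)"] gd \<tau> \<tau>2 by auto
        have "(t - \<tau>) * (- deriv (Greal P) z) \<le> (t - \<tau>) * b" using gb[of z] z \<tau> \<tau>2 by (intro mult_left_mono) auto
        also have "\<dots> \<le> 1 * b" using \<tau> b1 by (intro mult_right_mono) auto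
        finally show ?thesis using z(3) by simp
      qed (use b1 in simp)
      have "flow.v \<tau> \<le> (L * (gg \<tau> + K * b powr ((2 - a) / (2 * (1 - a)))) powr (1 / (2 - a)))\<^sup>2" by (rule T2(2)[OF \<tau>2(1)])
      also have "\<dots> \<le> (energy_factor * X)\<^sup>2"
        unfolding X_def using slow_decay_majorant[OF gg_ge_1[OF t0(1)] _ gt B(2) b_def] flow.Lc_pos gg_ge_1[OF \<tau>2(3)] by (intro power_mono) auto
      finally show ?thesis .
    qed
    have "(calB P epowr (1 / (2 * (1 - a))) + G P t epowr (1 / (2 - a))) epowr nu2 a r = ennreal (X powr nu2 a r)"
      using B gg_ge_1[OF t0(1)] X by (simp add: G_finite[OF t0(1)] epowr_ennreal X_def flip: ennreal_plus)
    thus ?thesis using Linf_bound[OF C r1 _ _ _ _ ZX v, of 1] t0 t T1 T2(1) energy_factor_ge(2) by (simp add: sup_factor_def)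
  qed
  show ?thesis by (rule exI[of _ "T2 + 1"]) (use main T1 T2(1) in auto)
qed

end

theorem theorem4p2:
  fixes a r r1 c1 c2 :: real
  assumes "0 < a" "a < 1" "2 < r" "0 < c1" "0 < c2"
    and "1 < r1" "r1 < r0 a r / 2"
  shows "kappa3 a r r1 > 0 \<and>
    (\<exists>C>0. \<forall>(P :: flow) M.
      medium P \<and> aF P = a \<and>
      set_integrable (leb (Dim P)) (Dom P) (Por P) \<and>
      weighted_ineq P r c2 \<and> weighted_ineq P 2 c1 \<and>
      extension P \<and> solution P \<and> majorant P M \<longrightarrow>
      (\<forall>t. 0 < t \<and> t < 1 \<longrightarrow>
        Linf_norm (Dim P) (Dom P) (t / 2) t (pbar P)
          \<le> ennreal (C * t powr (- kappa3 a r r1)) * N1 P r1 0 t epowr kappa2 a r r1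
            * (wnorm (Dim P) (Dom P) 2 (Por P) (pbar P 0) + ennreal (M t powr (1 / (2 - a))))
                epowr nu2 a r) \<and>
      (\<forall>t\<ge>1.
        Linf_norm (Dim P) (Dom P) (t - 1 / 2) t (pbar P)
          \<le> ennreal C * N1 P r1 (t - 1) t epowr kappa2 a r r1
            * (wnorm (Dim P) (Dom P) 2 (Por P) (pbar P 0) + ennreal (M t powr (1 / (2 - a))))
                epowr nu2 a r) \<and>
      (calA P < \<infinity> \<longrightarrow>
        Limsup at_top (\<lambda>t. Linf_norm (Dim P) (Dom P) (t - 1 / 2) t (pbar P))
          \<le> ennreal C * Limsup at_top (\<lambda>t. N1 P r1 (t - 1) t) epowr kappa2 a r r1
            * calA P epowr (nu2 a r / (2 - a))) \<and>
      (G_C1 P \<and> calB P < \<infinity> \<longrightarrow>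
        (\<exists>T>0. \<forall>t>T.
          Linf_norm (Dim P) (Dom P) (t - 1 / 2) t (pbar P)
            \<le> ennreal C * N1 P r1 (t - 1) t epowr kappa2 a r r1
              * (calB P epowr (1 / (2 * (1 - a))) + G P t epowr (1 / (2 - a))) epowr nu2 a r)))"
proof -
  note X = exponent_relations[OF assms(1-3,6,7)]
  obtain C \<rho> where C: "iteration_closes a r r1 c2 C \<rho>"
    using degiorgi_constants[OF assms(1-3,6,7,5)] by blast
  \<comment> \<open>The factors are written outside the locale of the boundary value problem, where
    they visibly depend on the parameters alone, and can so be fixed before the medium is
    given.\<close>
  define Z where "Z = (2 + energy_flow_initial.Lc a c1) * (2 * (energy_flow_initial.Kc a c1 + 1) * (1 + 2 powr (1 / (2 * (1 - a)))))"
  define D where "D = C * (2 powr (r1 / (r1 - 1))) powr kappa2 a r r1 * Z powr nu2 a r"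
  have C0: "0 < C" using C by (simp add: iteration_closes_def)
  \<comment> \<open>The bound by limits superior has the additional factor 2^kappa2, so its constant
    serves for all parts; adding 1 in the end gives positivity.\<close>
  define E where "E = 2 powr kappa2 a r r1 * D"
  have D0: "0 \<le> D" using C0 by (simp add: D_def)
  have "1 \<le> 2 powr kappa2 a r r1" using X(12) by (intro ge_one_powr_ge_zero) auto
  hence DE: "D \<le> E" using D0 mult_right_mono[of 1 "2 powr kappa2 a r r1" D] by (simp add: E_def)
  have setting: "ibvp P M r c1 c2" "aF P = a" "ibvp.sup_factor P r c1 C r1 = D"
    if "medium P \<and> aF P = a \<and> set_integrable (leb (Dim P)) (Dom P) (Por P) \<and>
      weighted_ineq P r c2 \<and> weighted_ineq P 2 c1 \<and> extension P \<and> solution P \<and> majorant P M" for P :: flow and M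
  proof -
    show *: "ibvp P M r c1 c2" "aF P = a" using that assms by (auto intro!: ibvp.intro)
    interpret ibvp P M r c1 c2 by (rule *)
    show "ibvp.sup_factor P r c1 C r1 = D" by (simp add: sup_factor_def energy_factor_def D_def Z_def *(2))
  qed
  have weaken: "x \<le> ennreal (E + 1) * y" if "x \<le> ennreal D * y" for x y
    using that DE by (elim order_trans) (auto intro!: mult_right_mono ennreal_leI)
  show ?thesis
  proof (rule conjI[OF X(11)], rule exI[of _ "E + 1"], intro conjI allI impI)
    show "0 < E + 1" using D0 DE by simp
  next
    fix P :: flow and M t
    assume H: "medium P \<and> aF P = a \<and> set_integrable (leb (Dim P)) (Dom P) (Por P) \<and>
      weighted_ineq P r c2 \<and> weighted_ineq P 2 c1 \<and> extension P \<and> solution P \<and> majorant P M"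
    interpret ibvp P M r c1 c2 by (rule setting[OF H])
    note S = setting(2,3)[OF H]
    have C': "iteration_closes (aF P) r r1 c2 C \<rho>" using C by (simp add: S)
    let ?Y = "\<lambda>t. (wnorm (Dim P) (Dom P) 2 (Por P) (pbar P 0) + ennreal (M t powr (1 / (2 - a)))) epowr nu2 a r"
    show "Linf_norm (Dim P) (Dom P) (t / 2) t (pbar P)
      \<le> ennreal ((E + 1) * t powr (- kappa3 a r r1)) * N1 P r1 0 t epowr kappa2 a r r1 * ?Y t" if t: "0 < t \<and> t < 1"
    proof -
      have "Linf_norm (Dim P) (Dom P) (t - t / 2) t (pbar P)
        \<le> ennreal (D * t powr (- kappa3 a r r1)) * N1 P r1 (t - t) t epowr kappa2 a r r1 * ?Y t"
        using bound_initial[OF C' assms(6), of t t] t unfolding S by simp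
      moreover have "ennreal (D * t powr (- kappa3 a r r1)) \<le> ennreal ((E + 1) * t powr (- kappa3 a r r1))"
        using DE by (intro ennreal_leI mult_right_mono) auto
      ultimately show ?thesis by simp (meson mult_right_mono order_trans zero_le)
    qed
    show "Linf_norm (Dim P) (Dom P) (t - 1 / 2) t (pbar P)
      \<le> ennreal (E + 1) * N1 P r1 (t - 1) t epowr kappa2 a r r1 * ?Y t" if t: "1 \<le> t"
      using bound_initial[OF C' assms(6), of 1 t] t weaken
      by (simp add: S mult.assoc)
    show "Limsup at_top (\<lambda>t. Linf_norm (Dim P) (Dom P) (t - 1 / 2) t (pbar P))
          \<le> ennreal (E + 1) * Limsup at_top (\<lambda>t. N1 P r1 (t - 1) t) epowr kappa2 a r r1
            * calA P epowr (nu2 a r / (2 - a))" if "calA P < \<infinity>"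
    proof -
      have "ennreal E \<le> ennreal (E + 1)" by (rule ennreal_leI) simp
      hence "ennreal E * y \<le> ennreal (E + 1) * y" for y by (rule mult_right_mono) simp
      thus ?thesis using bound_limsup[OF C' assms(6)] X(12,13) that
        by (simp add: S E_def[symmetric] mult.assoc) (meson order_trans)
    qed
    show "\<exists>T>0. \<forall>t>T. Linf_norm (Dim P) (Dom P) (t - 1 / 2) t (pbar P)
            \<le> ennreal (E + 1) * N1 P r1 (t - 1) t epowr kappa2 a r r1
              * (calB P epowr (1 / (2 * (1 - a))) + G P t epowr (1 / (2 - a))) epowr nu2 a r" if "G_C1 P \<and> calB P < \<infinity>"
      using bound_slow[OF C' assms(6)] that weaken
      by (simp add: S mult.assoc) meson
  qed
qed

end
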